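(* There exists a positive real number $M$ such that for every $\varepsilon>M$ and every $p=(p_1,p_2)\in\mathbb{R}^2$: $d_{\varepsilon,3}(p)=1-(p_2-p_1)+\max\{0,1/2-3p_1\}$ if $p$ lies on the closed line segment from $(0,1/2)$ to $(1/4,1/4)$, and $d_{\varepsilon,3}(p)=0$ otherwise; and $d^{\max}_{\varepsilon,3}(p)=1-(p_2-p_1)$ if $p$ lies on the closed line segment from $(1/6,1/3)$ to $(1/4,1/4)$, $d^{\max}_{\varepsilon,3}(p)=1$ if $p=(0,1/2)$, and $d^{\max}_{\varepsilon,3}(p)=0$ otherwise.
   Context: A rank $n$ ring is a commutative unital ring isomorphic to $\mathbb{Z}^n$ as an abelian group; it is nondegenerate if its discriminant $\mathrm{Disc}(R)=\det(\mathrm{Tr}(\alpha_i\alpha_j))$ is nonzero; $\Delta=|\mathrm{Disc}(R)|$. With $\sigma_1,\dots,\sigma_n$ the homomorphisms $R\to\mathbb{C}$, set $|x|=\sqrt{\frac1n\sum|\sigma_i(x)|^2}$; $\lambda_i(R)$ is the smallest $r$ such that $R$ has $i+1$ linearly independent elements of length $\le r$. For $p\in\mathbb{R}^2$, $\varepsilon>0$, $X>1$, let $\mathcal{F}_3(p,\varepsilon,X)$ be the set of isomorphism classes of nondegenerate cubic rings $R$ with $\Delta\le X$ and $\max_{i=1,2}|\log_\Delta\lambda_i(R)-p_i|\le\varepsilon/\log X$, and $\mathcal{F}_3^{\max}(p,\varepsilon,X)$ its subset of maximal cubic rings. $d_{\varepsilon,3}(p)=\lim_{X\to\infty}\frac{\log(\#\mathcal{F}_3(p,\varepsilon,X)+1)}{\log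 X}$ if it exists (else $\ast$), and $d^{\max}_{\varepsilon,3}$ analogously with $\mathcal{F}_3^{\max}$. *)

theory Defs
  imports
    "HOL-Analysis.Line_Segment"
    "HOL-Algebra.Product_Groups"
    "HOL-Algebra.Weak_Morphisms"
    "HOL-Library.Countable_Set"
    "Jordan_Normal_Form.VS_Connect"
begin

definition rank_ring :: "nat \<Rightarrow> 'a ring \<Rightarrow> bool" where
  "rank_ring n R \<longleftrightarrow>
     cring R \<and> add_monoid R \<cong> product_group {..<n} (\<lambda>_. integer_group)"

definition int_comb :: "'a ring \<Rightarrow> nat \<Rightarrow> (nat \<Rightarrow> int) \<Rightarrow> (nat \<Rightarrow> 'a) \<Rightarrow> 'a" where
  "int_comb R k c v = (\<Oplus>\<^bsub>R\<^esub>j\<in>{..<k}. [c j] \<cdot>\<^bsub>R\<^esub> v j)"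

definition int_basis :: "'a ring \<Rightarrow> nat \<Rightarrow> (nat \<Rightarrow> 'a) \<Rightarrow> bool" where
  "int_basis R n b \<longleftrightarrow>
     b \<in> {..<n} \<rightarrow> carrier R \<and>
     (\<forall>x\<in>carrier R. \<exists>!c. c \<in> extensional {..<n} \<and> int_comb R n c b = x)"

definition int_indep :: "'a ring \<Rightarrow> nat \<Rightarrow> (nat \<Rightarrow> 'a) \<Rightarrow> bool" where
  "int_indep R k v \<longleftrightarrow>
     v \<in> {..<k} \<rightarrow> carrier R \<and>
     (\<forall>c. int_comb R k c v = \<zero>\<^bsub>R\<^esub> \<longrightarrow> (\<forall>j<k. c j = 0))"

definition int_coord :: "'a ring \<Rightarrow> nat \<Rightarrow> (nat \<Rightarrow> 'a) \<Rightarrow> 'a \<Rightarrow> nat \<Rightarrow> int" where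
  "int_coord R n b x = (THE c. c \<in> extensional {..<n} \<and> int_comb R n c b = x)"

text \<open>The trace of multiplication by \<open>x\<close>, and the determinant of the trace form,
  with respect to a basis \<open>b\<close>; neither depends on \<open>b\<close>.\<close>

definition ring_trace :: "'a ring \<Rightarrow> nat \<Rightarrow> (nat \<Rightarrow> 'a) \<Rightarrow> 'a \<Rightarrow> int" where
  "ring_trace R n b x = (\<Sum>i<n. int_coord R n b (x \<otimes>\<^bsub>R\<^esub> b i) i)"

definition ring_disc :: "nat \<Rightarrow> 'a ring \<Rightarrow> int" where
  "ring_disc n R =
     (let b = (SOME b. int_basis R n b)
      in det (mat n n (\<lambda>(i, j). ring_trace R n b (b i \<otimes>\<^bsub>R\<^esub> b j))))"

definition nondegenerate :: "nat \<Rightarrow> 'a ring \<Rightarrow> bool" where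
  "nondegenerate n R \<longleftrightarrow> rank_ring n R \<and> ring_disc n R \<noteq> 0"

definition abs_disc :: "nat \<Rightarrow> 'a ring \<Rightarrow> real" where
  "abs_disc n R = real_of_int \<bar>ring_disc n R\<bar>"

text \<open>Without the restriction to \<open>extensional\<close>, homomorphisms that agree on the
  carrier would be counted separately.  A nondegenerate ring of rank \<open>n\<close> has
  exactly \<open>n\<close> homomorphisms to the complex numbers in this sense.\<close>

definition complex_homs :: "'a ring \<Rightarrow> ('a \<Rightarrow> complex) set" where
  "complex_homs R = Ring.ring_hom R class_ring \<inter> extensional (carrier R)"

definition ring_length :: "nat \<Rightarrow> 'a ring \<Rightarrow> 'a \<Rightarrow> real" where
  "ring_length n R x = sqrt (1 / real n * (\<Sum>\<sigma>\<in>complex_homs R. (cmod (\<sigma> x))\<^sup>2))"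

definition succ_min :: "nat \<Rightarrow> 'a ring \<Rightarrow> nat \<Rightarrow> real" where
  "succ_min n R i =
     (LEAST r. \<exists>v. int_indep R (Suc i) v \<and> (\<forall>j\<le>i. ring_length n R (v j) \<le> r))"

text \<open>Rings of finite rank are countable, so each of them has an isomorphic copy whose
  carrier is a set of natural numbers.  Hence quantifying over \<^typ>\<open>nat ring\<close> reaches
  every isomorphism class.\<close>

lemma rank_ring_nat_copy:
  assumes "rank_ring n R"
  shows "\<exists>S :: nat ring. rank_ring n S \<and> R \<simeq> S"
proof -
  have cr: "cring R" and iso: "add_monoid R \<cong> product_group {..<n} (\<lambda>_. integer_group)"
    using assms by (auto simp: rank_ring_def)
  interpret cring R by (fact cr)
  have "countable (carrier (product_group {..<n} (\<lambda>_. integer_group)))"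
    by (simp add: countable_PiE)
  moreover obtain g where "bij_betw g (carrier R) (carrier (product_group {..<n} (\<lambda>_. integer_group)))"
    using iso unfolding is_iso_def iso_def by auto
  ultimately have "countable (carrier R)"
    by (metis bij_betw_def countable_image_inj_on)
  then obtain f :: "'a \<Rightarrow> nat" where f: "inj_on f (carrier R)"
    by (auto simp: countable_def)
  define S where "S = image_ring f R"
  have h: "f \<in> ring_iso R S"
    using inj_imp_image_ring_iso[OF f] by (simp add: S_def)
  have S: "cring S"
    using ring_iso_imp_img_cring[OF h] by (simp add: S_def flip: image_ring_zero)
  have "f \<in> iso (add_monoid R) (add_monoid S)"
    using h by (auto simp: ring_iso_def Ring.ring_hom_def iso_def hom_def)
  then have "add_monoid R \<cong> add_monoid S" by (auto simp: is_iso_def)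
  then have "add_monoid S \<cong> product_group {..<n} (\<lambda>_. integer_group)"
    using iso group.iso_sym Group.iso_trans a_group by blast
  then show ?thesis using S h by (auto simp: rank_ring_def is_ring_iso_def)
qed

text \<open>The definition of maximality below says that \<open>R\<close> is not contained as a proper subring
  in a ring of the same rank; up to isomorphism, an overring is an injective
  ring homomorphism out of \<open>R\<close>.\<close>

definition maximal_ring :: "nat \<Rightarrow> nat ring \<Rightarrow> bool" where
  "maximal_ring n R \<longleftrightarrow>
     rank_ring n R \<and>
     (\<forall>S :: nat ring. \<forall>f\<in>Ring.ring_hom R S.
        rank_ring n S \<and> inj_on f (carrier R) \<longrightarrow> f ` carrier R = carrier S)"

definition rank_ring_iso :: "nat \<Rightarrow> (nat ring \<times> nat ring) set" where
  "rank_ring_iso n = {(R, S). rank_ring n R \<and> rank_ring n S \<and> R \<simeq> S}"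

text \<open>The only nondegenerate cubic ring with \<open>\<Delta> = 1\<close> is \<open>\<int>\<^sup>3\<close>.  For it \<open>log\<^sub>\<Delta>\<close> is
  not defined mathematically, and \<^term>\<open>log 1 x\<close> is \<open>0\<close> here; one single class more or
  less does not affect the limits below.\<close>

definition near_minima :: "real \<times> real \<Rightarrow> real \<Rightarrow> real \<Rightarrow> nat ring \<Rightarrow> bool" where
  "near_minima p \<epsilon> X R \<longleftrightarrow>
     max \<bar>log (abs_disc 3 R) (succ_min 3 R 1) - fst p\<bar>
         \<bar>log (abs_disc 3 R) (succ_min 3 R 2) - snd p\<bar> \<le> \<epsilon> / ln X"

definition cubic_classes :: "real \<times> real \<Rightarrow> real \<Rightarrow> real \<Rightarrow> nat ring set set" where
  "cubic_classes p \<epsilon> X =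
     {R. nondegenerate 3 R \<and> abs_disc 3 R \<le> X \<and> near_minima p \<epsilon> X R} // rank_ring_iso 3"

definition max_cubic_classes :: "real \<times> real \<Rightarrow> real \<Rightarrow> real \<Rightarrow> nat ring set set" where
  "max_cubic_classes p \<epsilon> X =
     {R. nondegenerate 3 R \<and> maximal_ring 3 R \<and> abs_disc 3 R \<le> X \<and> near_minima p \<epsilon> X R}
       // rank_ring_iso 3"

text \<open>\<^term>\<open>None\<close> is the value \<open>\<ast>\<close> for a limit that does not exist.  The sets of classes
  to which this is applied are finite, as there are only finitely many cubic rings of
  bounded nonzero discriminant, so \<^const>\<open>card\<close> counts them properly.\<close>

definition growth_exponent :: "(real \<Rightarrow> 'c set) \<Rightarrow> real option" where
  "growth_exponent F =
     (if \<exists>L. ((\<lambda>X. ln (real (card (F X)) + 1) / ln X) \<longlongrightarrow> L) at_top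
      then Some (Lim at_top (\<lambda>X. ln (real (card (F X)) + 1) / ln X))
      else None)"

definition cubic_density :: "real \<Rightarrow> real \<times> real \<Rightarrow> real option" where
  "cubic_density \<epsilon> p = growth_exponent (cubic_classes p \<epsilon>)"

definition max_cubic_density :: "real \<Rightarrow> real \<times> real \<Rightarrow> real option" where
  "max_cubic_density \<epsilon> p = growth_exponent (max_cubic_classes p \<epsilon>)"

end

theory Submission
  imports Defs
    "HOL-Computational_Algebra.Fundamental_Theorem_Algebra"
    "HOL-Computational_Algebra.Primes"
    "HOL-Real_Asymp.Real_Asymp"
begin

text \<open>Cubic rings correspond to classes of integral binary cubic forms
  \<open>(a, b, c, d) = a x\<^sup>3 + b x\<^sup>2 y + c x y\<^sup>2 + d y\<^sup>3\<close> (Levi, Delone--Faddeev).  Modulo \<open>\<int>\<close> the length is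
  comparable to the root of a positive definite binary quadratic form whose Gram determinant is
  comparable to \<open>\<Delta>\<close>.  For a form that is reduced with respect to it this gives
  \<open>\<lambda>\<^sub>1 \<lambda>\<^sub>2 \<approx> \<Delta>\<^sup>1\<^sup>/\<^sup>2\<close>, so that \<open>\<Delta>\<close> is bounded for \<open>p\<close> off the segment, and it confines the coefficients
  to the box with sides \<open>\<lambda>\<^sub>1\<^sup>3\<close>, \<open>\<lambda>\<^sub>1\<^sup>2 \<lambda>\<^sub>2\<close>, \<open>\<lambda>\<^sub>1 \<lambda>\<^sub>2\<^sup>2\<close>, \<open>\<lambda>\<^sub>2\<^sup>3\<close> over \<open>\<Delta>\<^sup>1\<^sup>/\<^sup>2\<close>.  Counting the points of the box
  gives the upper bounds.  For \<open>p\<^sub>1 < 1/6\<close> the coefficient \<open>a\<close> has to vanish; then the ring has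
  index \<open>\<bar>b\<bar>\<close> in another one, and if it is maximal then \<open>\<lambda>\<^sub>1\<close> is bounded.

  The lower bounds come from explicit boxes of forms whose Hessian is nearly diagonal and very
  unbalanced, which makes them inequivalent.  In order to obtain maximal rings, the discriminant is
  kept prime to all \<open>p \<le> 48\<close> by congruences.  For the larger \<open>p\<close> up to a power of \<open>\<Delta>\<close> one counts the
  forms with \<open>p\<^sup>2\<close> dividing the discriminant, and beyond that one counts the overrings of index \<open>p\<close>,
  using a crude bound for the number of all classes.\<close>

section \<open>Cubic rings and binary cubic forms\<close>

text \<open>The window \<open>\<epsilon> / ln X\<close> fixes each minimum up to a constant factor,
  because \<open>ln \<Delta> \<le> ln X\<close>. So every comparison between lengths,
  \<open>qf\<close> and coefficients may lose a constant, and \<open>M\<close> is governed by twice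
  the logarithm of the total loss. In the upper bound the number of box points is divided by the
  number of translates. If the side of \<open>a\<close> is at least 1, this gives the exponent
  \<open>1/2 + 2 p1\<close>, which is \<open>1 - (p2 - p1)\<close> on the segment; if it is below 1,
  the forms with \<open>a = 0\<close> dominate and give \<open>1 - p1\<close>. The two agree at
  \<open>p1 = 1/6\<close>.

  The obstacle for maximal rings is the tail of large primes. Counting forms with \<open>p^2\<close>
  dividing the discriminant works only while \<open>p\<close> is small against the sides of
  \<open>c\<close> and \<open>d\<close>, which can be as short as \<open>X^(1/4)\<close>. Counting
  overrings gives the tail bound \<open>X^(9/8) t^(-5/4)\<close> beyond a cut \<open>t\<close>, and
  this must be below \<open>X^(5/6)\<close>, the size of the smallest family. A cut slightly below
  \<open>X^(1/4)\<close> meets both conditions, even though the exponent 9/8 for all classes is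
  worse than the true 1.\<close>

type_synonym form = "int \<times> int \<times> int \<times> int"
type_synonym vec3 = "int \<times> int \<times> int"

text \<open>The Delone-Faddeev table for a basis \<open>1, \<omega>, \<theta>\<close> whose product
  \<open>\<omega> \<theta>\<close> is an integer: \<open>\<omega> \<theta> = - a d\<close>,
  \<open>\<omega>^2 = - a c - b \<omega> + a \<theta>\<close>,
  \<open>\<theta>^2 = - b d - d \<omega> + c \<theta>\<close>.\<close>

fun fmult :: "form \<Rightarrow> vec3 \<Rightarrow> vec3 \<Rightarrow> vec3" where
  "fmult (a, b, c, d) (x0, x1, x2) (y0, y1, y2) =
     (x0 * y0 - a * c * x1 * y1 - a * d * (x1 * y2 + x2 * y1) - b * d * x2 * y2,
      x0 * y1 + x1 * y0 - b * x1 * y1 - d * x2 * y2,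
      x0 * y2 + x2 * y0 + a * x1 * y1 + c * x2 * y2)"

definition form_ring :: "form \<Rightarrow> vec3 ring" where
  "form_ring f = \<lparr>carrier = UNIV, monoid.mult = fmult f, one = (1, 0, 0), zero = 0, add = (+)\<rparr>"

lemma form_ring_simps [simp]:
  "carrier (form_ring f) = UNIV" "x \<otimes>\<^bsub>form_ring f\<^esub> y = fmult f x y"
  "\<one>\<^bsub>form_ring f\<^esub> = (1, 0, 0)" "\<zero>\<^bsub>form_ring f\<^esub> = 0" "x \<oplus>\<^bsub>form_ring f\<^esub> y = x + y"
  by (simp_all add: form_ring_def)

lemma fmult_comm: "fmult f x y = fmult f y x"
  by (cases f; cases x; cases y) (simp add: algebra_simps)

lemma fmult_assoc: "fmult f (fmult f x y) z = fmult f x (fmult f y z)"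
  by (cases f; cases x; cases y; cases z) (simp add: algebra_simps)

lemma fmult_add: "fmult f (x + y) z = fmult f x z + fmult f y z"
  by (cases f; cases x; cases y; cases z) (simp add: algebra_simps)

lemma fmult_one: "fmult f (1, 0, 0) x = x"
  by (cases f; cases x) simp

lemma cring_form_ring: "cring (form_ring f)"
proof (rule cringI)
  show "abelian_group (form_ring f)"
  proof (rule abelian_groupI)
    fix x :: vec3
    show "\<exists>y\<in>carrier (form_ring f). y \<oplus>\<^bsub>form_ring f\<^esub> x = \<zero>\<^bsub>form_ring f\<^esub>"
      by (rule bexI[of _ "- x"]) auto
  qed (auto simp: add.commute add.assoc)
  show "Group.comm_monoid (form_ring f)"
  proof (rule comm_monoidI)
    fix x y z
    show "\<one>\<^bsub>form_ring f\<^esub> \<otimes>\<^bsub>form_ring f\<^esub> x = x" by (simp only: form_ring_simps fmult_one)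
    show "x \<otimes>\<^bsub>form_ring f\<^esub> y = y \<otimes>\<^bsub>form_ring f\<^esub> x" by (simp only: form_ring_simps fmult_comm)
  qed (simp_all only: form_ring_simps fmult_assoc UNIV_I)
  fix x y z
  show "(x \<oplus>\<^bsub>form_ring f\<^esub> y) \<otimes>\<^bsub>form_ring f\<^esub> z =
     x \<otimes>\<^bsub>form_ring f\<^esub> z \<oplus>\<^bsub>form_ring f\<^esub> y \<otimes>\<^bsub>form_ring f\<^esub> z"
    by (simp add: fmult_add)
qed

fun smul :: "int \<Rightarrow> vec3 \<Rightarrow> vec3" where
  "smul k (x, y, z) = (k * x, k * y, k * z)"

lemma smul_0_1 [simp]: "smul 0 x = 0" "smul 1 x = x"
  by (cases x; simp add: zero_prod_def)+

lemma smul_Suc: "smul (int (Suc n)) x = smul (int n) x + x"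
  by (cases x) (simp add: algebra_simps)

lemma smul_minus: "smul (- k) x = - smul k x"
  by (cases x) simp

lemma add_pow_form_ring: "add_pow (form_ring f) (k::int) x = smul k x"
proof -
  interpret cring "form_ring f" by (rule cring_form_ring)
  have nat: "add_pow (form_ring f) (n::nat) x = smul (int n) x" for n
  proof (induction n)
    case (Suc n)
    then show ?case by (simp only: smul_Suc add.nat_pow_Suc form_ring_simps)
  qed (simp only: add.nat_pow_0 form_ring_simps of_nat_0 smul_0_1)
  have neg: "\<ominus>\<^bsub>form_ring f\<^esub> y = - y" for y
    by (rule minus_equality) simp_all
  show ?thesis
  proof (cases "k \<ge> 0")
    case True
    then show ?thesis using nat[of "nat k"] add_pow_int_ge[of k "form_ring f" x] by simp
  next
    case False
    then have "add_pow (form_ring f) k x = \<ominus>\<^bsub>form_ring f\<^esub> (add_pow (form_ring f) (nat (- k)) x)"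
      by (intro add_pow_int_lt) simp
    then show ?thesis using nat[of "nat (-k)"] False neg smul_minus[of "-k" x] by simp
  qed
qed

lemma finsum_form_ring: "finite A \<Longrightarrow> finsum (form_ring f) g A = (\<Sum>x\<in>A. g x)"
proof -
  interpret cring "form_ring f" by (rule cring_form_ring)
  show "finite A \<Longrightarrow> finsum (form_ring f) g A = (\<Sum>x\<in>A. g x)"
    by (induction A rule: finite_induct) (auto)
qed

text \<open>Translates independence and bases in an abstract ring into sums of integer
  vectors.\<close>

lemma int_comb_hom:
  assumes R: "cring R" and h: "h \<in> Ring.ring_hom (form_ring f) R"
  shows "int_comb R k c (\<lambda>j. h (v j)) = h (\<Sum>j<k. smul (c j) (v j))"
proof -
  interpret S: cring "form_ring f" by (rule cring_form_ring)
  interpret R: cring R by fact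
  interpret h: ring_hom_cring "form_ring f" R h
    by unfold_locales (fact h)
  have g: "group_hom (add_monoid (form_ring f)) (add_monoid R) h"
    using S.a_group R.a_group h by (auto simp: group_hom_def group_hom_axioms_def hom_def Ring.ring_hom_def)
  have 1: "add_pow R (m::int) (h x) = h (add_pow (form_ring f) m x)" for m x
    using group_hom.hom_int_pow[OF g, of x m] by (simp add: add_pow_def)
  have "int_comb R k c (\<lambda>j. h (v j)) = finsum R (\<lambda>j. h (smul (c j) (v j))) {..<k}"
    unfolding int_comb_def by (rule R.finsum_cong') (auto simp: 1 add_pow_form_ring)
  also have "\<dots> = h (finsum (form_ring f) (\<lambda>j. smul (c j) (v j)) {..<k})"
    using h.hom_finsum[of "\<lambda>j. smul (c j) (v j)" "{..<k}"] by (simp add: comp_def)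
  finally show ?thesis by (simp add: finsum_form_ring)
qed

lemma rank_ring_form_ring: "rank_ring 3 (form_ring f)"
proof -
  interpret cring "form_ring f" by (rule cring_form_ring)
  let ?P = "product_group {..<3::nat} (\<lambda>_. integer_group)"
  define \<phi> :: "vec3 \<Rightarrow> nat \<Rightarrow> int" where
    "\<phi> = (\<lambda>(x, y, z). \<lambda>i\<in>{..<3}. if i = 0 then x else if i = 1 then y else z)"
  have "\<phi> \<in> Group.iso (add_monoid (form_ring f)) ?P"
  proof (rule isoI)
    show "\<phi> \<in> hom (add_monoid (form_ring f)) ?P"
    proof (rule homI)
      fix x y :: vec3
      show "\<phi> x \<in> carrier ?P" by (cases x) (simp add: \<phi>_def)
      show "\<phi> (x \<otimes>\<^bsub>add_monoid (form_ring f)\<^esub> y) = \<phi> x \<otimes>\<^bsub>?P\<^esub> \<phi> y"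
        by (cases x; cases y) (simp add: \<phi>_def fun_eq_iff restrict_def)
    qed
    show "bij_betw \<phi> (carrier (add_monoid (form_ring f))) (carrier ?P)"
    proof (rule bij_betw_byWitness[where f' = "\<lambda>g. (g 0, g 1, g 2)"])
      show "\<forall>a\<in>carrier (add_monoid (form_ring f)). (\<phi> a 0, \<phi> a 1, \<phi> a 2) = a"
        by (simp add: \<phi>_def split: prod.splits)
      show "\<phi> ` carrier (add_monoid (form_ring f)) \<subseteq> carrier ?P"
        by (simp add: \<phi>_def image_subset_iff split: prod.splits)
      show "\<forall>g\<in>carrier ?P. \<phi> (g 0, g 1, g 2) = g"
      proof
        fix g :: "nat \<Rightarrow> int" assume "g \<in> carrier ?P"
        then have g: "g i = undefined" if "\<not> i < 3" for i
          using that by (simp add: PiE_def extensional_def)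
        show "\<phi> (g 0, g 1, g 2) = g"
        proof
          fix i :: nat
          consider "i = 0" | "i = 1" | "i = 2" | "\<not> i < 3" by linarith
          then show "\<phi> (g 0, g 1, g 2) i = g i" by cases (simp_all add: \<phi>_def g)
        qed
      qed
    qed simp
  qed
  then show ?thesis unfolding rank_ring_def using cring_form_ring unfolding is_iso_def by blast
qed

lemma additive_int:
  fixes G :: "int \<Rightarrow> int" assumes "\<And>x y. G (x + y) = G x + G y"
  shows "G k = k * G 1"
proof (induction k rule: int_induct[of _ 0])
  case base show ?case using assms[of 0 0] by simp
next
  case (step1 i) then show ?case using assms[of i 1] by (simp add: algebra_simps)
next
  case (step2 i) then show ?case using assms[of "i - 1" 1] by (simp add: algebra_simps)
qed

lemma additive_vec3:
  fixes F :: "vec3 \<Rightarrow> vec3" assumes add: "\<And>x y. F (x + y) = F x + F y"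
  shows "F (x0, x1, x2) = smul x0 (F (1,0,0)) + smul x1 (F (0,1,0)) + smul x2 (F (0,0,1))"
proof -
  have l: "L (x0, x1, x2) = x0 * L (1,0,0) + x1 * L (0,1,0) + x2 * L (0,0,1)"
    if L: "\<And>x y. L (x + y) = L x + L y" for L :: "vec3 \<Rightarrow> int"
  proof -
    have "L (x0, x1, x2) = L ((x0,0,0) + (0,x1,0) + (0,0,x2))" by simp
    also have "\<dots> = L (x0,0,0) + L (0,x1,0) + L (0,0,x2)" by (simp only: L)
    also have "L (x0,0,0) = x0 * L (1,0,0)"
      by (rule additive_int[of "\<lambda>k. L (k,0,0)"]) (simp flip: L)
    also have "L (0,x1,0) = x1 * L (0,1,0)"
      by (rule additive_int[of "\<lambda>k. L (0,k,0)"]) (simp flip: L)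
    also have "L (0,0,x2) = x2 * L (0,0,1)"
      by (rule additive_int[of "\<lambda>k. L (0,0,k)"]) (simp flip: L)
    finally show ?thesis .
  qed
  have "fst (F (x0,x1,x2)) = x0 * fst (F (1,0,0)) + x1 * fst (F (0,1,0)) + x2 * fst (F (0,0,1))"
    by (rule l) (simp add: add)
  moreover have "fst (snd (F (x0,x1,x2))) = x0 * fst (snd (F (1,0,0))) + x1 * fst (snd (F (0,1,0)))
      + x2 * fst (snd (F (0,0,1)))"
    by (rule l) (simp add: add)
  moreover have "snd (snd (F (x0,x1,x2))) = x0 * snd (snd (F (1,0,0))) + x1 * snd (snd (F (0,1,0)))
      + x2 * snd (snd (F (0,0,1)))"
    by (rule l) (simp add: add)
  ultimately show ?thesis
    by (cases "F (1,0,0)"; cases "F (0,1,0)"; cases "F (0,0,1)"; cases "F (x0,x1,x2)") simp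
qed

text \<open>Associativity leaves no freedom in the constant terms: comparing the coefficients of
  \<open>\<omega>\<close> and \<open>\<theta>\<close> in
  \<open>(\<omega> \<omega>) \<theta> = \<omega> (\<omega> \<theta>)\<close> and in
  \<open>(\<omega> \<theta>) \<theta> = \<omega> (\<theta> \<theta>)\<close> expresses
  \<open>m\<close>, \<open>n\<close> and \<open>l\<close> through the other four entries, which are
  the coefficients of the form up to sign.\<close>

lemma table_normal_form:
  fixes \<mu> :: "vec3 \<Rightarrow> vec3 \<Rightarrow> vec3"
  assumes add: "\<And>x y z. \<mu> (x + y) z = \<mu> x z + \<mu> y z"
    and comm: "\<And>x y. \<mu> x y = \<mu> y x" and assoc: "\<And>x y z. \<mu> (\<mu> x y) z = \<mu> x (\<mu> y z)"
    and unit: "\<And>x. \<mu> (1,0,0) x = x" and wt: "\<mu> (0,1,0) (0,0,1) = (n, 0, 0)"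
  shows "\<exists>f. \<mu> = fmult f"
proof -
  obtain m b a where w2: "\<mu> (0,1,0) (0,1,0) = (m, - b, a)"
    by (metis prod_cases3 minus_minus)
  obtain l d c where t2: "\<mu> (0,0,1) (0,0,1) = (l, - d, c)"
    by (metis prod_cases3 minus_minus)
  have add2: "\<mu> z (x + y) = \<mu> z x + \<mu> z y" for x y z
    using add comm by metis
  have tw: "\<mu> (0,0,1) (0,1,0) = (n, 0, 0)" using wt comm by metis
  have unit2: "\<mu> x (1,0,0) = x" for x using unit comm by metis
  have expand: "\<mu> (x0,x1,x2) z = smul x0 z + smul x1 (\<mu> (0,1,0) z) + smul x2 (\<mu> (0,0,1) z)" for x0 x1 x2 z
    unfolding additive_vec3[of "\<lambda>x. \<mu> x z" x0 x1 x2, OF add] unit ..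
  have expand2: "\<mu> z (x0,x1,x2) = smul x0 z + smul x1 (\<mu> z (0,1,0)) + smul x2 (\<mu> z (0,0,1))" for x0 x1 x2 z
    unfolding additive_vec3[of "\<lambda>x. \<mu> z x" x0 x1 x2, OF add2] unit2 ..
  have 1: "\<mu> (\<mu> (0,1,0) (0,1,0)) (0,0,1) = \<mu> (0,1,0) (\<mu> (0,1,0) (0,0,1))" by (rule assoc)
  have 2: "\<mu> (\<mu> (0,1,0) (0,0,1)) (0,0,1) = \<mu> (0,1,0) (\<mu> (0,0,1) (0,0,1))" by (rule assoc)
  have c1: "m = - (a * c)" "n = - (a * d)"
    using 1 unfolding w2 wt by (simp_all add: expand[of m] expand2[of _ n] t2 wt w2 tw algebra_simps)
  have c2: "l = - (b * d)"
    using 2 unfolding t2 wt by (simp_all add: expand[of n] expand2[of _ l] t2 wt w2 tw algebra_simps)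
  have "\<mu> x y = fmult (a,b,c,d) x y" for x y
  proof -
    obtain x0 x1 x2 y0 y1 y2 where xy: "x = (x0,x1,x2)" "y = (y0,y1,y2)" by (metis prod_cases3)
    show ?thesis unfolding xy
      by (simp add: expand[of x0] expand2[of _ y0] wt w2 tw t2 c1 c2 algebra_simps)
  qed
  then show ?thesis by blast
qed

section \<open>Integral bases of a cubic ring and their normalisation\<close>

definition int_param :: "'a ring \<Rightarrow> (vec3 \<Rightarrow> 'a) \<Rightarrow> bool" where
  "int_param R E \<longleftrightarrow> bij_betw E UNIV (carrier R) \<and> (\<forall>x y. E (x + y) = E x \<oplus>\<^bsub>R\<^esub> E y)"

lemma int_param_comp:
  assumes "int_param R E" "bij L" "\<And>x y. L (x + y) = L x + L y"
  shows "int_param R (E \<circ> L)"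
  using assms unfolding int_param_def by (metis bij_betw_trans comp_apply)

lemma int_param_mult:
  assumes R: "cring R" and E: "int_param R E"
  obtains \<mu> u where
    "\<And>x y. E (\<mu> x y) = E x \<otimes>\<^bsub>R\<^esub> E y" "E u = \<one>\<^bsub>R\<^esub>"
    "\<And>x y z. \<mu> (x + y) z = \<mu> x z + \<mu> y z" "\<And>x y. \<mu> x y = \<mu> y x"
    "\<And>x y z. \<mu> (\<mu> x y) z = \<mu> x (\<mu> y z)" "\<And>x. \<mu> u x = x"
proof -
  interpret cring R by fact
  have bij: "bij_betw E UNIV (carrier R)" and add: "\<And>x y. E (x + y) = E x \<oplus>\<^bsub>R\<^esub> E y"
    using E by (auto simp: int_param_def)
  define G where "G = inv_into UNIV E"
  have EG: "E (G y) = y" if "y \<in> carrier R" for y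
    using that bij by (simp add: G_def bij_betw_def f_inv_into_f)
  have EC [simp]: "E x \<in> carrier R" for x using bij by (auto simp: bij_betw_def)
  have inj: "x = y" if "E x = E y" for x y
    using that bij by (meson UNIV_I bij_betw_def inj_onD)
  define \<mu> where "\<mu> x y = G (E x \<otimes>\<^bsub>R\<^esub> E y)" for x y
  have E\<mu>: "E (\<mu> x y) = E x \<otimes>\<^bsub>R\<^esub> E y" for x y by (simp add: \<mu>_def EG)
  have Eu: "E (G \<one>\<^bsub>R\<^esub>) = \<one>\<^bsub>R\<^esub>" by (simp add: EG)
  show ?thesis
  proof (rule that[of \<mu> "G \<one>\<^bsub>R\<^esub>"])
    show "\<mu> (x + y) z = \<mu> x z + \<mu> y z" for x y z
      by (rule inj) (simp add: E\<mu> add l_distr)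
    show "\<mu> x y = \<mu> y x" for x y by (simp add: \<mu>_def m_comm)
    show "\<mu> (\<mu> x y) z = \<mu> x (\<mu> y z)" for x y z
      by (rule inj) (simp add: E\<mu> m_assoc)
    show "\<mu> (G \<one>\<^bsub>R\<^esub>) x = x" for x by (rule inj) (simp add: E\<mu> Eu)
  qed (fact E\<mu> Eu)+
qed

text \<open>If \<open>\<omega> \<theta> = n + r \<omega> + q \<theta>\<close>, then
  \<open>(\<omega> - q) (\<theta> - r) = n + q r\<close>: subtracting integers from the last two
  basis elements normalises the basis, and \<open>table_normal_form\<close> applies. The shift is
  part of the conclusion so that the map induced modulo the integers can be read off.\<close>

lemma int_param_unit_form:
  assumes R: "cring R" and E: "int_param R E" and u: "E (1,0,0) = \<one>\<^bsub>R\<^esub>"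
  shows "\<exists>f q r. E \<circ> (\<lambda>(x0, x1, x2). (x0 - q * x1 - r * x2, x1, x2)) \<in> ring_iso (form_ring f) R"
proof -
  interpret cring R by fact
  obtain \<mu> u' where \<mu>: "\<And>x y. E (\<mu> x y) = E x \<otimes>\<^bsub>R\<^esub> E y" and u': "E u' = \<one>\<^bsub>R\<^esub>"
    and m: "\<And>x y z. \<mu> (x + y) z = \<mu> x z + \<mu> y z" "\<And>x y. \<mu> x y = \<mu> y x"
      "\<And>x y z. \<mu> (\<mu> x y) z = \<mu> x (\<mu> y z)" "\<And>x. \<mu> u' x = x"
    by (rule int_param_mult[OF R E]) (rule that; assumption)
  have EC [simp]: "E x \<in> carrier R" for x using E by (auto simp: bij_betw_def int_param_def)
  have inj: "x = y" if "E x = E y" for x y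
    using that E by (meson UNIV_I bij_betw_def inj_onD int_param_def)
  have uu: "u' = (1,0,0)" using inj u u' by metis
  obtain n r q where nrq: "\<mu> (0,1,0) (0,0,1) = (n, r, q)" by (metis prod_cases3)
  define L :: "vec3 \<Rightarrow> vec3" where "L = (\<lambda>(x0,x1,x2). (x0 - q * x1 - r * x2, x1, x2))"
  have L: "bij L" "\<And>x y. L (x + y) = L x + L y"
    by (rule o_bij[of "\<lambda>(x0,x1,x2). (x0 + q * x1 + r * x2, x1, x2)"])
       (auto simp: L_def fun_eq_iff algebra_simps)
  have E': "int_param R (E \<circ> L)" using E L by (rule int_param_comp)
  obtain \<nu> v where \<nu>: "\<And>x y. (E \<circ> L) (\<nu> x y) = (E \<circ> L) x \<otimes>\<^bsub>R\<^esub> (E \<circ> L) y" and v: "(E \<circ> L) v = \<one>\<^bsub>R\<^esub>"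
    and n: "\<And>x y z. \<nu> (x + y) z = \<nu> x z + \<nu> y z" "\<And>x y. \<nu> x y = \<nu> y x"
      "\<And>x y z. \<nu> (\<nu> x y) z = \<nu> x (\<nu> y z)" "\<And>x. \<nu> v x = x"
    by (rule int_param_mult[OF R E']) (rule that; assumption)
  have vv: "v = (1,0,0)"
    using inj[of "L v" "(1,0,0)"] v u L(1) by (auto simp: L_def split: prod.splits)
  have m2: "\<mu> z (x + y) = \<mu> z x + \<mu> z y" for x y z using m(1,2) by metis
  have munit: "\<mu> (1,0,0) x = x" "\<mu> x (1,0,0) = x" for x using m(2,4) uu by metis+
  have Lnu: "L (\<nu> x y) = \<mu> (L x) (L y)" for x y
    by (rule inj) (use \<nu>[of x y] in \<open>simp add: \<mu>\<close>)
  have "L (\<nu> (0,1,0) (0,0,1)) = \<mu> (- q, 1, 0) (- r, 0, 1)" by (subst Lnu) (simp add: L_def)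
  also have "\<dots> = (n + q * r, 0, 0)"
    by (simp add: additive_vec3[of "\<lambda>x. \<mu> x (- r, 0, 1)" "-q" 1 0, OF m(1)]
        additive_vec3[of "\<lambda>x. \<mu> (0,1,0) x" "-r" 0 1, OF m2] munit nrq;
        simp add: additive_vec3[of "\<lambda>x. \<mu> (0,0,1) x" "-r" 0 1, OF m2] munit zero_prod_def
         split: prod.splits)
  also have "\<dots> = L (n + q * r, 0, 0)" by (simp add: L_def)
  finally have "\<nu> (0,1,0) (0,0,1) = (n + q * r, 0, 0)"
    using bij_is_inj[OF L(1)] by (rule injD[rotated])
  then obtain f where f: "\<nu> = fmult f"
    using table_normal_form[OF n(1,2,3)] n(4) vv by metis
  have "E \<circ> L \<in> ring_iso (form_ring f) R"
    unfolding ring_iso_def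
  proof (intro CollectI conjI ring_hom_memI)
    show "bij_betw (E \<circ> L) (carrier (form_ring f)) (carrier R)"
      using E' by (simp add: int_param_def)
  qed (use \<nu> f E' v vv in \<open>auto simp: int_param_def\<close>)
  then show ?thesis unfolding L_def by blast
qed

text \<open>Two Bezout steps: one for \<open>x', y'\<close> with \<open>x = x' g\<close>,
  \<open>y = y' g\<close>, and one for \<open>g, z\<close>. The second column of \<open>L\<close>
  completes the first two coordinates, the third one completes \<open>g, z\<close>; \<open>K\<close>
  is the inverse matrix.\<close>

lemma unimodular_completion:
  fixes x y z :: int
  assumes prim: "\<And>g. g dvd x \<Longrightarrow> g dvd y \<Longrightarrow> g dvd z \<Longrightarrow> is_unit g"
  obtains L :: "vec3 \<Rightarrow> vec3" where "bij L" "\<And>u v. L (u + v) = L u + L v" "L (1,0,0) = (x,y,z)"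
proof -
  obtain g x' y' \<alpha> \<beta> where g: "x = x' * g" "y = y' * g" "x' * \<alpha> + y' * \<beta> = 1"
  proof (cases "gcd x y = 0")
    case True
    then show ?thesis by (intro that[of 1 0 0 1 0]) auto
  next
    case False
    define G where "G = gcd x y"
    obtain \<alpha> \<beta> where b: "\<alpha> * x + \<beta> * y = G" using bezout_int G_def by metis
    obtain x' y' where x': "x = G * x'" "y = G * y'" by (metis G_def dvd_def gcd_dvd1 gcd_dvd2)
    have "G * (x' * \<alpha> + y' * \<beta>) = \<alpha> * x + \<beta> * y" unfolding x' by (simp add: algebra_simps)
    then have "x' * \<alpha> + y' * \<beta> = 1" using False b by (auto simp: G_def)
    then show ?thesis using x' by (intro that[of x' G y' \<alpha> \<beta>]) (simp_all add: mult.commute)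
  qed
  have "coprime g z"
  proof (rule coprimeI)
    fix e assume "e dvd g" "e dvd z"
    then show "is_unit e" using prim g by (meson dvd_mult)
  qed
  then obtain \<gamma> \<delta> where gd: "\<gamma> * g + \<delta> * z = 1"
    by (metis bezout_int coprime_iff_gcd_eq_1)
  define L :: "vec3 \<Rightarrow> vec3" where "L = (\<lambda>(p,q,r). (x * p - \<beta> * q - x' * \<delta> * r, y * p + \<alpha> * q - y' * \<delta> * r, z * p + \<gamma> * r))"
  define K :: "vec3 \<Rightarrow> vec3" where "K = (\<lambda>(p,q,r). (\<alpha> * \<gamma> * p + \<beta> * \<gamma> * q + \<delta> * r, - y' * p + x' * q, - z * \<alpha> * p - z * \<beta> * q + g * r))"
  have e1: "\<alpha> * x' = 1 - y' * \<beta>" and e2: "g * \<gamma> = 1 - \<delta> * z" using g gd by (auto simp: algebra_simps)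
  have LK: "L (K (p,q,r)) = (p,q,r)" for p q r
    unfolding L_def K_def g(1,2) prod.case prod.inject using e1 e2 by (intro conjI; Groebner_Basis.algebra)
  have KL: "K (L (p,q,r)) = (p,q,r)" for p q r
    unfolding L_def K_def g(1,2) prod.case prod.inject using e1 e2 by (intro conjI; Groebner_Basis.algebra)
  show ?thesis
  proof (rule that)
    show "bij L" by (rule o_bij[of K]) (auto simp: fun_eq_iff LK KL)
    show "L (u + v) = L u + L v" for u v by (cases u; cases v) (simp add: L_def algebra_simps)
    show "L (1,0,0) = (x,y,z)" by (simp add: L_def)
  qed
qed

text \<open>The point is that \<open>1\<close> can be extended to a basis, for which it has to be a
  primitive vector. After that the basis is normalised and its table is that of a form.\<close>

lemma rank_3_ring_iso_form_ring:
  assumes "rank_ring 3 R"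
  shows "\<exists>f. form_ring f \<simeq> R"
proof -
  have R: "cring R" and i: "add_monoid R \<cong> product_group {..<3::nat} (\<lambda>_. integer_group)"
    using assms by (auto simp: rank_ring_def)
  interpret cring R by fact
  \<comment> \<open>The zero form serves as a model of the additive group only.\<close>
  have "add_monoid (form_ring (0,0,0,0)) \<cong> product_group {..<3::nat} (\<lambda>_. integer_group)"
    using rank_ring_form_ring by (auto simp: rank_ring_def)
  moreover have "product_group {..<3::nat} (\<lambda>_. integer_group) \<cong> add_monoid R"
    by (rule group.iso_sym[OF a_group i])
  ultimately have "add_monoid (form_ring (0,0,0,0)) \<cong> add_monoid R"
    by (rule Group.iso_trans)
  then obtain E where "E \<in> Group.iso (add_monoid (form_ring (0,0,0,0))) (add_monoid R)"
    by (auto simp: is_iso_def)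
  then have E: "int_param R E" by (auto simp: iso_def hom_def int_param_def)
  obtain \<mu> u where \<mu>: "\<And>x y. E (\<mu> x y) = E x \<otimes>\<^bsub>R\<^esub> E y" and u: "E u = \<one>\<^bsub>R\<^esub>"
    and m: "\<And>x y z. \<mu> (x + y) z = \<mu> x z + \<mu> y z" "\<And>x y. \<mu> x y = \<mu> y x"
      "\<And>x y z. \<mu> (\<mu> x y) z = \<mu> x (\<mu> y z)" "\<And>x. \<mu> u x = x"
    by (rule int_param_mult[OF R E]) (rule that; assumption)
  obtain u0 u1 u2 where uu: "u = (u0,u1,u2)" by (metis prod_cases3)
  have m2: "\<mu> z (x + y) = \<mu> z x + \<mu> z y" for x y z using m(1,2) by metis
  have smul1: "\<mu> (smul k x) y = smul k (\<mu> x y)" for k x y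
  proof -
    obtain x0 x1 x2 where x: "x = (x0,x1,x2)" by (metis prod_cases3)
    show ?thesis
      by (simp add: x additive_vec3[of "\<lambda>x. \<mu> x y", OF m(1), of "k * x0"] additive_vec3[of "\<lambda>x. \<mu> x y", OF m(1), of "x0"])
        (cases "\<mu> (1,0,0) y"; cases "\<mu> (0,1,0) y"; cases "\<mu> (0,0,1) y"; simp add: algebra_simps)
  qed
  have smul2: "\<mu> y (smul k x) = smul k (\<mu> y x)" for k x y using smul1 m(2) by metis
  have une: "u \<noteq> 0"
  proof
    assume "u = 0"
    then have "smul 0 u = u" by simp
    then have "\<mu> u (1,0,0) = 0" using smul1[of 0 u "(1,0,0)"] by simp
    then show False by (simp add: m(4) zero_prod_def)
  qed
  \<comment> \<open>If \<open>1 = g y\<close> with \<open>y\<close> primitive, then \<open>y = 1 y = g y\<^sup>2\<close>, so \<open>g\<close> is a unit.\<close>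
  have prim: "is_unit g" if "g dvd u0" "g dvd u1" "g dvd u2" for g
  proof -
    define G where "G = gcd u0 (gcd u1 u2)"
    have G0: "G \<noteq> 0" using une by (auto simp: G_def uu zero_prod_def)
    have "G dvd u0" "G dvd u1" "G dvd u2"
      unfolding G_def by (auto intro: dvd_trans[OF gcd_dvd2])
    then obtain v0 v1 v2 where v: "u0 = G * v0" "u1 = G * v1" "u2 = G * v2"
      by (auto elim!: dvdE)
    have uG: "u = smul G (v0,v1,v2)" by (simp add: uu v)
    have "(v0,v1,v2) = \<mu> u (v0,v1,v2)" by (simp add: m(4))
    also have "\<dots> = smul G (\<mu> (v0,v1,v2) (v0,v1,v2))" unfolding uG by (simp only: smul1)
    finally have "G dvd v0" "G dvd v1" "G dvd v2"
      by (cases "\<mu> (v0,v1,v2) (v0,v1,v2)"; simp)+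
    then have "G * G dvd G * v0" "G * G dvd G * v1" "G * G dvd G * v2" by simp_all
    then have "G * G dvd u0" "G * G dvd u1" "G * G dvd u2" unfolding v by simp_all
    then have "G * G dvd G * 1" unfolding G_def by simp
    then have "is_unit G" using G0 by (subst (asm) dvd_mult_cancel_left) simp
    moreover have "g dvd G" using that by (simp add: G_def)
    ultimately show ?thesis by (rule dvd_trans[rotated])
  qed
  obtain L :: "vec3 \<Rightarrow> vec3" where L: "bij L" "\<And>u v. L (u + v) = L u + L v" "L (1,0,0) = (u0,u1,u2)"
    by (rule unimodular_completion[OF prim, of u0 u1 u2]) (assumption | (rule that; assumption))+
  have "(E \<circ> L) (1,0,0) = \<one>\<^bsub>R\<^esub>" by (simp add: L(3) u flip: uu)
  then show ?thesis
    using int_param_unit_form[OF R int_param_comp[OF E L(1,2)]] unfolding is_ring_iso_def by blast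
qed

section \<open>Complex points of a form and homomorphisms to the complex numbers\<close>

definition ev :: "complex \<times> complex \<Rightarrow> vec3 \<Rightarrow> complex" where
  "ev u x = of_int (fst x) + of_int (fst (snd x)) * fst u + of_int (snd (snd x)) * snd u"

text \<open>A homomorphism to the complex numbers is determined by the images of
  \<open>\<omega>\<close> and \<open>\<theta>\<close>, so the pair of images stands for it;
  \<open>ev u\<close> is the homomorphism belonging to \<open>u\<close>.\<close>

definition pts :: "form \<Rightarrow> (complex \<times> complex) set" where
  "pts f = {u. \<forall>x y. ev u (fmult f x y) = ev u x * ev u y}"

lemma ev_simps [simp]:
  "ev (z, w) (x0, x1, x2) = of_int x0 + of_int x1 * z + of_int x2 * w"
  by (simp add: ev_def)

lemma ev_add: "ev u (x + y) = ev u x + ev u y"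
  by (simp add: ev_def algebra_simps)

lemma ev_unit: "ev u (1,0,0) = 1" "ev u (0,1,0) = fst u" "ev u (0,0,1) = snd u" "ev u 0 = 0"
  by (simp_all add: ev_def)

lemma additive_int_complex:
  fixes G :: "int \<Rightarrow> complex" assumes "\<And>x y. G (x + y) = G x + G y"
  shows "G k = of_int k * G 1"
proof (induction k rule: int_induct[of _ 0])
  case base show ?case using assms[of 0 0] by simp
next
  case (step1 i) then show ?case using assms[of i 1] by (simp add: algebra_simps)
next
  case (step2 i) then show ?case using assms[of "i - 1" 1] by (simp add: algebra_simps)
qed

lemma additive_eq_ev:
  fixes F :: "vec3 \<Rightarrow> complex"
  assumes add: "\<And>x y. F (x + y) = F x + F y" and one: "F (1,0,0) = 1"
  shows "F x = ev (F (0,1,0), F (0,0,1)) x"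
proof -
  obtain x0 x1 x2 where x: "x = (x0,x1,x2)" by (metis prod_cases3)
  have "F x = F ((x0,0,0) + (0,x1,0) + (0,0,x2))" by (simp add: x)
  also have "\<dots> = F (x0,0,0) + F (0,x1,0) + F (0,0,x2)" by (simp only: add)
  also have "F (x0,0,0) = of_int x0 * F (1,0,0)"
    by (rule additive_int_complex[of "\<lambda>k. F (k,0,0)"]) (simp flip: add)
  also have "F (0,x1,0) = of_int x1 * F (0,1,0)"
    by (rule additive_int_complex[of "\<lambda>k. F (0,k,0)"]) (simp flip: add)
  also have "F (0,0,x2) = of_int x2 * F (0,0,1)"
    by (rule additive_int_complex[of "\<lambda>k. F (0,0,k)"]) (simp flip: add)
  finally show ?thesis by (simp add: x one)
qed

lemma ev_fmult: "u \<in> pts f \<Longrightarrow> ev u (fmult f x y) = ev u x * ev u y"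
  by (simp only: pts_def mem_Collect_eq)

lemma pts_iff:
  "(z, w) \<in> pts (a, b, c, d) \<longleftrightarrow>
     z * w = - (of_int a * of_int d) \<and>
     z * z = - (of_int a * of_int c) - of_int b * z + of_int a * w \<and>
     w * w = - (of_int b * of_int d) - of_int d * z + of_int c * w" (is "_ \<longleftrightarrow> ?R")
proof
  assume "(z, w) \<in> pts (a, b, c, d)"
  note e = ev_fmult[OF this]
  show ?R
    using e[of "(0,1,0)" "(0,0,1)"] e[of "(0,1,0)" "(0,1,0)"] e[of "(0,0,1)" "(0,0,1)"] by simp
next
  assume R: ?R
  have "ev (z, w) (fmult (a,b,c,d) x y) = ev (z, w) x * ev (z, w) y" for x y
  proof -
    obtain x0 x1 x2 where x: "x = (x0,x1,x2)" by (metis prod_cases3)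
    obtain y0 y1 y2 where y: "y = (y0,y1,y2)" by (metis prod_cases3)
    have "ev (z, w) x * ev (z, w) y = of_int x0 * of_int y0
        + (of_int x0 * of_int y1 + of_int x1 * of_int y0) * z
        + (of_int x0 * of_int y2 + of_int x2 * of_int y0) * w
        + of_int x1 * of_int y1 * (z * z) + (of_int x1 * of_int y2 + of_int x2 * of_int y1) * (z * w)
        + of_int x2 * of_int y2 * (w * w)"
      by (simp add: x y algebra_simps)
    also have "\<dots> = ev (z, w) (fmult (a,b,c,d) x y)"
      using R by (simp only:) (simp add: x y algebra_simps)
    finally show ?thesis by simp
  qed
  then show "(z, w) \<in> pts (a, b, c, d)" by (simp only: pts_def mem_Collect_eq) blast
qed

lemma ring_iso_form_ringE:
  assumes "h \<in> ring_iso (form_ring f) R"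
  shows "bij_betw h UNIV (carrier R)" "h (x + y) = h x \<oplus>\<^bsub>R\<^esub> h y"
    "h (fmult f x y) = h x \<otimes>\<^bsub>R\<^esub> h y" "h (1,0,0) = \<one>\<^bsub>R\<^esub>" "h x \<in> carrier R"
  using ring_iso_memE[OF assms] by (simp_all del: split_paired_All)

lemma complex_homs_form:
  assumes h: "h \<in> ring_iso (form_ring f) R"
  shows complex_homs_ev: "\<And>\<sigma> x. \<sigma> \<in> complex_homs R \<Longrightarrow> \<sigma> (h x) = ev (\<sigma> (h (0,1,0)), \<sigma> (h (0,0,1))) x"
    and complex_homs_bij: "bij_betw (\<lambda>\<sigma>. (\<sigma> (h (0,1,0)), \<sigma> (h (0,0,1)))) (complex_homs R) (pts f)"
proof -
  note hE = ring_iso_form_ringE[OF h]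
  have hom: "\<sigma> (h (x + y)) = \<sigma> (h x) + \<sigma> (h y)" "\<sigma> (h (fmult f x y)) = \<sigma> (h x) * \<sigma> (h y)"
    "\<sigma> (h (1,0,0)) = 1" if "\<sigma> \<in> complex_homs R" for \<sigma> :: "_ \<Rightarrow> complex" and x y
    using that unfolding hE(2) hE(3) hE(4) by (simp_all add: complex_homs_def Ring.ring_hom_def hE(5))
  show ev: "\<sigma> (h x) = ev (\<sigma> (h (0,1,0)), \<sigma> (h (0,0,1))) x" if "\<sigma> \<in> complex_homs R" for \<sigma> x
    by (rule additive_eq_ev) (simp_all only: hom[OF that])
  \<comment> \<open>The restriction to the carrier makes the inverse land in
    \<open>extensional\<close>, so each point comes from exactly one member of
    \<open>complex_homs\<close>.\<close>
  define \<Psi> where "\<Psi> = (\<lambda>u. \<lambda>y\<in>carrier R. ev u (inv_into UNIV h y))"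
  have inv: "inv_into UNIV h (h x) = x" for x
    using hE(1) by (simp add: bij_betw_def inv_into_f_f del: split_paired_All)
  show "bij_betw (\<lambda>\<sigma>. (\<sigma> (h (0,1,0)), \<sigma> (h (0,0,1)))) (complex_homs R) (pts f)"
  proof (rule bij_betw_byWitness[where f' = \<Psi>])
    show "\<forall>\<sigma>\<in>complex_homs R. \<Psi> (\<sigma> (h (0,1,0)), \<sigma> (h (0,0,1))) = \<sigma>"
    proof
      fix \<sigma> assume \<sigma>: "\<sigma> \<in> complex_homs R"
      show "\<Psi> (\<sigma> (h (0,1,0)), \<sigma> (h (0,0,1))) = \<sigma>"
      proof
        fix y
        show "\<Psi> (\<sigma> (h (0,1,0)), \<sigma> (h (0,0,1))) y = \<sigma> y"
        proof (cases "y \<in> carrier R")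
          case True
          then obtain x where "y = h x" using hE(1) by (metis bij_betw_def imageE)
          then show ?thesis using True ev[OF \<sigma>, of x] by (simp add: \<Psi>_def inv)
        next
          case False
          then show ?thesis using \<sigma> by (simp add: \<Psi>_def complex_homs_def extensional_def)
        qed
      qed
    qed
    show "\<forall>u\<in>pts f. (\<Psi> u (h (0,1,0)), \<Psi> u (h (0,0,1))) = u"
      by (simp add: \<Psi>_def inv hE(5) ev_unit del: split_paired_All)
    show "(\<lambda>\<sigma>. (\<sigma> (h (0,1,0)), \<sigma> (h (0,0,1)))) ` complex_homs R \<subseteq> pts f"
    proof (rule image_subsetI)
      fix \<sigma> assume \<sigma>: "\<sigma> \<in> complex_homs R"
      show "(\<sigma> (h (0,1,0)), \<sigma> (h (0,0,1))) \<in> pts f"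
        by (simp only: pts_def mem_Collect_eq ev[OF \<sigma>, symmetric] hom[OF \<sigma>]) simp
    qed
    show "\<Psi> ` pts f \<subseteq> complex_homs R"
    proof (rule image_subsetI)
      fix u assume u: "u \<in> pts f"
      have \<Psi>h: "\<Psi> u (h x) = ev u x" for x by (simp add: \<Psi>_def inv hE(5))
      have ex: "\<exists>x. y = h x" if "y \<in> carrier R" for y
        using that hE(1) by (metis bij_betw_def imageE)
      have "\<Psi> u \<in> Ring.ring_hom R class_ring"
      proof (rule ring_hom_memI)
        fix x y assume "x \<in> carrier R" "y \<in> carrier R"
        then obtain x' y' where xy: "x = h x'" "y = h y'" using ex by metis
        show "\<Psi> u (x \<otimes>\<^bsub>R\<^esub> y) = \<Psi> u x \<otimes>\<^bsub>class_ring\<^esub> \<Psi> u y"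
          unfolding xy hE(3)[symmetric] \<Psi>h by (simp add: ev_fmult[OF u])
        show "\<Psi> u (x \<oplus>\<^bsub>R\<^esub> y) = \<Psi> u x \<oplus>\<^bsub>class_ring\<^esub> \<Psi> u y"
          unfolding xy hE(2)[symmetric] \<Psi>h by (simp add: ev_add)
      next
        show "\<Psi> u \<one>\<^bsub>R\<^esub> = \<one>\<^bsub>class_ring\<^esub>" unfolding hE(4)[symmetric] \<Psi>h by (simp add: ev_unit)
      qed simp
      then show "\<Psi> u \<in> complex_homs R" by (simp add: complex_homs_def \<Psi>_def)
    qed
  qed
qed

definition flen :: "form \<Rightarrow> vec3 \<Rightarrow> real" where
  "flen f x = sqrt (1 / 3 * (\<Sum>u\<in>pts f. (cmod (ev u x))\<^sup>2))"

lemma ring_length_form: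
  assumes h: "h \<in> ring_iso (form_ring f) R"
  shows "ring_length 3 R (h x) = flen f x"
proof -
  have "(\<Sum>\<sigma>\<in>complex_homs R. (cmod (\<sigma> (h x)))\<^sup>2) =
      (\<Sum>\<sigma>\<in>complex_homs R. (cmod (ev (\<sigma> (h (0,1,0)), \<sigma> (h (0,0,1))) x))\<^sup>2)"
    by (rule sum.cong[OF refl], subst complex_homs_ev[OF h]) (assumption, rule refl)
  also have "\<dots> = (\<Sum>u\<in>pts f. (cmod (ev u x))\<^sup>2)"
    by (rule sum.reindex_bij_betw[OF complex_homs_bij[OF h]])
  finally show ?thesis by (simp add: ring_length_def flen_def)
qed

section \<open>The index form and the action of invertible matrices\<close>

fun feval :: "form \<Rightarrow> int \<Rightarrow> int \<Rightarrow> int" where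
  "feval (a, b, c, d) x y = a * x ^ 3 + b * x\<^sup>2 * y + c * x * y\<^sup>2 + d * y ^ 3"

fun disc :: "form \<Rightarrow> int" where
  "disc (a, b, c, d) = b\<^sup>2 * c\<^sup>2 - 4 * a * c ^ 3 - 4 * b ^ 3 * d - 27 * a\<^sup>2 * d\<^sup>2 + 18 * a * b * c * d"

lemma feval_inject:
  assumes "\<And>x y. feval f x y = feval g x y" shows "f = g"
proof -
  obtain a b c d where f: "f = (a,b,c,d)" by (metis prod_cases4)
  obtain a' b' c' d' where g: "g = (a',b',c',d')" by (metis prod_cases4)
  show ?thesis
    using assms[of 1 0] assms[of 0 1] assms[of 1 1] assms[of 1 "-1"] by (simp add: f g)
qed

text \<open>The index form: \<open>1 \<and> \<alpha> \<and> \<alpha>\<^sup>2 = f(x\<^sub>1, x\<^sub>2) 1 \<and> \<omega> \<and> \<theta>\<close> for \<open>\<alpha> = x\<^sub>0 + x\<^sub>1 \<omega> + x\<^sub>2 \<theta>\<close>.\<close>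

lemma index_form:
  assumes "fmult f (x0, x1, x2) (x0, x1, x2) = (s, p, q)"
  shows "x1 * q - x2 * p = feval f x1 x2"
proof -
  obtain a b c d where f: "f = (a,b,c,d)" by (metis prod_cases4)
  have q: "q = x0 * x2 + x2 * x0 + a * x1 * x1 + c * x2 * x2"
    and p: "p = x0 * x1 + x1 * x0 - b * x1 * x1 - d * x2 * x2"
    using assms by (simp_all only: f fmult.simps prod.inject)
  show ?thesis unfolding p q f by (simp add: algebra_simps power2_eq_square power3_eq_cube)
qed

text \<open>A unital homomorphism acts on the quotient by the integers through a 2 by 2 matrix. The
  index of \<open>1, \<alpha>, \<alpha>^2\<close> is multiplied by its determinant, so
  \<open>index_form\<close> for an element and for its image relates the two forms. Homomorphisms
  that are not surjective are included, since overrings are treated in this way later.\<close>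

lemma form_ring_homE:
  assumes h: "h \<in> Ring.ring_hom (form_ring f) (form_ring g)"
  obtains n m \<alpha> \<beta> \<gamma> \<delta> where
    "\<And>x0 x1 x2. h (x0,x1,x2) = (x0 + n * x1 + m * x2, \<alpha> * x1 + \<beta> * x2, \<gamma> * x1 + \<delta> * x2)"
    "\<And>x y. feval g (\<alpha> * x + \<beta> * y) (\<gamma> * x + \<delta> * y) = (\<alpha> * \<delta> - \<beta> * \<gamma>) * feval f x y"
proof -
  have hE: "h (x + y) = h x + h y" "h (fmult f x y) = fmult g (h x) (h y)" "h (1,0,0) = (1,0,0)" for x y
    using ring_hom_memE[OF h] by (simp_all del: split_paired_All)
  obtain n \<alpha> \<gamma> where w: "h (0,1,0) = (n,\<alpha>,\<gamma>)" by (metis prod_cases3)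
  obtain m \<beta> \<delta> where t: "h (0,0,1) = (m,\<beta>,\<delta>)" by (metis prod_cases3)
  have lin: "h (x0,x1,x2) = (x0 + n * x1 + m * x2, \<alpha> * x1 + \<beta> * x2, \<gamma> * x1 + \<delta> * x2)" for x0 x1 x2
    by (subst additive_vec3[of h, OF hE(1)]) (simp add: hE(3) w t mult.commute)
  have "feval g (\<alpha> * x + \<beta> * y) (\<gamma> * x + \<delta> * y) = (\<alpha> * \<delta> - \<beta> * \<gamma>) * feval f x y" for x y
  proof -
    obtain s p q where sq: "fmult f (0,x,y) (0,x,y) = (s,p,q)" by (metis prod_cases3)
    have "fmult g (n * x + m * y, \<alpha> * x + \<beta> * y, \<gamma> * x + \<delta> * y) (n * x + m * y, \<alpha> * x + \<beta> * y, \<gamma> * x + \<delta> * y)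
       = (s + n * p + m * q, \<alpha> * p + \<beta> * q, \<gamma> * p + \<delta> * q)"
      using hE(2)[of "(0,x,y)" "(0,x,y)"] unfolding sq lin by simp
    from index_form[OF this] index_form[OF sq] show ?thesis by (simp add: algebra_simps)
  qed
  with lin show ?thesis by (rule that)
qed

lemma form_ring_isoE:
  assumes h: "h \<in> ring_iso (form_ring f) (form_ring g)"
  obtains n m \<alpha> \<beta> \<gamma> \<delta> where
    "\<And>x0 x1 x2. h (x0,x1,x2) = (x0 + n * x1 + m * x2, \<alpha> * x1 + \<beta> * x2, \<gamma> * x1 + \<delta> * x2)"
    "\<And>x y. feval g (\<alpha> * x + \<beta> * y) (\<gamma> * x + \<delta> * y) = (\<alpha> * \<delta> - \<beta> * \<gamma>) * feval f x y"
    "\<bar>\<alpha> * \<delta> - \<beta> * \<gamma>\<bar> = 1"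
proof -
  have "h \<in> Ring.ring_hom (form_ring f) (form_ring g)" using h by (simp add: ring_iso_def)
  then obtain n m \<alpha> \<beta> \<gamma> \<delta> where
    lin: "\<And>x0 x1 x2. h (x0,x1,x2) = (x0 + n * x1 + m * x2, \<alpha> * x1 + \<beta> * x2, \<gamma> * x1 + \<delta> * x2)" and
    ev: "\<And>x y. feval g (\<alpha> * x + \<beta> * y) (\<gamma> * x + \<delta> * y) = (\<alpha> * \<delta> - \<beta> * \<gamma>) * feval f x y"
    by (rule form_ring_homE) (rule that; assumption)
  have surj: "\<exists>x. h x = y" for y using ring_iso_form_ringE(1)[OF h] by (metis bij_betw_def form_ring_simps(1) imageE UNIV_I)
  obtain x where x: "h x = (0,1,0)" using surj by blast
  obtain y where y: "h y = (0,0,1)" using surj by blast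
  obtain x0 x1 x2 where x': "x = (x0,x1,x2)" by (metis prod_cases3)
  obtain y0 y1 y2 where y': "y = (y0,y1,y2)" by (metis prod_cases3)
  have "\<alpha> * x1 + \<beta> * x2 = 1" "\<gamma> * x1 + \<delta> * x2 = 0" using x by (simp_all add: x' lin)
  moreover have "\<alpha> * y1 + \<beta> * y2 = 0" "\<gamma> * y1 + \<delta> * y2 = 1" using y by (simp_all add: y' lin)
  ultimately have "(\<alpha> * \<delta> - \<beta> * \<gamma>) * (x1 * y2 - x2 * y1) = 1" by Groebner_Basis.algebra
  then have "\<bar>\<alpha> * \<delta> - \<beta> * \<gamma>\<bar> = 1" using zmult_eq_1_iff abs_1 abs_minus by metis
  with lin ev show ?thesis by (rule that)
qed

text \<open>The matrix gives a new basis containing \<open>1\<close>; normalising it produces the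
  form \<open>g\<close>, whose coefficients never have to be written down, and
  \<open>form_ring_isoE\<close> for the resulting isomorphism supplies the relation, which is
  twisted by the determinant.\<close>

lemma GL2_action:
  fixes \<alpha> \<beta> \<gamma> \<delta> :: int
  assumes det: "\<bar>\<alpha> * \<delta> - \<beta> * \<gamma>\<bar> = 1"
  obtains g h n m where "h \<in> ring_iso (form_ring g) (form_ring f)"
    "\<And>x0 x1 x2. h (x0,x1,x2) = (x0 + n * x1 + m * x2, \<alpha> * x1 + \<beta> * x2, \<gamma> * x1 + \<delta> * x2)"
    "\<And>x y. feval f (\<alpha> * x + \<beta> * y) (\<gamma> * x + \<delta> * y) = (\<alpha> * \<delta> - \<beta> * \<gamma>) * feval g x y"
proof -
  define e where "e = \<alpha> * \<delta> - \<beta> * \<gamma>"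
  have "\<bar>e\<bar> * \<bar>e\<bar> = 1" using det by (simp add: e_def)
  then have ee: "e * e = 1" by simp
  define L :: "vec3 \<Rightarrow> vec3" where "L = (\<lambda>(x0,x1,x2). (x0, \<alpha> * x1 + \<beta> * x2, \<gamma> * x1 + \<delta> * x2))"
  define K :: "vec3 \<Rightarrow> vec3" where "K = (\<lambda>(x0,x1,x2). (x0, e * (\<delta> * x1 - \<beta> * x2), e * (\<alpha> * x2 - \<gamma> * x1)))"
  have e1: "e * (\<alpha> * \<delta> - \<beta> * \<gamma>) * q = q" for q using ee by (simp add: e_def)
  have LK: "L (K (p,q,r)) = (p,q,r)" for p q r
    using e1[of q] e1[of r] by (simp add: L_def K_def algebra_simps)
  have KL: "K (L (p,q,r)) = (p,q,r)" for p q r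
    using e1[of q] e1[of r] by (simp add: L_def K_def algebra_simps)
  have "bij L" by (rule o_bij[of K]) (simp_all add: fun_eq_iff LK KL)
  moreover have "L (x + y) = L x + L y" for x y by (cases x; cases y) (simp add: L_def algebra_simps)
  ultimately have "int_param (form_ring f) L" unfolding int_param_def by simp
  moreover have "L (1,0,0) = \<one>\<^bsub>form_ring f\<^esub>" by (simp add: L_def)
  ultimately obtain g q r where iso: "L \<circ> (\<lambda>(x0, x1, x2). (x0 - q * x1 - r * x2, x1, x2)) \<in> ring_iso (form_ring g) (form_ring f)"
    using int_param_unit_form[OF cring_form_ring] by blast
  define h where "h = L \<circ> (\<lambda>(x0, x1, x2). (x0 - q * x1 - r * x2, x1, x2))"
  have h: "h \<in> ring_iso (form_ring g) (form_ring f)" using iso by (simp add: h_def)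
  have lin: "h (x0,x1,x2) = (x0 + (-q) * x1 + (-r) * x2, \<alpha> * x1 + \<beta> * x2, \<gamma> * x1 + \<delta> * x2)" for x0 x1 x2
    by (simp add: h_def L_def)
  \<comment> \<open>The matrix of \<open>h\<close> is already known from \<open>lin\<close>. This
    second description brings the relation between the forms; evaluating both at
    \<open>\<omega>\<close> and \<open>\<theta>\<close> identifies the entries.\<close>
  obtain n m \<alpha>' \<beta>' \<gamma>' \<delta>' where
    lin': "\<And>x0 x1 x2. h (x0,x1,x2) = (x0 + n * x1 + m * x2, \<alpha>' * x1 + \<beta>' * x2, \<gamma>' * x1 + \<delta>' * x2)" and
    ev: "\<And>x y. feval f (\<alpha>' * x + \<beta>' * y) (\<gamma>' * x + \<delta>' * y) = (\<alpha>' * \<delta>' - \<beta>' * \<gamma>') * feval g x y"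
    using h by (rule form_ring_isoE) (rule that; assumption)
  have "\<alpha>' = \<alpha>" "\<beta>' = \<beta>" "\<gamma>' = \<gamma>" "\<delta>' = \<delta>"
    using lin[of 0 1 0] lin'[of 0 1 0] lin[of 0 0 1] lin'[of 0 0 1] by simp_all
  with ev have "\<And>x y. feval f (\<alpha> * x + \<beta> * y) (\<gamma> * x + \<delta> * y) = (\<alpha> * \<delta> - \<beta> * \<gamma>) * feval g x y" by simp
  with h lin show ?thesis by (rule that)
qed

text \<open>Points are pulled back along \<open>h\<close>, so the direction is reversed; the inverse
  isomorphism gives the inverse map.\<close>

lemma pts_form_iso:
  assumes h: "h \<in> ring_iso (form_ring f) (form_ring g)"
  shows "bij_betw (\<lambda>u. (ev u (h (0,1,0)), ev u (h (0,0,1)))) (pts g) (pts f)"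
    and "u \<in> pts g \<Longrightarrow> ev (ev u (h (0,1,0)), ev u (h (0,0,1))) x = ev u (h x)"
proof -
  have tr: "ev (ev u (k (0,1,0)), ev u (k (0,0,1))) x = ev u (k x)"
    and tr2: "u \<in> pts g' \<Longrightarrow> (ev u (k (0,1,0)), ev u (k (0,0,1))) \<in> pts f'"
    if k: "k \<in> ring_iso (form_ring f') (form_ring g')" for k u x f' g'
  proof -
    note kE = ring_iso_form_ringE[OF k, unfolded form_ring_simps]
    show 1: "ev (ev u (k (0,1,0)), ev u (k (0,0,1))) x = ev u (k x)" for x
      by (rule additive_eq_ev[of "\<lambda>x. ev u (k x)", symmetric]) (simp_all only: kE(2,4) ev_add ev_unit)
    show "(ev u (k (0,1,0)), ev u (k (0,0,1))) \<in> pts f'" if "u \<in> pts g'"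
      unfolding pts_def mem_Collect_eq 1 kE(3) using ev_fmult[OF that] by blast
  qed
  show "u \<in> pts g \<Longrightarrow> ev (ev u (h (0,1,0)), ev u (h (0,0,1))) x = ev u (h x)" by (rule tr[OF h])
  define k where "k = inv_into UNIV h"
  have k: "k \<in> ring_iso (form_ring g) (form_ring f)"
    using ring_iso_set_sym[OF cring.axioms(1)[OF cring_form_ring] h] by (simp add: k_def)
  have hk: "h (k x) = x" and kh: "k (h x) = x" for x
    using ring_iso_form_ringE(1)[OF h] unfolding k_def form_ring_simps
    by (metis UNIV_I bij_betw_inv_into_right, metis UNIV_I bij_betw_inv_into_left)
  show "bij_betw (\<lambda>u. (ev u (h (0,1,0)), ev u (h (0,0,1)))) (pts g) (pts f)"
  proof (rule bij_betw_byWitness[where f' = "\<lambda>u. (ev u (k (0,1,0)), ev u (k (0,0,1)))"])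
    show "\<forall>u\<in>pts g. (ev (ev u (h (0,1,0)), ev u (h (0,0,1))) (k (0,1,0)), ev (ev u (h (0,1,0)), ev u (h (0,0,1))) (k (0,0,1))) = u"
      unfolding tr[OF h] hk by (simp only: ev_unit prod.collapse) simp
    show "\<forall>u\<in>pts f. (ev (ev u (k (0,1,0)), ev u (k (0,0,1))) (h (0,1,0)), ev (ev u (k (0,1,0)), ev u (k (0,0,1))) (h (0,0,1))) = u"
      unfolding tr[OF k] kh by (simp only: ev_unit prod.collapse) simp
  qed (use tr2[OF h] tr2[OF k] in blast)+
qed

section \<open>The discriminant of the trace form\<close>

definition det3 :: "(nat \<Rightarrow> nat \<Rightarrow> int) \<Rightarrow> int" where
  "det3 A = A 0 0 * (A 1 1 * A 2 2 - A 1 2 * A 2 1) - A 1 0 * (A 0 1 * A 2 2 - A 0 2 * A 2 1)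
     + A 2 0 * (A 0 1 * A 1 2 - A 0 2 * A 1 1)"

lemma det3_mult:
  "det3 (\<lambda>i j. A i 0 * B 0 j + A i 1 * B 1 j + A i 2 * B 2 j) = det3 A * det3 B"
  unfolding det3_def by (simp add: algebra_simps)

lemma det_mat_3: "Determinant.det (mat 3 3 (\<lambda>(i, j). A i j)) = det3 A"
proof -
  have d1: "Determinant.det (mat 1 1 g) = g (0, 0)" for g :: "nat \<times> nat \<Rightarrow> int"
    by (subst det_single) auto
  have c: "cofactor (mat (Suc n) (Suc n) g) i 0 = (- 1) ^ i *
      Determinant.det (mat n n (\<lambda>(i', j). g (if i' < i then i' else Suc i', Suc j)))"
    if "i \<le> n" for n i and g :: "nat \<times> nat \<Rightarrow> int"
    unfolding cofactor_def mat_delete_def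
    by (intro arg_cong2[of _ _ _ _ "(*)"] arg_cong[of _ _ Determinant.det] eq_matI) (auto simp: that)
  have d2: "Determinant.det (mat 2 2 g) = g (0,0) * g (1,1) - g (1,0) * g (0,1)" for g :: "nat \<times> nat \<Rightarrow> int"
    unfolding laplace_expansion_column[OF mat_carrier[of 2 2 g], of 0, simplified]
    by (simp add: c[of _ 1, simplified] numeral_2_eq_2 d1[simplified])
  show ?thesis
    unfolding laplace_expansion_column[OF mat_carrier[of 3 3 "\<lambda>(i, j). A i j"], of 0, simplified]
    by (simp add: numeral_3_eq_3 c[of _ 2, simplified numeral_2_eq_2] d2[unfolded numeral_2_eq_2] det3_def)
       (simp add: numeral_2_eq_2 algebra_simps)
qed

definition unit3 :: "nat \<Rightarrow> vec3" where
  "unit3 k = (if k = 0 then (1,0,0) else if k = 1 then (0,1,0) else (0,0,1))"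

definition coef3 :: "nat \<Rightarrow> vec3 \<Rightarrow> int" where
  "coef3 k x = (if k = 0 then fst x else if k = 1 then fst (snd x) else snd (snd x))"

lemma sum_lessThan_3: "(\<Sum>j<3::nat. g j) = g 0 + g 1 + (g 2 :: 'a::comm_monoid_add)"
  by (simp add: numeral_3_eq_3 numeral_2_eq_2)

lemma coef3_add: "coef3 k (x + y) = coef3 k x + coef3 k y"
  by (simp add: coef3_def)

lemma coef3_smul: "coef3 k (smul m x) = m * coef3 k x"
  by (cases x) (simp add: coef3_def)

lemma additive_vec3_int:
  fixes L :: "vec3 \<Rightarrow> int" assumes L: "\<And>x y. L (x + y) = L x + L y"
  shows "L x = coef3 0 x * L (unit3 0) + coef3 1 x * L (unit3 1) + coef3 2 x * L (unit3 2)"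
proof -
  have "fst (L x, (0::int,0::int)) = fst (smul (coef3 0 x) (L (unit3 0),0,0) + smul (coef3 1 x) (L (unit3 1),0,0)
     + smul (coef3 2 x) (L (unit3 2),0,0))"
    using additive_vec3[of "\<lambda>x. (L x, 0, 0)" "fst x" "fst (snd x)" "snd (snd x)"]
    by (simp add: L unit3_def coef3_def)
  then show ?thesis by simp
qed

fun ftr :: "form \<Rightarrow> vec3 \<Rightarrow> int" where
  "ftr (a, b, c, d) (x0, x1, x2) = 3 * x0 - b * x1 + c * x2"

lemma ftr_add: "ftr f (x + y) = ftr f x + ftr f y"
  by (cases f; cases x; cases y) (simp add: algebra_simps)

lemma ftr_diag: "coef3 0 (fmult f y (unit3 0)) + coef3 1 (fmult f y (unit3 1)) + coef3 2 (fmult f y (unit3 2)) = ftr f y"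
  by (cases f; cases y) (simp add: coef3_def unit3_def)

lemma fmult_add2: "fmult f z (x + y) = fmult f z x + fmult f z y"
  unfolding fmult_comm[of f z] by (rule fmult_add)

text \<open>The basis hidden in \<open>ring_disc\<close> is an arbitrary \<open>SOME\<close>. With
  \<open>B\<close> its coordinate matrix and \<open>C\<close> the matrix of the dual coordinates one
  has \<open>B C = 1\<close>. Hence the trace is that of the standard basis, the Gram matrix changes
  by \<open>B\<close> from both sides, and \<open>det B\<close> is a unit, whose square is 1. In the
  standard basis the determinant is computed directly.\<close>

lemma ring_disc_form:
  assumes R: "cring R" and h: "h \<in> ring_iso (form_ring f) R"
  shows "ring_disc 3 R = disc f"
proof -
  interpret cring R by fact
  note hE = ring_iso_form_ringE[OF h]
  have hom: "h \<in> Ring.ring_hom (form_ring f) R" using h by (simp add: ring_iso_def)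
  have inj: "x = y" if "h x = h y" for x y
    using that hE(1) by (meson UNIV_I bij_betw_def inj_onD)
  have ex: "\<exists>x. y = h x" if "y \<in> carrier R" for y using that hE(1) by (metis bij_betw_def imageE)
  have unit_comb: "(\<Sum>j<3::nat. smul (c j) (unit3 j)) = (c 0, c 1, c 2)" for c
    by (simp add: sum_lessThan_3 unit3_def)
  have "int_basis R 3 (\<lambda>j. h (unit3 j))"
    unfolding int_basis_def
  proof (intro conjI ballI)
    fix x assume "x \<in> carrier R"
    then obtain x' where x: "x = h x'" using ex by blast
    obtain x0 x1 x2 where x': "x' = (x0,x1,x2)" by (metis prod_cases3)
    show "\<exists>!c. c \<in> extensional {..<3} \<and> int_comb R 3 c (\<lambda>j. h (unit3 j)) = x"
    proof (rule ex1I)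
      show "(\<lambda>i\<in>{..<3::nat}. coef3 i x') \<in> extensional {..<3} \<and>
        int_comb R 3 (\<lambda>i\<in>{..<3::nat}. coef3 i x') (\<lambda>j. h (unit3 j)) = x"
        by (simp add: int_comb_hom[OF R hom] unit_comb x) (simp add: coef3_def)
      fix c assume c: "c \<in> extensional {..<3} \<and> int_comb R 3 c (\<lambda>j. h (unit3 j)) = x"
      then have "h (c 0, c 1, c 2) = h x'" unfolding int_comb_hom[OF R hom] unit_comb x by blast
      then have "x' = (c 0, c 1, c 2)" by (rule inj[symmetric])
      then have "coef3 0 x' = c 0" "coef3 1 x' = c 1" "coef3 2 x' = c 2" by (simp_all add: coef3_def)
      moreover have "j = 0 \<or> j = 1 \<or> j = 2" if "j < 3" for j :: nat using that by linarith
      ultimately have "c j = coef3 j x'" if "j < 3" for j using that by metis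
      then show "c = (\<lambda>i\<in>{..<3}. coef3 i x')" using c by (intro extensionalityI[of _ "{..<3}"]) simp_all
    qed
  qed (simp add: hE(5))
  then have bas: "int_basis R 3 (SOME b. int_basis R 3 b)" by (rule someI[of "int_basis R 3"])
  define b where "b = (SOME b. int_basis R 3 b)"
  have b: "int_basis R 3 b" using bas by (simp add: b_def)
  then have bC: "b j \<in> carrier R" if "j < 3" for j using that by (auto simp: int_basis_def)
  have "\<exists>x. b j = h x" if "j < 3" for j using ex[OF bC[OF that]] .
  then obtain \<beta> where \<beta>: "\<And>j. j < 3 \<Longrightarrow> b j = h (\<beta> j)" by metis
  have comb: "int_comb R 3 c b = h (\<Sum>j<3. smul (c j) (\<beta> j))" for c
  proof -
    have "int_comb R 3 c b = int_comb R 3 c (\<lambda>j. h (\<beta> j))"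
      unfolding int_comb_def by (rule finsum_cong') (auto simp: \<beta> hE(5))
    then show ?thesis by (simp add: int_comb_hom[OF R hom])
  qed
  define co where "co x = int_coord R 3 b (h x)" for x
  have co_ex: "\<exists>!c. c \<in> extensional {..<3} \<and> int_comb R 3 c b = h x" for x
    using b hE(5) by (simp only: int_basis_def)
  have co1: "co x \<in> extensional {..<3} \<and> int_comb R 3 (co x) b = h x" for x
    unfolding co_def int_coord_def by (rule theI'[OF co_ex])
  have co2: "smul (co x 0) (\<beta> 0) + smul (co x 1) (\<beta> 1) + smul (co x 2) (\<beta> 2) = x" for x
    using co1[of x] unfolding comb sum_lessThan_3 by (blast intro: inj)
  have co_unique: "co x i = c i"
    if "smul (c 0) (\<beta> 0) + smul (c 1) (\<beta> 1) + smul (c 2) (\<beta> 2) = x" "i < 3" for x c i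
  proof -
    have "restrict c {..<3} \<in> extensional {..<3} \<and> int_comb R 3 (restrict c {..<3}) b = h x"
      unfolding comb sum_lessThan_3 using that(1) by simp
    then have "restrict c {..<3} = co x" using co_ex[of x] co1[of x] by blast
    then show ?thesis using that(2) by (metis lessThan_iff restrict_apply')
  qed
  have smul_add: "smul (m + n) v = smul m v + smul n v" for m n v by (cases v) (simp add: algebra_simps)
  have co_add: "co (x + y) i = co x i + co y i" if "i < 3" for x y i
  proof (rule co_unique[of "\<lambda>i. co x i + co y i", OF _ that])
    show "smul (co x 0 + co y 0) (\<beta> 0) + smul (co x 1 + co y 1) (\<beta> 1) + smul (co x 2 + co y 2) (\<beta> 2) = x + y"
      using arg_cong2[of _ _ _ _ "(+)", OF co2[of x] co2[of y]] by (simp only: smul_add ac_simps)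
  qed
  define C where "C i l = co (unit3 l) i" for i l
  define B where "B k i = coef3 k (\<beta> i)" for k i
  have coC: "co v i = coef3 0 v * C i 0 + coef3 1 v * C i 1 + coef3 2 v * C i 2" if "i < 3" for v i
    unfolding C_def by (rule additive_vec3_int[of "\<lambda>v. co v i"]) (rule co_add[OF that])
  have BC: "B k 0 * C 0 l + B k 1 * C 1 l + B k 2 * C 2 l = coef3 k (unit3 l)" for k l
    using arg_cong[OF co2[of "unit3 l"], of "coef3 k"]
    by (simp add: coef3_add coef3_smul B_def C_def mult.commute)
  \<comment> \<open>Spelled out because the trace below, that of a conjugated matrix, is regrouped
    into exactly these nine sums.\<close>
  have BC': "B 0 0 * C 0 0 + B 0 1 * C 1 0 + B 0 2 * C 2 0 = 1" "B 0 0 * C 0 1 + B 0 1 * C 1 1 + B 0 2 * C 2 1 = 0" "B 0 0 * C 0 2 + B 0 1 * C 1 2 + B 0 2 * C 2 2 = 0"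
    "B 1 0 * C 0 0 + B 1 1 * C 1 0 + B 1 2 * C 2 0 = 0" "B 1 0 * C 0 1 + B 1 1 * C 1 1 + B 1 2 * C 2 1 = 1" "B 1 0 * C 0 2 + B 1 1 * C 1 2 + B 1 2 * C 2 2 = 0"
    "B 2 0 * C 0 0 + B 2 1 * C 1 0 + B 2 2 * C 2 0 = 0" "B 2 0 * C 0 1 + B 2 1 * C 1 1 + B 2 2 * C 2 1 = 0" "B 2 0 * C 0 2 + B 2 1 * C 1 2 + B 2 2 * C 2 2 = 1"
    unfolding BC by (simp_all add: coef3_def unit3_def)
  have tr: "ring_trace R 3 b (h y) = ftr f y" for y
  proof -
    define M where "M k l = coef3 l (fmult f y (unit3 k))" for k l
    have e: "coef3 l (fmult f y v) = coef3 0 v * M 0 l + coef3 1 v * M 1 l + coef3 2 v * M 2 l" for v l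
      unfolding M_def by (rule additive_vec3_int) (simp only: fmult_add2 coef3_add)
    have "ring_trace R 3 b (h y) = (\<Sum>i<3. co (fmult f y (\<beta> i)) i)"
      unfolding ring_trace_def co_def by (rule sum.cong) (auto simp: \<beta> hE(3))
    also have "\<dots> = (\<Sum>i<3. (B 0 i * M 0 0 + B 1 i * M 1 0 + B 2 i * M 2 0) * C i 0
       + (B 0 i * M 0 1 + B 1 i * M 1 1 + B 2 i * M 2 1) * C i 1
       + (B 0 i * M 0 2 + B 1 i * M 1 2 + B 2 i * M 2 2) * C i 2)"
      by (rule sum.cong) (simp_all add: coC e B_def)
    also have "\<dots> =
       M 0 0 * (B 0 0 * C 0 0 + B 0 1 * C 1 0 + B 0 2 * C 2 0) + M 0 1 * (B 0 0 * C 0 1 + B 0 1 * C 1 1 + B 0 2 * C 2 1)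
     + M 0 2 * (B 0 0 * C 0 2 + B 0 1 * C 1 2 + B 0 2 * C 2 2) + M 1 0 * (B 1 0 * C 0 0 + B 1 1 * C 1 0 + B 1 2 * C 2 0)
     + M 1 1 * (B 1 0 * C 0 1 + B 1 1 * C 1 1 + B 1 2 * C 2 1) + M 1 2 * (B 1 0 * C 0 2 + B 1 1 * C 1 2 + B 1 2 * C 2 2)
     + M 2 0 * (B 2 0 * C 0 0 + B 2 1 * C 1 0 + B 2 2 * C 2 0) + M 2 1 * (B 2 0 * C 0 1 + B 2 1 * C 1 1 + B 2 2 * C 2 1)
     + M 2 2 * (B 2 0 * C 0 2 + B 2 1 * C 1 2 + B 2 2 * C 2 2)"
      unfolding sum_lessThan_3 by (simp only: algebra_simps)
    also have "\<dots> = M 0 0 + M 1 1 + M 2 2"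
      unfolding BC' by simp
    also have "\<dots> = ftr f y" unfolding M_def by (rule ftr_diag)
    finally show ?thesis .
  qed
  define G where "G k l = ftr f (fmult f (unit3 k) (unit3 l))" for k l
  have T: "ftr f (fmult f x y) = coef3 0 x * (G 0 0 * coef3 0 y + G 0 1 * coef3 1 y + G 0 2 * coef3 2 y)
     + coef3 1 x * (G 1 0 * coef3 0 y + G 1 1 * coef3 1 y + G 1 2 * coef3 2 y)
     + coef3 2 x * (G 2 0 * coef3 0 y + G 2 1 * coef3 1 y + G 2 2 * coef3 2 y)" for x y
  proof -
    have 1: "ftr f (fmult f x y) = coef3 0 x * ftr f (fmult f (unit3 0) y)
        + coef3 1 x * ftr f (fmult f (unit3 1) y) + coef3 2 x * ftr f (fmult f (unit3 2) y)"
      by (rule additive_vec3_int) (simp only: fmult_add ftr_add)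
    have 2: "ftr f (fmult f (unit3 k) y) = coef3 0 y * G k 0 + coef3 1 y * G k 1 + coef3 2 y * G k 2" for k
      unfolding G_def by (rule additive_vec3_int) (simp only: fmult_add2 ftr_add)
    show ?thesis unfolding 1 2 by (simp only: mult.commute)
  qed
  have "ring_disc 3 R = Determinant.det (mat 3 3 (\<lambda>(i, j). ring_trace R 3 b (b i \<otimes>\<^bsub>R\<^esub> b j)))"
    by (simp add: ring_disc_def b_def Let_def)
  also have "mat 3 3 (\<lambda>(i, j). ring_trace R 3 b (b i \<otimes>\<^bsub>R\<^esub> b j)) = mat 3 3 (\<lambda>(i, j). ftr f (fmult f (\<beta> i) (\<beta> j)))"
    by (rule eq_matI) (simp_all add: \<beta> tr flip: hE(3))
  also have "Determinant.det \<dots> = det3 (\<lambda>i j. ftr f (fmult f (\<beta> i) (\<beta> j)))" by (rule det_mat_3)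
  also have "\<dots> = det3 (\<lambda>i k. B k i) * (det3 G * det3 B)"
    by (simp only: T B_def[symmetric] det3_mult[symmetric])
  finally have disc1: "ring_disc 3 R = det3 (\<lambda>i k. B k i) * (det3 G * det3 B)" .
  have "det3 B * det3 C = det3 (\<lambda>k l. coef3 k (unit3 l))" by (simp only: det3_mult[symmetric] BC)
  also have "\<dots> = 1" by (simp add: det3_def coef3_def unit3_def)
  finally have "det3 B * det3 B = 1" using zmult_eq_1_iff by auto
  moreover have "det3 (\<lambda>i k. B k i) = det3 B" unfolding det3_def by (simp add: algebra_simps)
  moreover have "det3 G = disc f"
    by (cases f) (simp add: det3_def G_def unit3_def power2_eq_square power3_eq_cube algebra_simps)
  ultimately show ?thesis using disc1 by (simp add: mult.left_commute mult.commute)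
qed

section \<open>The length form and reduction\<close>

text \<open>Differences of the points of a nondegenerate form: the form is recovered from them as
  \<open>f(x, y) \<delta> = \<Prod>(p\<^sub>i x + q\<^sub>i y)\<close> with \<open>\<delta>\<^sup>2 = Disc f\<close>.\<close>

definition points_of :: "form \<Rightarrow> complex \<times> complex \<Rightarrow> complex \<times> complex \<Rightarrow> complex \<times> complex \<Rightarrow> bool" where
  "points_of f u v t \<longleftrightarrow> pts f = {u, v, t} \<and>
    (let p1 = fst v - fst u; p2 = fst t - fst u; p3 = fst t - fst v;
         q1 = snd v - snd u; q2 = snd t - snd u; q3 = snd t - snd v; \<delta> = p1 * q2 - p2 * q1
     in case f of (a, b, c, d) \<Rightarrow>
       \<delta>\<^sup>2 = of_int (disc f) \<and> of_int a * \<delta> = p1 * p2 * p3 \<and>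
       of_int b * \<delta> = p1 * p2 * q3 + p1 * q2 * p3 + q1 * p2 * p3 \<and>
       of_int c * \<delta> = p1 * q2 * q3 + q1 * p2 * q3 + q1 * q2 * p3 \<and>
       of_int d * \<delta> = q1 * q2 * q3 \<and>
       fst u + fst v + fst t = - of_int b \<and> snd u + snd v + snd t = of_int c \<and>
       p1\<^sup>2 + p2\<^sup>2 + p3\<^sup>2 = 2 * (of_int b ^ 2 - 3 * of_int a * of_int c))"

lemma quadratic_roots:
  fixes e g :: complex obtains r s where "r + s = - e" "r * s = g"
proof
  show "(- e + csqrt (e\<^sup>2 - 4 * g)) / 2 + (- e - csqrt (e\<^sup>2 - 4 * g)) / 2 = - e"
    by (simp add: field_simps)
  show "(- e + csqrt (e\<^sup>2 - 4 * g)) / 2 * ((- e - csqrt (e\<^sup>2 - 4 * g)) / 2) = g"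
    using power2_csqrt[of "e\<^sup>2 - 4 * g"] by (simp add: field_simps power2_eq_square)
qed

lemma cubic_roots:
  fixes b c d :: complex
  obtains r s t where "r + s + t = - b" "r * s + r * t + s * t = c" "r * s * t = - d"
proof -
  have "\<not> constant (poly [:d, c, b, 1:])"
    by (simp add: constant_degree)
  then obtain r where r: "poly [:d, c, b, 1:] r = 0" using fundamental_theorem_of_algebra by blast
  obtain s t where st: "s + t = - (b + r)" "s * t = c + (b + r) * r" using quadratic_roots by blast
  show ?thesis
  proof (rule that[of r s t])
    show "r + s + t = - b" using st(1) by (simp add: algebra_simps)
    have "r * s + r * t + s * t = r * (s + t) + s * t" by (simp add: algebra_simps)
    then show "r * s + r * t + s * t = c" unfolding st by (simp add: algebra_simps)
    have "r * s * t = r * (s * t)" by (simp add: algebra_simps)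
    also have "\<dots> = - d" using r unfolding st by (simp add: algebra_simps add_eq_0_iff)
    finally show "r * s * t = - d" .
  qed
qed

lemma pts_cubic:
  assumes "(z, w) \<in> pts (a, b, c, d)"
  shows "z ^ 3 + of_int b * z\<^sup>2 + of_int (a * c) * z + of_int (a\<^sup>2 * d) = 0"
    and "w ^ 3 - of_int c * w\<^sup>2 + of_int (b * d) * w - of_int (a * d\<^sup>2) = 0"
  using assms unfolding pts_iff power2_eq_square power3_eq_cube of_int_mult by - (Groebner_Basis.algebra)+

text \<open>The value \<open>z\<close> of \<open>\<omega>\<close> is a root of
  \<open>z^3 + b z^2 + a c z + a^2 d\<close>, and the table gives
  \<open>a w = z^2 + b z + a c\<close> for the value \<open>w\<close> of \<open>\<theta>\<close>.
  The identities are first proved after multiplication by a power of \<open>a\<close>, which turns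
  them into polynomial identities in the three roots.\<close>

lemma points_of_nonzero:
  assumes a: "a \<noteq> 0" shows "\<exists>u v t. points_of (a, b, c, d) u v t"
proof -
  define A B C D :: complex where ABCD: "A = of_int a" "B = of_int b" "C = of_int c" "D = of_int d"
  have A: "A \<noteq> 0" using a by (simp add: ABCD)
  obtain r s t where v: "r + s + t = - B" "r * s + r * t + s * t = A * C" "r * s * t = - (A\<^sup>2 * D)"
    using cubic_roots by blast
  define w where "w z = (z\<^sup>2 + B * z + A * C) / A" for z
  have Aw: "A * w z = z\<^sup>2 + B * z + A * C" for z using A by (simp add: w_def)
  have cub: "(z - r) * (z - s) * (z - t) = z ^ 3 + B * z\<^sup>2 + A * C * z + A\<^sup>2 * D" for z
    using v by Groebner_Basis.algebra
  have root: "(z, w z) \<in> pts (a, b, c, d)" if "z ^ 3 + B * z\<^sup>2 + A * C * z + A\<^sup>2 * D = 0" for z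
  proof -
    have "A * (z * w z) = A * - (A * D)" using Aw[of z] that by Groebner_Basis.algebra
    then have 1: "z * w z = - (A * D)" by (rule mult_left_cancel[OF A, THEN iffD1])
    have 2: "z * z = - (A * C) - B * z + A * w z" using Aw[of z] by Groebner_Basis.algebra
    have "A * (w z * w z) = A * (- (B * D) - D * z + C * w z)" using Aw[of z] 1 by Groebner_Basis.algebra
    then have "w z * w z = - (B * D) - D * z + C * w z" by (rule mult_left_cancel[OF A, THEN iffD1])
    with 1 2 show ?thesis by (simp add: pts_iff ABCD)
  qed
  have pts: "pts (a, b, c, d) = {(r, w r), (s, w s), (t, w t)}"
  proof (intro equalityI subsetI)
    fix u assume u: "u \<in> pts (a, b, c, d)"
    obtain z w' where zw: "u = (z, w')" by (cases u)
    have "z ^ 3 + B * z\<^sup>2 + A * C * z + A\<^sup>2 * D = 0"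
      using pts_cubic(1)[OF u[unfolded zw]] by (simp add: ABCD)
    then have z: "z = r \<or> z = s \<or> z = t" unfolding cub[symmetric] by simp
    have "A * w' = A * w z" unfolding Aw using u by (simp add: zw pts_iff ABCD power2_eq_square)
    then have "w' = w z" using A by simp
    with z show "u \<in> {(r, w r), (s, w s), (t, w t)}" by (auto simp: zw)
  next
    have "z = r \<or> z = s \<or> z = t \<Longrightarrow> (z, w z) \<in> pts (a, b, c, d)" for z
      by (rule root) (auto simp flip: cub)
    then show "u \<in> pts (a, b, c, d)" if "u \<in> {(r, w r), (s, w s), (t, w t)}" for u using that by auto
  qed
  \<comment> \<open>The divided difference of \<open>z^2 + b z\<close> at two roots is their sum
    plus \<open>b\<close>, that is, minus the third root.\<close>
  have q: "A * (w s - w r) = - (s - r) * t" "A * (w t - w r) = - (t - r) * s" "A * (w t - w s) = - (t - s) * r"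
    using Aw[of r] Aw[of s] Aw[of t] v(1) by - (Groebner_Basis.algebra)+
  define q1 q2 q3 where qs: "q1 = w s - w r" "q2 = w t - w r" "q3 = w t - w s"
  define p1 p2 p3 where ps: "p1 = s - r" "p2 = t - r" "p3 = t - s"
  define \<delta> where "\<delta> = p1 * q2 - p2 * q1"
  have q': "A * q1 = - p1 * t" "A * q2 = - p2 * s" "A * q3 = - p3 * r" using q by (simp_all add: qs ps)
  have p123: "p1 * p2 * p3 = (s - r) * (t - r) * (t - s)" by (simp add: ps)
  have d1: "A * \<delta> = p1 * p2 * p3" unfolding \<delta>_def using q' ps by Groebner_Basis.algebra
  have "A * (B * \<delta>) = A * (p1 * p2 * q3 + p1 * q2 * p3 + q1 * p2 * p3)"
    using d1 q' v(1) by Groebner_Basis.algebra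
  then have d2: "B * \<delta> = p1 * p2 * q3 + p1 * q2 * p3 + q1 * p2 * p3" by (rule mult_left_cancel[OF A, THEN iffD1])
  have "A\<^sup>2 * (C * \<delta>) = A\<^sup>2 * (p1 * q2 * q3 + q1 * p2 * q3 + q1 * q2 * p3)"
    using d1 q' v(2) by Groebner_Basis.algebra
  then have d3: "C * \<delta> = p1 * q2 * q3 + q1 * p2 * q3 + q1 * q2 * p3" by (rule mult_left_cancel[OF power_not_zero[OF A], THEN iffD1])
  have "A ^ 3 * (D * \<delta>) = A ^ 3 * (q1 * q2 * q3)"
    using d1 q' v(3) by Groebner_Basis.algebra
  then have d4: "D * \<delta> = q1 * q2 * q3" by (rule mult_left_cancel[OF power_not_zero[OF A], THEN iffD1])
  have "(p1 * p2 * p3)\<^sup>2 = (r + s + t)\<^sup>2 * (r * s + r * t + s * t)\<^sup>2 - 4 * (r * s + r * t + s * t) ^ 3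
     - 4 * (r + s + t) ^ 3 * (r * s * t) - 27 * (r * s * t)\<^sup>2 + 18 * (r + s + t) * (r * s + r * t + s * t) * (r * s * t)"
    unfolding p123 by Groebner_Basis.algebra
  then have "A\<^sup>2 * \<delta>\<^sup>2 = A\<^sup>2 * (B\<^sup>2 * C\<^sup>2 - 4 * A * C ^ 3 - 4 * B ^ 3 * D - 27 * A\<^sup>2 * D\<^sup>2 + 18 * A * B * C * D)"
    unfolding v d1[symmetric] by Groebner_Basis.algebra
  then have "\<delta>\<^sup>2 = B\<^sup>2 * C\<^sup>2 - 4 * A * C ^ 3 - 4 * B ^ 3 * D - 27 * A\<^sup>2 * D\<^sup>2 + 18 * A * B * C * D"
    by (rule mult_left_cancel[OF power_not_zero[OF A], THEN iffD1])
  then have d5: "\<delta>\<^sup>2 = of_int (disc (a, b, c, d))" by (simp add: ABCD)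
  have "A * (w r + w s + w t) = A * C"
    using Aw[of r] Aw[of s] Aw[of t] v(1,2) by Groebner_Basis.algebra
  then have d6: "w r + w s + w t = C" by (rule mult_left_cancel[OF A, THEN iffD1])
  have d7: "p1\<^sup>2 + p2\<^sup>2 + p3\<^sup>2 = 2 * (B ^ 2 - 3 * A * C)"
    unfolding ps using v(1,2) by Groebner_Basis.algebra
  have "points_of (a, b, c, d) (r, w r) (s, w s) (t, w t)"
    unfolding points_of_def Let_def fst_conv snd_conv prod.case ps[symmetric] qs[symmetric] \<delta>_def[symmetric]
      ABCD[symmetric]
    using pts d1 d2 d3 d4 d5 d6 d7 v(1) by blast
  then show ?thesis by blast
qed

text \<open>With \<open>a = 0\<close> the product \<open>z w\<close> vanishes: either
  \<open>z = 0\<close> and \<open>w\<close> is a root of \<open>w^2 - c w + b d\<close>, or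
  \<open>w = 0\<close> and \<open>z = - b\<close>.\<close>

lemma points_of_zero:
  assumes b: "b \<noteq> 0" shows "\<exists>u v t. points_of (0, b, c, d) u v t"
proof -
  define B C D :: complex where BCD: "B = of_int b" "C = of_int c" "D = of_int d"
  have B: "B \<noteq> 0" using b by (simp add: BCD)
  obtain r s where rs: "r + s = C" "r * s = B * D" using quadratic_roots[of "- C" "B * D"] by auto
  have pts: "pts (0, b, c, d) = {(0, r), (0, s), (- B, 0)}"
  proof (intro equalityI subsetI)
    fix u assume u: "u \<in> pts (0, b, c, d)"
    obtain z w where zw: "u = (z, w)" by (cases u)
    have e: "z * w = 0" "z * z = - B * z" "w * w = - (B * D) - D * z + C * w"
      using u by (simp_all add: zw pts_iff BCD)
    show "u \<in> {(0, r), (0, s), (- B, 0)}"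
    proof (cases "z = 0")
      case True
      have "(w - r) * (w - s) = w * w - (r + s) * w + r * s" by (simp add: algebra_simps)
      then have "(w - r) * (w - s) = 0" unfolding rs using e(3) True by simp
      then show ?thesis using True by (auto simp: zw)
    next
      case False
      then have "w = 0" "z = - B" using e by (simp_all, metis mult_right_cancel)
      then show ?thesis by (simp add: zw)
    qed
  next
    have "r * r = - (B * D) + C * r" "s * s = - (B * D) + C * s"
      unfolding rs[symmetric] by (simp_all add: algebra_simps)
    then show "u \<in> pts (0, b, c, d)" if "u \<in> {(0, r), (0, s), (- B, 0)}" for u
      using that by (auto simp: pts_iff BCD)
  qed
  have "(B * (s - r))\<^sup>2 = B\<^sup>2 * (C\<^sup>2 - 4 * (B * D))"
    unfolding rs[symmetric] by (simp add: power2_eq_square algebra_simps)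
  then have d: "(B * (s - r))\<^sup>2 = of_int (disc (0, b, c, d))"
    by (simp add: BCD power2_eq_square power3_eq_cube algebra_simps)
  have e1: "C * (B * (s - r)) = (s - r) * B * s + (s - r) * r * B"
    unfolding rs(1)[symmetric] by (simp add: algebra_simps)
  have "(s - r) * r * s = (s - r) * (B * D)" unfolding rs(2)[symmetric] by (simp add: mult.assoc)
  then have e2: "D * (B * (s - r)) = (s - r) * r * s" by (simp add: algebra_simps)
  have "points_of (0, b, c, d) (0, r) (0, s) (- B, 0)"
    unfolding points_of_def Let_def fst_conv snd_conv prod.case BCD[symmetric]
    using pts d e1 e2 rs by (simp add: BCD[symmetric] algebra_simps power2_eq_square)
  then show ?thesis by blast
qed

lemma points_of_exists:
  assumes "disc f \<noteq> 0" shows "\<exists>u v t. points_of f u v t"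
proof -
  obtain a b c d where f: "f = (a, b, c, d)" by (metis prod_cases4)
  have "a \<noteq> 0 \<or> b \<noteq> 0" using assms by (auto simp: f)
  then show ?thesis using points_of_nonzero points_of_zero unfolding f by metis
qed

text \<open>Up to a constant the squared length of the projection orthogonal to \<open>1\<close>:
  differences of conjugates do not change when an integer is added, so this is a form on the
  quotient by the integers. The division by 2 counts each unordered pair once.\<close>

definition qf :: "form \<Rightarrow> int \<Rightarrow> int \<Rightarrow> real" where
  "qf f x y = (\<Sum>u\<in>pts f. \<Sum>v\<in>pts f. (cmod (ev u (0, x, y) - ev v (0, x, y)))\<^sup>2) / 2"

lemma bij_cnj_pts: "bij_betw (\<lambda>u. (cnj (fst u), cnj (snd u))) (pts f) (pts f)"
proof -
  have ev: "ev (cnj (fst u), cnj (snd u)) x = cnj (ev u x)" for u x by (simp add: ev_def)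
  have "(cnj (fst u), cnj (snd u)) \<in> pts f" if "u \<in> pts f" for u
    unfolding pts_def mem_Collect_eq ev using ev_fmult[OF that] by simp
  then show ?thesis by (intro bij_betw_byWitness[where f' = "\<lambda>u. (cnj (fst u), cnj (snd u))"]) auto
qed

text \<open>Complex conjugation permutes the points, so the hermitian pairing of the two coordinate
  vectors is real. The middle coefficient of \<open>qf\<close> is thus twice the whole pairing and
  not only its real part, as the Gram determinant requires.\<close>

lemma pairing_real:
  "cnj (\<Sum>u\<in>pts f. \<Sum>v\<in>pts f. (fst u - fst v) * cnj (snd u - snd v)) =
     (\<Sum>u\<in>pts f. \<Sum>v\<in>pts f. cnj (fst u - fst v) * (snd u - snd v))"
  "(\<Sum>u\<in>pts f. \<Sum>v\<in>pts f. cnj (fst u - fst v) * (snd u - snd v)) =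
     (\<Sum>u\<in>pts f. \<Sum>v\<in>pts f. (fst u - fst v) * cnj (snd u - snd v))"
proof -
  let ?g = "\<lambda>u v. (fst u - fst v) * cnj (snd u - snd v)"
  let ?k = "\<lambda>u :: complex \<times> complex. (cnj (fst u), cnj (snd u))"
  show "cnj (\<Sum>u\<in>pts f. \<Sum>v\<in>pts f. ?g u v) =
     (\<Sum>u\<in>pts f. \<Sum>v\<in>pts f. cnj (fst u - fst v) * (snd u - snd v))"
    by simp
  have "(\<Sum>u\<in>pts f. \<Sum>v\<in>pts f. ?g u v) = (\<Sum>u\<in>pts f. \<Sum>v\<in>pts f. ?g (?k u) v)"
    by (rule sum.reindex_bij_betw[OF bij_cnj_pts, symmetric])
  also have "\<dots> = (\<Sum>u\<in>pts f. \<Sum>v\<in>pts f. ?g (?k u) (?k v))"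
    by (rule sum.cong[OF refl], rule sum.reindex_bij_betw[OF bij_cnj_pts, symmetric])
  finally show "(\<Sum>u\<in>pts f. \<Sum>v\<in>pts f. cnj (fst u - fst v) * (snd u - snd v)) = (\<Sum>u\<in>pts f. \<Sum>v\<in>pts f. ?g u v)"
    by simp
qed

lemma form_points:
  assumes "disc f \<noteq> 0"
  obtains u v t where "points_of f u v t" "pts f = {u, v, t}" "u \<noteq> v" "u \<noteq> t" "v \<noteq> t"
    "\<And>x y. qf f x y = (cmod (of_int x * (fst v - fst u) + of_int y * (snd v - snd u)))\<^sup>2
       + (cmod (of_int x * (fst t - fst u) + of_int y * (snd t - snd u)))\<^sup>2
       + (cmod (of_int x * (fst t - fst v) + of_int y * (snd t - snd v)))\<^sup>2"
proof -
  obtain u v t where p: "points_of f u v t" using points_of_exists[OF assms] by blast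
  then have pts: "pts f = {u, v, t}" by (simp add: points_of_def)
  have "((fst v - fst u) * (snd t - snd u) - (fst t - fst u) * (snd v - snd u))\<^sup>2 = of_int (disc f)"
    using p by (cases f) (simp add: points_of_def Let_def)
  then have nz: "(fst v - fst u) * (snd t - snd u) - (fst t - fst u) * (snd v - snd u) \<noteq> 0"
    using assms by auto
  have ne: "u \<noteq> v" "u \<noteq> t" "v \<noteq> t" using nz by auto
  have swap: "cmod (ev r x - ev s x) = cmod (ev s x - ev r x)" for r s x by (rule norm_minus_commute)
  have "qf f x y = (cmod (ev v (0,x,y) - ev u (0,x,y)))\<^sup>2 + (cmod (ev t (0,x,y) - ev u (0,x,y)))\<^sup>2
     + (cmod (ev t (0,x,y) - ev v (0,x,y)))\<^sup>2" for x y
    unfolding qf_def pts using ne swap[of u _ v] swap[of u _ t] swap[of v _ t] by simp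
  moreover have "ev r (0,x,y) - ev s (0,x,y) = of_int x * (fst r - fst s) + of_int y * (snd r - snd s)" for r s x y
    by (simp add: ev_def algebra_simps)
  ultimately show ?thesis using that p pts ne by simp
qed

lemma form_differences:
  assumes "disc (a, b, c, d) \<noteq> 0"
  obtains p1 p2 p3 q1 q2 q3 \<delta> :: complex where
    "p3 = p2 - p1" "q3 = q2 - q1" "\<delta> = p1 * q2 - p2 * q1" "(cmod \<delta>)\<^sup>2 = \<bar>of_int (disc (a, b, c, d))\<bar>"
    "of_int a * \<delta> = p1 * p2 * p3" "of_int b * \<delta> = p1 * p2 * q3 + p1 * q2 * p3 + q1 * p2 * p3"
    "of_int c * \<delta> = p1 * q2 * q3 + q1 * p2 * q3 + q1 * q2 * p3" "of_int d * \<delta> = q1 * q2 * q3"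
    "p1\<^sup>2 + p2\<^sup>2 + p3\<^sup>2 = 2 * (of_int b ^ 2 - 3 * of_int a * of_int c)"
    "\<And>x y. qf (a, b, c, d) x y = (cmod (of_int x * p1 + of_int y * q1))\<^sup>2
       + (cmod (of_int x * p2 + of_int y * q2))\<^sup>2 + (cmod (of_int x * p3 + of_int y * q3))\<^sup>2"
    "cnj (p1 * cnj q1 + p2 * cnj q2 + p3 * cnj q3) = p1 * cnj q1 + p2 * cnj q2 + p3 * cnj q3"
proof -
  let ?f = "(a, b, c, d)"
  obtain u v t where p: "points_of (a, b, c, d) u v t" and pts: "pts (a, b, c, d) = {u, v, t}" and ne: "u \<noteq> v" "u \<noteq> t" "v \<noteq> t"
    and qf: "\<And>x y. qf (a, b, c, d) x y = (cmod (of_int x * (fst v - fst u) + of_int y * (snd v - snd u)))\<^sup>2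
       + (cmod (of_int x * (fst t - fst u) + of_int y * (snd t - snd u)))\<^sup>2
       + (cmod (of_int x * (fst t - fst v) + of_int y * (snd t - snd v)))\<^sup>2"
    by (rule form_points[OF assms]) (rule that; assumption)
  define p1 p2 p3 q1 q2 q3 \<delta> where d: "p1 = fst v - fst u" "p2 = fst t - fst u" "p3 = fst t - fst v"
     "q1 = snd v - snd u" "q2 = snd t - snd u" "q3 = snd t - snd v" "\<delta> = p1 * q2 - p2 * q1"
  note P = p[unfolded points_of_def Let_def prod.case, folded d]
  have "\<delta>\<^sup>2 = of_int (disc ?f)" unfolding d(7) using P by blast
  then have "(cmod \<delta>)\<^sup>2 = cmod (of_int (disc ?f))" by (simp only: norm_power[symmetric])
  also have "\<dots> = \<bar>of_int (disc ?f)\<bar>" by (rule norm_of_int)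
  finally have \<delta>: "(cmod \<delta>)\<^sup>2 = \<bar>of_int (disc ?f)\<bar>" .
  have "(\<Sum>u\<in>pts ?f. \<Sum>v\<in>pts ?f. (fst u - fst v) * cnj (snd u - snd v)) = 2 * (p1 * cnj q1 + p2 * cnj q2 + p3 * cnj q3)"
    unfolding pts d using ne by (simp add: algebra_simps)
  then have "cnj (2 * (p1 * cnj q1 + p2 * cnj q2 + p3 * cnj q3)) = 2 * (p1 * cnj q1 + p2 * cnj q2 + p3 * cnj q3)"
    using pairing_real[of ?f] by simp
  then have cn: "cnj (p1 * cnj q1 + p2 * cnj q2 + p3 * cnj q3) = p1 * cnj q1 + p2 * cnj q2 + p3 * cnj q3"
    unfolding complex_cnj_mult complex_cnj_numeral by (rule mult_left_cancel[THEN iffD1, rotated]) simp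
  have "p3 = p2 - p1" "q3 = q2 - q1" by (simp_all add: d)
  then show ?thesis
    by (rule that[of p3 p2 p1 q3 q2 q1 \<delta>])
       (use P \<delta> cn qf d in \<open>simp_all del: complex_cnj_add complex_cnj_mult\<close>)
qed

definition qP :: "form \<Rightarrow> real" where "qP f = qf f 1 0"
definition qR :: "form \<Rightarrow> real" where "qR f = qf f 0 1"
definition qB :: "form \<Rightarrow> real" where "qB f = qf f 1 1 - qP f - qR f"

lemma norm_sq_expand:
  "(cmod (of_real x * p + of_real y * q))\<^sup>2 = x\<^sup>2 * (cmod p)\<^sup>2 + 2 * x * y * Re (p * cnj q) + y\<^sup>2 * (cmod q)\<^sup>2"
  unfolding cmod_power2 by (simp add: power2_eq_square algebra_simps)

text \<open>Lagrange's identity: because \<open>p3 = p2 - p1\<close> and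
  \<open>q3 = q2 - q1\<close>, all three minors of the two vectors equal \<open>\<delta>\<close>, so
  the Gram determinant is \<open>3 |\<delta>|^2\<close>, and \<open>\<delta>^2\<close> is the
  discriminant.\<close>

lemma qf_expand_gram:
  assumes "disc f \<noteq> 0"
  shows "qf f x y = qP f * (real_of_int x)\<^sup>2 + qB f * (of_int x * of_int y) + qR f * (of_int y)\<^sup>2"
    and "4 * qP f * qR f - (qB f)\<^sup>2 = 12 * \<bar>of_int (disc f)\<bar>"
proof -
  obtain a b c d where f: "f = (a, b, c, d)" by (metis prod_cases4)
  note assms' = assms[unfolded f]
  obtain p1 p2 p3 q1 q2 q3 \<delta> :: complex where p: "p3 = p2 - p1" "q3 = q2 - q1" "\<delta> = p1 * q2 - p2 * q1"
    and \<delta>: "(cmod \<delta>)\<^sup>2 = \<bar>of_int (disc (a, b, c, d))\<bar>" and a: "of_int a * \<delta> = p1 * p2 * p3"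
    and b: "of_int b * \<delta> = p1 * p2 * q3 + p1 * q2 * p3 + q1 * p2 * p3"
    and c: "of_int c * \<delta> = p1 * q2 * q3 + q1 * p2 * q3 + q1 * q2 * p3" and d: "of_int d * \<delta> = q1 * q2 * q3"
    and s: "p1\<^sup>2 + p2\<^sup>2 + p3\<^sup>2 = 2 * (of_int b ^ 2 - 3 * of_int a * of_int c)"
    and qf: "\<And>x y. qf (a, b, c, d) x y = (cmod (of_int x * p1 + of_int y * q1))\<^sup>2
       + (cmod (of_int x * p2 + of_int y * q2))\<^sup>2 + (cmod (of_int x * p3 + of_int y * q3))\<^sup>2"
    and cn: "cnj (p1 * cnj q1 + p2 * cnj q2 + p3 * cnj q3) = p1 * cnj q1 + p2 * cnj q2 + p3 * cnj q3"
    by (rule form_differences[OF assms']) (rule that; assumption)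
  note \<delta> = \<delta>[folded f] and qf = qf[folded f]
  define P where "P = (cmod p1)\<^sup>2 + (cmod p2)\<^sup>2 + (cmod p3)\<^sup>2"
  define R where "R = (cmod q1)\<^sup>2 + (cmod q2)\<^sup>2 + (cmod q3)\<^sup>2"
  define S where "S = Re (p1 * cnj q1) + Re (p2 * cnj q2) + Re (p3 * cnj q3)"
  have e: "qf f x y = P * (real_of_int x)\<^sup>2 + 2 * S * (of_int x * of_int y) + R * (of_int y)\<^sup>2" for x y
    unfolding qf P_def R_def S_def using norm_sq_expand[of "of_int x" _ "of_int y"]
    by (simp add: algebra_simps)
  have qs: "qP f = P" "qR f = R" "qB f = 2 * S" by (simp_all add: qP_def qR_def qB_def e)
  show "qf f x y = qP f * (real_of_int x)\<^sup>2 + qB f * (of_int x * of_int y) + qR f * (of_int y)\<^sup>2"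
    unfolding qs by (rule e)
  have cS: "complex_of_real S = p1 * cnj q1 + p2 * cnj q2 + p3 * cnj q3"
  proof -
    have "p1 * cnj q1 + p2 * cnj q2 + p3 * cnj q3 \<in> \<real>" using cn by (simp only: Reals_cnj_iff)
    then have "complex_of_real (Re (p1 * cnj q1 + p2 * cnj q2 + p3 * cnj q3)) = p1 * cnj q1 + p2 * cnj q2 + p3 * cnj q3"
      by (rule of_real_Re)
    then show ?thesis by (simp only: S_def plus_complex.sel)
  qed
  then have cS': "complex_of_real S = cnj p1 * q1 + cnj p2 * q2 + cnj p3 * q3"
    using cn by simp
  have "complex_of_real (P * R - S\<^sup>2) = (p1 * cnj p1 + p2 * cnj p2 + p3 * cnj p3) * (q1 * cnj q1 + q2 * cnj q2 + q3 * cnj q3)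
      - complex_of_real S * complex_of_real S"
    by (simp only: P_def R_def of_real_diff of_real_mult of_real_add complex_norm_square power2_eq_square[of S])
  also have "\<dots> = (p1 * cnj p1 + p2 * cnj p2 + p3 * cnj p3) * (q1 * cnj q1 + q2 * cnj q2 + q3 * cnj q3)
      - (p1 * cnj q1 + p2 * cnj q2 + p3 * cnj q3) * (cnj p1 * q1 + cnj p2 * q2 + cnj p3 * q3)"
    using cS cS' by metis
  also have "\<dots> = 3 * (\<delta> * cnj \<delta>)" unfolding p by (simp add: algebra_simps)
  also have "\<dots> = complex_of_real (3 * (cmod \<delta>)\<^sup>2)" by (simp only: of_real_mult complex_norm_square of_real_numeral)
  finally have "P * R - S\<^sup>2 = 3 * (cmod \<delta>)\<^sup>2" by (simp only: of_real_eq_iff)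
  then show "4 * qP f * qR f - (qB f)\<^sup>2 = 12 * \<bar>of_int (disc f)\<bar>"
    unfolding qs \<delta> by (simp add: power2_eq_square)
qed

text \<open>Integrality: \<open>\<Sum>(z\<^sub>i - z\<^sub>j)\<^sup>2 = 2 (b\<^sup>2 - 3 a c)\<close> and \<open>\<Prod>(z\<^sub>i - z\<^sub>j)\<^sup>2 = a\<^sup>2 Disc f\<close> cannot both vanish.\<close>

lemma qP_ge_1:
  assumes "disc f \<noteq> 0" shows "qP f \<ge> 1"
proof (rule ccontr)
  assume "\<not> qP f \<ge> 1"
  then have P: "qP f < 1" by simp
  obtain a b c d where f: "f = (a, b, c, d)" by (metis prod_cases4)
  note assms' = assms[unfolded f]
  obtain p1 p2 p3 q1 q2 q3 \<delta> :: complex where p: "p3 = p2 - p1" "q3 = q2 - q1" "\<delta> = p1 * q2 - p2 * q1"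
    and \<delta>: "(cmod \<delta>)\<^sup>2 = \<bar>of_int (disc (a, b, c, d))\<bar>" and a: "of_int a * \<delta> = p1 * p2 * p3"
    and b: "of_int b * \<delta> = p1 * p2 * q3 + p1 * q2 * p3 + q1 * p2 * p3"
    and c: "of_int c * \<delta> = p1 * q2 * q3 + q1 * p2 * q3 + q1 * q2 * p3" and d: "of_int d * \<delta> = q1 * q2 * q3"
    and s: "p1\<^sup>2 + p2\<^sup>2 + p3\<^sup>2 = 2 * (of_int b ^ 2 - 3 * of_int a * of_int c)"
    and qf: "\<And>x y. qf (a, b, c, d) x y = (cmod (of_int x * p1 + of_int y * q1))\<^sup>2
       + (cmod (of_int x * p2 + of_int y * q2))\<^sup>2 + (cmod (of_int x * p3 + of_int y * q3))\<^sup>2"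
    and cn: "cnj (p1 * cnj q1 + p2 * cnj q2 + p3 * cnj q3) = p1 * cnj q1 + p2 * cnj q2 + p3 * cnj q3"
    by (rule form_differences[OF assms']) (rule that; assumption)
  note \<delta> = \<delta>[folded f] and qf = qf[folded f]
  have P': "(cmod p1)\<^sup>2 + (cmod p2)\<^sup>2 + (cmod p3)\<^sup>2 < 1" using P by (simp add: qP_def qf)
  have le: "cmod p1 < 1" "cmod p2 < 1" "cmod p3 < 1"
  proof -
    have "(cmod p1)\<^sup>2 < 1\<^sup>2" "(cmod p2)\<^sup>2 < 1\<^sup>2" "(cmod p3)\<^sup>2 < 1\<^sup>2"
      using P' zero_le_power2[of "cmod p1"] zero_le_power2[of "cmod p2"] zero_le_power2[of "cmod p3"]
      unfolding one_power2 by linarith+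
    then show "cmod p1 < 1" "cmod p2 < 1" "cmod p3 < 1" by (simp_all add: power_less_imp_less_base)
  qed
  have "cmod (of_int (2 * (b\<^sup>2 - 3 * a * c))) = cmod (p1\<^sup>2 + p2\<^sup>2 + p3\<^sup>2)" by (simp add: s)
  also have "\<dots> \<le> (cmod p1)\<^sup>2 + (cmod p2)\<^sup>2 + (cmod p3)\<^sup>2"
    by (intro norm_triangle_le add_mono) (simp_all add: norm_power)
  finally have "\<bar>real_of_int (2 * (b\<^sup>2 - 3 * a * c))\<bar> < 1" using P' unfolding norm_of_int by linarith
  then have "\<bar>2 * (b\<^sup>2 - 3 * a * c)\<bar> < 1" unfolding of_int_abs[symmetric] of_int_less_1_iff .
  moreover have "k = 0" if "\<bar>2 * k\<bar> < 1" for k :: int using that by linarith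
  ultimately have "b\<^sup>2 - 3 * a * c = 0" by blast
  then have bac: "b\<^sup>2 = 3 * a * c" by simp
  have "cmod (p1 * p2 * p3) < 1"
    unfolding norm_mult using mult_strict_mono[OF mult_strict_mono[OF le(1,2)] le(3)] le
    by (smt (verit) mult_le_one norm_ge_zero mult_less_cancel_left2)
  then have "\<bar>real_of_int a\<bar> * cmod \<delta> < 1" unfolding a[symmetric] norm_mult norm_of_int .
  moreover have "cmod \<delta> \<ge> 1"
  proof -
    have "\<bar>real_of_int (disc f)\<bar> \<ge> 1" using assms by linarith
    then have "(cmod \<delta>)\<^sup>2 \<ge> 1\<^sup>2" using \<delta> by simp
    then show ?thesis by (rule power2_le_imp_le) simp
  qed
  moreover have "1 * 1 \<le> \<bar>real_of_int a\<bar> * cmod \<delta>" if "a \<noteq> 0"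
    using that \<open>cmod \<delta> \<ge> 1\<close> by (intro mult_mono) linarith+
  ultimately have "a = 0" by fastforce
  then show False using bac assms by (simp add: f)
qed

text \<open>Each coefficient times \<open>\<delta>\<close> is a sum of products of three
  differences, those of the first coordinates being at most \<open>s\<close> and those of the second
  at most \<open>t\<close>.\<close>

lemma coeff_bound:
  assumes "disc (a, b, c, d) \<noteq> 0" and s: "s \<ge> 0" "qP (a, b, c, d) \<le> s\<^sup>2" and t: "t \<ge> 0" "qR (a, b, c, d) \<le> t\<^sup>2"
  defines "D \<equiv> sqrt \<bar>of_int (disc (a, b, c, d))\<bar>"
  shows "\<bar>of_int a\<bar> * D \<le> s ^ 3" "\<bar>of_int b\<bar> * D \<le> 3 * s\<^sup>2 * t"
    "\<bar>of_int c\<bar> * D \<le> 3 * s * t\<^sup>2" "\<bar>of_int d\<bar> * D \<le> t ^ 3"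
proof -
  let ?f = "(a, b, c, d)"
  obtain p1 p2 p3 q1 q2 q3 \<delta> :: complex where p: "p3 = p2 - p1" "q3 = q2 - q1" "\<delta> = p1 * q2 - p2 * q1"
    and \<delta>: "(cmod \<delta>)\<^sup>2 = \<bar>of_int (disc (a, b, c, d))\<bar>" and a: "of_int a * \<delta> = p1 * p2 * p3"
    and b: "of_int b * \<delta> = p1 * p2 * q3 + p1 * q2 * p3 + q1 * p2 * p3"
    and c: "of_int c * \<delta> = p1 * q2 * q3 + q1 * p2 * q3 + q1 * q2 * p3" and d: "of_int d * \<delta> = q1 * q2 * q3"
    and s': "p1\<^sup>2 + p2\<^sup>2 + p3\<^sup>2 = 2 * (of_int b ^ 2 - 3 * of_int a * of_int c)"
    and qf: "\<And>x y. qf (a, b, c, d) x y = (cmod (of_int x * p1 + of_int y * q1))\<^sup>2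
       + (cmod (of_int x * p2 + of_int y * q2))\<^sup>2 + (cmod (of_int x * p3 + of_int y * q3))\<^sup>2"
    and cn: "cnj (p1 * cnj q1 + p2 * cnj q2 + p3 * cnj q3) = p1 * cnj q1 + p2 * cnj q2 + p3 * cnj q3"
    by (rule form_differences[OF assms(1)]) (rule that; assumption)
  have D: "D = cmod \<delta>" unfolding D_def \<delta>[symmetric] by simp
  have ple: "cmod p1 \<le> s" "cmod p2 \<le> s" "cmod p3 \<le> s"
  proof -
    have "(cmod p1)\<^sup>2 + (cmod p2)\<^sup>2 + (cmod p3)\<^sup>2 \<le> s\<^sup>2" using s(2) by (simp add: qP_def qf)
    then have "(cmod p1)\<^sup>2 \<le> s\<^sup>2" "(cmod p2)\<^sup>2 \<le> s\<^sup>2" "(cmod p3)\<^sup>2 \<le> s\<^sup>2"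
      using zero_le_power2[of "cmod p1"] zero_le_power2[of "cmod p2"] zero_le_power2[of "cmod p3"] by linarith+
    then show "cmod p1 \<le> s" "cmod p2 \<le> s" "cmod p3 \<le> s" using s(1) by (blast intro: power2_le_imp_le)+
  qed
  have qle: "cmod q1 \<le> t" "cmod q2 \<le> t" "cmod q3 \<le> t"
  proof -
    have "(cmod q1)\<^sup>2 + (cmod q2)\<^sup>2 + (cmod q3)\<^sup>2 \<le> t\<^sup>2" using t(2) by (simp add: qR_def qf)
    then have "(cmod q1)\<^sup>2 \<le> t\<^sup>2" "(cmod q2)\<^sup>2 \<le> t\<^sup>2" "(cmod q3)\<^sup>2 \<le> t\<^sup>2"
      using zero_le_power2[of "cmod q1"] zero_le_power2[of "cmod q2"] zero_le_power2[of "cmod q3"] by linarith+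
    then show "cmod q1 \<le> t" "cmod q2 \<le> t" "cmod q3 \<le> t" using t(1) by (blast intro: power2_le_imp_le)+
  qed
  have m: "cmod (x * y * z) \<le> X * Y * Z" if "cmod x \<le> X" "cmod y \<le> Y" "cmod z \<le> Z" for x y z X Y Z
    unfolding norm_mult using that
    by (intro mult_mono mult_nonneg_nonneg) (auto intro: order_trans[OF norm_ge_zero])
  have "\<bar>of_int a\<bar> * D = cmod (p1 * p2 * p3)" unfolding D a[symmetric] norm_mult norm_of_int ..
  then show "\<bar>of_int a\<bar> * D \<le> s ^ 3" using m[OF ple] by (simp add: power3_eq_cube)
  have "\<bar>of_int d\<bar> * D = cmod (q1 * q2 * q3)" unfolding D d[symmetric] norm_mult norm_of_int ..
  then show "\<bar>of_int d\<bar> * D \<le> t ^ 3" using m[OF qle] by (simp add: power3_eq_cube)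
  have "\<bar>of_int b\<bar> * D = cmod (p1 * p2 * q3 + p1 * q2 * p3 + q1 * p2 * p3)"
    unfolding D b[symmetric] norm_mult norm_of_int ..
  also have "\<dots> \<le> s * s * t + s * t * s + t * s * s"
    by (intro norm_triangle_le add_mono m ple qle)
  finally show "\<bar>of_int b\<bar> * D \<le> 3 * s\<^sup>2 * t" by (simp add: power2_eq_square algebra_simps)
  have "\<bar>of_int c\<bar> * D = cmod (p1 * q2 * q3 + q1 * p2 * q3 + q1 * q2 * p3)"
    unfolding D c[symmetric] norm_mult norm_of_int ..
  also have "\<dots> \<le> s * t * t + t * s * t + t * t * s"
    by (intro norm_triangle_le add_mono m ple qle)
  finally show "\<bar>of_int c\<bar> * D \<le> 3 * s * t\<^sup>2" by (simp add: power2_eq_square algebra_simps)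
qed

text \<open>\<open>|x - y|^2 \<le> 2 |x|^2 + 2 |y|^2\<close>, and each conjugate enters two of the
  three pairs. This gives 4 times the sum of squares, that is, 12 times the mean.\<close>

lemma flen_lower:
  assumes "disc f \<noteq> 0" shows "qf f x1 x2 \<le> 12 * (flen f (x0, x1, x2))\<^sup>2"
proof -
  obtain u v t where p: "points_of f u v t" and pts: "pts f = {u, v, t}" and ne: "u \<noteq> v" "u \<noteq> t" "v \<noteq> t"
    and qf: "\<And>x y. qf f x y = (cmod (of_int x * (fst v - fst u) + of_int y * (snd v - snd u)))\<^sup>2
       + (cmod (of_int x * (fst t - fst u) + of_int y * (snd t - snd u)))\<^sup>2
       + (cmod (of_int x * (fst t - fst v) + of_int y * (snd t - snd v)))\<^sup>2"
    by (rule form_points[OF assms]) (rule that; assumption)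
  let ?e = "\<lambda>u. ev u (x0, x1, x2)"
  have d: "of_int x1 * (fst r - fst s) + of_int x2 * (snd r - snd s) = ?e r - ?e s" for r s
    by (simp add: ev_def algebra_simps)
  have sq: "(cmod (x - y))\<^sup>2 \<le> 2 * (cmod x)\<^sup>2 + 2 * (cmod y)\<^sup>2" for x y
  proof -
    have "(cmod (x - y))\<^sup>2 \<le> (cmod x + cmod y)\<^sup>2" by (intro power_mono norm_triangle_ineq4) simp
    also have "\<dots> \<le> 2 * (cmod x)\<^sup>2 + 2 * (cmod y)\<^sup>2"
      using zero_le_power2[of "cmod x - cmod y"] by (simp add: power2_eq_square algebra_simps)
    finally show ?thesis .
  qed
  have "(flen f (x0, x1, x2))\<^sup>2 = 1 / 3 * ((cmod (?e u))\<^sup>2 + (cmod (?e v))\<^sup>2 + (cmod (?e t))\<^sup>2)"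
    unfolding flen_def pts using ne by (subst real_sqrt_pow2) (auto intro!: sum_nonneg)
  then show ?thesis
    unfolding qf d using add_mono[OF add_mono[OF sq[of "?e v" "?e u"] sq[of "?e t" "?e u"]] sq[of "?e t" "?e v"]]
    by (simp add: algebra_simps)
qed

text \<open>The integer \<open>x0\<close> is chosen to bring the mean of the conjugates to at most
  \<open>1/2\<close> in absolute value; the deviation of a conjugate from the mean is a third of the
  sum of two differences, each at most \<open>sqrt (qf f x1 x2)\<close>.\<close>

lemma flen_upper:
  assumes "disc f \<noteq> 0" shows "\<exists>x0. flen f (x0, x1, x2) \<le> 1 / 2 + sqrt (qf f x1 x2)"
proof -
  obtain a b c d where f: "f = (a, b, c, d)" by (metis prod_cases4)
  obtain u v t where p: "points_of f u v t" and pts: "pts f = {u, v, t}" and ne: "u \<noteq> v" "u \<noteq> t" "v \<noteq> t"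
    and qf: "\<And>x y. qf f x y = (cmod (of_int x * (fst v - fst u) + of_int y * (snd v - snd u)))\<^sup>2
       + (cmod (of_int x * (fst t - fst u) + of_int y * (snd t - snd u)))\<^sup>2
       + (cmod (of_int x * (fst t - fst v) + of_int y * (snd t - snd v)))\<^sup>2"
    by (rule form_points[OF assms]) (rule that; assumption)
  define Q where "Q = sqrt (qf f x1 x2)"
  let ?y = "\<lambda>u. ev u (0, x1, x2)"
  have d: "of_int x1 * (fst r - fst s) + of_int x2 * (snd r - snd s) = ?y r - ?y s" for r s
    by (simp add: ev_def algebra_simps)
  have dQ: "cmod (?y v - ?y u) \<le> Q" "cmod (?y t - ?y u) \<le> Q" "cmod (?y t - ?y v) \<le> Q"
    unfolding Q_def by (rule real_le_rsqrt, simp add: qf d)+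
  then have dQ': "cmod (?y u - ?y v) \<le> Q" "cmod (?y u - ?y t) \<le> Q" "cmod (?y v - ?y t) \<le> Q"
    by (simp_all add: norm_minus_commute)
  define m :: real where "m = of_int (c * x2 - b * x1) / 3"
  have "fst u + fst v + fst t = - of_int b \<and> snd u + snd v + snd t = of_int c"
    using p by (simp add: points_of_def f Let_def)
  moreover have "?y u + ?y v + ?y t = of_int x1 * (fst u + fst v + fst t) + of_int x2 * (snd u + snd v + snd t)"
    by (simp add: ev_def algebra_simps)
  ultimately have sum: "?y u + ?y v + ?y t = 3 * complex_of_real m" by (simp add: m_def)
  define x0 where "x0 = - round m"
  have x0: "cmod (of_int x0 + complex_of_real m) \<le> 1 / 2"
  proof -
    have "of_int x0 + complex_of_real m = complex_of_real (- (of_int (round m) - m))" by (simp add: x0_def)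
    then have "cmod (of_int x0 + complex_of_real m) = \<bar>of_int (round m) - m\<bar>"
      by (simp only: norm_of_real abs_minus_cancel)
    then show ?thesis using of_int_round_abs_le[of m] by simp
  qed
  have key: "cmod (ev r (x0, x1, x2)) \<le> 1 / 2 + Q"
    if "cmod (?y r - ?y s) \<le> Q" "cmod (?y r - ?y s') \<le> Q" "?y r + ?y s + ?y s' = 3 * complex_of_real m" for r s s'
  proof -
    have "ev r (x0, x1, x2) = of_int x0 + ?y r" by (simp add: ev_def)
    also have "\<dots> = (of_int x0 + complex_of_real m) + ((?y r - ?y s) + (?y r - ?y s')) / 3"
      using that(3) by (simp add: field_simps)
    finally have "cmod (ev r (x0, x1, x2)) \<le> cmod (of_int x0 + complex_of_real m) + cmod (((?y r - ?y s) + (?y r - ?y s')) / 3)"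
      by (simp only: norm_triangle_ineq)
    moreover have "cmod (((?y r - ?y s) + (?y r - ?y s')) / 3) \<le> (Q + Q) / 3"
      unfolding norm_divide using norm_triangle_le[OF add_mono[OF that(1,2)]] by simp
    moreover have "Q \<ge> 0" using norm_ge_zero that(1) by (rule order_trans)
    moreover have "e \<le> 1 / 2 + Q" if "e \<le> g + h" "h \<le> (Q + Q) / 3" "0 \<le> Q" "g \<le> 1 / 2" for e g h :: real
      using that by argo
    ultimately show ?thesis using x0 by blast
  qed
  have e: "cmod (ev u (x0,x1,x2)) \<le> 1 / 2 + Q" "cmod (ev v (x0,x1,x2)) \<le> 1 / 2 + Q" "cmod (ev t (x0,x1,x2)) \<le> 1 / 2 + Q"
    using key[of u v t] key[of v u t] key[of t u v] dQ dQ' sum by (simp_all add: ac_simps)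
  have Q0: "0 \<le> Q" using norm_ge_zero dQ(1) by (rule order_trans)
  have "(cmod (ev r (x0,x1,x2)))\<^sup>2 \<le> (1 / 2 + Q)\<^sup>2" if "cmod (ev r (x0,x1,x2)) \<le> 1 / 2 + Q" for r
    using that by (rule power_mono) simp
  then have "1 / 3 * (\<Sum>u\<in>pts f. (cmod (ev u (x0,x1,x2)))\<^sup>2) \<le> (1 / 2 + Q)\<^sup>2"
    unfolding pts using ne e by simp (smt (verit))
  then have "flen f (x0, x1, x2) \<le> 1 / 2 + Q"
    unfolding flen_def using Q0 by (intro real_le_lsqrt) (auto intro!: sum_nonneg)
  then show ?thesis unfolding Q_def by blast
qed

section \<open>Equivalence and reduction of forms\<close>

definition form_equiv :: "form \<Rightarrow> form \<Rightarrow> bool" where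
  "form_equiv f g \<longleftrightarrow> form_ring f \<simeq> form_ring g"

lemma form_equiv_refl: "form_equiv f f"
  by (simp add: form_equiv_def ring_iso_refl)

lemma form_equiv_sym: "form_equiv f g \<Longrightarrow> form_equiv g f"
  unfolding form_equiv_def by (rule ring_iso_sym[OF cring.axioms(1)[OF cring_form_ring]])

lemma form_equiv_trans: "form_equiv f g \<Longrightarrow> form_equiv g k \<Longrightarrow> form_equiv f k"
  unfolding form_equiv_def by (rule ring_iso_trans)

lemma form_equiv_disc:
  assumes "form_equiv f g" shows "disc f = disc g"
proof -
  obtain h where "h \<in> ring_iso (form_ring f) (form_ring g)"
    using assms unfolding form_equiv_def is_ring_iso_def by blast
  then have "ring_disc 3 (form_ring g) = disc f" by (rule ring_disc_form[OF cring_form_ring])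
  moreover have "ring_disc 3 (form_ring g) = disc g"
    by (rule ring_disc_form[OF cring_form_ring ring_iso_set_refl])
  ultimately show ?thesis by simp
qed

text \<open>An isomorphism only relabels the points, and the shift by \<open>n x + m y\<close>
  cancels in differences.\<close>

lemma qf_transform:
  assumes h: "h \<in> ring_iso (form_ring f) (form_ring g)"
    and lin: "\<And>x0 x1 x2. h (x0,x1,x2) = (x0 + n * x1 + m * x2, \<alpha> * x1 + \<beta> * x2, \<gamma> * x1 + \<delta> * x2)"
  shows "qf f x y = qf g (\<alpha> * x + \<beta> * y) (\<gamma> * x + \<delta> * y)"
proof -
  define \<Phi> where "\<Phi> u = (ev u (h (0,1,0)), ev u (h (0,0,1)))" for u
  have bij: "bij_betw \<Phi> (pts g) (pts f)" unfolding \<Phi>_def by (rule pts_form_iso(1)[OF h])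
  have ev: "ev (\<Phi> u) (0,x,y) = ev u (n * x + m * y, \<alpha> * x + \<beta> * y, \<gamma> * x + \<delta> * y)" if "u \<in> pts g" for u
    unfolding \<Phi>_def by (subst pts_form_iso(2)[OF h that]) (simp only: lin add_0_left)
  have d: "ev (\<Phi> u) (0,x,y) - ev (\<Phi> v) (0,x,y) = ev u (0, \<alpha> * x + \<beta> * y, \<gamma> * x + \<delta> * y) - ev v (0, \<alpha> * x + \<beta> * y, \<gamma> * x + \<delta> * y)"
    if "u \<in> pts g" "v \<in> pts g" for u v
    unfolding ev[OF that(1)] ev[OF that(2)] by (simp add: ev_def)
  have "(\<Sum>u\<in>pts f. \<Sum>v\<in>pts f. (cmod (ev u (0, x, y) - ev v (0, x, y)))\<^sup>2)
     = (\<Sum>u\<in>pts g. \<Sum>v\<in>pts f. (cmod (ev (\<Phi> u) (0, x, y) - ev v (0, x, y)))\<^sup>2)"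
    by (rule sum.reindex_bij_betw[OF bij, symmetric])
  also have "\<dots> = (\<Sum>u\<in>pts g. \<Sum>v\<in>pts g. (cmod (ev (\<Phi> u) (0, x, y) - ev (\<Phi> v) (0, x, y)))\<^sup>2)"
    by (rule sum.cong[OF refl], rule sum.reindex_bij_betw[OF bij, symmetric])
  finally show ?thesis by (simp add: qf_def d)
qed

lemma GL2_equiv:
  fixes \<alpha> \<beta> \<gamma> \<delta> :: int
  assumes "\<bar>\<alpha> * \<delta> - \<beta> * \<gamma>\<bar> = 1"
  obtains g where "form_equiv g f" "\<And>x y. qf g x y = qf f (\<alpha> * x + \<beta> * y) (\<gamma> * x + \<delta> * y)"
    "\<And>x y. feval f (\<alpha> * x + \<beta> * y) (\<gamma> * x + \<delta> * y) = (\<alpha> * \<delta> - \<beta> * \<gamma>) * feval g x y"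
proof -
  obtain g h n m where h: "h \<in> ring_iso (form_ring g) (form_ring f)"
    and lin: "\<And>x0 x1 x2. h (x0,x1,x2) = (x0 + n * x1 + m * x2, \<alpha> * x1 + \<beta> * x2, \<gamma> * x1 + \<delta> * x2)"
    and ev: "\<And>x y. feval f (\<alpha> * x + \<beta> * y) (\<gamma> * x + \<delta> * y) = (\<alpha> * \<delta> - \<beta> * \<gamma>) * feval g x y"
    by (rule GL2_action[OF assms, where f = f]) (rule that; assumption)
  have "form_equiv g f" unfolding form_equiv_def is_ring_iso_def using h by blast
  then show ?thesis using qf_transform[OF h lin] ev by (rule that)
qed

text \<open>Gauss reduction with respect to \<open>qf\<close>, which is positive definite for both
  signs of the discriminant, unlike the Hessian.\<close>

definition reduced :: "form \<Rightarrow> bool" where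
  "reduced f \<longleftrightarrow> disc f \<noteq> 0 \<and> \<bar>qB f\<bar> \<le> qP f \<and> qP f \<le> qR f"

lemma qf_nonneg: "qf f x y \<ge> 0"
  unfolding qf_def by (simp add: sum_nonneg)

lemma abs_disc_ge_1: "disc f \<noteq> 0 \<Longrightarrow> \<bar>real_of_int (disc f)\<bar> \<ge> 1"
  by linarith

definition form_box :: "real \<Rightarrow> real \<Rightarrow> real \<Rightarrow> real \<Rightarrow> form set" where
  "form_box A B C D = {x. \<bar>of_int x\<bar> \<le> A} \<times> {x. \<bar>of_int x\<bar> \<le> B} \<times> {x. \<bar>of_int x\<bar> \<le> C} \<times> {x. \<bar>of_int x\<bar> \<le> D}"

lemma int_abs_le: "A \<ge> 0 \<Longrightarrow> {x::int. \<bar>real_of_int x\<bar> \<le> A} = {- \<lfloor>A\<rfloor>..\<lfloor>A\<rfloor>}"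
  by (auto simp: abs_le_iff le_floor_iff; linarith)

lemma finite_int_abs_le: "finite {x::int. \<bar>real_of_int x\<bar> \<le> A}"
proof (cases "A \<ge> 0")
  case False
  then have "{x::int. \<bar>real_of_int x\<bar> \<le> A} = {}" by auto
  then show ?thesis by simp
qed (simp add: int_abs_le)

lemma card_int_abs_le:
  assumes "A \<ge> 0" shows "real (card {x::int. \<bar>real_of_int x\<bar> \<le> A}) \<le> 2 * A + 1"
proof -
  have "real (card {x::int. \<bar>real_of_int x\<bar> \<le> A}) = 2 * of_int \<lfloor>A\<rfloor> + 1"
    using assms by (simp add: int_abs_le)
  then show ?thesis using of_int_floor_le[of A] by linarith
qed

lemma finite_form_box: "finite (form_box A B C D)"
  unfolding form_box_def by (intro finite_cartesian_product finite_int_abs_le)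

lemma card_form_box:
  assumes "A \<ge> 0" "B \<ge> 0" "C \<ge> 0" "D \<ge> 0"
  shows "real (card (form_box A B C D)) \<le> (2 * A + 1) * ((2 * B + 1) * ((2 * C + 1) * (2 * D + 1)))"
  unfolding form_box_def card_cartesian_product of_nat_mult
  using assms by (intro mult_mono card_int_abs_le) auto

lemma in_form_box:
  assumes "disc f \<noteq> 0" and s: "s \<ge> 0" "qP f \<le> s\<^sup>2" and t: "t \<ge> 0" "qR f \<le> t\<^sup>2"
    and D: "D > 0" "D \<le> sqrt \<bar>of_int (disc f)\<bar>"
  shows "f \<in> form_box (s ^ 3 / D) (3 * s\<^sup>2 * t / D) (3 * s * t\<^sup>2 / D) (t ^ 3 / D)"
proof -
  obtain a b c d where f: "f = (a, b, c, d)" by (metis prod_cases4)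
  have 1: "\<bar>real_of_int x\<bar> \<le> y / D" if "\<bar>of_int x\<bar> * sqrt \<bar>of_int (disc f)\<bar> \<le> y" for x y
  proof -
    have "\<bar>real_of_int x\<bar> * D \<le> \<bar>of_int x\<bar> * sqrt \<bar>of_int (disc f)\<bar>" using D by (intro mult_left_mono) auto
    then show ?thesis using that D by (simp add: pos_le_divide_eq)
  qed
  note cb = coeff_bound[OF assms(1)[unfolded f] s[unfolded f] t[unfolded f], folded f]
  show ?thesis unfolding form_box_def f using cb[THEN 1] by simp
qed

text \<open>Minimise \<open>qP + qR\<close> over the class. The values are real, so the existence of
  a minimum needs an argument: the forms whose value does not exceed that of \<open>f\<close> lie in
  one finite coefficient box. At a minimum the shears by 1 and -1 in either variable cannot decrease
  the sum, which bounds \<open>qB\<close>; exchanging the variables orders the diagonal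
  entries.\<close>

lemma reduced_exists:
  assumes "disc f \<noteq> 0" shows "\<exists>g. form_equiv g f \<and> reduced g"
proof -
  define m where "m g = qP g + qR g" for g
  have P0: "qP g \<ge> 0" "qR g \<ge> 0" for g by (simp_all add: qP_def qR_def qf_nonneg)
  define S where "S = {g. form_equiv g f \<and> m g \<le> m f}"
  define s where "s = sqrt (m f)"
  have s: "s \<ge> 0" "s\<^sup>2 = m f" using P0[of f] by (simp_all add: s_def m_def)
  have "S \<subseteq> form_box (s ^ 3 / 1) (3 * s\<^sup>2 * s / 1) (3 * s * s\<^sup>2 / 1) (s ^ 3 / 1)"
  proof
    fix g assume "g \<in> S"
    then have g: "form_equiv g f" "m g \<le> m f" by (auto simp: S_def)
    then have d: "disc g \<noteq> 0" using form_equiv_disc assms by metis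
    show "g \<in> form_box (s ^ 3 / 1) (3 * s\<^sup>2 * s / 1) (3 * s * s\<^sup>2 / 1) (s ^ 3 / 1)"
    proof (rule in_form_box[OF d])
      show "qP g \<le> s\<^sup>2" "qR g \<le> s\<^sup>2" using g(2) P0[of g] unfolding s(2) m_def[of g] by linarith+
      show "1 \<le> sqrt \<bar>of_int (disc g)\<bar>" using abs_disc_ge_1[OF d] by simp
    qed (simp_all add: s)
  qed
  then have "finite S" using finite_form_box by (rule finite_subset)
  moreover have "S \<noteq> {}" unfolding S_def using form_equiv_refl by blast
  ultimately obtain g where gS: "g \<in> S" and min: "\<And>k. k \<in> S \<Longrightarrow> m g \<le> m k"
    using ex_min_if_finite[of "m ` S"] by (metis (no_types, lifting) finite_imageI image_iff image_is_empty linorder_not_less)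
  have gf: "form_equiv g f" using gS by (simp add: S_def)
  have dg: "disc g \<noteq> 0" using form_equiv_disc[OF gf] assms by simp
  have min': "m g \<le> m k" if "form_equiv k g" for k
  proof (cases "m k \<le> m f")
    case True
    then show ?thesis using min form_equiv_trans[OF that gf] by (simp add: S_def)
  next
    case False
    then show ?thesis using gS by (simp add: S_def)
  qed
  note e = qf_expand_gram(1)[OF dg]
  have B1: "0 \<le> qP g + of_int e * qB g" "0 \<le> qR g + of_int e * qB g" if "e = 1 \<or> e = - 1" for e :: int
  proof -
    have ee: "real_of_int e * real_of_int e = 1" using that by auto
    obtain k where k: "form_equiv k g" "\<And>x y. qf k x y = qf g (1 * x + e * y) (0 * x + 1 * y)"
      by (rule GL2_equiv[of 1 1 e 0 g], simp) (rule that; assumption)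
    have "m k = qP g + (qP g + of_int e * qB g + qR g)"
      by (simp add: m_def qP_def[of k] qR_def[of k] k(2) e power2_eq_square ee mult.commute)
    then show "0 \<le> qP g + of_int e * qB g" using min'[OF k(1)] by (simp add: m_def)
    obtain k where k: "form_equiv k g" "\<And>x y. qf k x y = qf g (1 * x + 0 * y) (e * x + 1 * y)"
      by (rule GL2_equiv[of 1 1 0 e g], simp) (rule that; assumption)
    have "m k = (qP g + of_int e * qB g + qR g) + qR g"
      by (simp add: m_def qP_def[of k] qR_def[of k] k(2) e power2_eq_square ee mult.commute)
    then show "0 \<le> qR g + of_int e * qB g" using min'[OF k(1)] by (simp add: m_def)
  qed
  have B: "\<bar>qB g\<bar> \<le> qP g" "\<bar>qB g\<bar> \<le> qR g" using B1[of 1] B1[of "-1"] by auto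
  show ?thesis
  proof (cases "qP g \<le> qR g")
    case True
    then show ?thesis using B gf dg unfolding reduced_def by blast
  next
    case False
    obtain k where k: "form_equiv k g" "\<And>x y. qf k x y = qf g (0 * x + 1 * y) (1 * x + 0 * y)"
      by (rule GL2_equiv[of 0 0 1 1 g], simp) (rule that; assumption)
    have "qP k = qR g" "qR k = qP g" by (simp_all add: qP_def qR_def k(2))
    moreover from this have "qB k = qB g" by (simp add: qB_def k(2))
    moreover have "disc k \<noteq> 0" using form_equiv_disc[OF k(1)] dg by simp
    ultimately have "reduced k" using False B by (simp add: reduced_def)
    then show ?thesis using form_equiv_trans[OF k(1) gf] by blast
  qed
qed

text \<open>The mixed term is at most \<open>qP (x^2 + y^2) / 2\<close>, half of the diagonal
  part.\<close>

lemma reduced_qf_ge: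
  assumes "reduced f"
  shows "qP f * (real_of_int x)\<^sup>2 + qR f * (real_of_int y)\<^sup>2 \<le> 2 * qf f x y"
proof -
  have f: "disc f \<noteq> 0" "\<bar>qB f\<bar> \<le> qP f" "qP f \<le> qR f" using assms by (auto simp: reduced_def)
  have P0: "qP f \<ge> 0" by (simp add: qP_def qf_nonneg)
  have "\<bar>qB f * (of_int x * of_int y)\<bar> \<le> qP f * \<bar>of_int x * of_int y\<bar>"
    unfolding abs_mult[of "qB f"] using f(2) by (intro mult_right_mono) auto
  moreover have "2 * \<bar>real_of_int x * of_int y\<bar> \<le> (real_of_int x)\<^sup>2 + (real_of_int y)\<^sup>2"
    using zero_le_power2[of "\<bar>real_of_int x\<bar> - \<bar>real_of_int y\<bar>"]
    by (simp add: power2_diff abs_mult)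
  then have "qP f * (2 * \<bar>real_of_int x * of_int y\<bar>) \<le> qP f * ((real_of_int x)\<^sup>2 + (real_of_int y)\<^sup>2)"
    using P0 by (rule mult_left_mono)
  moreover have "qP f * (real_of_int y)\<^sup>2 \<le> qR f * (real_of_int y)\<^sup>2" using f(3) by (intro mult_right_mono) auto
  ultimately show ?thesis unfolding qf_expand_gram(1)[OF f(1)] by (simp add: algebra_simps abs_le_iff)
qed

lemma reduced_gram:
  assumes "reduced f"
  shows "3 * \<bar>real_of_int (disc f)\<bar> \<le> qP f * qR f" "qP f * qR f \<le> 4 * \<bar>real_of_int (disc f)\<bar>"
proof -
  have f: "disc f \<noteq> 0" "\<bar>qB f\<bar> \<le> qP f" "qP f \<le> qR f" using assms by (auto simp: reduced_def)
  have P0: "qP f \<ge> 0" by (simp add: qP_def qf_nonneg)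
  have g: "4 * (qP f * qR f) - (qB f)\<^sup>2 = 12 * \<bar>real_of_int (disc f)\<bar>" using qf_expand_gram(2)[OF f(1)] by simp
  have "(qB f)\<^sup>2 = \<bar>qB f\<bar> * \<bar>qB f\<bar>" by (simp add: power2_eq_square)
  also have "\<dots> \<le> qP f * qR f" using f P0 by (intro mult_mono) auto
  finally have "(qB f)\<^sup>2 \<le> qP f * qR f" .
  then show "3 * \<bar>real_of_int (disc f)\<bar> \<le> qP f * qR f" "qP f * qR f \<le> 4 * \<bar>real_of_int (disc f)\<bar>"
    using g zero_le_power2[of "qB f"] by linarith+
qed

lemma reduced_ge_1:
  assumes "reduced f" shows "1 \<le> qP f" "1 \<le> qR f"
  using assms qP_ge_1[of f] unfolding reduced_def by linarith+

section \<open>Successive minima and classes\<close>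

lemma smul_eq: "smul k x = (k * fst x, k * fst (snd x), k * snd (snd x))"
  by (cases x) simp

lemma int_indep_form:
  assumes R: "cring R" and h: "h \<in> ring_iso (form_ring f) R" and v: "\<And>j. j < k \<Longrightarrow> v j = h (w j)"
  shows "int_indep R k v \<longleftrightarrow> (\<forall>c. (\<Sum>j<k. smul (c j) (w j)) = 0 \<longrightarrow> (\<forall>j<k. c j = 0))"
proof -
  interpret cring R by fact
  note hE = ring_iso_form_ringE[OF h]
  have hom: "h \<in> Ring.ring_hom (form_ring f) R" using h by (simp add: ring_iso_def)
  have inj: "x = y" if "h x = h y" for x y
    using that hE(1) by (meson UNIV_I bij_betw_def inj_onD)
  have zero: "h 0 = \<zero>\<^bsub>R\<^esub>"
    using ring_hom_zero[OF hom cring.axioms(1)[OF cring_form_ring] ring_axioms] by simp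
  have "int_comb R k c v = h (\<Sum>j<k. smul (c j) (w j))" for c
  proof -
    have "int_comb R k c v = int_comb R k c (\<lambda>j. h (w j))"
      unfolding int_comb_def by (rule finsum_cong') (auto simp: v hE(5))
    then show ?thesis by (simp add: int_comb_hom[OF R hom])
  qed
  then have "int_comb R k c v = \<zero>\<^bsub>R\<^esub> \<longleftrightarrow> (\<Sum>j<k. smul (c j) (w j)) = 0" for c
    using inj zero by metis
  moreover have "v \<in> {..<k} \<rightarrow> carrier R" using v hE(5) by auto
  ultimately show ?thesis unfolding int_indep_def by simp
qed

text \<open>Two vectors on the line of \<open>1\<close> satisfy the relation whose coefficients are
  their own entries, exchanged and with one sign changed.\<close>

lemma indep_pair:
  assumes "\<forall>c. (\<Sum>j<2::nat. smul (c j) (w j)) = 0 \<longrightarrow> (\<forall>j<2. c j = 0)"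
  shows "\<exists>j<2::nat. snd (w j) \<noteq> (0::int \<times> int)"
proof (rule ccontr)
  assume "\<not> (\<exists>j<2::nat. snd (w j) \<noteq> 0)"
  then have "snd (w 0) = 0" "snd (w 1) = 0" by auto
  then have s: "smul k (w 0) = (k * fst (w 0), 0, 0)" "smul k (w 1) = (k * fst (w 1), 0, 0)" for k
    by (simp_all add: smul_eq)
  have ind: "c 0 = 0 \<and> c 1 = 0" if "smul (c 0) (w 0) + smul (c 1) (w 1) = 0" for c :: "nat \<Rightarrow> int"
  proof -
    have "(\<Sum>j<2. smul (c j) (w j)) = 0" using that by (simp add: numeral_2_eq_2)
    then have "\<forall>j<2. c j = 0" by (rule assms[THEN spec, THEN mp])
    then show ?thesis by simp
  qed
  have "smul (fst (w 1)) (w 0) + smul (- fst (w 0)) (w 1) = 0"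
    unfolding s by (simp add: zero_prod_def)
  then have "fst (w 1) = 0 \<and> fst (w 0) = 0"
    using ind[of "\<lambda>j. if j = 0 then fst (w 1) else - fst (w 0)"] by simp
  then have "smul 1 (w 0) + smul 1 (w 1) = 0" unfolding s by (simp add: zero_prod_def)
  then show False using ind[of "\<lambda>_. 1"] by simp
qed

text \<open>Three vectors in the plane of \<open>1\<close> and \<open>\<omega>\<close> are related
  by their 2 by 2 minors. Independence forces first the minors and then the entries of the first two
  vectors to vanish.\<close>

lemma indep_triple:
  assumes "\<forall>c. (\<Sum>j<3::nat. smul (c j) (w j)) = 0 \<longrightarrow> (\<forall>j<3. c j = 0)"
  shows "\<exists>j<3::nat. snd (snd (w j)) \<noteq> (0::int)"
proof (rule ccontr)
  assume neg: "\<not> (\<exists>j<3. snd (snd (w j)) \<noteq> 0)"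
  define m n where mn: "m j = fst (w j)" "n j = fst (snd (w j))" for j
  have s: "smul k (w j) = (k * m j, k * n j, 0)" if "j < 3" for j k
    using neg that by (simp add: smul_eq mn)
  have ind: "c0 = 0 \<and> c1 = 0 \<and> c2 = 0"
    if "c0 * m 0 + c1 * m 1 + c2 * m 2 = 0" "c0 * n 0 + c1 * n 1 + c2 * n 2 = 0" for c0 c1 c2 :: int
  proof -
    let ?c = "\<lambda>j::nat. if j = 0 then c0 else if j = 1 then c1 else c2"
    have "(\<Sum>j<3. smul (?c j) (w j)) = 0"
      unfolding sum_lessThan_3 using that by (simp add: s zero_prod_def)
    then have "\<forall>j<3. ?c j = 0" by (rule assms[THEN spec, THEN mp])
    then have z: "j < 3 \<longrightarrow> ?c j = 0" for j by (rule spec)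
    show ?thesis using z[of 0] z[of 1] z[of 2] by simp
  qed
  have "m 1 = 0 \<and> - m 0 = 0 \<and> 0 = (0::int)"
  proof (rule ind)
    have "m 1 * n 2 - m 2 * n 1 = 0 \<and> m 2 * n 0 - m 0 * n 2 = 0 \<and> m 0 * n 1 - m 1 * n 0 = 0"
      by (rule ind) (simp_all add: algebra_simps)
    then show "m 1 * n 0 + - m 0 * n 1 + 0 * n 2 = 0" by (simp add: algebra_simps)
  qed (simp add: algebra_simps)
  then have m: "m 0 = 0" "m 1 = 0" "m (Suc 0) = 0" by simp_all
  have "n 1 = 0 \<and> - n 0 = 0 \<and> 0 = (0::int)" by (rule ind) (simp_all add: m algebra_simps)
  then have "(1::int) = 0 \<and> (0::int) = 0 \<and> (0::int) = 0" by (intro ind) (simp_all add: m)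
  then show False by simp
qed

text \<open>\<open>qf\<close> bounds the last two coordinates, and a single complex embedding then
  bounds the first. The 24 is 12 from \<open>flen_lower\<close> times 2 from
  \<open>reduced_qf_ge\<close>.\<close>

lemma finite_flen_le:
  assumes f: "reduced f" shows "finite {v. flen f v \<le> r}"
proof -
  have d: "disc f \<noteq> 0" using f by (simp add: reduced_def)
  obtain u v t where "pts f = {u, v, t}" "u \<noteq> v" "u \<noteq> t" "v \<noteq> t"
    by (rule form_points[OF d]) (rule that; assumption)
  then have u: "u \<in> pts f" and fin: "finite (pts f)" by auto
  define K where "K = sqrt (24 * r\<^sup>2)"
  define N where "N = 2 * \<bar>r\<bar> + K * cmod (fst u) + K * cmod (snd u)"
  have "{v. flen f v \<le> r} \<subseteq> {x. \<bar>of_int x\<bar> \<le> N} \<times> {x. \<bar>of_int x\<bar> \<le> K} \<times> {x. \<bar>of_int x\<bar> \<le> K}"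
  proof
    fix x assume "x \<in> {v. flen f v \<le> r}"
    then have x: "flen f x \<le> r" by simp
    obtain x0 x1 x2 where xx: "x = (x0,x1,x2)" by (metis prod_cases3)
    have l0: "0 \<le> flen f x" unfolding flen_def by (intro real_sqrt_ge_zero mult_nonneg_nonneg sum_nonneg) auto
    have l2: "(flen f x)\<^sup>2 \<le> r\<^sup>2" using x l0 by (rule power_mono)
    have "qf f x1 x2 \<le> 12 * (flen f x)\<^sup>2" unfolding xx by (rule flen_lower[OF d])
    moreover have "(real_of_int x1)\<^sup>2 \<le> qP f * (real_of_int x1)\<^sup>2" "(real_of_int x2)\<^sup>2 \<le> qR f * (real_of_int x2)\<^sup>2"
      using reduced_ge_1[OF f] by (simp_all add: mult_le_cancel_right1)
    ultimately have "(real_of_int x1)\<^sup>2 + (real_of_int x2)\<^sup>2 \<le> 24 * r\<^sup>2"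
      using reduced_qf_ge[OF f, of x1 x2] l2 by linarith
    then have "(real_of_int x1)\<^sup>2 \<le> 24 * r\<^sup>2" "(real_of_int x2)\<^sup>2 \<le> 24 * r\<^sup>2"
      using zero_le_power2[of "real_of_int x1"] zero_le_power2[of "real_of_int x2"] by linarith+
    then have k: "\<bar>real_of_int x1\<bar> \<le> K" "\<bar>real_of_int x2\<bar> \<le> K"
      unfolding K_def by (simp_all add: real_le_rsqrt)
    have "(cmod (ev u x))\<^sup>2 \<le> (\<Sum>u\<in>pts f. (cmod (ev u x))\<^sup>2)"
      using u fin by (intro member_le_sum) auto
    also have "\<dots> = 3 * (flen f x)\<^sup>2"
      unfolding flen_def by (subst real_sqrt_pow2) (auto intro!: sum_nonneg)
    also have "\<dots> \<le> (2 * \<bar>r\<bar>)\<^sup>2"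
    proof -
      have "(2 * \<bar>r\<bar>)\<^sup>2 = 4 * r\<^sup>2" by (simp add: power_mult_distrib)
      then show ?thesis using l2 zero_le_power2[of r] by linarith
    qed
    finally have e: "cmod (ev u x) \<le> 2 * \<bar>r\<bar>" by (rule power2_le_imp_le) simp
    have "complex_of_int x0 = ev u x - of_int x1 * fst u - of_int x2 * snd u" by (simp add: xx ev_def)
    then have "cmod (of_int x0) \<le> cmod (ev u x) + cmod (of_int x1 * fst u) + cmod (of_int x2 * snd u)"
      by (metis (no_types, lifting) add_right_mono norm_triangle_ineq4 order_trans)
    also have "\<dots> \<le> N"
      unfolding N_def norm_mult norm_of_int using k e by (intro add_mono mult_right_mono) auto
    finally show "x \<in> {x. \<bar>of_int x\<bar> \<le> N} \<times> {x. \<bar>of_int x\<bar> \<le> K} \<times> {x. \<bar>of_int x\<bar> \<le> K}"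
      using k by (simp add: xx)
  qed
  then show ?thesis
    by (rule finite_subset) (intro finite_cartesian_product finite_int_abs_le)
qed

text \<open>\<open>succ_min\<close> is a \<open>LEAST\<close> over the reals and says nothing unless
  a minimum exists. The candidates can be taken among the lengths of ring elements that are at most
  \<open>r\<close>, and these are finite in number.\<close>

lemma succ_min_attained:
  assumes R: "cring R" and h: "h \<in> ring_iso (form_ring f) R" and f: "reduced f"
    and ind: "int_indep R (Suc i) v" and le: "\<And>j. j \<le> i \<Longrightarrow> ring_length 3 R (v j) \<le> r"
  shows "succ_min 3 R i \<le> r"
    and "\<exists>v. int_indep R (Suc i) v \<and> (\<forall>j\<le>i. ring_length 3 R (v j) \<le> succ_min 3 R i)"
proof -
  note hE = ring_iso_form_ringE[OF h]
  define Q where "Q r \<longleftrightarrow> (\<exists>v. int_indep R (Suc i) v \<and> (\<forall>j\<le>i. ring_length 3 R (v j) \<le> r))" for r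
  define E where "E = ring_length 3 R ` {x \<in> carrier R. ring_length 3 R x \<le> r}"
  have "{x \<in> carrier R. ring_length 3 R x \<le> r} = h ` {v. flen f v \<le> r}"
  proof (intro equalityI subsetI)
    fix y assume y: "y \<in> {x \<in> carrier R. ring_length 3 R x \<le> r}"
    then obtain v where "y = h v" using hE(1) unfolding bij_betw_def by blast
    then show "y \<in> h ` {v. flen f v \<le> r}" using y ring_length_form[OF h, of v] by simp
  next
    fix y assume "y \<in> h ` {v. flen f v \<le> r}"
    then obtain v where "y = h v" "flen f v \<le> r" by blast
    then show "y \<in> {x \<in> carrier R. ring_length 3 R x \<le> r}"
      using hE(5)[of v] ring_length_form[OF h, of v] by simp
  qed
  then have "finite E" unfolding E_def using finite_flen_le[OF f] by simp
  have down: "\<exists>e\<in>E. e \<le> r' \<and> Q e" if r': "r' \<le> r" "Q r'" for r'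
  proof -
    obtain v where v: "int_indep R (Suc i) v" "\<forall>j\<le>i. ring_length 3 R (v j) \<le> r'" using r'(2) by (auto simp: Q_def)
    define e where "e = Max ((\<lambda>j. ring_length 3 R (v j)) ` {..i})"
    have "e \<in> (\<lambda>j. ring_length 3 R (v j)) ` {..i}" unfolding e_def by (rule Max_in) auto
    then obtain j where j: "j \<le> i" "e = ring_length 3 R (v j)" by auto
    have "v j \<in> carrier R" using v(1) j(1) by (auto simp: int_indep_def)
    then have "e \<in> E" using j v(2) r'(1) by (force simp: E_def)
    moreover have "Q e" unfolding Q_def e_def using v(1) by (intro exI[of _ v] conjI allI impI Max_ge) auto
    ultimately show ?thesis using j v(2) by blast
  qed
  have Qr: "Q r" using ind le by (auto simp: Q_def)
  define m where "m = Min {e \<in> E. Q e}"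
  have fin: "finite {e \<in> E. Q e}" using \<open>finite E\<close> by simp
  have ne: "{e \<in> E. Q e} \<noteq> {}" using down[OF order_refl Qr] by blast
  have m: "m \<in> E" "Q m" using Min_in[OF fin ne] by (auto simp: m_def)
  have min: "m \<le> r'" if "Q r'" for r'
  proof (cases "r' \<le> r")
    case True
    from down[OF this that] obtain e where "e \<in> E" "e \<le> r'" "Q e" by blast
    then show ?thesis using Min_le[OF fin, of e] by (simp add: m_def)
  next
    case False
    moreover have "m \<le> r" using m(1) by (auto simp: E_def)
    ultimately show ?thesis by simp
  qed
  have "succ_min 3 R i = m"
    unfolding succ_min_def Q_def[symmetric] by (rule Least_equality) (use m min in auto)
  then show "succ_min 3 R i \<le> r" "\<exists>v. int_indep R (Suc i) v \<and> (\<forall>j\<le>i. ring_length 3 R (v j) \<le> succ_min 3 R i)"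
    using min Qr m(2) by (auto simp: Q_def)
qed

lemma flen_unit:
  assumes "disc f \<noteq> 0" shows "flen f (1,0,0) = 1"
proof -
  obtain u v t where "pts f = {u, v, t}" "u \<noteq> v" "u \<noteq> t" "v \<noteq> t"
    by (rule form_points[OF assms]) (rule that; assumption)
  then show ?thesis by (simp add: flen_def ev_unit)
qed

text \<open>The upper bounds hold for every form, so they also estimate the minima of forms given
  explicitly.\<close>

lemma succ_min_le_flen:
  assumes R: "cring R" and h: "h \<in> ring_iso (form_ring f) R" and d: "disc f \<noteq> 0"
  shows "succ_min 3 R 1 \<le> max 1 (flen f (x, 1, 0))"
    and "succ_min 3 R 2 \<le> max (max 1 (flen f (x, 1, 0))) (flen f (y, 0, 1))"
proof -
  obtain g where g: "form_equiv g f" "reduced g" using reduced_exists[OF d] by blast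
  obtain k where k: "k \<in> ring_iso (form_ring g) (form_ring f)"
    using g(1) unfolding form_equiv_def is_ring_iso_def by blast
  have hk: "h \<circ> k \<in> ring_iso (form_ring g) R" by (rule ring_iso_set_trans[OF k h])
  define w :: "nat \<Rightarrow> vec3" where "w j = (if j = 0 then (1,0,0) else if j = 1 then (x,1,0) else (y,0,1))" for j
  have i2: "int_indep R (Suc 1) (\<lambda>j. h (w j))"
    unfolding int_indep_form[OF R h refl]
    by (intro allI impI) (auto simp: w_def zero_prod_def less_Suc_eq)
  have i3: "int_indep R (Suc 2) (\<lambda>j. h (w j))"
    unfolding int_indep_form[OF R h refl]
    by (intro allI impI) (auto simp: w_def zero_prod_def less_Suc_eq numeral_2_eq_2)
  show "succ_min 3 R 1 \<le> max 1 (flen f (x, 1, 0))"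
    by (rule succ_min_attained(1)[OF R hk g(2) i2])
       (auto simp: ring_length_form[OF h] w_def flen_unit[OF d])
  show "succ_min 3 R 2 \<le> max (max 1 (flen f (x, 1, 0))) (flen f (y, 0, 1))"
    by (rule succ_min_attained(1)[OF R hk g(2) i3])
       (auto simp: ring_length_form[OF h] w_def flen_unit[OF d])
qed

text \<open>For the upper bounds, \<open>1/2 + sqrt (qP f)\<close> is at most
  \<open>2 sqrt (qP f)\<close> as \<open>qP f \<ge> 1\<close>, and likewise for \<open>qR\<close>.
  For the lower bounds, one of the independent vectors lies off the line of \<open>1\<close>,
  respectively off the plane of \<open>1\<close> and \<open>\<omega>\<close>, and there
  \<open>qf\<close> is at least half of \<open>qP f\<close>, respectively
  \<open>qR f\<close>.\<close>

lemma succ_min_bounds: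
  assumes R: "cring R" and h: "h \<in> ring_iso (form_ring f) R" and f: "reduced f"
  shows "succ_min 3 R 1 \<le> 2 * sqrt (qP f)" "sqrt (qP f) \<le> 5 * succ_min 3 R 1"
    "succ_min 3 R 2 \<le> 2 * sqrt (qR f)" "sqrt (qR f) \<le> 5 * succ_min 3 R 2"
proof -
  have d: "disc f \<noteq> 0" and PR: "qP f \<le> qR f" using f by (auto simp: reduced_def)
  note ge1 = reduced_ge_1[OF f]
  note hE = ring_iso_form_ringE[OF h]
  have s1: "1 \<le> sqrt (qP f)" "sqrt (qP f) \<le> sqrt (qR f)" using ge1 PR by simp_all
  obtain x where x: "flen f (x, 1, 0) \<le> 1 / 2 + sqrt (qP f)" using flen_upper[OF d, of 1 0] by (auto simp: qP_def)
  obtain y where y: "flen f (y, 0, 1) \<le> 1 / 2 + sqrt (qR f)" using flen_upper[OF d, of 0 1] by (auto simp: qR_def)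
  show u1: "succ_min 3 R 1 \<le> 2 * sqrt (qP f)"
    using succ_min_le_flen(1)[OF R h d, of x] x s1 by linarith
  show u2: "succ_min 3 R 2 \<le> 2 * sqrt (qR f)"
    using succ_min_le_flen(2)[OF R h d, of x y] x y s1 by linarith
  \<comment> \<open>The constant 5 comes from \<open>24 \<le> 5^2\<close>, with 12 from
    \<open>flen_lower\<close> and 2 from the assumption on \<open>Z\<close>.\<close>
  have low: "sqrt Z \<le> 5 * r" if "Z \<le> qf f a b * 2" "flen f (c, a, b) \<le> r" for Z a b c r
  proof -
    have l0: "0 \<le> flen f (c, a, b)" unfolding flen_def by (intro real_sqrt_ge_zero mult_nonneg_nonneg sum_nonneg) auto
    have "Z \<le> 24 * (flen f (c, a, b))\<^sup>2" using that(1) flen_lower[OF d, of a b c] by linarith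
    also have "(flen f (c, a, b))\<^sup>2 \<le> r\<^sup>2" using that(2) l0 by (rule power_mono)
    also have "24 * r\<^sup>2 \<le> (5 * r)\<^sup>2" by (simp add: power_mult_distrib)
    finally have "Z \<le> (5 * r)\<^sup>2" by simp
    moreover have "0 \<le> 5 * r" using that(2) l0 by linarith
    ultimately show ?thesis by (intro real_le_lsqrt)
  qed
  have one: "1 \<le> (real_of_int b)\<^sup>2" if "b \<noteq> 0" for b
  proof -
    have "1 \<le> \<bar>real_of_int b\<bar>" using that by linarith
    then have "1\<^sup>2 \<le> \<bar>real_of_int b\<bar>\<^sup>2" by (intro power_mono) auto
    then show ?thesis by simp
  qed
  have att: "\<exists>v. int_indep R (Suc i) v \<and> (\<forall>j\<le>i. ring_length 3 R (v j) \<le> succ_min 3 R i)" if "i = 1 \<or> i = 2" for i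
  proof -
    define w :: "nat \<Rightarrow> vec3" where "w j = (if j = 0 then (1,0,0) else if j = 1 then (x,1,0) else (y,0,1))" for j
    have ind: "int_indep R (Suc i) (\<lambda>j. h (w j))"
      unfolding int_indep_form[OF R h refl]
      using that by (intro allI impI) (auto simp: w_def zero_prod_def less_Suc_eq numeral_2_eq_2)
    show ?thesis
      by (rule succ_min_attained(2)[OF R h f ind, of "max (flen f (w 0)) (max (flen f (w 1)) (flen f (w 2)))"])
         (use that in \<open>auto simp: ring_length_form[OF h] w_def\<close>)
  qed
  have pre: "\<exists>x. v = h x" if "v \<in> carrier R" for v using that hE(1) by (metis bij_betw_def imageE)
  show "sqrt (qP f) \<le> 5 * succ_min 3 R 1"
  proof -
    obtain v where v: "int_indep R (Suc 1) v" "\<forall>j\<le>1. ring_length 3 R (v j) \<le> succ_min 3 R 1" using att by blast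
    have "\<forall>j<2. \<exists>x. v j = h x" using v(1) pre by (auto simp: int_indep_def Pi_def)
    then obtain w where w: "\<And>j. j < 2 \<Longrightarrow> v j = h (w j)" by metis
    have "int_indep R 2 v" using v(1) by (simp add: numeral_2_eq_2)
    then have "\<forall>c. (\<Sum>j<2. smul (c j) (w j)) = 0 \<longrightarrow> (\<forall>j<2. c j = 0)"
      by (rule int_indep_form[OF R h w, THEN iffD1, rotated])
    from indep_pair[OF this] obtain j where j: "j < 2" "snd (w j) \<noteq> 0" by blast
    obtain c a b where cab: "w j = (c, a, b)" by (metis prod_cases3)
    have "j \<le> 1" using j(1) by simp
    with v(2) have "ring_length 3 R (v j) \<le> succ_min 3 R 1" by blast
    then have "flen f (c, a, b) \<le> succ_min 3 R 1"
      unfolding w[OF j(1)] ring_length_form[OF h] cab .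
    moreover have "qP f \<le> qf f a b * 2"
    proof -
      have "a \<noteq> 0 \<or> b \<noteq> 0" using j(2) by (auto simp: cab zero_prod_def)
      then have "1 \<le> (real_of_int a)\<^sup>2 + (real_of_int b)\<^sup>2"
        using one[of a] one[of b] zero_le_power2[of "real_of_int a"] zero_le_power2[of "real_of_int b"] by linarith
      then have "qP f * 1 \<le> qP f * ((real_of_int a)\<^sup>2 + (real_of_int b)\<^sup>2)" using ge1 by (intro mult_left_mono) auto
      moreover have "qP f * (real_of_int b)\<^sup>2 \<le> qR f * (real_of_int b)\<^sup>2" using PR by (intro mult_right_mono) auto
      ultimately show ?thesis using reduced_qf_ge[OF f, of a b] by (simp add: algebra_simps)
    qed
    ultimately show ?thesis by (intro low)
  qed
  show "sqrt (qR f) \<le> 5 * succ_min 3 R 2"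
  proof -
    obtain v where v: "int_indep R (Suc 2) v" "\<forall>j\<le>2. ring_length 3 R (v j) \<le> succ_min 3 R 2" using att by blast
    have "\<forall>j<3. \<exists>x. v j = h x" using v(1) pre by (auto simp: int_indep_def Pi_def)
    then obtain w where w: "\<And>j. j < 3 \<Longrightarrow> v j = h (w j)" by metis
    have "int_indep R 3 v" using v(1) by (simp add: numeral_3_eq_3 numeral_2_eq_2)
    then have "\<forall>c. (\<Sum>j<3. smul (c j) (w j)) = 0 \<longrightarrow> (\<forall>j<3. c j = 0)"
      by (rule int_indep_form[OF R h w, THEN iffD1, rotated])
    from indep_triple[OF this] obtain j where j: "j < 3" "snd (snd (w j)) \<noteq> 0" by blast
    obtain c a b where cab: "w j = (c, a, b)" by (metis prod_cases3)
    have "j \<le> 2" using j(1) by simp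
    with v(2) have "ring_length 3 R (v j) \<le> succ_min 3 R 2" by blast
    then have "flen f (c, a, b) \<le> succ_min 3 R 2"
      unfolding w[OF j(1)] ring_length_form[OF h] cab .
    moreover have "qR f \<le> qf f a b * 2"
    proof -
      have "1 \<le> (real_of_int b)\<^sup>2" using one[of b] j(2) by (simp add: cab)
      then have "qR f * 1 \<le> qR f * (real_of_int b)\<^sup>2" using ge1 by (intro mult_left_mono) auto
      moreover have "0 \<le> qP f * (real_of_int a)\<^sup>2" using ge1 by simp
      ultimately show ?thesis using reduced_qf_ge[OF f, of a b] by (simp add: algebra_simps)
    qed
    ultimately show ?thesis by (intro low)
  qed
qed

text \<open>Consists of rings on the natural numbers to match the sets that are counted. By
  \<open>rank_ring_nat_copy\<close> it is never empty, on which \<open>form_class_eq_iff\<close>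
  rests.\<close>

definition form_class :: "form \<Rightarrow> nat ring set" where
  "form_class f = {S. rank_ring 3 S \<and> form_ring f \<simeq> S}"

lemma form_class_eq_iff: "form_class f = form_class g \<longleftrightarrow> form_equiv f g"
proof
  assume eq: "form_class f = form_class g"
  obtain S :: "nat ring" where "rank_ring 3 S" "form_ring f \<simeq> S"
    using rank_ring_nat_copy[OF rank_ring_form_ring] by blast
  then have "S \<in> form_class f" by (simp add: form_class_def)
  then have "form_ring g \<simeq> S" unfolding eq by (simp add: form_class_def)
  then have "S \<simeq> form_ring g" by (rule ring_iso_sym[OF cring.axioms(1)[OF cring_form_ring]])
  then show "form_equiv f g"
    unfolding form_equiv_def using \<open>form_ring f \<simeq> S\<close> by (rule ring_iso_trans[rotated])
next
  assume fg: "form_equiv f g"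
  show "form_class f = form_class g"
    unfolding form_class_def using fg form_equiv_sym[OF fg] unfolding form_equiv_def
    by (auto intro: ring_iso_trans)
qed

text \<open>From here on classes of rings are images of sets of forms; that every ring of rank 3
  comes from a form enters at this point.\<close>

lemma quotient_rank_ring_iso:
  assumes "A \<subseteq> {R. rank_ring 3 R}"
  shows "A // rank_ring_iso 3 = form_class ` {f. \<exists>R\<in>A. form_ring f \<simeq> R}"
proof -
  have cls: "rank_ring_iso 3 `` {R} = form_class f" if "rank_ring 3 R" "form_ring f \<simeq> R" for R :: "nat ring" and f
  proof -
    have Rf: "R \<simeq> form_ring f" using that(2) by (rule ring_iso_sym[OF cring.axioms(1)[OF cring_form_ring]])
    show ?thesis unfolding rank_ring_iso_def form_class_def Image_def
      using that Rf by (auto intro: ring_iso_trans)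
  qed
  show ?thesis
  proof (intro equalityI subsetI)
    fix C assume "C \<in> A // rank_ring_iso 3"
    then obtain R where R: "R \<in> A" "C = rank_ring_iso 3 `` {R}" by (auto simp: quotient_def)
    then obtain f where f: "form_ring f \<simeq> R" using rank_3_ring_iso_form_ring[of R] assms by blast
    then have "C = form_class f" using cls[of R f] R assms by blast
    then show "C \<in> form_class ` {f. \<exists>R\<in>A. form_ring f \<simeq> R}" using f R(1) by blast
  next
    fix C assume "C \<in> form_class ` {f. \<exists>R\<in>A. form_ring f \<simeq> R}"
    then obtain f R where f: "C = form_class f" "R \<in> A" "form_ring f \<simeq> R" by blast
    then have "C = rank_ring_iso 3 `` {R}" using cls[of R f] assms by blast
    then show "C \<in> A // rank_ring_iso 3" using f(2) by (simp add: quotientI)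
  qed
qed

section \<open>Counting reduced forms\<close>

text \<open>The coefficients of \<open>f(x + k y, y)\<close>.\<close>

fun translate :: "int \<Rightarrow> form \<Rightarrow> form" where
  "translate k (a, b, c, d) =
     (a, b + 3 * a * k, c + 2 * b * k + 3 * a * k\<^sup>2, d + c * k + b * k\<^sup>2 + a * k ^ 3)"

lemma translate_props:
  shows translate_equiv: "form_equiv (translate k f) f"
    and translate_qf: "qf (translate k f) x y = qf f (x + k * y) y"
proof -
  obtain g where g: "form_equiv g f" "\<And>x y. qf g x y = qf f (1 * x + k * y) (0 * x + 1 * y)"
    "\<And>x y. feval f (1 * x + k * y) (0 * x + 1 * y) = (1 * 1 - k * 0) * feval g x y"
    by (rule GL2_equiv[of 1 1 k 0 f], simp) (rule that; assumption)
  have "feval (translate k f) x y = feval g x y" for x y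
    using g(3)[of x y] by (cases f) (simp add: algebra_simps power2_eq_square power3_eq_cube)
  then have "translate k f = g" by (rule feval_inject)
  then show "form_equiv (translate k f) f" "qf (translate k f) x y = qf f (x + k * y) y" using g(1,2) by simp_all
qed

text \<open>If \<open>a \<noteq> 0\<close>, the coefficient \<open>b + 3 a k\<close> determines
  \<open>k\<close>; if \<open>a = 0\<close>, then \<open>b \<noteq> 0\<close> and the third
  coefficient determines it.\<close>

lemma translate_inject:
  assumes "disc f \<noteq> 0" "translate k f = translate k' f" shows "k = k'"
proof -
  obtain a b c d where f: "f = (a, b, c, d)" by (metis prod_cases4)
  show ?thesis
  proof (cases "a = 0")
    case True
    then have "b \<noteq> 0" using assms(1) by (auto simp: f)
    then show ?thesis using assms(2) True by (simp add: f)
  qed (use assms(2) in \<open>simp add: f\<close>)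
qed

definition reduced_range :: "real \<Rightarrow> real \<Rightarrow> real \<Rightarrow> form set" where
  "reduced_range Y S S' = {f. reduced f \<and> Y / 2 < \<bar>of_int (disc f)\<bar> \<and> \<bar>of_int (disc f)\<bar> \<le> Y \<and>
     S \<le> sqrt (qP f) \<and> sqrt (qP f) \<le> S'}"

lemma reduced_sqrt_bounds:
  assumes f: "f \<in> reduced_range Y S S'" and Y: "Y > 0"
  shows "sqrt Y \<le> sqrt (qP f) * sqrt (qR f)" "sqrt (qP f) * sqrt (qR f) \<le> 2 * sqrt Y"
    "1 \<le> sqrt (qP f)" "sqrt (qP f) \<le> sqrt (qR f)"
proof -
  have r: "reduced f" and d: "Y / 2 < \<bar>of_int (disc f)\<bar>" "\<bar>of_int (disc f)\<bar> \<le> Y"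
    using f by (auto simp: reduced_range_def)
  have "Y \<le> qP f * qR f" using reduced_gram(1)[OF r] d by linarith
  then have "sqrt Y \<le> sqrt (qP f * qR f)" by simp
  then show "sqrt Y \<le> sqrt (qP f) * sqrt (qR f)" by (simp add: real_sqrt_mult)
  have "qP f * qR f \<le> 4 * Y" using reduced_gram(2)[OF r] d by linarith
  then have "sqrt (qP f * qR f) \<le> sqrt (4 * Y)" by simp
  then show "sqrt (qP f) * sqrt (qR f) \<le> 2 * sqrt Y" by (simp add: real_sqrt_mult)
  show "1 \<le> sqrt (qP f)" using reduced_ge_1[OF r] by simp
  show "sqrt (qP f) \<le> sqrt (qR f)" using r by (simp add: reduced_def)
qed

lemma reduced_qR_sqrt:
  assumes f: "f \<in> reduced_range Y S S'" and Y: "Y > 0" and S: "S > 0"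
  shows "sqrt (qR f) \<le> 2 * sqrt Y / S"
proof -
  have "S * sqrt (qR f) \<le> sqrt (qP f) * sqrt (qR f)"
    using f by (intro mult_right_mono) (auto simp: reduced_range_def qR_def qf_nonneg)
  then show ?thesis using reduced_sqrt_bounds(2)[OF f Y] S by (simp add: pos_le_divide_eq mult.commute)
qed

text \<open>The translates of a reduced form by \<open>k \<le> sqrt Y / S'\<^sup>2\<close> all lie in one box of coefficients,
  so every class is counted that often among the lattice points of the box.\<close>

lemma card_reduced_range_box:
  assumes Y: "Y > 0" and S: "S > 0" "S \<le> S'"
  shows "finite (form_class ` reduced_range Y S S')"
    and "real (card (form_class ` reduced_range Y S S')) * (sqrt Y / S'\<^sup>2) \<le>
      (2 * (2 * S' ^ 3 / sqrt Y) + 1) * ((2 * (24 * S'\<^sup>2 / S) + 1) *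
      ((2 * (96 * S' * sqrt Y / S\<^sup>2) + 1) * (2 * (128 * Y / S ^ 3) + 1)))"
proof -
  define K where "K = form_class ` reduced_range Y S S'"
  \<comment> \<open>The translates used have \<open>sqrt qR\<close> at most twice that of the
    reduced form, which is at most \<open>2 sqrt Y / S\<close>.\<close>
  define t where "t = 4 * sqrt Y / S"
  define n where "n = nat \<lfloor>sqrt Y / S'\<^sup>2\<rfloor>"
  \<comment> \<open>\<open>|Disc| > Y / 2\<close> would allow \<open>sqrt (Y / 2)\<close>; the
    smaller value keeps the constants rational.\<close>
  define D where "D = sqrt Y / 2"
  have S': "S' > 0" and sY: "sqrt Y > 0" using S Y by simp_all
  define B where "B = form_box (S' ^ 3 / D) (3 * S'\<^sup>2 * t / D) (3 * S' * t\<^sup>2 / D) (t ^ 3 / D)"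
  have "\<exists>f. f \<in> reduced_range Y S S' \<and> form_class f = \<kappa>" if "\<kappa> \<in> K" for \<kappa> using that by (auto simp: K_def)
  then obtain rep where rep: "\<And>\<kappa>. \<kappa> \<in> K \<Longrightarrow> rep \<kappa> \<in> reduced_range Y S S' \<and> form_class (rep \<kappa>) = \<kappa>" by metis
  define \<phi> where "\<phi> = (\<lambda>(\<kappa>, k::nat). translate (int k) (rep \<kappa>))"
  have inj: "inj_on \<phi> (K \<times> {..n})"
  proof (rule inj_onI, clarify)
    fix \<kappa> k \<kappa>' k' assume K: "\<kappa> \<in> K" "\<kappa>' \<in> K" and eq: "\<phi> (\<kappa>, k) = \<phi> (\<kappa>', k')"
    have eq': "translate (int k) (rep \<kappa>) = translate (int k') (rep \<kappa>')" using eq by (simp add: \<phi>_def)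
    have "form_equiv (rep \<kappa>) (rep \<kappa>')"
      using translate_equiv[of "int k" "rep \<kappa>"] translate_equiv[of "int k'" "rep \<kappa>'"] eq'
      by (metis form_equiv_sym form_equiv_trans)
    then have "\<kappa> = \<kappa>'" using rep[OF K(1)] rep[OF K(2)] form_class_eq_iff by metis
    moreover have "disc (rep \<kappa>) \<noteq> 0" using rep[OF K(1)] by (simp add: reduced_range_def reduced_def)
    ultimately show "\<kappa> = \<kappa>' \<and> k = k'" using translate_inject eq' by fastforce
  qed
  have img: "\<phi> ` (K \<times> {..n}) \<subseteq> B"
  proof (rule image_subsetI, clarify)
    fix \<kappa> k assume \<kappa>: "\<kappa> \<in> K" and k: "k \<le> n"
    define f where "f = rep \<kappa>"
    have f: "f \<in> reduced_range Y S S'" using rep[OF \<kappa>] by (simp add: f_def)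
    then have r: "reduced f" and d: "Y / 2 < \<bar>of_int (disc f)\<bar>" and s2: "sqrt (qP f) \<le> S'"
      by (auto simp: reduced_range_def)
    define s where "s = sqrt (qP f)"
    define u where "u = sqrt (qR f)"
    have sq: "qP f = s\<^sup>2" "qR f = u\<^sup>2" using reduced_ge_1[OF r] by (simp_all add: s_def u_def)
    note b = reduced_sqrt_bounds[OF f Y, folded s_def u_def]
    have u0: "u \<ge> 0" using b by linarith
    have "real k \<le> sqrt Y / S'\<^sup>2"
      using k Y by (simp add: n_def le_nat_iff le_floor_iff)
    then have "real k * s\<^sup>2 \<le> sqrt Y / S'\<^sup>2 * S'\<^sup>2"
      using s2 b(3) S' by (intro mult_mono power_mono) (auto simp: s_def)
    then have "real k * s\<^sup>2 \<le> s * u" using b(1) S' by simp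
    \<comment> \<open>This limits the number of translates: while \<open>k s \<le> u\<close>, the
      shear by \<open>k\<close> changes \<open>sqrt qR\<close> by a constant factor only.\<close>
    then have ks: "real k * s \<le> u" using b(3) by (simp add: power2_eq_square mult.assoc mult.left_commute[of _ s])
    have d0: "disc f \<noteq> 0" using r by (simp add: reduced_def)
    have "qR (translate (int k) f) = s\<^sup>2 * (real k)\<^sup>2 + qB f * real k + u\<^sup>2"
      by (simp add: qR_def[of "translate _ _"] translate_qf qf_expand_gram(1)[OF d0] sq)
    also have "\<dots> \<le> s\<^sup>2 * (real k)\<^sup>2 + s\<^sup>2 * real k + u\<^sup>2"
      using r sq by (intro add_mono mult_right_mono) (auto simp: reduced_def abs_le_iff)
    also have "\<dots> = (real k * s) * (real k * s) + s * (real k * s) + u\<^sup>2" by (simp add: power2_eq_square algebra_simps)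
    also have "\<dots> \<le> u * u + u * u + u\<^sup>2"
      using ks b u0 by (intro add_mono mult_mono) auto
    also have "\<dots> \<le> (2 * u)\<^sup>2" by (simp add: power2_eq_square)
    finally have qR: "qR (translate (int k) f) \<le> (2 * u)\<^sup>2" .
    have "2 * u \<le> t" using reduced_qR_sqrt[OF f Y S(1)] by (simp add: u_def t_def)
    then have "(2 * u)\<^sup>2 \<le> t\<^sup>2" using u0 by (intro power_mono) auto
    with qR have qR': "qR (translate (int k) f) \<le> t\<^sup>2" by linarith
    have dd: "disc (translate (int k) f) = disc f" by (rule form_equiv_disc[OF translate_equiv])
    have "translate (int k) f \<in> B"
      unfolding B_def
    proof (rule in_form_box)
      show "disc (translate (int k) f) \<noteq> 0" using d0 dd by simp
      have "s\<^sup>2 \<le> S'\<^sup>2" using s2 b(3) by (intro power_mono) (auto simp: s_def)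
      moreover have "qP (translate (int k) f) = s\<^sup>2"
        unfolding qP_def translate_qf using sq(1) by (simp add: qP_def)
      ultimately show "qP (translate (int k) f) \<le> S'\<^sup>2" by simp
      show "0 \<le> t" using S Y by (simp add: t_def)
      show "D > 0" using sY by (simp add: D_def)
      have "D\<^sup>2 \<le> \<bar>real_of_int (disc f)\<bar>" using d Y by (simp add: D_def power_divide)
      then show "D \<le> sqrt \<bar>real_of_int (disc (translate (int k) f))\<bar>"
        unfolding dd by (rule real_le_rsqrt)
    qed (use S' qR' in auto)
    then show "\<phi> (\<kappa>, k) \<in> B" by (simp add: \<phi>_def f_def)
  qed
  have finB: "finite B" unfolding B_def by (rule finite_form_box)
  have "finite (K \<times> {..n})" using finite_imageD[OF finite_subset[OF img finB] inj] .
  then have finK: "finite K" by (rule finite_cartesian_productD1) simp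
  then show "finite (form_class ` reduced_range Y S S')" by (simp add: K_def)
  have "card (K \<times> {..n}) \<le> card B" by (rule card_inj_on_le[OF inj img finB])
  then have "real (card K) * (real n + 1) \<le> real (card B)"
    unfolding card_cartesian_product by (metis card_atMost of_nat_Suc of_nat_le_iff of_nat_mult add.commute)
  moreover have "sqrt Y / S'\<^sup>2 \<le> real n + 1" unfolding n_def using Y by (simp add: of_nat_nat)
  ultimately have 1: "real (card K) * (sqrt Y / S'\<^sup>2) \<le> real (card B)"
    using mult_left_mono[of "sqrt Y / S'\<^sup>2" "real n + 1" "real (card K)"] by linarith
  have t0: "t \<ge> 0" "D > 0" using S Y sY by (simp_all add: t_def D_def)
  have "real (card B) \<le> (2 * (S' ^ 3 / D) + 1) * ((2 * (3 * S'\<^sup>2 * t / D) + 1) * ((2 * (3 * S' * t\<^sup>2 / D) + 1) * (2 * (t ^ 3 / D) + 1)))"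
    unfolding B_def using S' t0 by (intro card_form_box) auto
  moreover have "S' ^ 3 / D = 2 * S' ^ 3 / sqrt Y" by (simp add: D_def)
  moreover have "3 * S'\<^sup>2 * t / D = 24 * S'\<^sup>2 / S" using sY by (simp add: D_def t_def)
  moreover have "3 * S' * t\<^sup>2 / D = 96 * S' * sqrt Y / S\<^sup>2"
    using sY by (simp add: D_def t_def power2_eq_square field_simps)
  moreover have "t ^ 3 / D = 128 * Y / S ^ 3"
  proof -
    have "sqrt Y * sqrt Y = Y" using Y by simp
    then show ?thesis using sY S by (simp add: D_def t_def power3_eq_cube field_simps)
  qed
  ultimately show "real (card (form_class ` reduced_range Y S S')) * (sqrt Y / S'\<^sup>2) \<le>
      (2 * (2 * S' ^ 3 / sqrt Y) + 1) * ((2 * (24 * S'\<^sup>2 / S) + 1) *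
      ((2 * (96 * S' * sqrt Y / S\<^sup>2) + 1) * (2 * (128 * Y / S ^ 3) + 1)))"
    using 1 unfolding K_def by simp
qed

text \<open>The sides of \<open>b\<close>, \<open>c\<close> and \<open>d\<close> are bounded below
  in terms of \<open>\<rho>\<close>, so they absorb the summand 1; the side of \<open>a\<close> may
  be below 1, so both of its summands are kept. The 1 yields \<open>Y / S\<close>, the order of the
  contribution of \<open>a = 0\<close>, and the side itself yields
  \<open>sqrt Y * S^2\<close>.\<close>

lemma card_reduced_range:
  assumes Y: "Y > 0" and S: "S > 0" and \<rho>: "\<rho> \<ge> 1"
  shows "real (card (form_class ` reduced_range Y S (\<rho> * S))) \<le> 10 ^ 7 * \<rho> ^ 9 * (Y / S + sqrt Y * S\<^sup>2)"
proof (cases "reduced_range Y S (\<rho> * S) = {}")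
  case True
  then show ?thesis using assms by simp
next
  case False
  then obtain f where f: "f \<in> reduced_range Y S (\<rho> * S)" by blast
  define y where "y = sqrt Y"
  have y: "y > 0" "Y = y\<^sup>2" using Y by (simp_all add: y_def)
  note b = reduced_sqrt_bounds[OF f Y, folded y_def]
  have s: "S \<le> sqrt (qP f)" "sqrt (qP f) \<le> \<rho> * S" using f by (auto simp: reduced_range_def)
  have \<rho>S: "1 \<le> \<rho> * S" using b(3) s(2) by linarith
  have "S * S \<le> sqrt (qP f) * sqrt (qR f)" using s b S by (intro mult_mono) linarith+
  then have SS: "S\<^sup>2 \<le> 2 * y" using b(2) by (simp add: power2_eq_square)
  define c where "c = real (card (form_class ` reduced_range Y S (\<rho> * S)))"
  have le: "S \<le> \<rho> * S" using \<rho> S by simp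
  have main: "c * (y / (\<rho> * S)\<^sup>2) \<le>
      (2 * (2 * (\<rho> * S) ^ 3 / y) + 1) * ((2 * (24 * (\<rho> * S)\<^sup>2 / S) + 1) *
      ((2 * (96 * (\<rho> * S) * y / S\<^sup>2) + 1) * (2 * (128 * Y / S ^ 3) + 1)))"
    unfolding c_def y_def by (rule card_reduced_range_box(2)[OF Y S le])
  have m1: "2 * (24 * (\<rho> * S)\<^sup>2 / S) + 1 \<le> 49 * \<rho>\<^sup>2 * S"
  proof -
    have "\<rho> * S \<le> \<rho>\<^sup>2 * S" using \<rho> S by (intro mult_right_mono) (auto simp: power2_eq_square)
    moreover have "24 * (\<rho> * S)\<^sup>2 / S = 24 * (\<rho>\<^sup>2 * S)" using S by (simp add: power2_eq_square)
    moreover have "49 * \<rho>\<^sup>2 * S = 49 * (\<rho>\<^sup>2 * S)" by simp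
    ultimately show ?thesis using \<rho>S by linarith
  qed
  have yS: "S \<le> 2 * (y / S)" using SS S by (simp add: power2_eq_square field_simps)
  have m2: "2 * (96 * (\<rho> * S) * y / S\<^sup>2) + 1 \<le> 194 * \<rho> * (y / S)"
  proof -
    have "\<rho> * S \<le> \<rho> * (2 * (y / S))" using yS \<rho> by (intro mult_left_mono) auto
    moreover define q where "q = \<rho> * (y / S)"
    moreover have e: "96 * (\<rho> * S) * y / S\<^sup>2 = 96 * q" "194 * \<rho> * (y / S) = 194 * q"
      using S by (simp_all add: q_def power2_eq_square)
    moreover have "\<rho> * (2 * (y / S)) = 2 * q" by (simp add: q_def)
    ultimately have "1 \<le> 2 * q" using \<rho>S by linarith
    then show ?thesis unfolding e by linarith
  qed
  have m3: "2 * (128 * Y / S ^ 3) + 1 \<le> 260 * \<rho> * (Y / S ^ 3)"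
  proof -
    have "S * S \<le> (2 * (y / S)) * (2 * (y / S))" using yS S y by (intro mult_mono) auto
    then have "S \<le> 4 * (Y / S ^ 3)" using S by (simp add: y(2) power2_eq_square power3_eq_cube field_simps)
    then have a: "\<rho> * S \<le> \<rho> * (4 * (Y / S ^ 3))" using \<rho> by (intro mult_left_mono) auto
    define q where "q = \<rho> * (Y / S ^ 3)"
    define r where "r = Y / S ^ 3"
    have e: "260 * \<rho> * (Y / S ^ 3) = 260 * q" "128 * Y / S ^ 3 = 128 * r" by (simp_all add: q_def r_def)
    have "\<rho> * (4 * (Y / S ^ 3)) = 4 * q" by (simp add: q_def)
    then have "1 \<le> 4 * q" using \<rho>S a by linarith
    moreover have "1 * r \<le> \<rho> * r" unfolding r_def using \<rho> S Y by (intro mult_right_mono) auto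
    then have "r \<le> q" by (simp add: q_def r_def)
    ultimately show ?thesis unfolding e by linarith
  qed
  have "c * (y / (\<rho> * S)\<^sup>2) \<le>
      (2 * (2 * (\<rho> * S) ^ 3 / y) + 1) * ((49 * \<rho>\<^sup>2 * S) * ((194 * \<rho> * (y / S)) * (260 * \<rho> * (Y / S ^ 3))))"
    using S y \<rho> Y by (intro order_trans[OF main] mult_left_mono mult_mono m1 m2 m3) (auto intro!: add_nonneg_nonneg mult_nonneg_nonneg divide_nonneg_nonneg)
  \<comment> \<open>The number is \<open>49 * 194 * 260\<close>, from the three estimates above;
    \<open>10 ^ 7\<close> is a round bound for four times it.\<close>
  also have "\<dots> = (2471560 * \<rho> ^ 6 * (Y / S) * (1 + 4 * (\<rho> * S) ^ 3 / y)) * (y / (\<rho> * S)\<^sup>2)"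
    using S y \<rho> by (simp add: field_simps power2_eq_square power3_eq_cube eval_nat_numeral)
  finally have "c \<le> 2471560 * \<rho> ^ 6 * (Y / S) * (1 + 4 * (\<rho> * S) ^ 3 / y)"
    using S y \<rho> by (subst (asm) mult_le_cancel_right) auto
  also have "\<dots> = 2471560 * \<rho> ^ 6 * (Y / S) + 9886240 * \<rho> ^ 9 * (y * S\<^sup>2)"
    using S y by (simp add: field_simps power2_eq_square power3_eq_cube eval_nat_numeral)
  also have "\<dots> \<le> 10 ^ 7 * \<rho> ^ 9 * (Y / S) + 10 ^ 7 * \<rho> ^ 9 * (y * S\<^sup>2)"
  proof -
    have "\<rho> ^ 6 \<le> \<rho> ^ 9" using \<rho> by (intro power_increasing) auto
    then show ?thesis using S y Y \<rho> by (intro add_mono mult_right_mono mult_mono) auto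
  qed
  finally show ?thesis unfolding c_def y_def by (simp add: algebra_simps)
qed

lemma dyadic_range:
  fixes x :: real assumes "x \<ge> 1" obtains i :: nat where "2 ^ i \<le> x" "x < 2 ^ (i + 1)"
proof -
  define k where "k = nat \<lfloor>x\<rfloor>"
  have "1 \<le> k" unfolding k_def using assms by (simp add: le_nat_iff le_floor_iff)
  then obtain n where n: "2 ^ n \<le> k" "k < 2 ^ (n + 1)" using ex_power_ivl1[of 2 k] by auto
  have kx: "real k \<le> x" "x < real k + 1" unfolding k_def using assms by (simp_all add: of_nat_nat)
  have "real (2 ^ n) \<le> real k" using n(1) by (simp only: of_nat_le_iff)
  moreover have "real (k + 1) \<le> real (2 ^ (n + 1))" using n(2) by (simp only: of_nat_le_iff Suc_leI Suc_eq_plus1[symmetric])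
  moreover have "real (2 ^ n) = 2 ^ n" "real (2 ^ (n + 1)) = 2 ^ (n + 1)" "real (k + 1) = real k + 1" by simp_all
  ultimately have "2 ^ n \<le> x" "x < 2 ^ (n + 1)" using kx by linarith+
  then show ?thesis by (rule that)
qed

lemma pow2_le_log:
  fixes X :: real assumes "X \<ge> 1" "2 ^ i \<le> X" shows "i \<le> nat \<lfloor>log 2 X\<rfloor>"
proof -
  have "real i = log 2 (2 ^ i)" by (simp add: log_nat_power)
  also have "\<dots> \<le> log 2 X" using assms by (subst log_le_cancel_iff) auto
  finally show ?thesis by (simp add: le_nat_iff le_floor_iff)
qed

section \<open>All classes of bounded discriminant\<close>

definition disc_classes :: "real \<Rightarrow> nat ring set set" where
  "disc_classes Y = form_class ` {f. disc f \<noteq> 0 \<and> \<bar>of_int (disc f)\<bar> \<le> Y}"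

lemma card_UN_le_const:
  assumes "finite A" "\<And>i. i \<in> A \<Longrightarrow> real (card (S i)) \<le> c"
  shows "real (card (\<Union>i\<in>A. S i)) \<le> real (card A) * c"
proof -
  have "real (card (\<Union>i\<in>A. S i)) \<le> (\<Sum>i\<in>A. real (card (S i)))"
    using card_UN_le[OF assms(1), of S] by (metis of_nat_le_iff of_nat_sum)
  also have "\<dots> \<le> (\<Sum>i\<in>A. c)" by (rule sum_mono) (rule assms(2))
  finally show ?thesis by simp
qed

lemma log2_bound:
  fixes X :: real assumes "X \<ge> 1" "\<eta> > 0"
  shows "log 2 X \<le> X powr \<eta> / (\<eta> * ln 2)"
proof -
  have "\<eta> * ln X = ln (X powr \<eta>)" using assms by (simp add: ln_powr)
  also have "\<dots> \<le> X powr \<eta>" using assms ln_less_self[of "X powr \<eta>"] by simp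
  finally have "ln X \<le> X powr \<eta> / \<eta>" using assms by (simp add: pos_le_divide_eq mult.commute)
  then have "ln X / ln 2 \<le> X powr \<eta> / \<eta> / ln 2" by (intro divide_right_mono) auto
  then show ?thesis by (simp add: log_def)
qed

lemma disc_classes_dyadic:
  fixes Y :: real assumes Y: "Y \<ge> 1"
  defines "L \<equiv> nat \<lfloor>log 2 (2 * Y)\<rfloor>"
  shows "disc_classes Y \<subseteq> (\<Union>(i, j)\<in>{..L} \<times> {..L}. form_class ` reduced_range (Y / 2 ^ i) (2 ^ j) (2 * 2 ^ j))"
proof
  fix \<kappa> assume "\<kappa> \<in> disc_classes Y"
  then obtain f0 where f0: "disc f0 \<noteq> 0" "\<bar>of_int (disc f0)\<bar> \<le> Y" "\<kappa> = form_class f0" by (auto simp: disc_classes_def)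
  obtain f where f: "form_equiv f f0" "reduced f" using reduced_exists[OF f0(1)] by blast
  have \<kappa>: "\<kappa> = form_class f" using f(1) f0(3) form_class_eq_iff by metis
  have d: "\<bar>of_int (disc f)\<bar> \<le> Y" using form_equiv_disc[OF f(1)] f0(2) by simp
  have d1: "1 \<le> \<bar>real_of_int (disc f)\<bar>" using abs_disc_ge_1 f(2) by (simp add: reduced_def)
  define \<Delta> where "\<Delta> = \<bar>real_of_int (disc f)\<bar>"
  have \<Delta>: "1 \<le> \<Delta>" "\<Delta> \<le> Y" using d d1 by (simp_all add: \<Delta>_def)
  have "1 \<le> Y / \<Delta>" using \<Delta> by simp
  then obtain i where i: "2 ^ i \<le> Y / \<Delta>" "Y / \<Delta> < 2 ^ (i + 1)" by (rule dyadic_range)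
  have i1: "\<Delta> \<le> Y / 2 ^ i" "Y / 2 ^ i / 2 < \<Delta>" using i \<Delta> by (simp_all add: field_simps)
  have s1: "1 \<le> sqrt (qP f)" using reduced_ge_1[OF f(2)] by simp
  then obtain j where j: "2 ^ j \<le> sqrt (qP f)" "sqrt (qP f) < 2 ^ (j + 1)" by (rule dyadic_range)
  have mem: "f \<in> reduced_range (Y / 2 ^ i) (2 ^ j) (2 * 2 ^ j)"
    using f(2) i1 j by (simp add: reduced_range_def \<Delta>_def)
  have "2 ^ i * 1 \<le> 2 ^ i * \<Delta>" using \<Delta> by (intro mult_left_mono) auto
  moreover have "2 ^ i * \<Delta> \<le> Y" using i(1) \<Delta> by (simp add: field_simps)
  ultimately have "2 ^ i \<le> 2 * Y" using Y by linarith
  then have iL: "i \<le> L" unfolding L_def using Y by (intro pow2_le_log) auto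
  have Yi: "Y / 2 ^ i > 0" using Y by simp
  note b = reduced_sqrt_bounds[OF mem Yi]
  have "2 ^ j * 1 \<le> sqrt (qP f) * sqrt (qR f)" using j b by (intro mult_mono) auto
  also have "\<dots> \<le> 2 * sqrt (Y / 2 ^ i)" by (rule b(2))
  also have "sqrt (Y / 2 ^ i) \<le> sqrt Y" using Y by (simp add: field_simps)
  also have "sqrt Y \<le> Y" using Y by (simp add: real_le_lsqrt power2_eq_square)
  finally have "2 ^ j \<le> 2 * Y" by simp
  then have jL: "j \<le> L" unfolding L_def using Y by (intro pow2_le_log) auto
  show "\<kappa> \<in> (\<Union>(i, j)\<in>{..L} \<times> {..L}. form_class ` reduced_range (Y / 2 ^ i) (2 ^ j) (2 * 2 ^ j))"
    using mem \<kappa> iL jL by blast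
qed

text \<open>Each pair of dyadic ranges contributes at most a constant times \<open>Y\<close>,
  because \<open>S^2 \<le> 2 sqrt Z\<close> whenever the range is not empty. There are about
  \<open>(log Y)^2\<close> pairs, and the excess of \<open>9 / 8\<close> over 1 pays for them.
  Finiteness is proved along with the bound, since \<open>card\<close> of an infinite set is
  0.\<close>

lemma disc_classes_bound:
  shows finite_disc_classes: "finite (disc_classes Y)"
    and card_disc_classes: "\<exists>C>0. \<forall>Y\<ge>0. real (card (disc_classes Y)) \<le> C * Y powr (9 / 8)"
proof -
  define C :: real where "C = (2 + 16 / ln 2)\<^sup>2 * (10 ^ 7 * 2 ^ 9 * 3)"
  have "2 + 16 / ln 2 > (0::real)" by (intro add_pos_pos divide_pos_pos) auto
  then have C0: "C > 0" unfolding C_def by (intro mult_pos_pos zero_less_power) auto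
  have empty: "disc_classes Y = {}" if "Y < 1" for Y
  proof -
    have "\<not> (disc f \<noteq> 0 \<and> \<bar>real_of_int (disc f)\<bar> \<le> Y)" for f using abs_disc_ge_1[of f] that by linarith
    then show ?thesis by (simp add: disc_classes_def)
  qed
  have main: "finite (disc_classes Y) \<and> real (card (disc_classes Y)) \<le> C * Y powr (9 / 8)" if Y: "Y \<ge> 1" for Y
  proof -
    define L where "L = nat \<lfloor>log 2 (2 * Y)\<rfloor>"
    let ?S = "\<lambda>(i, j). form_class ` reduced_range (Y / 2 ^ i) (2 ^ j) (2 * 2 ^ j)"
    let ?A = "{..L} \<times> {..L}"
    have sub: "disc_classes Y \<subseteq> (\<Union>ij\<in>?A. ?S ij)" unfolding L_def by (rule disc_classes_dyadic[OF Y])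
    have fin: "finite (?S ij)" for ij :: "nat \<times> nat"
    proof -
      obtain i j where ij: "ij = (i, j)" by fastforce
      show ?thesis unfolding ij prod.case by (rule card_reduced_range_box(1)) (use Y in auto)
    qed
    have each: "real (card (?S ij)) \<le> 10 ^ 7 * 2 ^ 9 * 3 * Y" for ij :: "nat \<times> nat"
    proof -
      obtain i j where ij: "ij = (i, j)" by fastforce
      define Z where "Z = Y / 2 ^ i"
      define S :: real where "S = 2 ^ j"
      have Z: "Z > 0" "Z \<le> Y" using Y by (simp_all add: Z_def field_simps)
      have S: "S \<ge> 1" by (simp add: S_def)
      show ?thesis
      proof (cases "reduced_range Z S (2 * S) = {}")
        case True
        then show ?thesis using Y by (simp add: ij Z_def S_def)
      next
        case False
        then obtain f where f: "f \<in> reduced_range Z S (2 * S)" by blast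
        note b = reduced_sqrt_bounds[OF f Z(1)]
        have "S \<le> sqrt (qP f)" using f by (simp add: reduced_range_def)
        then have "S * S \<le> sqrt (qP f) * sqrt (qR f)" using b S by (intro mult_mono) linarith+
        then have "S\<^sup>2 \<le> 2 * sqrt Z" using b(2) by (simp add: power2_eq_square)
        then have "sqrt Z * S\<^sup>2 \<le> sqrt Z * (2 * sqrt Z)" using Z by (intro mult_left_mono) auto
        moreover have "sqrt Z * (2 * sqrt Z) = 2 * Z" using Z by (simp add: mult.left_commute[of _ 2])
        ultimately have 1: "sqrt Z * S\<^sup>2 \<le> 2 * Z" by simp
        have 2: "Z / S \<le> Z" using Z S by (simp add: divide_le_eq mult_le_cancel_left1)
        have "real (card (form_class ` reduced_range Z S (2 * S))) \<le> 10 ^ 7 * 2 ^ 9 * (Z / S + sqrt Z * S\<^sup>2)"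
          using Z S by (intro card_reduced_range) auto
        also have "\<dots> \<le> 10 ^ 7 * 2 ^ 9 * (3 * Y)" using 1 2 Z by (intro mult_left_mono) (linarith, simp)
        finally show ?thesis by (simp add: ij Z_def S_def)
      qed
    qed
    have "finite (\<Union>ij\<in>?A. ?S ij)" using fin by (intro finite_UN_I) auto
    then have fin': "finite (disc_classes Y)" and "card (disc_classes Y) \<le> card (\<Union>ij\<in>?A. ?S ij)"
      using sub by (rule finite_subset[rotated], intro card_mono)
    then have "real (card (disc_classes Y)) \<le> real (card (\<Union>ij\<in>?A. ?S ij))" by simp
    also have "\<dots> \<le> real (card ?A) * (10 ^ 7 * 2 ^ 9 * 3 * Y)"
      by (rule card_UN_le_const) (use each in auto)
    also have "real (card ?A) = (real L + 1)\<^sup>2" by (simp add: power2_eq_square algebra_simps)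
    \<comment> \<open>The logarithm is bounded by \<open>Y powr (1 / 16)\<close>, so that its square
      costs \<open>1 / 8\<close> in the exponent.\<close>
    also have "(real L + 1)\<^sup>2 * (10 ^ 7 * 2 ^ 9 * 3 * Y) \<le> ((2 + 16 / ln 2) * Y powr (1 / 16))\<^sup>2 * (10 ^ 7 * 2 ^ 9 * 3 * Y)"
    proof (intro mult_right_mono power_mono)
      have "real L \<le> log 2 (2 * Y)" unfolding L_def using Y by (simp add: of_nat_nat)
      also have "log 2 (2 * Y) = 1 + log 2 Y" using Y by (simp add: log_mult)
      also have "log 2 Y \<le> Y powr (1 / 16) / (1 / 16 * ln 2)" by (rule log2_bound[OF Y]) simp
      finally have "real L + 1 \<le> 2 * 1 + 16 / ln 2 * Y powr (1 / 16)" by (simp add: mult.commute)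
      also have "2 * 1 \<le> 2 * Y powr (1 / 16)" using Y by (intro mult_left_mono ge_one_powr_ge_zero) auto
      finally show "real L + 1 \<le> (2 + 16 / ln 2) * Y powr (1 / 16)" by (simp add: algebra_simps)
    qed (use Y in auto)
    also have "\<dots> = C * (Y powr (1 / 16) * Y powr (1 / 16) * Y powr 1)"
      using Y by (simp add: C_def power2_eq_square)
    also have "Y powr (1 / 16) * Y powr (1 / 16) * Y powr 1 = Y powr (1 / 16 + 1 / 16 + 1)" by (simp only: powr_add)
    also have "1 / 16 + 1 / 16 + 1 = (9 / 8 :: real)" by simp
    finally show ?thesis using fin' by simp
  qed
  show "finite (disc_classes Y)" using main[of Y] empty[of Y] by (cases "Y < 1") auto
  have "real (card (disc_classes Y)) \<le> C * Y powr (9 / 8)" if "Y \<ge> 0" for Y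
  proof (cases "Y < 1")
    case True
    then show ?thesis using C0 by (simp add: empty)
  qed (use main[of Y] in auto)
  then show "\<exists>C>0. \<forall>Y\<ge>0. real (card (disc_classes Y)) \<le> C * Y powr (9 / 8)" using C0 by blast
qed

definition segment_forms :: "real \<Rightarrow> real \<Rightarrow> real \<Rightarrow> form set" where
  "segment_forms p c X = {f. reduced f \<and> \<bar>of_int (disc f)\<bar> \<le> X \<and>
     \<bar>of_int (disc f)\<bar> powr p / c \<le> sqrt (qP f) \<and> sqrt (qP f) \<le> c * \<bar>of_int (disc f)\<bar> powr p}"

text \<open>A dyadic decomposition of the discriminant alone suffices: it fixes
  \<open>sqrt (qP f)\<close> up to \<open>c^2\<close> and up to the variation of
  \<open>\<Delta> powr p\<close> within the range, at most a factor 2 because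
  \<open>p \<le> 1\<close>. With \<open>S\<close> of order \<open>Y powr p\<close> the two terms of
  \<open>card_reduced_range\<close> become the two exponents in \<open>E\<close>, and the number of
  ranges gives the logarithm.\<close>

lemma card_segment_forms:
  assumes p: "0 \<le> p" "p \<le> 1" and c: "c \<ge> 1"
  defines "E \<equiv> max (1 - p) (1 / 2 + 2 * p)"
  shows "\<exists>C>0. \<forall>X\<ge>1. real (card (form_class ` segment_forms p c X)) \<le> C * (1 + log 2 X) * X powr E"
proof -
  define \<rho> where "\<rho> = 2 * c\<^sup>2"
  define C where "C = 10 ^ 7 * \<rho> ^ 9 * (2 * c + 1)"
  have \<rho>: "\<rho> \<ge> 1" using c one_le_power[of c 2] unfolding \<rho>_def by linarith
  have C: "C > 0" using \<rho> c by (simp add: C_def)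
  have "real (card (form_class ` segment_forms p c X)) \<le> C * (1 + log 2 X) * X powr E" if X: "X \<ge> 1" for X
  proof -
    define L where "L = nat \<lfloor>log 2 X\<rfloor>"
    define Y where "Y i = X / 2 ^ i" for i :: nat
    define S where "S i = Y i powr p / (2 * c)" for i
    let ?B = "\<lambda>i. if Y i \<ge> 1 then form_class ` reduced_range (Y i) (S i) (\<rho> * S i) else {}"
    have sub: "form_class ` segment_forms p c X \<subseteq> (\<Union>i\<in>{..L}. ?B i)"
    proof (rule image_subsetI)
      fix f assume f: "f \<in> segment_forms p c X"
      then have r: "reduced f" by (simp add: segment_forms_def)
      define \<Delta> where "\<Delta> = \<bar>real_of_int (disc f)\<bar>"
      have \<Delta>: "1 \<le> \<Delta>" "\<Delta> \<le> X" and s: "\<Delta> powr p / c \<le> sqrt (qP f)" "sqrt (qP f) \<le> c * \<Delta> powr p"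
        using f abs_disc_ge_1[of f] by (simp_all add: segment_forms_def \<Delta>_def reduced_def)
      have "1 \<le> X / \<Delta>" using \<Delta> by simp
      then obtain i where i: "2 ^ i \<le> X / \<Delta>" "X / \<Delta> < 2 ^ (i + 1)" by (rule dyadic_range)
      have i1: "\<Delta> \<le> Y i" "Y i / 2 < \<Delta>" using i \<Delta> by (simp_all add: Y_def field_simps)
      have "2 ^ i * 1 \<le> 2 ^ i * \<Delta>" using \<Delta> by (intro mult_left_mono) auto
      moreover have "2 ^ i * \<Delta> \<le> X" using i(1) \<Delta> by (simp add: field_simps)
      ultimately have "2 ^ i \<le> X" by linarith
      then have iL: "i \<le> L" unfolding L_def using X by (intro pow2_le_log) auto
      have Y1: "Y i \<ge> 1" using i1 \<Delta> by simp
      have "Y i powr p / 2 \<le> Y i powr p / 2 powr p"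
        using p powr_mono[of p 1 2] by (intro divide_left_mono) auto
      also have "\<dots> = (Y i / 2) powr p" using Y1 by (simp add: powr_divide)
      also have "\<dots> \<le> \<Delta> powr p" using i1 Y1 p by (intro powr_mono2) auto
      finally have "Y i powr p / 2 / c \<le> \<Delta> powr p / c" using c by (intro divide_right_mono) auto
      then have S1: "S i \<le> sqrt (qP f)" using s(1) by (simp add: S_def)
      have "\<rho> * S i = c * Y i powr p" using c by (simp add: \<rho>_def S_def power2_eq_square)
      moreover have "c * \<Delta> powr p \<le> c * Y i powr p" using i1 \<Delta> p c by (intro mult_left_mono powr_mono2) auto
      ultimately have "sqrt (qP f) \<le> \<rho> * S i" using s(2) by linarith
      then have "f \<in> reduced_range (Y i) (S i) (\<rho> * S i)"
        using r i1 S1 by (simp add: reduced_range_def \<Delta>_def)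
      then have "form_class f \<in> ?B i" using Y1 by simp
      then show "form_class f \<in> (\<Union>i\<in>{..L}. ?B i)" using iL by blast
    qed
    have each: "real (card (?B i)) \<le> C * X powr E" for i
    proof (cases "Y i \<ge> 1")
      case True
      have S: "S i > 0" using True c by (simp add: S_def)
      have YX: "Y i \<le> X" using X by (simp add: Y_def field_simps)
      have mono: "Y i powr e \<le> X powr E" if "e \<le> E" for e
      proof -
        have "Y i powr e \<le> Y i powr E" using True that by (intro powr_mono) auto
        also have "\<dots> \<le> X powr E" using True YX p by (intro powr_mono2) (auto simp: E_def)
        finally show ?thesis .
      qed
      have "Y i / S i = 2 * c * Y i powr (1 - p)" using True by (simp add: S_def powr_diff)
      also have "\<dots> \<le> 2 * c * X powr E" using c by (intro mult_left_mono mono) (auto simp: E_def)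
      finally have 1: "Y i / S i \<le> 2 * c * X powr E" .
      have "Y i powr (1 / 2 + 2 * p) = sqrt (Y i) * (Y i powr p * Y i powr p)"
        using True by (simp add: powr_half_sqrt flip: powr_add) (simp add: powr_add powr_half_sqrt)
      then have "sqrt (Y i) * (S i)\<^sup>2 = Y i powr (1 / 2 + 2 * p) / (2 * c)\<^sup>2"
        unfolding S_def power_divide by (simp add: power2_eq_square[of "Y i powr p"])
      also have "\<dots> \<le> Y i powr (1 / 2 + 2 * p) / 1"
        using c one_le_power[of "2 * c" 2] by (intro divide_left_mono) auto
      also have "\<dots> \<le> X powr E" using mono[of "1 / 2 + 2 * p"] by (simp add: E_def)
      finally have 2: "sqrt (Y i) * (S i)\<^sup>2 \<le> X powr E" .
      have "real (card (form_class ` reduced_range (Y i) (S i) (\<rho> * S i))) \<le> 10 ^ 7 * \<rho> ^ 9 * (Y i / S i + sqrt (Y i) * (S i)\<^sup>2)"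
        using True S \<rho> by (intro card_reduced_range) auto
      also have "\<dots> \<le> 10 ^ 7 * \<rho> ^ 9 * (2 * c * X powr E + X powr E)"
        using 1 2 \<rho> by (intro mult_left_mono add_mono) auto
      also have "\<dots> = C * X powr E" by (simp add: C_def algebra_simps)
      finally show ?thesis using True by simp
    qed (use C in auto)
    have fin: "finite (?B i)" for i
    proof (cases "Y i \<ge> 1")
      case True
      then have "S i > 0" using c by (simp add: S_def)
      then show ?thesis using True \<rho> card_reduced_range_box(1)[of "Y i" "S i" "\<rho> * S i"] by auto
    qed auto
    have "real (card (form_class ` segment_forms p c X)) \<le> real (card (\<Union>i\<in>{..L}. ?B i))"
      by (intro of_nat_mono card_mono finite_UN_I finite_atMost fin sub)
    also have "\<dots> \<le> real (card {..L}) * (C * X powr E)"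
      by (rule card_UN_le_const) (use each in auto)
    also have "\<dots> \<le> (1 + log 2 X) * (C * X powr E)"
    proof (intro mult_right_mono)
      show "real (card {..L}) \<le> 1 + log 2 X" unfolding L_def using X by (simp add: of_nat_nat)
    qed (use C in auto)
    finally show ?thesis by (simp add: mult_ac)
  qed
  then show ?thesis using C by blast
qed

lemma growth_exponentI:
  assumes up: "\<And>\<eta>. \<eta> > 0 \<Longrightarrow> \<forall>\<^sub>F X in at_top. real (card (F X)) + 1 \<le> X powr (L + \<eta>)"
    and low: "\<And>\<eta>. \<eta> > 0 \<Longrightarrow> \<forall>\<^sub>F X in at_top. X powr (L - \<eta>) \<le> real (card (F X)) + 1"
  shows "growth_exponent F = Some L"
proof -
  let ?g = "\<lambda>X. ln (real (card (F X)) + 1) / ln X"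
  have lim: "(?g \<longlongrightarrow> L) at_top"
  proof (rule order_tendstoI)
    fix a assume "a < L"
    have "\<forall>\<^sub>F X in at_top. X powr (L - (L - a) / 2) \<le> real (card (F X)) + 1" using \<open>a < L\<close> by (intro low) simp
    then show "\<forall>\<^sub>F X in at_top. a < ?g X"
      using eventually_gt_at_top[of 1]
    proof eventually_elim
      case (elim X)
      have "ln (X powr (L - (L - a) / 2)) \<le> ln (real (card (F X)) + 1)" using elim by (subst ln_le_cancel_iff) auto
      then have "(L - (L - a) / 2) * ln X \<le> ln (real (card (F X)) + 1)" using elim by (simp add: ln_powr)
      then have "L - (L - a) / 2 \<le> ?g X" using elim by (simp add: pos_le_divide_eq)
      moreover have "a < L - (L - a) / 2" using \<open>a < L\<close> by (simp add: field_simps)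
      ultimately show ?case by linarith
    qed
  next
    fix a assume "L < a"
    have "\<forall>\<^sub>F X in at_top. real (card (F X)) + 1 \<le> X powr (L + (a - L) / 2)" using \<open>L < a\<close> by (intro up) simp
    then show "\<forall>\<^sub>F X in at_top. ?g X < a"
      using eventually_gt_at_top[of 1]
    proof eventually_elim
      case (elim X)
      have "ln (real (card (F X)) + 1) \<le> ln (X powr (L + (a - L) / 2))" using elim by (subst ln_le_cancel_iff) auto
      then have "ln (real (card (F X)) + 1) \<le> (L + (a - L) / 2) * ln X" using elim by (simp add: ln_powr)
      then have "?g X \<le> L + (a - L) / 2" using elim by (simp add: pos_divide_le_eq)
      moreover have "L + (a - L) / 2 < a" using \<open>L < a\<close> by (simp add: field_simps)
      ultimately show ?case by linarith
    qed
  qed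
  moreover have "Lim at_top ?g = L" by (rule tendsto_Lim[OF _ lim]) simp
  ultimately show ?thesis unfolding growth_exponent_def by auto
qed

section \<open>Overrings of prime index\<close>

fun scale_form :: "int \<Rightarrow> form \<Rightarrow> form" where
  "scale_form m (a, b, c, d) = (m * a, m * b, m * c, m * d)"

fun subst_form :: "form \<Rightarrow> int \<Rightarrow> int \<Rightarrow> int \<Rightarrow> int \<Rightarrow> form" where
  "subst_form (a, b, c, d) \<alpha> \<beta> \<gamma> \<delta> =
     (a * \<alpha> ^ 3 + b * \<alpha>\<^sup>2 * \<gamma> + c * \<alpha> * \<gamma>\<^sup>2 + d * \<gamma> ^ 3,
      3 * a * \<alpha>\<^sup>2 * \<beta> + b * (\<alpha>\<^sup>2 * \<delta> + 2 * \<alpha> * \<beta> * \<gamma>) + c * (2 * \<alpha> * \<gamma> * \<delta> + \<beta> * \<gamma>\<^sup>2) + 3 * d * \<gamma>\<^sup>2 * \<delta>,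
      3 * a * \<alpha> * \<beta>\<^sup>2 + b * (2 * \<alpha> * \<beta> * \<delta> + \<beta>\<^sup>2 * \<gamma>) + c * (\<alpha> * \<delta>\<^sup>2 + 2 * \<beta> * \<gamma> * \<delta>) + 3 * d * \<gamma> * \<delta>\<^sup>2,
      a * \<beta> ^ 3 + b * \<beta>\<^sup>2 * \<delta> + c * \<beta> * \<delta>\<^sup>2 + d * \<delta> ^ 3)"

lemma feval_scale: "feval (scale_form m f) x y = m * feval f x y"
  by (cases f) (simp add: algebra_simps)

lemma feval_subst: "feval (subst_form f \<alpha> \<beta> \<gamma> \<delta>) x y = feval f (\<alpha> * x + \<beta> * y) (\<gamma> * x + \<delta> * y)"
  by (cases f) (simp add: algebra_simps power2_eq_square power3_eq_cube)

lemma feval_homogeneous: "feval f (k * x) (k * y) = k ^ 3 * feval f x y"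
  by (cases f) (simp add: algebra_simps power2_eq_square power3_eq_cube)

text \<open>The matrix \<open>- 1\<close> has determinant 1 and changes the sign of a cubic form, so
  a form is equivalent to its negative and the sign \<open>e\<close> can be adjusted to the
  determinant.\<close>

lemma form_equivI:
  assumes det: "\<bar>\<alpha> * \<delta> - \<beta> * \<gamma>\<bar> = 1" and e: "\<bar>e\<bar> = 1"
    and ev: "\<And>x y. feval f (\<alpha> * x + \<beta> * y) (\<gamma> * x + \<delta> * y) = e * feval g x y"
  shows "form_equiv g f"
proof -
  have 1: "form_equiv k f" if dt: "\<bar>\<alpha> * \<delta> - \<beta> * \<gamma>\<bar> = 1"
     and k: "\<And>x y. feval f (\<alpha> * x + \<beta> * y) (\<gamma> * x + \<delta> * y) = (\<alpha> * \<delta> - \<beta> * \<gamma>) * feval k x y"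
    for k f \<alpha> \<beta> \<gamma> \<delta>
  proof -
    obtain k' where k': "form_equiv k' f" "\<And>x y. qf k' x y = qf f (\<alpha> * x + \<beta> * y) (\<gamma> * x + \<delta> * y)"
      "\<And>x y. feval f (\<alpha> * x + \<beta> * y) (\<gamma> * x + \<delta> * y) = (\<alpha> * \<delta> - \<beta> * \<gamma>) * feval k' x y"
      by (rule GL2_equiv[OF dt, of f]) (rule that; assumption)
    have "\<alpha> * \<delta> - \<beta> * \<gamma> \<noteq> 0" using dt by auto
    then have "feval k x y = feval k' x y" for x y using k[of x y] k'(3)[of x y] by simp
    then have "k = k'" by (rule feval_inject)
    then show ?thesis using k'(1) by simp
  qed
  define s where "s = e * (\<alpha> * \<delta> - \<beta> * \<gamma>)"
  have s: "s = 1 \<or> s = - 1" using det e by (auto simp: s_def abs_if split: if_splits)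
  have ee: "e * e = 1" using e by (auto simp: abs_if split: if_splits)
  have dd: "(\<alpha> * \<delta> - \<beta> * \<gamma>) * (\<alpha> * \<delta> - \<beta> * \<gamma>) = 1"
    using abs_mult_self_eq[of "\<alpha> * \<delta> - \<beta> * \<gamma>"] det by simp
  define k where "k = scale_form s g"
  have "form_equiv k f"
  proof (rule 1[OF det])
    fix x y
    have "(\<alpha> * \<delta> - \<beta> * \<gamma>) * feval k x y = ((\<alpha> * \<delta> - \<beta> * \<gamma>) * (\<alpha> * \<delta> - \<beta> * \<gamma>)) * (e * feval g x y)"
      unfolding k_def feval_scale s_def by (simp only: mult_ac)
    then show "feval f (\<alpha> * x + \<beta> * y) (\<gamma> * x + \<delta> * y) = (\<alpha> * \<delta> - \<beta> * \<gamma>) * feval k x y"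
      unfolding dd ev by simp
  qed
  moreover have "form_equiv g k"
  proof (cases "s = 1")
    case True
    then have "k = g" by (cases g) (simp add: k_def)
    then show ?thesis by (simp add: form_equiv_refl)
  next
    case False
    then have "s = - 1" using s by simp
    then show ?thesis
      by (intro 1[of "-1" "-1" 0 0]) (cases g; simp add: k_def)+
  qed
  ultimately show ?thesis by (rule form_equiv_trans[rotated])
qed

lemma form_equivE:
  assumes "form_equiv f g"
  obtains \<alpha> \<beta> \<gamma> \<delta> where "\<bar>\<alpha> * \<delta> - \<beta> * \<gamma>\<bar> = 1"
    "\<And>x y. feval g (\<alpha> * x + \<beta> * y) (\<gamma> * x + \<delta> * y) = (\<alpha> * \<delta> - \<beta> * \<gamma>) * feval f x y"
proof -
  obtain h where h: "h \<in> ring_iso (form_ring f) (form_ring g)"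
    using assms unfolding form_equiv_def is_ring_iso_def by blast
  obtain n m \<alpha> \<beta> \<gamma> \<delta> where
    "\<And>x0 x1 x2. h (x0,x1,x2) = (x0 + n * x1 + m * x2, \<alpha> * x1 + \<beta> * x2, \<gamma> * x1 + \<delta> * x2)" and
    ev: "\<And>x y. feval g (\<alpha> * x + \<beta> * y) (\<gamma> * x + \<delta> * y) = (\<alpha> * \<delta> - \<beta> * \<gamma>) * feval f x y" and
    det: "\<bar>\<alpha> * \<delta> - \<beta> * \<gamma>\<bar> = 1"
    using h by (rule form_ring_isoE) (rule that; assumption)
  show ?thesis using det ev by (rule that)
qed

text \<open>One row of the matrix is not divisible by \<open>p\<close>. The primitive integer vector
  orthogonal to this row kills it exactly; the other row sends the vector to the determinant
  divided, up to sign, by the gcd of the first row, and this gcd is prime to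
  \<open>q\<close>.\<close>

lemma kernel_vector:
  fixes \<alpha> \<beta> \<gamma> \<delta> q :: int
  assumes p: "prime p" and q: "q = p ^ j" and det: "q dvd \<alpha> * \<delta> - \<beta> * \<gamma>"
    and nz: "\<not> (p dvd \<alpha> \<and> p dvd \<beta> \<and> p dvd \<gamma> \<and> p dvd \<delta>)"
  obtains u v where "coprime u v" "q dvd \<alpha> * u + \<beta> * v" "q dvd \<gamma> * u + \<delta> * v"
proof -
  have key: "\<exists>u v. coprime u v \<and> a * u + b * v = 0 \<and> q dvd c * u + d * v"
    if nz: "\<not> (p dvd a \<and> p dvd b)" and det: "q dvd a * d - b * c" for a b c d
  proof -
    define G where "G = gcd a b"
    have "\<not> p dvd G" using nz by (auto simp: G_def)
    then have cop: "coprime q G" using p by (simp add: q prime_imp_coprime)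
    have "G \<noteq> 0" using nz by (auto simp: G_def)
    then obtain a' b' where ab: "a = a' * G" "b = b' * G" "coprime a' b'"
      using gcd_coprime_exists[of a b] G_def by (metis gcd_eq_0_iff)
    have "a * d - b * c = G * (a' * d - b' * c)" by (simp add: ab algebra_simps)
    then have "q dvd G * (a' * d - b' * c)" using det by simp
    then have "q dvd a' * d - b' * c" using cop by (simp add: coprime_dvd_mult_right_iff)
    moreover have "c * (- b') + d * a' = a' * d - b' * c" by (simp add: algebra_simps)
    ultimately have "q dvd c * (- b') + d * a'" by (simp only:)
    moreover have "coprime (- b') a'" using ab(3) by (simp add: coprime_commute)
    moreover have "a * (- b') + b * a' = 0" by (simp add: ab)
    ultimately show ?thesis by blast
  qed
  show ?thesis
  proof (cases "p dvd \<alpha> \<and> p dvd \<beta>")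
    case False
    then show ?thesis using key[OF False det] that by fastforce
  next
    case True
    then have "\<not> (p dvd \<gamma> \<and> p dvd \<delta>)" using nz by blast
    moreover have "q dvd \<gamma> * \<beta> - \<delta> * \<alpha>" using det by (simp add: mult.commute dvd_diff_commute)
    ultimately obtain u v where "coprime u v" "\<gamma> * u + \<delta> * v = 0" "q dvd \<alpha> * u + \<beta> * v"
      using key by blast
    then show ?thesis using that by simp
  qed
qed

lemma extract_power:
  fixes m :: int assumes "m \<noteq> 0" "prime p" obtains j n where "m = p ^ j * n" "\<not> p dvd n"
  using assms by (metis not_prime_unit multiplicity_decompose')

text \<open>A form that is the pullback of an integral form under a sublattice of index divisible by
  \<open>p\<close> is divisible by \<open>p\<close> or has, after a change of basis, a double root modulo \<open>p\<close> at which it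
  vanishes modulo \<open>p\<^sup>2\<close>: this is the \<open>p\<close>-part of the Smith normal form.\<close>

definition nonmax_at :: "int \<Rightarrow> form \<Rightarrow> bool" where
  "nonmax_at p f \<longleftrightarrow> (\<exists>g. f = scale_form p g) \<or>
     (\<exists>a b c d. form_equiv (a, b, p * c, p\<^sup>2 * d) f)"

lemma nonmax_at_if_pullback:
  fixes p :: int
  assumes p: "prime p" and m: "m = \<alpha> * \<delta> - \<beta> * \<gamma>" "m \<noteq> 0" "p dvd m"
    and ev: "\<And>x y. feval g (\<alpha> * x + \<beta> * y) (\<gamma> * x + \<delta> * y) = m * feval f x y"
  shows "nonmax_at p f"
proof -
  have p0: "p \<noteq> 0" using p by auto
  \<comment> \<open>The power \<open>p ^ i\<close> in the content of the matrix is split off; what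
    remains has an entry prime to \<open>p\<close>, as \<open>kernel_vector\<close> demands.\<close>
  define G where "G = gcd (gcd \<alpha> \<beta>) (gcd \<gamma> \<delta>)"
  have G0: "G \<noteq> 0" using m by (auto simp: G_def)
  obtain i G' where i: "G = p ^ i * G'" "\<not> p dvd G'" using extract_power[OF G0 p] by blast
  have "p ^ i dvd G" using i by simp
  then have "p ^ i dvd \<alpha>" "p ^ i dvd \<beta>" "p ^ i dvd \<gamma>" "p ^ i dvd \<delta>" by (simp_all add: G_def)
  then obtain \<alpha>1 \<beta>1 \<gamma>1 \<delta>1 where r: "\<alpha> = p ^ i * \<alpha>1" "\<beta> = p ^ i * \<beta>1" "\<gamma> = p ^ i * \<gamma>1" "\<delta> = p ^ i * \<delta>1"
    by (auto elim!: dvdE)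
  have nz: "\<not> (p dvd \<alpha>1 \<and> p dvd \<beta>1 \<and> p dvd \<gamma>1 \<and> p dvd \<delta>1)"
  proof
    assume "p dvd \<alpha>1 \<and> p dvd \<beta>1 \<and> p dvd \<gamma>1 \<and> p dvd \<delta>1"
    then have "p ^ i * p dvd G" unfolding G_def r by (simp add: mult_dvd_mono)
    then show False using i p0 by simp
  qed
  define m1 where "m1 = \<alpha>1 * \<delta>1 - \<beta>1 * \<gamma>1"
  have mm: "m = (p ^ i)\<^sup>2 * m1" by (simp add: m(1) r m1_def power2_eq_square algebra_simps)
  have m10: "m1 \<noteq> 0" using m(2) mm by auto
  \<comment> \<open>The cubic form scales by \<open>p^(3 i)\<close> and the determinant by
    \<open>p^(2 i)\<close>, so one factor \<open>p ^ i\<close> survives on the left.\<close>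
  have ev1: "p ^ i * feval g (\<alpha>1 * x + \<beta>1 * y) (\<gamma>1 * x + \<delta>1 * y) = m1 * feval f x y" for x y
  proof -
    have "(p ^ i) ^ 3 * feval g (\<alpha>1 * x + \<beta>1 * y) (\<gamma>1 * x + \<delta>1 * y) = (p ^ i)\<^sup>2 * m1 * feval f x y"
      using ev[of x y] unfolding feval_homogeneous[symmetric] mm r by (simp add: algebra_simps)
    then have "(p ^ i)\<^sup>2 * (p ^ i * feval g (\<alpha>1 * x + \<beta>1 * y) (\<gamma>1 * x + \<delta>1 * y)) = (p ^ i)\<^sup>2 * (m1 * feval f x y)"
      by (simp add: power2_eq_square power3_eq_cube mult.assoc)
    then show ?thesis using p0 by (simp add: mult_left_cancel)
  qed
  show ?thesis
  proof (cases "p dvd m1")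
    case False
    then have "i > 0" using m(3) mm p by (cases i) (auto simp: prime_dvd_mult_iff)
    then obtain i' where i': "i = Suc i'" by (cases i) auto
    have "scale_form (p ^ i) (subst_form g \<alpha>1 \<beta>1 \<gamma>1 \<delta>1) = scale_form m1 f"
      by (rule feval_inject) (simp only: feval_scale feval_subst ev1)
    moreover obtain a b c d where f: "f = (a, b, c, d)" by (metis prod_cases4)
    moreover obtain a' b' c' d' where "subst_form g \<alpha>1 \<beta>1 \<gamma>1 \<delta>1 = (a', b', c', d')" by (metis prod_cases4)
    ultimately have "p * (p ^ i' * a') = m1 * a" "p * (p ^ i' * b') = m1 * b" "p * (p ^ i' * c') = m1 * c"
       "p * (p ^ i' * d') = m1 * d" by (simp_all add: i' mult.assoc)
    then have "p dvd m1 * a" "p dvd m1 * b" "p dvd m1 * c" "p dvd m1 * d" by (metis dvd_triv_left)+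
    then have "p dvd a" "p dvd b" "p dvd c" "p dvd d" using False p by (simp_all add: prime_dvd_mult_iff)
    then obtain a1 b1 c1 d1 where "f = scale_form p (a1, b1, c1, d1)" by (auto simp: f elim!: dvdE)
    then show ?thesis unfolding nonmax_at_def by blast
  next
    case True
    obtain j n where jn: "m1 = p ^ j * n" "\<not> p dvd n" using extract_power[OF m10 p] by blast
    have "j > 0" using True jn by (cases j) auto
    then obtain j' where j': "j = Suc j'" by (cases j) auto
    have "p ^ j dvd \<alpha>1 * \<delta>1 - \<beta>1 * \<gamma>1" using jn by (simp add: m1_def)
    \<comment> \<open>With the kernel vector modulo \<open>p ^ j\<close> as second basis vector, the
      second column of the matrix is divisible by \<open>p ^ j\<close>. The last two coefficients of
      the pullback then carry \<open>p^(2 j)\<close> and \<open>p^(3 j)\<close>, of which the factor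
      \<open>m1 = p ^ j * n\<close> takes away one \<open>p ^ j\<close>.\<close>
    then obtain u v where uv: "coprime u v" "p ^ j dvd \<alpha>1 * u + \<beta>1 * v" "p ^ j dvd \<gamma>1 * u + \<delta>1 * v"
      using kernel_vector[OF p refl _ nz] by blast
    then obtain B C where BC: "\<alpha>1 * u + \<beta>1 * v = p ^ j * B" "\<gamma>1 * u + \<delta>1 * v = p ^ j * C" by (auto elim!: dvdE)
    obtain k l where kl: "k * u + l * v = 1" using uv(1) bezout_int by (metis coprime_iff_gcd_eq_1)
    have det: "\<bar>l * v - u * (- k)\<bar> = 1" using kl by (simp add: algebra_simps)
    obtain f1 where f1: "form_equiv f1 f" "\<And>x y. qf f1 x y = qf f (l * x + u * y) ((- k) * x + v * y)"
      "\<And>x y. feval f (l * x + u * y) ((- k) * x + v * y) = (l * v - u * (- k)) * feval f1 x y"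
      by (rule GL2_equiv[OF det, of f]) (rule that; assumption)
    define A D where AD: "A = \<alpha>1 * l - \<beta>1 * k" "D = \<gamma>1 * l - \<delta>1 * k"
    obtain ga gb gc gd where g: "g = (ga, gb, gc, gd)" by (metis prod_cases4)
    obtain a b c d where f: "f1 = (a, b, c, d)" by (metis prod_cases4)
    have "scale_form (p ^ i) (subst_form g A (p ^ j * B) D (p ^ j * C)) = scale_form m1 f1"
    proof (rule feval_inject, unfold feval_scale feval_subst)
      fix x y
      have "m1 * feval f1 x y = p ^ i * feval g (\<alpha>1 * (l * x + u * y) + \<beta>1 * ((- k) * x + v * y))
          (\<gamma>1 * (l * x + u * y) + \<delta>1 * ((- k) * x + v * y))"
        unfolding ev1 f1(3) using kl by (simp add: algebra_simps)
      moreover have "\<alpha>1 * (l * x + u * y) + \<beta>1 * ((- k) * x + v * y) = A * x + (p ^ j * B) * y"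
         unfolding BC[symmetric] AD by (simp add: algebra_simps)
      moreover have "\<gamma>1 * (l * x + u * y) + \<delta>1 * ((- k) * x + v * y) = D * x + (p ^ j * C) * y"
         unfolding BC[symmetric] AD by (simp add: algebra_simps)
      ultimately show "p ^ i * feval g (A * x + (p ^ j * B) * y) (D * x + (p ^ j * C) * y) = m1 * feval f1 x y"
        by simp
    qed
    then have e: "p ^ i * (3 * ga * A * (p ^ j * B)\<^sup>2 + gb * (2 * A * (p ^ j * B) * (p ^ j * C) + (p ^ j * B)\<^sup>2 * D)
        + gc * (A * (p ^ j * C)\<^sup>2 + 2 * (p ^ j * B) * D * (p ^ j * C)) + 3 * gd * D * (p ^ j * C)\<^sup>2) = m1 * c"
      "p ^ i * (ga * (p ^ j * B) ^ 3 + gb * (p ^ j * B)\<^sup>2 * (p ^ j * C) + gc * (p ^ j * B) * (p ^ j * C)\<^sup>2 + gd * (p ^ j * C) ^ 3) = m1 * d"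
      unfolding g f subst_form.simps scale_form.simps prod.inject by blast+
    define H3 where "H3 = p ^ i * (3 * ga * A * B\<^sup>2 + gb * (2 * A * B * C + B\<^sup>2 * D) + gc * (A * C\<^sup>2 + 2 * B * D * C) + 3 * gd * D * C\<^sup>2)"
    define H4 where "H4 = p ^ i * (ga * B ^ 3 + gb * B\<^sup>2 * C + gc * B * C\<^sup>2 + gd * C ^ 3)"
    have "p ^ j * (p ^ j * H3) = p ^ j * (n * c)"
      using e(1) unfolding jn H3_def by (simp add: algebra_simps power2_eq_square)
    then have "p ^ j * H3 = n * c" using p0 by (simp add: mult_left_cancel)
    then have "p * (p ^ j' * H3) = n * c" by (simp add: j' mult.assoc)
    then have "p dvd n * c" by (metis dvd_triv_left)
    then have pc: "p dvd c" using jn(2) p by (simp add: prime_dvd_mult_iff)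
    have "p ^ j * (p ^ j * (p ^ j * H4)) = p ^ j * (n * d)"
      using e(2) unfolding jn H4_def by (simp add: algebra_simps power2_eq_square power3_eq_cube)
    then have "p ^ j * (p ^ j * H4) = n * d" using p0 by (simp add: mult_left_cancel)
    then have "p\<^sup>2 * (p ^ j' * p ^ j' * H4) = n * d" by (simp add: j' power2_eq_square mult_ac)
    then have "p\<^sup>2 dvd n * d" by (metis dvd_triv_left)
    moreover have "coprime (p\<^sup>2) n" using jn(2) p by (simp add: prime_imp_coprime)
    ultimately have pd: "p\<^sup>2 dvd d" by (simp add: coprime_dvd_mult_right_iff)
    obtain c' d' where "c = p * c'" "d = p\<^sup>2 * d'" using pc pd by (auto elim!: dvdE)
    then have "form_equiv (a, b, p * c', p\<^sup>2 * d') f" using f1(1) f by simp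
    then show ?thesis unfolding nonmax_at_def by blast
  qed
qed

text \<open>The discriminant is homogeneous of degree 4, and \<open>(a, b, p c, p^2 d)\<close> has
  the overform \<open>(p a, b, c, d)\<close>, whose discriminant is smaller by the factor
  \<open>p^2\<close>.\<close>

lemma nonmax_at_disc:
  assumes "nonmax_at p f" shows "p\<^sup>2 dvd disc f"
proof -
  consider g where "f = scale_form p g" | a b c d where "form_equiv (a, b, p * c, p\<^sup>2 * d) f"
    using assms unfolding nonmax_at_def by blast
  then show ?thesis
  proof cases
    case 1
    obtain a b c d where g: "g = (a, b, c, d)" by (metis prod_cases4)
    have "disc f = p\<^sup>2 * (p\<^sup>2 * disc g)"
      unfolding 1 g by (simp add: algebra_simps power2_eq_square power3_eq_cube)
    then show ?thesis by (rule dvdI)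
  next
    case 2
    have "disc f = p\<^sup>2 * disc (p * a, b, c, d)"
      unfolding form_equiv_disc[OF 2, symmetric] by (simp add: algebra_simps power2_eq_square power3_eq_cube)
    then show ?thesis by simp
  qed
qed

text \<open>A proper overring is a homomorphism whose matrix modulo the integers has a determinant
  \<open>D\<close> that is nonzero by injectivity and no unit since the image is proper; any prime
  divisor of \<open>D\<close> will do. This turns maximality into a condition on the coefficients
  that can be sieved.\<close>

lemma not_maximal_imp_nonmax_at:
  fixes R :: "nat ring"
  assumes R: "rank_ring 3 R" and h: "h \<in> ring_iso (form_ring f) R" and nm: "\<not> maximal_ring 3 R"
  shows "\<exists>p. prime p \<and> nonmax_at p f"
proof -
  obtain S :: "nat ring" and \<phi> where S: "rank_ring 3 S" and \<phi>: "\<phi> \<in> Ring.ring_hom R S"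
    "inj_on \<phi> (carrier R)" "\<phi> ` carrier R \<noteq> carrier S"
    using nm R by (auto simp: maximal_ring_def)
  obtain g k where k: "k \<in> ring_iso (form_ring g) S"
    using rank_3_ring_iso_form_ring[OF S] unfolding is_ring_iso_def by blast
  define k' where "k' = inv_into UNIV k"
  have k': "k' \<in> ring_iso S (form_ring g)"
    using ring_iso_set_sym[OF cring.axioms(1)[OF cring_form_ring] k] by (simp add: k'_def)
  define \<psi> where "\<psi> = k' \<circ> (\<phi> \<circ> h)"
  have "\<phi> \<circ> h \<in> Ring.ring_hom (form_ring f) S" using h \<phi>(1) by (intro ring_hom_trans) (auto simp: ring_iso_def)
  moreover have "k' \<in> Ring.ring_hom S (form_ring g)" using k' by (simp add: ring_iso_def)
  ultimately have \<psi>: "\<psi> \<in> Ring.ring_hom (form_ring f) (form_ring g)"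
    unfolding \<psi>_def by (rule ring_hom_trans)
  have bh: "bij_betw h UNIV (carrier R)" using ring_iso_form_ringE(1)[OF h] .
  have bk: "bij_betw k UNIV (carrier S)" using ring_iso_form_ringE(1)[OF k] .
  have bk': "bij_betw k' (carrier S) UNIV" unfolding k'_def by (rule bij_betw_inv_into[OF bk])
  have \<phi>S: "\<phi> ` carrier R \<subseteq> carrier S" using \<phi>(1) by (auto simp: Ring.ring_hom_def)
  have img: "\<psi> ` UNIV = k' ` (\<phi> ` carrier R)" unfolding \<psi>_def image_comp[symmetric] using bh unfolding bij_betw_def by simp
  have inj: "inj \<psi>"
  proof (rule injI)
    fix x y assume "\<psi> x = \<psi> y"
    then have eq: "k' (\<phi> (h x)) = k' (\<phi> (h y))" by (simp add: \<psi>_def)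
    have hR: "h z \<in> carrier R" for z using bh by (rule bij_betwE[THEN bspec]) simp
    have "\<phi> (h x) = \<phi> (h y)"
      using bij_betw_imp_inj_on[OF bk'] eq by (rule inj_onD) (use hR \<phi>S in blast)+
    with \<phi>(2) have "h x = h y" by (rule inj_onD) (use hR in blast)+
    then show "x = y" using bij_betw_imp_inj_on[OF bh] by (simp add: inj_eq)
  qed
  have nsurj: "\<not> surj \<psi>"
  proof
    assume "surj \<psi>"
    then have "k' ` (\<phi> ` carrier R) = k' ` carrier S" using img bk' by (simp add: bij_betw_def)
    then have "\<phi> ` carrier R = carrier S"
      by (rule inj_on_image_eq_iff[OF bij_betw_imp_inj_on[OF bk'] \<phi>S order_refl, THEN iffD1])
    then show False using \<phi>(3) by simp
  qed
  obtain n m \<alpha> \<beta> \<gamma> \<delta> where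
    lin: "\<And>x0 x1 x2. \<psi> (x0,x1,x2) = (x0 + n * x1 + m * x2, \<alpha> * x1 + \<beta> * x2, \<gamma> * x1 + \<delta> * x2)" and
    ev: "\<And>x y. feval g (\<alpha> * x + \<beta> * y) (\<gamma> * x + \<delta> * y) = (\<alpha> * \<delta> - \<beta> * \<gamma>) * feval f x y"
    using \<psi> by (rule form_ring_homE) (rule that; assumption)
  define D where "D = \<alpha> * \<delta> - \<beta> * \<gamma>"
  have ker: "x = 0 \<and> y = 0" if "\<alpha> * x + \<beta> * y = 0" "\<gamma> * x + \<delta> * y = 0" for x y
  proof -
    have "\<psi> (- (n * x + m * y), x, y) = \<psi> (0, 0, 0)" unfolding lin using that by simp
    then have "(- (n * x + m * y), x, y) = (0, 0, 0)" by (rule injD[OF inj])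
    then show ?thesis by simp
  qed
  have D0: "D \<noteq> 0"
  proof
    assume "D = 0"
    then have e: "\<alpha> * \<delta> = \<beta> * \<gamma>" by (simp add: D_def)
    have 1: "\<delta> = 0 \<and> - \<gamma> = 0" by (rule ker) (simp_all add: e algebra_simps)
    have 2: "- \<beta> = 0 \<and> \<alpha> = 0" by (rule ker) (simp_all add: e algebra_simps)
    have "(1::int) = 0 \<and> (0::int) = 0" by (rule ker) (use 1 2 in simp_all)
    then show False by simp
  qed
  have "\<bar>D\<bar> \<noteq> 1"
  proof
    assume "\<bar>D\<bar> = 1"
    then have DD: "D * D = 1" by (auto simp: abs_if split: if_splits)
    have "\<exists>x. \<psi> x = y" for y
    proof -
      obtain y0 y1 y2 where y: "y = (y0,y1,y2)" by (metis prod_cases3)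
      define x1 where "x1 = D * (\<delta> * y1 - \<beta> * y2)"
      define x2 where "x2 = D * (\<alpha> * y2 - \<gamma> * y1)"
      have "\<alpha> * x1 + \<beta> * x2 = D * D * y1" "\<gamma> * x1 + \<delta> * x2 = D * D * y2"
        unfolding x1_def x2_def by (simp_all add: D_def algebra_simps)
      then have "\<psi> (y0 - n * x1 - m * x2, x1, x2) = y" unfolding lin y DD by simp
      then show ?thesis by blast
    qed
    then have "surj \<psi>" unfolding surj_def by metis
    then show False using nsurj by simp
  qed
  then obtain p where "prime p" "p dvd D" using prime_divisor_exists[of D] D0 by (auto simp: zdvd1_eq)
  then show ?thesis using nonmax_at_if_pullback[OF _ D_def D0 _ ev[folded D_def]] by blast
qed

section \<open>Roots modulo a prime and the number of forms with an overform\<close>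

lemma prime_dvd_diff_eq:
  fixes p :: int assumes "p dvd x - y" "x \<in> {0..<p}" "y \<in> {0..<p}" shows "x = y"
proof (rule ccontr)
  assume "x \<noteq> y"
  then have "p \<le> \<bar>x - y\<bar>" using assms(1) zdvd_imp_le[of p "\<bar>x - y\<bar>"] by simp
  then show False using assms(2,3) by auto
qed

lemma finite_residues: "finite {t\<in>{0..<p::int}. Q t}"
  by (rule finite_subset[of _ "{0..<p}"]) auto

lemma card_linear_roots:
  fixes p :: int assumes p: "prime p" and b: "\<not> p dvd b"
  shows "card {t\<in>{0..<p}. p dvd a + b * t} \<le> 1"
proof -
  have "t = t'" if "t \<in> {0..<p}" "t' \<in> {0..<p}" "p dvd a + b * t" "p dvd a + b * t'" for t t'
  proof -
    have "p dvd (a + b * t) - (a + b * t')" using that by (intro dvd_diff)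
    then have "p dvd b * (t - t')" by (simp add: algebra_simps)
    then have "p dvd t - t'" using b p by (simp add: prime_dvd_mult_iff)
    then show ?thesis using that by (intro prime_dvd_diff_eq)
  qed
  then have "\<forall>t\<in>{t\<in>{0..<p}. p dvd a + b * t}. \<forall>t'\<in>{t\<in>{0..<p}. p dvd a + b * t}. t = t'" by blast
  then show ?thesis unfolding One_nat_def card_le_Suc0_iff_eq[OF finite_residues] .
qed

text \<open>The induction step of Lagrange's bound without polynomial rings: \<open>g t0\<close> is
  the difference quotient at a root \<open>t0\<close> and has one degree less.\<close>

lemma card_le_of_root:
  fixes p :: int
  assumes p: "prime p" and g: "\<And>t t0. f t - f t0 = (t - t0) * g t0 t"
    and c: "\<And>t0. card {t\<in>{0..<p}. p dvd g t0 t} \<le> n"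
  shows "card {t\<in>{0..<p}. p dvd f t} \<le> Suc n"
proof (cases "{t\<in>{0..<p}. p dvd f t} = {}")
  case False
  then obtain t0 where t0: "t0 \<in> {0..<p}" "p dvd f t0" by blast
  have "{t\<in>{0..<p}. p dvd f t} \<subseteq> insert t0 {t\<in>{0..<p}. p dvd g t0 t}"
  proof
    fix t assume t: "t \<in> {t\<in>{0..<p}. p dvd f t}"
    then have "p dvd f t - f t0" using t0 by (intro dvd_diff) auto
    then have "p dvd t - t0 \<or> p dvd g t0 t" unfolding g using p by (simp add: prime_dvd_mult_iff)
    then show "t \<in> insert t0 {t\<in>{0..<p}. p dvd g t0 t}" using t t0 prime_dvd_diff_eq[of p t t0] by auto
  qed
  then have "card {t\<in>{0..<p}. p dvd f t} \<le> card (insert t0 {t\<in>{0..<p}. p dvd g t0 t})"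
    by (intro card_mono finite.insertI finite_residues)
  also have "\<dots> \<le> Suc (card {t\<in>{0..<p}. p dvd g t0 t})" by (rule card_insert_le_m1) auto
  finally show ?thesis using c[of t0] by simp
qed (simp only: card.empty le0)

lemma card_cubic_roots:
  fixes p :: int assumes p: "prime p" and nz: "\<not> (p dvd a \<and> p dvd b \<and> p dvd c \<and> p dvd d)"
  shows "card {t\<in>{0..<p}. p dvd a + b * t + c * t\<^sup>2 + d * t ^ 3} \<le> 3"
proof -
  have quad: "card {t\<in>{0..<p}. p dvd a + b * t + c * t\<^sup>2} \<le> Suc 1" if "\<not> p dvd c" for a b c
  proof (rule card_le_of_root[OF p, where g = "\<lambda>t0 t. (b + c * t0) + c * t"])
    show "card {t\<in>{0..<p}. p dvd (b + c * t0) + c * t} \<le> 1" for t0 by (rule card_linear_roots[OF p that])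
  qed (simp add: algebra_simps power2_eq_square)
  have cubic: "card {t\<in>{0..<p}. p dvd a + b * t + c * t\<^sup>2 + d * t ^ 3} \<le> Suc (Suc 1)" if "\<not> p dvd d" for a b c
  proof (rule card_le_of_root[OF p, where g = "\<lambda>t0 t. (b + c * t0 + d * t0\<^sup>2) + (c + d * t0) * t + d * t\<^sup>2"])
    show "card {t\<in>{0..<p}. p dvd (b + c * t0 + d * t0\<^sup>2) + (c + d * t0) * t + d * t\<^sup>2} \<le> Suc 1" for t0
      by (rule quad[OF that])
  qed (simp add: algebra_simps power2_eq_square power3_eq_cube)
  show ?thesis
  proof (cases "p dvd d")
    case False
    then show ?thesis using cubic[OF False, of a b c] by simp
  next
    case d: True
    then have e1: "p dvd a + b * t + c * t\<^sup>2 + d * t ^ 3 \<longleftrightarrow> p dvd a + b * t + c * t\<^sup>2" for t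
      by (simp add: dvd_add_left_iff)
    show ?thesis
    proof (cases "p dvd c")
      case False
      then show ?thesis using quad[OF False, of a b] by (simp add: e1)
    next
      case c: True
      then have e2: "p dvd a + b * t + c * t\<^sup>2 \<longleftrightarrow> p dvd a + b * t" for t by (simp add: dvd_add_left_iff)
      show ?thesis
      proof (cases "p dvd b")
        case False
        then show ?thesis using card_linear_roots[OF p False, of a] by (simp add: e1 e2)
      next
        case b: True
        then have "\<not> p dvd a + b * t" for t using nz c d by (simp add: dvd_add_left_iff)
        then show ?thesis by (simp add: e1 e2)
      qed
    qed
  qed
qed

text \<open>The second alternative of \<open>nonmax_at\<close>. It is kept apart because it comes
  with an overform of index \<open>p\<close> that can be counted; the first alternative is covered
  by a condition on the content.\<close>

definition overform_at :: "int \<Rightarrow> form \<Rightarrow> bool" where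
  "overform_at p f \<longleftrightarrow> (\<exists>a b c d. form_equiv (a, b, p * c, p\<^sup>2 * d) f)"

text \<open>Each form in question determines an integral overform of discriminant \<open>Disc f / p\<^sup>2\<close>
  together with a root of it modulo \<open>p\<close>, from which the form is recovered up to equivalence.\<close>

lemma card_overform_at:
  fixes p :: int
  assumes p: "prime p" and F: "finite F" "inj_on form_class F"
    and disc: "\<And>f. f \<in> F \<Longrightarrow> disc f \<noteq> 0 \<and> \<bar>real_of_int (disc f)\<bar> \<le> X" and X: "X < of_int p ^ 6"
  shows "card {f\<in>F. overform_at p f} \<le> 4 * card (disc_classes (X / (of_int p)\<^sup>2))"
proof -
  define Bad where "Bad = {f\<in>F. overform_at p f}"
  have p0: "p > 0" using p prime_gt_0_int by blast
  have "\<exists>a b c d. form_equiv (a, b, p * c, p\<^sup>2 * d) f" if "f \<in> Bad" for f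
    using that by (simp add: Bad_def overform_at_def)
  then obtain a b c d where abcd: "\<And>f. f \<in> Bad \<Longrightarrow> form_equiv (a f, b f, p * c f, p\<^sup>2 * d f) f" by metis
  define f1 where "f1 f = (a f, b f, p * c f, p\<^sup>2 * d f)" for f
  define f2 where "f2 f = (p * a f, b f, c f, d f)" for f
  have f1: "form_equiv (f1 f) f" if "f \<in> Bad" for f using abcd[OF that] by (simp add: f1_def)
  have f12: "p * feval (f1 f) x y = feval (f2 f) x (p * y)" for f x y
    by (simp add: f1_def f2_def algebra_simps power2_eq_square power3_eq_cube)
  have disc2: "disc f = p\<^sup>2 * disc (f2 f)" if "f \<in> Bad" for f
    unfolding form_equiv_disc[OF f1[OF that], symmetric]
    by (simp add: f1_def f2_def algebra_simps power2_eq_square power3_eq_cube)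
  have disc2': "disc (f2 f) \<noteq> 0 \<and> \<bar>real_of_int (disc (f2 f))\<bar> \<le> X / (of_int p)\<^sup>2" if "f \<in> Bad" for f
  proof -
    have "disc f \<noteq> 0" "\<bar>real_of_int (disc f)\<bar> \<le> X" using disc that by (auto simp: Bad_def)
    then show ?thesis using disc2[OF that] p0 by (simp add: abs_mult field_simps)
  qed
  \<comment> \<open>A fixed representative of each class, so that the roots of different overforms
    in the same class can be compared.\<close>
  define rep where "rep \<kappa> = (SOME g. form_class g = \<kappa>)" for \<kappa>
  define g where "g f = rep (form_class (f2 f))" for f
  have "form_class (g f) = form_class (f2 f)" for f
    unfolding g_def rep_def by (rule someI[of "\<lambda>g. form_class g = form_class (f2 f)"]) simp
  then have g2: "form_equiv (f2 f) (g f)" for f by (metis form_class_eq_iff)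
  have "\<exists>\<alpha> \<beta> \<gamma> \<delta>. \<bar>\<alpha> * \<delta> - \<beta> * \<gamma>\<bar> = 1 \<and>
      (\<forall>x y. feval (g f) (\<alpha> * x + \<beta> * y) (\<gamma> * x + \<delta> * y) = (\<alpha> * \<delta> - \<beta> * \<gamma>) * feval (f2 f) x y)" for f
    using form_equivE[OF g2] by metis
  then obtain A B C D where det: "\<And>f. \<bar>A f * D f - B f * C f\<bar> = 1"
    and ev: "\<And>f x y. feval (g f) (A f * x + B f * y) (C f * x + D f * y) = (A f * D f - B f * C f) * feval (f2 f) x y"
    by metis
  define e where "e f = A f * D f - B f * C f" for f
  have ee: "e f * e f = 1" for f using abs_mult_self_eq[of "e f"] det[of f] by (simp add: e_def)
  have root: "p dvd feval (g f) (A f) (C f)" for f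
    using ev[of f 1 0] by (simp add: f2_def)
  \<comment> \<open>The root is a point of the projective line modulo \<open>p\<close>:
    \<open>t\<close> stands for \<open>(1 : t)\<close>, and \<open>- 1\<close> codes the point at
    infinity \<open>(0 : 1)\<close>. It is the image of \<open>(1 : 0)\<close>, a root of
    \<open>f2 f\<close> because \<open>p\<close> divides the leading coefficient.\<close>
  have "\<exists>t. (p dvd A f \<longrightarrow> t = - 1) \<and> (\<not> p dvd A f \<longrightarrow> t \<in> {0..<p} \<and> p dvd A f * t - C f)" for f
  proof (cases "p dvd A f")
    case False
    then have "coprime (A f) p" using p by (simp add: prime_imp_coprime coprime_commute)
    then obtain u v where uv: "u * A f + v * p = 1" by (metis bezout_int coprime_iff_gcd_eq_1)
    define t where "t = (u * C f) mod p"
    have "p dvd u * C f - t" unfolding t_def by (rule dvd_minus_mod)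
    then have "p dvd A f * (u * C f - t)" by simp
    moreover have "A f * t - C f = - (A f * (u * C f - t)) - p * (v * C f)"
      using arg_cong[OF uv, of "\<lambda>z. z * C f"] by (simp add: algebra_simps)
    ultimately have "p dvd A f * t - C f" by simp
    moreover have "t \<in> {0..<p}" using p0 by (simp add: t_def)
    ultimately show ?thesis using False by blast
  qed simp
  then obtain pt where pt: "\<And>f. p dvd A f \<Longrightarrow> pt f = - 1"
    "\<And>f. \<not> p dvd A f \<Longrightarrow> pt f \<in> {0..<p} \<and> p dvd A f * pt f - C f" by metis
  define Z where "Z \<kappa> = insert (- 1) {t\<in>{0..<p}. p dvd feval (rep \<kappa>) 1 t}" for \<kappa>
  have ptZ: "pt f \<in> Z (form_class (f2 f))" for f
  proof (cases "p dvd A f")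
    case False
    note t = pt(2)[OF False]
    then obtain k where k: "A f * pt f = C f + p * k" by (metis dvdE diff_eq_eq add.commute)
    obtain ga gb gc gd where G: "g f = (ga, gb, gc, gd)" by (metis prod_cases4)
    have "feval (g f) (A f) (C f + p * k) = feval (g f) (A f) (C f) + p * (k * (gb * (A f)\<^sup>2 + gc * A f * (2 * C f + p * k)
       + gd * (3 * (C f)\<^sup>2 + 3 * C f * p * k + p\<^sup>2 * k\<^sup>2)))"
      by (simp add: G algebra_simps power2_eq_square power3_eq_cube)
    then have "p dvd feval (g f) (A f) (C f + p * k)" using root[of f] by simp
    moreover have "feval (g f) (A f) (C f + p * k) = A f ^ 3 * feval (g f) 1 (pt f)"
      unfolding k[symmetric] using feval_homogeneous[of "g f" "A f" 1 "pt f"] by simp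
    ultimately have "p dvd A f ^ 3 * feval (g f) 1 (pt f)" by simp
    then have "p dvd feval (g f) 1 (pt f)" using False p by (auto simp: prime_dvd_mult_iff dest: prime_dvd_power)
    then show ?thesis using t by (simp add: Z_def g_def)
  qed (simp add: Z_def pt(1))
  \<comment> \<open>Three finite roots and the point at infinity. The representative does not vanish
    modulo \<open>p\<close>: otherwise its discriminant would be divisible by \<open>p ^ 4\<close>
    and that of \<open>f\<close> by \<open>p ^ 6\<close>, against \<open>X < p ^ 6\<close>.\<close>
  have cardZ: "card (Z (form_class (f2 f))) \<le> 4" if "f \<in> Bad" for f
  proof -
    obtain ga gb gc gd where G: "g f = (ga, gb, gc, gd)" by (metis prod_cases4)
    have nz: "\<not> (p dvd ga \<and> p dvd gb \<and> p dvd gc \<and> p dvd gd)"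
    proof
      assume "p dvd ga \<and> p dvd gb \<and> p dvd gc \<and> p dvd gd"
      then obtain ha hb hc hd where h: "ga = p * ha" "gb = p * hb" "gc = p * hc" "gd = p * hd" by (auto elim!: dvdE)
      have "disc f = p\<^sup>2 * disc (g f)" using disc2[OF that] form_equiv_disc[OF g2[of f]] by simp
      also have "\<dots> = p ^ 6 * disc (ha, hb, hc, hd)"
        by (simp add: G h eval_nat_numeral algebra_simps)
      finally have "p ^ 6 dvd \<bar>disc f\<bar>" by simp
      moreover have "disc f \<noteq> 0" "\<bar>real_of_int (disc f)\<bar> \<le> X" using disc that by (auto simp: Bad_def)
      ultimately have "p ^ 6 \<le> \<bar>disc f\<bar>" by (intro zdvd_imp_le) auto
      then have "real_of_int (p ^ 6) \<le> real_of_int \<bar>disc f\<bar>" by (simp only: of_int_le_iff)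
      then show False using X \<open>\<bar>real_of_int (disc f)\<bar> \<le> X\<close> by simp
    qed
    have "card (Z (form_class (f2 f))) \<le> Suc (card {t\<in>{0..<p}. p dvd feval (g f) 1 t})"
      unfolding Z_def g_def by (rule card_insert_le_m1) auto
    also have "{t\<in>{0..<p}. p dvd feval (g f) 1 t} = {t\<in>{0..<p}. p dvd ga + gb * t + gc * t\<^sup>2 + gd * t ^ 3}"
      by (simp add: G)
    also have "Suc (card \<dots>) \<le> 4" using card_cubic_roots[OF p nz] by simp
    finally show ?thesis .
  qed
  have inj: "inj_on (\<lambda>f. (form_class (f2 f), pt f)) Bad"
  proof (rule inj_onI)
    fix f h assume fh: "f \<in> Bad" "h \<in> Bad" and eq: "(form_class (f2 f), pt f) = (form_class (f2 h), pt h)"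
    have G: "g f = g h" using eq by (simp add: g_def)
    have ptq: "pt f = pt h" using eq by simp
    have "p dvd A f * C h - C f * A h"
    proof (cases "p dvd A f")
      case True
      then have "p dvd A h" using ptq pt(1)[of f] pt(2)[of h] by auto
      then show ?thesis using True by simp
    next
      case False
      then have "\<not> p dvd A h" using ptq pt(1)[of h] pt(2)[of f] by auto
      then have "p dvd A h * pt f - C h" using ptq pt(2) by simp
      moreover have "p dvd A f * pt f - C f" using pt(2)[OF False] by blast
      ultimately have "p dvd A h * (A f * pt f - C f) - A f * (A h * pt f - C h)" by simp
      then show ?thesis by (simp add: algebra_simps)
    qed
    then obtain r where r: "A f * C h - C f * A h = p * r" by (metis dvdE)
    \<comment> \<open>The transition matrix between the two overforms is
      \<open>(M1, M2; p M3, M4)\<close>: equal roots mean that \<open>p\<close> divides its lower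
      left entry. Conjugation by the diagonal matrix \<open>(1, p)\<close> therefore keeps it
      integral and makes it an equivalence between \<open>f1 f\<close> and
      \<open>f1 h\<close>.\<close>
    define M1 M2 M3 M4 where M: "M1 = e f * (D f * A h - B f * C h)" "M2 = e f * (D f * B h - B f * D h)"
      "M3 = e f * r" "M4 = e f * (A f * D h - C f * B h)"
    have M3: "p * M3 = e f * (A f * C h - C f * A h)" by (simp add: M r)
    have e1: "e f * (A f * D f - B f * C f) * z = z" for z using ee[of f] by (simp add: e_def)
    have WM1: "A f * (M1 * x + M2 * y) + B f * (p * M3 * x + M4 * y) = A h * x + B h * y" for x y
    proof -
      have "A f * (M1 * x + M2 * y) + B f * (p * M3 * x + M4 * y) = e f * (A f * D f - B f * C f) * (A h * x + B h * y)"
        unfolding M3 M(1,2,4) by (simp add: algebra_simps)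
      then show ?thesis by (simp only: e1)
    qed
    have WM2: "C f * (M1 * x + M2 * y) + D f * (p * M3 * x + M4 * y) = C h * x + D h * y" for x y
    proof -
      have "C f * (M1 * x + M2 * y) + D f * (p * M3 * x + M4 * y) = e f * (A f * D f - B f * C f) * (C h * x + D h * y)"
        unfolding M3 M(1,2,4) by (simp add: algebra_simps)
      then show ?thesis by (simp only: e1)
    qed
    have f2h: "e h * feval (f2 h) x y = e f * feval (f2 f) (M1 * x + M2 * y) (p * M3 * x + M4 * y)" for x y
      using ev[of h x y] ev[of f "M1 * x + M2 * y" "p * M3 * x + M4 * y"]
      unfolding WM1 WM2 G e_def[symmetric] by simp
    have "p * (e f * feval (f1 f) (M1 * x + (p * M2) * y) (M3 * x + M4 * y)) = p * (e h * feval (f1 h) x y)" for x y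
    proof -
      have "p * (e h * feval (f1 h) x y) = e h * feval (f2 h) x (p * y)" using f12[of h x y] by (simp add: mult.left_commute)
      also have "\<dots> = e f * feval (f2 f) (M1 * x + (p * M2) * y) (p * (M3 * x + M4 * y))"
        unfolding f2h by (simp add: algebra_simps)
      also have "\<dots> = p * (e f * feval (f1 f) (M1 * x + (p * M2) * y) (M3 * x + M4 * y))"
        unfolding f12[symmetric] by (simp add: mult.left_commute)
      finally show ?thesis by (rule sym)
    qed
    then have 1: "e f * feval (f1 f) (M1 * x + (p * M2) * y) (M3 * x + M4 * y) = e h * feval (f1 h) x y" for x y
      using p0 by simp
    have 2: "feval (f1 f) (M1 * x + (p * M2) * y) (M3 * x + M4 * y) = (e f * e h) * feval (f1 h) x y" for x y
    proof -
      have "feval (f1 f) (M1 * x + (p * M2) * y) (M3 * x + M4 * y) = e f * e f * feval (f1 f) (M1 * x + (p * M2) * y) (M3 * x + M4 * y)"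
        by (simp add: ee)
      also have "\<dots> = e f * (e f * feval (f1 f) (M1 * x + (p * M2) * y) (M3 * x + M4 * y))" by (simp only: mult.assoc)
      finally show ?thesis unfolding 1 by (simp only: mult.assoc)
    qed
    have "M1 * M4 - (p * M2) * M3 = M1 * M4 - M2 * (p * M3)" by (simp add: mult_ac)
    also have "\<dots> = (e f * e f) * ((A f * D f - B f * C f) * (A h * D h - B h * C h))"
      unfolding M3 M(1,2,4) by (simp add: algebra_simps)
    also have "\<dots> = e f * e h" unfolding ee e_def[symmetric] by simp
    finally have dM: "M1 * M4 - (p * M2) * M3 = e f * e h" .
    have eu: "\<bar>e f * e h\<bar> = 1" using det[of f] det[of h] by (simp add: abs_mult e_def)
    have "form_equiv (f1 h) (f1 f)"
      by (rule form_equivI[OF _ eu 2]) (simp add: dM eu)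
    then have "form_equiv h f" using f1[OF fh(1)] f1[OF fh(2)] by (meson form_equiv_sym form_equiv_trans)
    then have "form_class h = form_class f" by (simp add: form_class_eq_iff)
    then show "f = h" using F(2) fh by (auto simp: Bad_def inj_on_def)
  qed
  define K where "K = (\<lambda>f. form_class (f2 f)) ` Bad"
  have KD: "K \<subseteq> disc_classes (X / (of_int p)\<^sup>2)" unfolding K_def disc_classes_def using disc2' by blast
  have finK: "finite K" using KD finite_disc_classes by (rule finite_subset)
  have finZ: "finite (Z \<kappa>)" for \<kappa> by (simp only: Z_def finite_insert finite_residues)
  have "(\<lambda>f. (form_class (f2 f), pt f)) ` Bad \<subseteq> Sigma K Z" using ptZ by (auto simp: K_def)
  then have "card Bad \<le> card (Sigma K Z)" using inj finK finZ by (intro card_inj_on_le[OF inj]) auto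
  also have "\<dots> = (\<Sum>\<kappa>\<in>K. card (Z \<kappa>))" using finK finZ by (simp add: card_SigmaI)
  also have "\<dots> \<le> (\<Sum>\<kappa>\<in>K. 4)" using cardZ by (intro sum_mono) (auto simp: K_def)
  also have "\<dots> \<le> 4 * card (disc_classes (X / (of_int p)\<^sup>2))"
    using card_mono[OF finite_disc_classes KD] by simp
  finally show ?thesis by (simp add: Bad_def)
qed

text \<open>Telescoping with \<open>1 / (k + 1)^2 \<le> 1 / k - 1 / (k + 1)\<close>; the
  \<open>max\<close> lets the induction run through the empty ranges.\<close>

lemma sum_inverse_squares:
  assumes "t \<ge> 1" shows "(\<Sum>k=Suc t..n. 1 / (real k)\<^sup>2) \<le> 1 / real t"
proof -
  have "(\<Sum>k=Suc t..n. 1 / (real k)\<^sup>2) \<le> 1 / real t - 1 / real (max t n)"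
  proof (induction n)
    case (Suc n)
    show ?case
    proof (cases "Suc n \<le> t")
      case False
      then have n: "t \<le> n" "n \<ge> 1" using assms by auto
      have "1 / (real (Suc n))\<^sup>2 \<le> 1 / (real n * real (Suc n))"
        using n by (intro divide_left_mono) (auto simp: power2_eq_square)
      also have "\<dots> = 1 / real n - 1 / real (Suc n)" using n by (simp add: field_simps)
      finally show ?thesis using Suc.IH n by (simp add: max_def)
    qed (use assms in \<open>simp add: max_def\<close>)
  qed (use assms in \<open>simp add: max_def\<close>)
  moreover have "0 \<le> 1 / real (max t n)" by simp
  ultimately show ?thesis by linarith
qed

text \<open>\<open>X \<le> t ^ 6\<close> makes \<open>card_overform_at\<close> applicable to every
  prime beyond \<open>t\<close>, with a bound of order \<open>(X / k^2) powr (9 / 8)\<close>. The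
  resulting \<open>k powr (- 9 / 4)\<close> is split into \<open>k powr (- 1 / 4)\<close>, estimated
  at \<open>t\<close>, and \<open>k powr (- 2)\<close>, summed by telescoping. Only primes up to
  \<open>X\<close> occur, as \<open>p^2\<close> divides the discriminant.\<close>

lemma card_overform_large:
  assumes C: "\<forall>Y\<ge>0. real (card (disc_classes Y)) \<le> C * Y powr (9 / 8)" "C > 0"
    and F: "finite F" "inj_on form_class F"
    and disc: "\<And>f. f \<in> F \<Longrightarrow> disc f \<noteq> 0 \<and> \<bar>real_of_int (disc f)\<bar> \<le> X"
    and X: "X \<ge> 1" and t: "t \<ge> 1" "X \<le> real t ^ 6"
  shows "real (card {f\<in>F. \<exists>p. prime p \<and> p > int t \<and> overform_at p f}) \<le> 4 * C * X powr (9 / 8) * real t powr (- 5 / 4)"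
proof -
  define n where "n = nat \<lfloor>X\<rfloor>"
  let ?S = "\<lambda>k::nat. if prime (int k) then {f\<in>F. overform_at (int k) f} else {}"
  have sub: "{f\<in>F. \<exists>p. prime p \<and> p > int t \<and> overform_at p f} \<subseteq> (\<Union>k\<in>{Suc t..n}. ?S k)"
  proof
    fix f assume "f \<in> {f\<in>F. \<exists>p. prime p \<and> p > int t \<and> overform_at p f}"
    then obtain p where f: "f \<in> F" and p: "prime p" "p > int t" "overform_at p f" by blast
    have "nonmax_at p f" using p(3) by (auto simp: nonmax_at_def overform_at_def)
    then have "p\<^sup>2 dvd \<bar>disc f\<bar>" using nonmax_at_disc by simp
    then have "p\<^sup>2 \<le> \<bar>disc f\<bar>" using disc[OF f] by (intro zdvd_imp_le) auto
    moreover have "p \<le> p\<^sup>2" using p(2) by (simp add: power2_eq_square)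
    ultimately have "real_of_int p \<le> real_of_int \<bar>disc f\<bar>" by (simp only: of_int_le_iff)
    then have "real_of_int p \<le> X" using disc[OF f] by simp
    then have "nat p \<le> n" unfolding n_def by (simp add: le_floor_iff nat_mono)
    moreover have "f \<in> ?S (nat p)" using f p by simp
    ultimately show "f \<in> (\<Union>k\<in>{Suc t..n}. ?S k)" using p(2) by (intro UN_I[of "nat p"]) auto
  qed
  have each: "real (card (?S k)) \<le> 4 * C * X powr (9 / 8) * real t powr (- 1 / 4) * (1 / (real k)\<^sup>2)" if k: "k \<in> {Suc t..n}" for k
  proof (cases "prime (int k)")
    case True
    have "real t ^ 6 < real k ^ 6" using k t by (intro power_strict_mono) auto
    then have X6: "X < of_int (int k) ^ 6" using t(2) by simp
    have "real (card (?S k)) \<le> 4 * real (card (disc_classes (X / (real k)\<^sup>2)))"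
      using card_overform_at[OF True F disc X6] True by simp
    also have "\<dots> \<le> 4 * (C * (X / (real k)\<^sup>2) powr (9 / 8))" using C(1) X by simp
    also have "(X / (real k)\<^sup>2) powr (9 / 8) = X powr (9 / 8) * real k powr (- 9 / 4)"
    proof -
      have "(real k)\<^sup>2 = real k powr 2" using k by simp
      then have "(X / (real k)\<^sup>2) powr (9 / 8) = X powr (9 / 8) / (real k powr 2) powr (9 / 8)"
        using X k by (simp only: powr_divide)
      also have "(real k powr 2) powr (9 / 8) = real k powr (9 / 4)" unfolding powr_powr by simp
      finally show ?thesis by (simp add: powr_minus field_simps)
    qed
    also have "real k powr (- 9 / 4) = real k powr (- 1 / 4) * real k powr (- 2)" by (simp flip: powr_add)
    also have "real k powr (- 2) = 1 / (real k)\<^sup>2" using k by (simp add: powr_minus_divide)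
    also have "4 * (C * (X powr (9 / 8) * (real k powr (- 1 / 4) * (1 / (real k)\<^sup>2))))
        \<le> 4 * (C * (X powr (9 / 8) * (real t powr (- 1 / 4) * (1 / (real k)\<^sup>2))))"
      using C(2) k t by (intro mult_left_mono mult_right_mono powr_mono2') auto
    finally show ?thesis by (simp only: mult.assoc)
  next
    case False
    then show ?thesis using C by simp
  qed
  have "real (card {f\<in>F. \<exists>p. prime p \<and> p > int t \<and> overform_at p f}) \<le> real (card (\<Union>k\<in>{Suc t..n}. ?S k))"
    using sub F(1) by (intro of_nat_mono card_mono finite_UN_I) auto
  also have "\<dots> \<le> (\<Sum>k\<in>{Suc t..n}. real (card (?S k)))"
    unfolding of_nat_sum[symmetric] by (intro of_nat_mono card_UN_le finite_atLeastAtMost)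
  also have "\<dots> \<le> (\<Sum>k\<in>{Suc t..n}. 4 * C * X powr (9 / 8) * real t powr (- 1 / 4) * (1 / (real k)\<^sup>2))"
    by (rule sum_mono[OF each])
  also have "\<dots> = 4 * C * X powr (9 / 8) * real t powr (- 1 / 4) * (\<Sum>k=Suc t..n. 1 / (real k)\<^sup>2)"
    by (simp only: sum_distrib_left)
  also have "\<dots> \<le> 4 * C * X powr (9 / 8) * real t powr (- 1 / 4) * (1 / real t)"
    using C(2) by (intro mult_left_mono sum_inverse_squares t(1)) auto
  also have "\<dots> = 4 * C * X powr (9 / 8) * real t powr (- 5 / 4)"
  proof -
    have "real t powr (- 1 / 4) * (1 / real t) = real t powr (- 1 / 4) * real t powr (- 1)"
      using t by (simp add: powr_minus_divide)
    also have "\<dots> = real t powr (- 5 / 4)" unfolding powr_add[symmetric] by simp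
    finally show ?thesis by (simp only: mult.assoc)
  qed
  finally show ?thesis .
qed

section \<open>A sieve for maximal rings\<close>

lemma card_residue_class:
  fixes S :: "int set"
  assumes S: "S \<subseteq> {x0..<x0 + l}" and k: "k > 0" and l: "l \<ge> 0"
    and cong: "\<And>x y. x \<in> S \<Longrightarrow> y \<in> S \<Longrightarrow> k dvd x - y"
  shows "real (card S) \<le> real_of_int l / real_of_int k + 1"
proof (cases "S = {}")
  case False
  have fin: "finite S" using S by (rule finite_subset) simp
  define s where "s = Min S"
  have s: "s \<in> S" "\<And>x. x \<in> S \<Longrightarrow> s \<le> x" using fin False by (auto simp: s_def)
  have inj: "inj_on (\<lambda>x. (x - s) div k) S"
  proof (rule inj_onI)
    fix x y assume xy: "x \<in> S" "y \<in> S" "(x - s) div k = (y - s) div k"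
    have "k * ((x - s) div k) = x - s" "k * ((y - s) div k) = y - s"
      using cong[OF xy(1) s(1)] cong[OF xy(2) s(1)] by simp_all
    then show "x = y" using xy(3) by (metis diff_add_cancel)
  qed
  have img: "(\<lambda>x. (x - s) div k) ` S \<subseteq> {0..l div k}"
  proof (rule image_subsetI)
    fix x assume x: "x \<in> S"
    have "s \<in> {x0..<x0 + l}" "x \<in> {x0..<x0 + l}" using S s(1) x by blast+
    then have "0 \<le> x - s" "x - s \<le> l" using s(2)[OF x] by auto
    then show "(x - s) div k \<in> {0..l div k}" using k by (simp add: zdiv_mono1 pos_imp_zdiv_nonneg_iff)
  qed
  have "card S \<le> card {0..l div k}" by (rule card_inj_on_le[OF inj img]) simp
  then have "int (card S) \<le> l div k + 1"
    using l k by (simp add: le_nat_iff pos_imp_zdiv_nonneg_iff)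
  then have "real_of_int (int (card S)) \<le> real_of_int (l div k + 1)" by (simp only: of_int_le_iff)
  then have "real (card S) \<le> real_of_int (l div k) + 1" by simp
  also have "real_of_int (l div k) \<le> real_of_int l / real_of_int k" by (rule real_of_int_div4)
  finally show ?thesis by simp
qed (use k l in simp)

text \<open>The syzygy between the Hessian, the cubic covariant and the discriminant of a cubic
  form, taken at the point \<open>(1, 0)\<close>.\<close>

lemma disc_resolvent:
  "4 * (b\<^sup>2 - 3 * a * c) ^ 3 = (2 * b ^ 3 - 9 * a * b * c + 27 * a\<^sup>2 * d)\<^sup>2 + 27 * a\<^sup>2 * disc (a, b, c, d)"
  by (simp add: algebra_simps power2_eq_square power3_eq_cube)

text \<open>For fixed \<open>a, b, c\<close> the discriminant is a quadratic polynomial in \<open>d\<close>; its zeros modulo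
  \<open>p\<^sup>2\<close> are controlled by the resolvent identity \<open>4 P\<^sup>3 = U\<^sup>2 + 27 a\<^sup>2 Disc\<close>.\<close>

context
  fixes p N a b c q :: int
  assumes p: "prime p" "p > 3" "\<not> p dvd N" and q: "q \<ge> 0"
begin

lemma p_facts: "\<not> p dvd 2" "\<not> p dvd 4" "\<not> p dvd 27" "\<not> p dvd 3" "p > 0"
proof -
  show "p > 0" using p by simp
  show "\<not> p dvd 2" "\<not> p dvd 3" using p zdvd_imp_le[of p 2] zdvd_imp_le[of p 3] by auto
  then have "\<not> p dvd 2 ^ 2" "\<not> p dvd 3 ^ 3" using prime_dvd_power[OF p(1)] by blast+
  then show "\<not> p dvd 4" "\<not> p dvd 27" by simp_all
qed

lemma p2_dvd_cancel: "\<not> p dvd x \<Longrightarrow> p\<^sup>2 dvd x * y \<Longrightarrow> p\<^sup>2 dvd y"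
  using p(1) by (metis coprime_dvd_mult_right_iff coprime_power_left_iff prime_imp_coprime)

text \<open>\<open>U\<close> is linear in \<open>d\<close> with slope prime to \<open>p\<close>, and
  \<open>U^2\<close> is constant modulo \<open>p^2\<close> on the set. As \<open>p\<close> divides
  neither 2 nor \<open>U\<close>, it divides at most one of \<open>U - U0\<close> and
  \<open>U + U0\<close>; so \<open>U\<close> is congruent to \<open>U0\<close> or
  \<open>- U0\<close>, and \<open>d\<close> lies in one of two classes modulo
  \<open>p^2\<close>.\<close>

lemma card_disc_generic:
  assumes a: "\<not> p dvd a" and P: "\<not> p dvd b\<^sup>2 - 3 * a * c"
  shows "real (card {d\<in>{0..<q}. p\<^sup>2 dvd disc (a, b, c, N * d)}) \<le> 2 * (of_int q / of_int (p\<^sup>2) + 1)"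
proof (cases "{d\<in>{0..<q}. p\<^sup>2 dvd disc (a, b, c, N * d)} = {}")
  case True
  then show ?thesis using q by (simp only: card.empty) simp
next
  case False
  define S where "S = {d\<in>{0..<q}. p\<^sup>2 dvd disc (a, b, c, N * d)}"
  define U where "U d = 2 * b ^ 3 - 9 * a * b * c + 27 * a\<^sup>2 * (N * d)" for d
  obtain d0 where d0: "d0 \<in> S" using False by (auto simp: S_def)
  have pU: "\<not> p dvd U d" if "d \<in> S" for d
  proof
    assume "p dvd U d"
    moreover have "p dvd disc (a, b, c, N * d)" using that by (auto simp: S_def power2_eq_square intro: dvd_trans[of p "p * p"])
    ultimately have "p dvd 4 * (b\<^sup>2 - 3 * a * c) ^ 3"
      unfolding disc_resolvent[of b a c "N * d"] U_def[symmetric] by (simp add: power2_eq_square)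
    then have "p dvd b\<^sup>2 - 3 * a * c" using p(1) p_facts by (simp add: prime_dvd_mult_iff prime_dvd_power_iff)
    then show False using P by simp
  qed
  have diff: "p\<^sup>2 dvd x - y" if "p\<^sup>2 dvd U x - U y" for x y
  proof -
    have "U x - U y = (27 * a * a * N) * (x - y)" by (simp add: U_def power2_eq_square algebra_simps)
    moreover have "\<not> p dvd 27 * a * a * N" using a p p_facts by (simp add: prime_dvd_mult_iff)
    ultimately show ?thesis using p2_dvd_cancel that by metis
  qed
  have split: "p\<^sup>2 dvd U d - U d0 \<or> p\<^sup>2 dvd U d + U d0" if "d \<in> S" for d
  proof -
    have "(U d - U d0) * (U d + U d0) = 27 * a\<^sup>2 * disc (a, b, c, N * d0) - 27 * a\<^sup>2 * disc (a, b, c, N * d)"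
      using disc_resolvent[of b a c "N * d"] disc_resolvent[of b a c "N * d0"]
      unfolding U_def[symmetric] by (simp add: power2_eq_square algebra_simps)
    then have dv: "p\<^sup>2 dvd (U d - U d0) * (U d + U d0)" using that d0 by (simp add: S_def)
    have "\<not> (p dvd U d - U d0 \<and> p dvd U d + U d0)"
    proof
      assume "p dvd U d - U d0 \<and> p dvd U d + U d0"
      then have "p dvd (U d - U d0) + (U d + U d0)" using dvd_add[of p "U d - U d0" "U d + U d0"] by blast
      then have "p dvd 2 * U d" by simp
      then show False using pU[OF that] p(1) p_facts by (simp add: prime_dvd_mult_iff)
    qed
    then show ?thesis using p2_dvd_cancel dv by (metis mult.commute)
  qed
  define S1 where "S1 = {d\<in>S. p\<^sup>2 dvd U d - U d0}"
  define S2 where "S2 = {d\<in>S. p\<^sup>2 dvd U d + U d0}"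
  have p2: "p\<^sup>2 > 0" using p_facts by simp
  have "real (card S1) \<le> of_int q / of_int (p\<^sup>2) + 1"
  proof (rule card_residue_class[OF _ p2 q])
    show "S1 \<subseteq> {0..<0 + q}" by (auto simp: S1_def S_def)
    show "p\<^sup>2 dvd x - y" if "x \<in> S1" "y \<in> S1" for x y
    proof (rule diff)
      have "p\<^sup>2 dvd (U x - U d0) - (U y - U d0)"
        using that dvd_diff[of "p\<^sup>2" "U x - U d0" "U y - U d0"] unfolding S1_def by blast
      then show "p\<^sup>2 dvd U x - U y" by simp
    qed
  qed
  moreover have "real (card S2) \<le> of_int q / of_int (p\<^sup>2) + 1"
  proof (rule card_residue_class[OF _ p2 q])
    show "S2 \<subseteq> {0..<0 + q}" by (auto simp: S2_def S_def)
    show "p\<^sup>2 dvd x - y" if "x \<in> S2" "y \<in> S2" for x y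
    proof (rule diff)
      have "p\<^sup>2 dvd (U x + U d0) - (U y + U d0)"
        using that dvd_diff[of "p\<^sup>2" "U x + U d0" "U y + U d0"] unfolding S2_def by blast
      then show "p\<^sup>2 dvd U x - U y" by simp
    qed
  qed
  moreover have "S = S1 \<union> S2" using split by (auto simp: S1_def S2_def)
  then have "card S \<le> card S1 + card S2" by (simp add: card_Un_le)
  then have "real (card S) \<le> real (card S1) + real (card S2)" by (simp only: of_nat_add[symmetric] of_nat_le_iff)
  moreover have "w \<le> 2 * (z + 1)" if "x \<le> z + 1" "y \<le> z + 1" "w \<le> x + y" for w x y z :: real
    using that by argo
  ultimately show ?thesis unfolding S_def[symmetric] by blast
qed

text \<open>Modulo \<open>p\<close> the form has the root \<open>(1 : 0)\<close>, which is simple as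
  \<open>p\<close> does not divide \<open>b\<close>. The difference of two discriminants, divided by
  the difference of the parameters, is \<open>- 4 b ^ 3 N\<close> modulo \<open>p\<close>, a unit,
  so one class modulo \<open>p^2\<close> remains.\<close>

lemma card_disc_infinite:
  assumes a: "p dvd a" and b: "\<not> p dvd b"
  shows "real (card {d\<in>{0..<q}. p\<^sup>2 dvd disc (a, b, c, N * d)}) \<le> of_int q / of_int (p\<^sup>2) + 1"
proof (rule card_residue_class[OF _ _ q])
  show "p\<^sup>2 > 0" using p_facts by simp
  show "p\<^sup>2 dvd x - y" if "x \<in> {d\<in>{0..<q}. p\<^sup>2 dvd disc (a, b, c, N * d)}" "y \<in> {d\<in>{0..<q}. p\<^sup>2 dvd disc (a, b, c, N * d)}" for x y
  proof -
    define E where "E = a * (- 27 * a * N * (x + y) + 18 * b * c) - 4 * b ^ 3"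
    have "p\<^sup>2 dvd disc (a, b, c, N * x) - disc (a, b, c, N * y)" using that by (intro dvd_diff) auto
    also have "disc (a, b, c, N * x) - disc (a, b, c, N * y) = (E * N) * (x - y)"
      by (simp add: E_def algebra_simps power2_eq_square power3_eq_cube)
    finally have "p\<^sup>2 dvd (E * N) * (x - y)" .
    moreover have "\<not> p dvd E"
    proof
      assume "p dvd E"
      then have "p dvd a * (- 27 * a * N * (x + y) + 18 * b * c) - E" using a by (intro dvd_diff) auto
      then have "p dvd 4 * b ^ 3" by (simp add: E_def)
      then show False using b p(1) p_facts by (simp add: prime_dvd_mult_iff prime_dvd_power_iff)
    qed
    then have "\<not> p dvd E * N" using p by (simp add: prime_dvd_mult_iff)
    ultimately show ?thesis by (rule p2_dvd_cancel[rotated])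
  qed
qed auto

text \<open>A triple root modulo \<open>p\<close> is possible here: the resolvent identity forces
  \<open>p\<close> to divide \<open>U\<close>, which fixes \<open>d\<close> modulo \<open>p\<close>
  only. The condition on \<open>c\<close> makes up for the lost factor in
  \<open>card_small_prime\<close>.\<close>

lemma card_disc_triple:
  assumes a: "\<not> p dvd a" and P: "p dvd b\<^sup>2 - 3 * a * c"
  shows "real (card {d\<in>{0..<q}. p\<^sup>2 dvd disc (a, b, c, N * d)}) \<le> of_int q / of_int p + 1"
proof (rule card_residue_class[OF _ _ q])
  show "p > 0" by (rule p_facts)
  define U where "U d = 2 * b ^ 3 - 9 * a * b * c + 27 * a\<^sup>2 * (N * d)" for d
  have pU: "p dvd U d" if "d \<in> {d\<in>{0..<q}. p\<^sup>2 dvd disc (a, b, c, N * d)}" for d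
  proof -
    have "p dvd disc (a, b, c, N * d)" using that by (auto simp: power2_eq_square intro: dvd_trans[of p "p * p"])
    then have "p dvd 27 * a\<^sup>2 * disc (a, b, c, N * d)" by simp
    moreover have "p dvd 4 * (b\<^sup>2 - 3 * a * c) ^ 3" using P by (simp add: power3_eq_cube)
    ultimately have "p dvd 4 * (b\<^sup>2 - 3 * a * c) ^ 3 - 27 * a\<^sup>2 * disc (a, b, c, N * d)" by (rule dvd_diff[rotated])
    then have "p dvd (U d)\<^sup>2" unfolding disc_resolvent[of b a c "N * d"] U_def[symmetric] by simp
    then show ?thesis using p(1) by (simp add: prime_dvd_power_iff)
  qed
  show "p dvd x - y" if "x \<in> {d\<in>{0..<q}. p\<^sup>2 dvd disc (a, b, c, N * d)}" "y \<in> {d\<in>{0..<q}. p\<^sup>2 dvd disc (a, b, c, N * d)}" for x y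
  proof -
    have "p dvd U x - U y" using pU that by (intro dvd_diff) auto
    moreover have "U x - U y = 27 * a * a * N * (x - y)" by (simp add: U_def power2_eq_square algebra_simps)
    ultimately show ?thesis using a p p_facts by (simp add: prime_dvd_mult_iff)
  qed
qed auto

end

text \<open>The parameter \<open>b\<close> stays below every \<open>a\<close>, which later excludes
  translations, and the factor 100 makes \<open>c\<close> so large that the term
  \<open>- 4 a c ^ 3\<close> dominates the discriminant.\<close>

definition fam_index :: "int \<Rightarrow> int \<Rightarrow> int \<Rightarrow> (int \<times> int \<times> int \<times> int) set" where
  "fam_index m n q = {m..<2 * m} \<times> {0..<m} \<times> {100 * n..<200 * n} \<times> {0..<q}"

text \<open>Modulo \<open>N\<close> this is \<open>(0, 1, 1, 0)\<close>, of discriminant 1, so the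
  discriminant is prime to \<open>N\<close>. The sign of the third coefficient makes the dominating
  term \<open>- 4 a c ^ 3\<close> positive.\<close>

fun fam_form :: "int \<Rightarrow> int \<times> int \<times> int \<times> int \<Rightarrow> form" where
  "fam_form N (a, b, c, d) = (N * a, 1 + N * b, 1 - N * c, N * d)"

lemma fam_form_disc_mod: "\<exists>k. disc (fam_form N x) = 1 + N * k"
proof -
  obtain a b c d where x: "x = (a, b, c, d)" by (metis prod_cases4)
  have "disc (fam_form N x) = 1 + N * ((2 * b + N * b\<^sup>2) * (1 - N * c)\<^sup>2 + (N * c\<^sup>2 - 2 * c)
     - 4 * a * (1 - N * c) ^ 3 - 4 * (1 + N * b) ^ 3 * d - 27 * a\<^sup>2 * N * (N * d)\<^sup>2 + 18 * a * (1 + N * b) * (1 - N * c) * (N * d))"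
    unfolding x fam_form.simps disc.simps by (simp add: algebra_simps power2_eq_square power3_eq_cube)
  then show ?thesis by blast
qed

lemma card_Sigma_le:
  assumes "finite A" "\<And>x. x \<in> A \<Longrightarrow> finite (B x)" "\<And>x. x \<in> A \<Longrightarrow> real (card (B x)) \<le> M"
  shows "real (card (Sigma A B)) \<le> real (card A) * M"
proof -
  have "real (card (Sigma A B)) = (\<Sum>x\<in>A. real (card (B x)))" using assms by (simp add: card_SigmaI)
  also have "\<dots> \<le> (\<Sum>x\<in>A. M)" by (rule sum_mono) (rule assms(3))
  finally show ?thesis by simp
qed

lemma card_Sigma2_le:
  fixes Q :: "int \<Rightarrow> int \<Rightarrow> int \<Rightarrow> int \<Rightarrow> bool"
  assumes m: "m \<ge> 0" and M: "M \<ge> 0"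
    and fib: "\<And>a b. a \<in> {m..<2 * m} \<Longrightarrow> b \<in> {0..<m} \<Longrightarrow>
        real (card {(c, d)\<in>{100 * n..<200 * n} \<times> {0..<q}. Q a b c d}) \<le> M"
  shows "real (card {(a, b, c, d)\<in>fam_index m n q. Q a b c d}) \<le> (of_int m)\<^sup>2 * M"
proof -
  define F where "F a b = {(c, d)\<in>{100 * n..<200 * n} \<times> {0..<q}. Q a b c d}" for a b
  have fin: "finite (F a b)" for a b
    unfolding F_def by (rule finite_subset[of _ "{100 * n..<200 * n} \<times> {0..<q}"]) auto
  have eq: "{(a, b, c, d)\<in>fam_index m n q. Q a b c d} = Sigma {m..<2 * m} (\<lambda>a. Sigma {0..<m} (F a))"
    unfolding fam_index_def F_def by auto
  have "real (card (Sigma {0..<m} (F a))) \<le> of_int m * M" if a: "a \<in> {m..<2 * m}" for a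
    using card_Sigma_le[of "{0..<m}" "F a" M] fin fib[OF a] m by (simp add: F_def)
  then have "real (card (Sigma {m..<2 * m} (\<lambda>a. Sigma {0..<m} (F a)))) \<le> real (card {m..<2 * m}) * (of_int m * M)"
    using fin by (intro card_Sigma_le) auto
  then show ?thesis unfolding eq using m by (simp add: power2_eq_square mult.assoc)
qed

text \<open>Splits by the reduction modulo \<open>p\<close>. If \<open>p\<close> does not divide
  \<open>a\<close>, the values of \<open>c\<close> for which \<open>p\<close> divides the leading
  coefficient of the Hessian lie in one class modulo \<open>p\<close> and leave one class of
  \<open>d\<close> modulo \<open>p\<close>; in all other cases at most two classes of
  \<open>d\<close> modulo \<open>p^2\<close> remain. Either way the main term is of order
  \<open>1 / p^2\<close>.\<close>

lemma card_small_prime: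
  fixes p :: int
  assumes p: "prime p" "p > 3" "\<not> p dvd N" and m: "m \<ge> 0" and n: "n \<ge> 0" and q: "q \<ge> 0"
  shows "real (card {(a, b, c, d)\<in>fam_index m n q. \<not> (p dvd a \<and> p dvd 1 + N * b) \<and> p\<^sup>2 dvd disc (fam_form N (a, b, c, d))})
     \<le> (of_int m)\<^sup>2 * ((100 * of_int n / of_int p + 1) * (of_int q / of_int p + 1) + 100 * of_int n * (2 * (of_int q / of_int (p\<^sup>2) + 1)))"
proof (rule card_Sigma2_le[OF m])
  have p0: "p > 0" using p by simp
  show M0: "0 \<le> (100 * real_of_int n / of_int p + 1) * (of_int q / of_int p + 1) + 100 * of_int n * (2 * (of_int q / of_int (p\<^sup>2) + 1))"
    using n q p0 by (intro add_nonneg_nonneg mult_nonneg_nonneg divide_nonneg_nonneg) auto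
  fix a b
  define A where "A = N * a"
  define B where "B = 1 + N * b"
  define D where "D c = {d\<in>{0..<q}. p\<^sup>2 dvd disc (A, B, 1 - N * c, N * d)}" for c
  have finD: "finite (D c)" for c unfolding D_def by (rule finite_subset[of _ "{0..<q}"]) auto
  show "real (card {(c, d)\<in>{100 * n..<200 * n} \<times> {0..<q}. \<not> (p dvd a \<and> p dvd 1 + N * b) \<and> p\<^sup>2 dvd disc (fam_form N (a, b, c, d))})
     \<le> (100 * of_int n / of_int p + 1) * (of_int q / of_int p + 1) + 100 * of_int n * (2 * (of_int q / of_int (p\<^sup>2) + 1))"
  proof (cases "p dvd a \<and> p dvd 1 + N * b")
    case True
    then have "{(c, d)\<in>{100 * n..<200 * n} \<times> {0..<q}. \<not> (p dvd a \<and> p dvd 1 + N * b) \<and> p\<^sup>2 dvd disc (fam_form N (a, b, c, d))} = {}"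
      by auto
    then show ?thesis using M0 by (simp only: card.empty of_nat_0)
  next
    case nab: False
    have pA: "p dvd A \<longleftrightarrow> p dvd a" using p by (simp add: A_def prime_dvd_mult_iff)
    define C1 where "C1 = {c\<in>{100 * n..<200 * n}. \<not> p dvd A \<and> p dvd B\<^sup>2 - 3 * A * (1 - N * c)}"
    define C2 where "C2 = {100 * n..<200 * n} - C1"
    have finC: "finite C1" "finite C2" by (auto simp: C1_def C2_def intro: finite_subset[of _ "{100 * n..<200 * n}"])
    have "{(c, d)\<in>{100 * n..<200 * n} \<times> {0..<q}. \<not> (p dvd a \<and> p dvd 1 + N * b) \<and> p\<^sup>2 dvd disc (fam_form N (a, b, c, d))}
        = Sigma C1 D \<union> Sigma C2 D"
      using nab unfolding C1_def C2_def D_def A_def B_def by auto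
    then have "card {(c, d)\<in>{100 * n..<200 * n} \<times> {0..<q}. \<not> (p dvd a \<and> p dvd 1 + N * b) \<and> p\<^sup>2 dvd disc (fam_form N (a, b, c, d))}
        \<le> card (Sigma C1 D) + card (Sigma C2 D)" by (simp add: card_Un_le)
    then have le: "real (card {(c, d)\<in>{100 * n..<200 * n} \<times> {0..<q}. \<not> (p dvd a \<and> p dvd 1 + N * b) \<and> p\<^sup>2 dvd disc (fam_form N (a, b, c, d))})
        \<le> real (card (Sigma C1 D)) + real (card (Sigma C2 D))" by (simp only: of_nat_add[symmetric] of_nat_le_iff)
    have "real (card C1) \<le> of_int (100 * n) / of_int p + 1"
    proof (rule card_residue_class[of _ "100 * n", OF _ p0])
      show "C1 \<subseteq> {100 * n..<100 * n + 100 * n}" by (auto simp: C1_def)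
      show "p dvd x - y" if "x \<in> C1" "y \<in> C1" for x y
      proof -
        have "p dvd (B\<^sup>2 - 3 * A * (1 - N * x)) - (B\<^sup>2 - 3 * A * (1 - N * y))"
          using that dvd_diff[of p "B\<^sup>2 - 3 * A * (1 - N * x)" "B\<^sup>2 - 3 * A * (1 - N * y)"] unfolding C1_def by blast
        then have "p dvd 3 * A * N * (x - y)" by (simp add: algebra_simps)
        moreover have "\<not> p dvd A" using that by (simp add: C1_def)
        ultimately show ?thesis using p p_facts[OF p q] by (simp add: prime_dvd_mult_iff)
      qed
    qed (use n in simp)
    moreover have "real (card (Sigma C1 D)) \<le> real (card C1) * (of_int q / of_int p + 1)"
      using card_disc_triple[OF p q] finD finC by (intro card_Sigma_le) (auto simp: D_def C1_def)
    moreover have "0 \<le> real_of_int q / of_int p + 1" using q p0 by simp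
    ultimately have 1: "real (card (Sigma C1 D)) \<le> (100 * of_int n / of_int p + 1) * (of_int q / of_int p + 1)"
      using mult_right_mono[of "real (card C1)" "of_int (100 * n) / of_int p + 1" "of_int q / of_int p + 1"] by simp
    have "real (card (Sigma C2 D)) \<le> real (card C2) * (2 * (of_int q / of_int (p\<^sup>2) + 1))"
    proof (rule card_Sigma_le)
      fix c assume c: "c \<in> C2"
      have q2: "0 \<le> real_of_int q / of_int (p\<^sup>2)" using q by simp
      show "real (card (D c)) \<le> 2 * (of_int q / of_int (p\<^sup>2) + 1)"
      proof (cases "p dvd A")
        case True
        then have "\<not> p dvd B" using nab pA by (simp add: B_def)
        from card_disc_infinite[OF p q True this, of "1 - N * c"] show ?thesis
          unfolding D_def by (rule order_trans) (use q2 in simp)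
      next
        case False
        then have "\<not> p dvd B\<^sup>2 - 3 * A * (1 - N * c)" using c by (auto simp: C1_def C2_def)
        from card_disc_generic[OF p q False this] show ?thesis unfolding D_def .
      qed
    qed (use finC finD in auto)
    also have "\<dots> \<le> (100 * of_int n) * (2 * (of_int q / of_int (p\<^sup>2) + 1))"
    proof (rule mult_right_mono)
      have "card C2 \<le> card {100 * n..<200 * n}" unfolding C2_def by (intro card_mono) auto
      then show "real (card C2) \<le> 100 * of_int n" using n by simp
    qed (use q in simp)
    finally have 2: "real (card (Sigma C2 D)) \<le> 100 * of_int n * (2 * (of_int q / of_int (p\<^sup>2) + 1))" .
    show ?thesis using le 1 2 by linarith
  qed
qed

text \<open>A bound free of constant error terms and hence summable over all primes: for
  \<open>p \<ge> 2 m\<close> no \<open>a\<close> in the range is divisible by \<open>p\<close>, and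
  for smaller \<open>p\<close> the summand 1 in \<open>m / p + 1\<close> is at most
  \<open>2 m / p\<close>.\<close>

lemma card_content_prime:
  fixes p :: int
  assumes p: "prime p" "\<not> p dvd N" and m: "m \<ge> 1" and n: "n \<ge> 0" and q: "q \<ge> 0"
  shows "real (card {(a, b, c, d)\<in>fam_index m n q. p dvd a \<and> p dvd 1 + N * b})
     \<le> (of_int m)\<^sup>2 * (100 * of_int n) * of_int q * (9 * (1 / (of_int p)\<^sup>2))"
proof -
  define A where "A = {a\<in>{m..<2 * m}. p dvd a}"
  define B where "B = {b\<in>{0..<m}. p dvd 1 + N * b}"
  have p0: "p > 0" using p prime_gt_0_int by blast
  have eq: "{(a, b, c, d)\<in>fam_index m n q. p dvd a \<and> p dvd 1 + N * b} = A \<times> B \<times> {100 * n..<200 * n} \<times> {0..<q}"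
    unfolding fam_index_def A_def B_def by auto
  have card: "real (card {(a, b, c, d)\<in>fam_index m n q. p dvd a \<and> p dvd 1 + N * b}) = real (card A) * (real (card B) * (100 * of_int n * of_int q))"
    unfolding eq card_cartesian_product using n q by simp
  have R0: "0 \<le> (real_of_int m)\<^sup>2 * (100 * of_int n) * of_int q * (9 * (1 / (of_int p)\<^sup>2))" using n q by simp
  show ?thesis
  proof (cases "p < 2 * m")
    case False
    have "A = {}"
    proof -
      have "\<not> p dvd a" if "a \<in> {m..<2 * m}" for a using that False m zdvd_imp_le[of p a] by auto
      then show ?thesis by (auto simp: A_def)
    qed
    then show ?thesis unfolding card using R0 by simp
  next
    case True
    then have le3: "of_int m / of_int p + 1 \<le> 3 * (real_of_int m / of_int p)" using p0 by (simp add: field_simps)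
    have "real (card A) \<le> of_int m / of_int p + 1"
      by (rule card_residue_class[of _ m, OF _ p0]) (use m in \<open>auto simp: A_def intro: dvd_diff\<close>)
    then have 1: "real (card A) \<le> 3 * (real_of_int m / of_int p)" using le3 by linarith
    have "real (card B) \<le> of_int m / of_int p + 1"
    proof (rule card_residue_class[of _ 0, OF _ p0])
      show "p dvd x - y" if "x \<in> B" "y \<in> B" for x y
      proof -
        have "p dvd (1 + N * x) - (1 + N * y)" using that by (intro dvd_diff) (auto simp: B_def)
        then have "p dvd N * (x - y)" by (simp add: algebra_simps)
        then show ?thesis using p by (simp add: prime_dvd_mult_iff)
      qed
    qed (use m in \<open>auto simp: B_def\<close>)
    then have 2: "real (card B) \<le> 3 * (real_of_int m / of_int p)" using le3 by linarith
    have "real (card A) * (real (card B) * (100 * of_int n * of_int q)) \<le>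
       3 * (real_of_int m / of_int p) * (3 * (real_of_int m / of_int p) * (100 * of_int n * of_int q))"
      using 1 2 n q m p0 by (intro mult_mono mult_nonneg_nonneg) auto
    then show ?thesis unfolding card by (simp add: power2_eq_square mult_ac)
  qed
qed

text \<open>From 48 on, the tail of the sum of \<open>1 / k^2\<close>, taken 9 times for the content
  and 3 times for the squares, is small enough against the family; the balance is drawn in
  \<open>card_good_index\<close>.\<close>

definition sieve_modulus :: int where "sieve_modulus = fact 48"

lemma sieve_modulus_pos: "sieve_modulus > 0"
  by (simp add: sieve_modulus_def)

lemma prime_dvd_sieve_modulus: "prime p \<Longrightarrow> p dvd sieve_modulus \<longleftrightarrow> p \<le> 48"
proof -
  assume p: "prime p"
  then obtain k where k: "p = int k" using prime_ge_0_int zero_le_imp_eq_int by blast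
  then have "prime k" using p by simp
  then have "int k dvd int (fact 48) \<longleftrightarrow> k \<le> 48" unfolding int_dvd_int_iff by (rule prime_dvd_fact_iff)
  then show ?thesis unfolding sieve_modulus_def k of_nat_fact by simp
qed

lemma finite_fam_index: "finite (fam_index m n q)"
  by (simp add: fam_index_def)

definition content_bad :: "int \<Rightarrow> int \<Rightarrow> int \<Rightarrow> (int \<times> int \<times> int \<times> int) set" where
  "content_bad m n q = {(a, b, c, d)\<in>fam_index m n q. \<exists>p. prime p \<and> p > 48 \<and> p dvd a \<and> p dvd 1 + sieve_modulus * b}"

definition square_bad :: "nat \<Rightarrow> int \<Rightarrow> int \<Rightarrow> int \<Rightarrow> (int \<times> int \<times> int \<times> int) set" where
  "square_bad t m n q = {(a, b, c, d)\<in>fam_index m n q. \<exists>p. prime p \<and> p > 48 \<and> p \<le> int t \<and>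
     \<not> (p dvd a \<and> p dvd 1 + sieve_modulus * b) \<and> p\<^sup>2 dvd disc (fam_form sieve_modulus (a, b, c, d))}"

lemma card_UN_le_sum:
  assumes "finite A" "S \<subseteq> (\<Union>k\<in>A. T k)" "\<And>k. finite (T k)" "\<And>k. k \<in> A \<Longrightarrow> real (card (T k)) \<le> g k"
  shows "real (card S) \<le> (\<Sum>k\<in>A. g k)"
proof -
  have "real (card S) \<le> real (card (\<Union>k\<in>A. T k))" using assms(1-3) by (intro of_nat_mono card_mono finite_UN_I) auto
  also have "\<dots> \<le> (\<Sum>k\<in>A. real (card (T k)))"
    unfolding of_nat_sum[symmetric] by (intro of_nat_mono card_UN_le assms(1))
  also have "\<dots> \<le> (\<Sum>k\<in>A. g k)" by (rule sum_mono[OF assms(4)])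
  finally show ?thesis .
qed

lemma card_content_bad:
  assumes m: "m \<ge> 1" and n: "n \<ge> 0" and q: "q \<ge> 0"
  shows "real (card (content_bad m n q)) \<le> (of_int m)\<^sup>2 * (100 * of_int n) * of_int q * (9 / 48)"
proof -
  define T where "T k = (if prime (int k) \<and> k > 48 then
     {(a, b, c, d)\<in>fam_index m n q. int k dvd a \<and> int k dvd 1 + sieve_modulus * b} else {})" for k :: nat
  define W where "W = (real_of_int m)\<^sup>2 * (100 * of_int n) * of_int q"
  have W: "W \<ge> 0" unfolding W_def using n q by simp
  have "content_bad m n q \<subseteq> (\<Union>k\<in>{Suc 48..nat (2 * m)}. T k)"
  proof
    fix x assume "x \<in> content_bad m n q"
    then obtain a b c d p where x: "x = (a, b, c, d)" "(a, b, c, d) \<in> fam_index m n q"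
      and p: "prime p" "p > 48" "p dvd a" "p dvd 1 + sieve_modulus * b" by (auto simp: content_bad_def)
    have a: "m \<le> a" "a < 2 * m" using x(2) by (auto simp: fam_index_def)
    then have "p \<le> a" using p(3) m by (intro zdvd_imp_le) auto
    then have "nat p \<in> {Suc 48..nat (2 * m)}" using p(2) a by auto
    moreover have "x \<in> T (nat p)" using x p by (simp add: T_def)
    ultimately show "x \<in> (\<Union>k\<in>{Suc 48..nat (2 * m)}. T k)" by blast
  qed
  moreover have "finite (T k)" for k
    unfolding T_def using finite_fam_index by (auto intro: finite_subset[of _ "fam_index m n q"])
  moreover have "real (card (T k)) \<le> W * 9 * (1 / (real k)\<^sup>2)" for k
  proof (cases "prime (int k) \<and> k > 48")
    case True
    then have "\<not> int k dvd sieve_modulus" using prime_dvd_sieve_modulus by simp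
    from card_content_prime[OF _ this m n q] True show ?thesis by (simp add: T_def W_def)
  next
    case False
    then show ?thesis using W by (auto simp: T_def)
  qed
  ultimately have "real (card (content_bad m n q)) \<le> (\<Sum>k\<in>{Suc 48..nat (2 * m)}. W * 9 * (1 / (real k)\<^sup>2))"
    by (intro card_UN_le_sum[where T = T]) auto
  also have "\<dots> = W * 9 * (\<Sum>k=Suc 48..nat (2 * m). 1 / (real k)\<^sup>2)" by (simp only: sum_distrib_left)
  also have "\<dots> \<le> W * 9 * (1 / real 48)" using W by (intro mult_left_mono sum_inverse_squares) auto
  finally show ?thesis by (simp add: W_def)
qed

lemma card_square_bad:
  assumes m: "m \<ge> 1" and n: "n \<ge> 1" and q: "q \<ge> 1"
  shows "real (card (square_bad t m n q)) \<le> (of_int m)\<^sup>2 * (100 * of_int n * of_int q * (3 / 48) + real t * (300 * of_int n + of_int q + 1))"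
proof -
  define T where "T k = (if prime (int k) \<and> k > 48 then
     {(a, b, c, d)\<in>fam_index m n q. \<not> (int k dvd a \<and> int k dvd 1 + sieve_modulus * b) \<and>
        (int k)\<^sup>2 dvd disc (fam_form sieve_modulus (a, b, c, d))} else {})" for k :: nat
  define M where "M = 100 * real_of_int n"
  define Q where "Q = real_of_int q"
  have MQ: "M \<ge> 0" "Q \<ge> 0" using n q by (simp_all add: M_def Q_def)
  define g where "g k = (real_of_int m)\<^sup>2 * (3 * M * Q * (1 / (real k)\<^sup>2) + (3 * M + Q + 1))" for k :: nat
  have g0: "g k \<ge> 0" for k unfolding g_def using MQ by (intro mult_nonneg_nonneg add_nonneg_nonneg) auto
  have "square_bad t m n q \<subseteq> (\<Union>k\<in>{Suc 48..t}. T k)"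
  proof
    fix x assume "x \<in> square_bad t m n q"
    then obtain a b c d p where x: "x = (a, b, c, d)" "(a, b, c, d) \<in> fam_index m n q"
      and p: "prime p" "p > 48" "p \<le> int t" "\<not> (p dvd a \<and> p dvd 1 + sieve_modulus * b)"
      "p\<^sup>2 dvd disc (fam_form sieve_modulus (a, b, c, d))" unfolding square_bad_def by blast
    have "nat p \<in> {Suc 48..t}" using p(2,3) by auto
    moreover have "x \<in> T (nat p)" using x p by (simp add: T_def)
    ultimately show "x \<in> (\<Union>k\<in>{Suc 48..t}. T k)" by blast
  qed
  moreover have "finite (T k)" for k
    unfolding T_def using finite_fam_index by (auto intro: finite_subset[of _ "fam_index m n q"])
  moreover have "real (card (T k)) \<le> g k" for k
  proof (cases "prime (int k) \<and> k > 48")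
    case True
    then have "\<not> int k dvd sieve_modulus" using prime_dvd_sieve_modulus by simp
    then have "real (card (T k)) \<le> (of_int m)\<^sup>2 * ((M / real k + 1) * (Q / real k + 1) + M * (2 * (Q / (real k)\<^sup>2 + 1)))"
      using card_small_prime[of "int k" sieve_modulus m n q] True m n q by (simp add: T_def M_def Q_def)
    also have "\<dots> \<le> g k"
    proof -
      have e: "(M / real k + 1) * (Q / real k + 1) = M * Q * (1 / (real k)\<^sup>2) + M / real k + Q / real k + 1"
        using True by (simp add: field_simps power2_eq_square)
      have "M / real k \<le> M" "Q / real k \<le> Q" using MQ True by (simp_all add: divide_le_eq mult_le_cancel_left1)
      moreover have "M * (2 * (Q / (real k)\<^sup>2 + 1)) = 2 * (M * Q * (1 / (real k)\<^sup>2)) + 2 * M" by (simp add: algebra_simps)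
      moreover have "3 * M * Q * (1 / (real k)\<^sup>2) = 3 * (M * Q * (1 / (real k)\<^sup>2))" by simp
      ultimately have "(M / real k + 1) * (Q / real k + 1) + M * (2 * (Q / (real k)\<^sup>2 + 1)) \<le> 3 * M * Q * (1 / (real k)\<^sup>2) + (3 * M + Q + 1)"
        unfolding e by linarith
      then show ?thesis unfolding g_def by (rule mult_left_mono) simp
    qed
    finally show ?thesis .
  next
    case False
    then show ?thesis using g0[of k] by (auto simp: T_def)
  qed
  ultimately have "real (card (square_bad t m n q)) \<le> (\<Sum>k\<in>{Suc 48..t}. g k)"
    by (intro card_UN_le_sum[where T = T]) auto
  also have "\<dots> = (of_int m)\<^sup>2 * (3 * M * Q * (\<Sum>k=Suc 48..t. 1 / (real k)\<^sup>2) + real (card {Suc 48..t}) * (3 * M + Q + 1))"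
    unfolding g_def sum_distrib_left[symmetric] sum.distrib by (simp, simp add: algebra_simps)
  also have "\<dots> \<le> (of_int m)\<^sup>2 * (3 * M * Q * (1 / real 48) + real t * (3 * M + Q + 1))"
    using MQ by (intro mult_left_mono add_mono mult_right_mono sum_inverse_squares) auto
  finally show ?thesis by (simp add: M_def Q_def)
qed

text \<open>The Hessian \<open>(b\<^sup>2 - 3 a c, b c - 9 a d, c\<^sup>2 - 3 b d)\<close> is a covariant.  When it is nearly
  diagonal and unbalanced, any equivalence must fix the first basis vector up to sign.\<close>

lemma hessian_covariant:
  assumes "subst_form (a, b, c, d) \<alpha> \<beta> \<gamma> \<delta> = (a', b', c', d')"
  shows "b'\<^sup>2 - 3 * a' * c' = (\<alpha> * \<delta> - \<beta> * \<gamma>)\<^sup>2 *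
     ((b\<^sup>2 - 3 * a * c) * \<alpha>\<^sup>2 + (b * c - 9 * a * d) * \<alpha> * \<gamma> + (c\<^sup>2 - 3 * b * d) * \<gamma>\<^sup>2)"
proof -
  have e: "a' = a * \<alpha> ^ 3 + b * \<alpha>\<^sup>2 * \<gamma> + c * \<alpha> * \<gamma>\<^sup>2 + d * \<gamma> ^ 3"
    "b' = 3 * a * \<alpha>\<^sup>2 * \<beta> + b * (\<alpha>\<^sup>2 * \<delta> + 2 * \<alpha> * \<beta> * \<gamma>) + c * (2 * \<alpha> * \<gamma> * \<delta> + \<beta> * \<gamma>\<^sup>2) + 3 * d * \<gamma>\<^sup>2 * \<delta>"
    "c' = 3 * a * \<alpha> * \<beta>\<^sup>2 + b * (2 * \<alpha> * \<beta> * \<delta> + \<beta>\<^sup>2 * \<gamma>) + c * (\<alpha> * \<delta>\<^sup>2 + 2 * \<beta> * \<gamma> * \<delta>) + 3 * d * \<gamma> * \<delta>\<^sup>2"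
    using assms by simp_all
  show ?thesis unfolding e by (simp add: algebra_simps power2_eq_square power3_eq_cube)
qed

lemma equiv_upper_triangular:
  fixes a b c d a' b' c' d' :: int
  assumes eq: "form_equiv (a, b, c, d) (a', b', c', d')"
    and Q: "(b' * c' - 9 * a' * d')\<^sup>2 \<le> (b'\<^sup>2 - 3 * a' * c') * (c'\<^sup>2 - 3 * b' * d')"
    and P0: "0 \<le> b'\<^sup>2 - 3 * a' * c'" and P1: "0 \<le> b\<^sup>2 - 3 * a * c" and PR: "2 * (b\<^sup>2 - 3 * a * c) < c'\<^sup>2 - 3 * b' * d'"
  obtains \<alpha> \<beta> \<delta> where "\<bar>\<alpha>\<bar> = 1" "\<bar>\<delta>\<bar> = 1"
    "a = \<delta> * a'" "b = \<alpha> * (3 * a' * \<beta> * \<delta> + b')"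
    "c = \<delta> * (3 * a' * \<beta>\<^sup>2) + \<delta> * (2 * b' * \<beta> * \<delta>) + \<delta> * c'"
    "\<alpha> * \<delta> * d = a' * \<beta> ^ 3 + b' * \<beta>\<^sup>2 * \<delta> + c' * \<beta> + d' * \<delta>"
proof -
  obtain \<alpha> \<beta> \<gamma> \<delta> where det: "\<bar>\<alpha> * \<delta> - \<beta> * \<gamma>\<bar> = 1"
    and ev: "\<And>x y. feval (a', b', c', d') (\<alpha> * x + \<beta> * y) (\<gamma> * x + \<delta> * y) = (\<alpha> * \<delta> - \<beta> * \<gamma>) * feval (a, b, c, d) x y"
    by (rule form_equivE[OF eq]) (rule that; assumption)
  define e where "e = \<alpha> * \<delta> - \<beta> * \<gamma>"
  have ee: "e\<^sup>2 = 1" using abs_mult_self_eq[of e] det by (simp add: e_def power2_eq_square)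
  define P' Q' R' where PQR: "P' = b'\<^sup>2 - 3 * a' * c'" "Q' = b' * c' - 9 * a' * d'" "R' = c'\<^sup>2 - 3 * b' * d'"
  have sub: "subst_form (a', b', c', d') \<alpha> \<beta> \<gamma> \<delta> = scale_form e (a, b, c, d)"
    by (rule feval_inject) (simp only: feval_subst feval_scale ev e_def)
  then have "subst_form (a', b', c', d') \<alpha> \<beta> \<gamma> \<delta> = (e * a, e * b, e * c, e * d)" by simp
  from hessian_covariant[OF this] have "e\<^sup>2 * (b\<^sup>2 - 3 * a * c) = e\<^sup>2 * (P' * \<alpha>\<^sup>2 + Q' * \<alpha> * \<gamma> + R' * \<gamma>\<^sup>2)"
    unfolding PQR e_def[symmetric] by (simp add: power2_eq_square algebra_simps)
  then have H: "b\<^sup>2 - 3 * a * c = P' * \<alpha>\<^sup>2 + Q' * \<alpha> * \<gamma> + R' * \<gamma>\<^sup>2" unfolding ee by simp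
  have R0: "R' \<ge> 0"
  proof -
    have "0 \<le> 2 * (b\<^sup>2 - 3 * a * c)" by (intro mult_nonneg_nonneg P1) simp
    also have "\<dots> < R'" using PR unfolding PQR .
    finally show ?thesis by simp
  qed
  \<comment> \<open>By \<open>Q'^2 \<le> P' R'\<close> and the inequality of the means, the mixed
    term is at most half of \<open>P' \<alpha>^2 + R' \<gamma>^2\<close>, so the value of the
    Hessian is at least half of \<open>R' \<gamma>^2\<close>. Since \<open>R'\<close> exceeds twice
    that value, \<open>\<gamma>\<close> must vanish.\<close>
  have half: "R' * \<gamma>\<^sup>2 \<le> 2 * (b\<^sup>2 - 3 * a * c)"
  proof -
    have "(Q' * \<alpha> * \<gamma>)\<^sup>2 * 4 \<le> (P' * \<alpha>\<^sup>2 + R' * \<gamma>\<^sup>2)\<^sup>2"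
    proof -
      have "(Q' * \<alpha> * \<gamma>)\<^sup>2 = Q'\<^sup>2 * (\<alpha>\<^sup>2 * \<gamma>\<^sup>2)" by (simp add: power_mult_distrib)
      also have "\<dots> \<le> (P' * R') * (\<alpha>\<^sup>2 * \<gamma>\<^sup>2)" using Q unfolding PQR[symmetric] by (intro mult_right_mono) auto
      finally have "(Q' * \<alpha> * \<gamma>)\<^sup>2 * 4 \<le> 4 * (P' * \<alpha>\<^sup>2) * (R' * \<gamma>\<^sup>2)" by (simp add: mult_ac)
      also have "\<dots> \<le> (P' * \<alpha>\<^sup>2 + R' * \<gamma>\<^sup>2)\<^sup>2"
        using zero_le_power2[of "P' * \<alpha>\<^sup>2 - R' * \<gamma>\<^sup>2"] by (simp add: power2_diff power2_sum mult_ac)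
      finally show ?thesis .
    qed
    then have "(2 * \<bar>Q' * \<alpha> * \<gamma>\<bar>)\<^sup>2 \<le> (P' * \<alpha>\<^sup>2 + R' * \<gamma>\<^sup>2)\<^sup>2" unfolding power_mult_distrib[of 2] power2_abs by simp
    then have "2 * \<bar>Q' * \<alpha> * \<gamma>\<bar> \<le> P' * \<alpha>\<^sup>2 + R' * \<gamma>\<^sup>2"
      by (rule power2_le_imp_le) (use R0 P0 in \<open>simp add: PQR\<close>)
    moreover have "0 \<le> P' * \<alpha>\<^sup>2" using P0 unfolding PQR[symmetric] by simp
    ultimately show ?thesis using abs_ge_minus_self[of "Q' * \<alpha> * \<gamma>"] unfolding H distrib_left by linarith
  qed
  have "\<gamma> = 0"
  proof (rule ccontr)
    assume "\<gamma> \<noteq> 0"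
    then have "1 \<le> \<gamma>\<^sup>2" using zero_less_power2[of \<gamma>] by linarith
    then have "R' * 1 \<le> R' * \<gamma>\<^sup>2" using R0 by (intro mult_left_mono)
    then show False using half PR unfolding PQR[symmetric] by linarith
  qed
  then have e: "e = \<alpha> * \<delta>" by (simp add: e_def)
  then have "\<bar>\<alpha>\<bar> * \<bar>\<delta>\<bar> = 1" using det \<open>\<gamma> = 0\<close> by (simp add: abs_mult)
  then have ad: "\<bar>\<alpha>\<bar> = 1" "\<bar>\<delta>\<bar> = 1" by (auto simp: zmult_eq_1_iff)
  have sq: "\<alpha> * \<alpha> = 1" "\<delta> * \<delta> = 1" using abs_mult_self_eq[of \<alpha>] abs_mult_self_eq[of \<delta>] ad by simp_all
  have sq': "\<alpha> * (\<alpha> * z) = z" "\<delta> * (\<delta> * z) = z" for z using sq by (metis mult.assoc mult_1)+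
  have 1: "a' * \<alpha> ^ 3 = e * a" "3 * a' * \<alpha>\<^sup>2 * \<beta> + b' * (\<alpha>\<^sup>2 * \<delta>) = e * b"
    "3 * a' * \<alpha> * \<beta>\<^sup>2 + b' * (2 * \<alpha> * \<beta> * \<delta>) + c' * (\<alpha> * \<delta>\<^sup>2) = e * c"
    "a' * \<beta> ^ 3 + b' * \<beta>\<^sup>2 * \<delta> + c' * \<beta> * \<delta>\<^sup>2 + d' * \<delta> ^ 3 = e * d"
    using sub unfolding \<open>\<gamma> = 0\<close> by simp_all
  show ?thesis
  proof (rule that[OF ad, of \<beta>])
    have inv: "z = \<alpha> * \<delta> * (e * z)" for z
    proof -
      have "\<alpha> * \<delta> * (e * z) = (\<alpha> * \<alpha>) * (\<delta> * \<delta>) * z" unfolding e by (simp only: mult_ac)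
      then show ?thesis by (simp add: sq)
    qed
    have pw: "\<alpha> ^ 3 = \<alpha>" "\<delta> ^ 3 = \<delta>" "\<alpha>\<^sup>2 = 1" "\<delta>\<^sup>2 = 1"
      by (simp_all add: power3_eq_cube power2_eq_square sq)
    note 1 = 1[unfolded pw]
    have "a = \<alpha> * \<delta> * (a' * \<alpha>)" unfolding 1(1) by (rule inv)
    also have "\<dots> = (\<alpha> * \<alpha>) * (\<delta> * a')" by (simp only: mult_ac)
    finally show "a = \<delta> * a'" by (simp add: sq)
    have "b = \<alpha> * \<delta> * (3 * a' * 1 * \<beta> + b' * (1 * \<delta>))" unfolding 1(2) by (rule inv)
    also have "\<dots> = \<alpha> * (3 * a' * \<beta> * \<delta> + b' * (\<delta> * \<delta>))" by Groebner_Basis.algebra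
    finally show "b = \<alpha> * (3 * a' * \<beta> * \<delta> + b')" by (simp add: sq)
    have "c = \<alpha> * \<delta> * (3 * a' * \<alpha> * \<beta>\<^sup>2 + b' * (2 * \<alpha> * \<beta> * \<delta>) + c' * (\<alpha> * 1))" unfolding 1(3) by (rule inv)
    also have "\<dots> = (\<alpha> * \<alpha>) * (\<delta> * (3 * a' * \<beta>\<^sup>2) + \<delta> * (2 * b' * \<beta> * \<delta>) + \<delta> * c')" by Groebner_Basis.algebra
    finally show "c = \<delta> * (3 * a' * \<beta>\<^sup>2) + \<delta> * (2 * b' * \<beta> * \<delta>) + \<delta> * c'" by (simp only: sq mult_1)
    show "\<alpha> * \<delta> * d = a' * \<beta> ^ 3 + b' * \<beta>\<^sup>2 * \<delta> + c' * \<beta> + d' * \<delta>"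
      using 1(4) unfolding e by simp
  qed
qed

text \<open>An upper triangular equivalence changes \<open>b\<close>, up to sign, by a multiple of
  \<open>3 a'\<close>. As \<open>b\<close> and \<open>b'\<close> lie between 1 and the common
  leading coefficient, neither \<open>b - b'\<close> nor \<open>- (b + b')\<close> is a nonzero
  multiple of it, and positivity fixes the signs.\<close>

lemma equiv_eq_nonzero:
  fixes a b c d a' b' c' d' :: int
  assumes eq: "form_equiv (a, b, c, d) (a', b', c', d')"
    and Q: "(b' * c' - 9 * a' * d')\<^sup>2 \<le> (b'\<^sup>2 - 3 * a' * c') * (c'\<^sup>2 - 3 * b' * d')"
    and P0: "0 \<le> b'\<^sup>2 - 3 * a' * c'" and P1: "0 \<le> b\<^sup>2 - 3 * a * c" and PR: "2 * (b\<^sup>2 - 3 * a * c) < c'\<^sup>2 - 3 * b' * d'"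
    and b: "1 \<le> b" "b \<le> a" "1 \<le> b'" "b' \<le> a'"
  shows "(a, b, c, d) = (a', b', c', d')"
proof -
  obtain \<alpha> \<beta> \<delta> where ad: "\<bar>\<alpha>\<bar> = 1" "\<bar>\<delta>\<bar> = 1" and e:
    "a = \<delta> * a'" "b = \<alpha> * (3 * a' * \<beta> * \<delta> + b')"
    "c = \<delta> * (3 * a' * \<beta>\<^sup>2) + \<delta> * (2 * b' * \<beta> * \<delta>) + \<delta> * c'"
    "\<alpha> * \<delta> * d = a' * \<beta> ^ 3 + b' * \<beta>\<^sup>2 * \<delta> + c' * \<beta> + d' * \<delta>"
    by (rule equiv_upper_triangular[OF eq Q P0 P1 PR]) (rule that; assumption)
  have d1: "\<delta> = 1"
  proof (rule ccontr)
    assume "\<delta> \<noteq> 1"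
    then have "\<delta> = - 1" using ad(2) by linarith
    then show False using e(1) b by simp
  qed
  have aa: "a = a'" using e(1) d1 by simp
  have small: "\<beta> = 0" if "\<bar>a' * (3 * \<beta>)\<bar> \<le> 2 * a'" for \<beta>
  proof (rule ccontr)
    assume "\<beta> \<noteq> 0"
    then have "a' * 3 \<le> a' * \<bar>3 * \<beta>\<bar>" using b by (intro mult_left_mono) auto
    then show False using that b by (simp add: abs_mult)
  qed
  have \<alpha>: "\<alpha> = 1"
  proof (rule ccontr)
    assume "\<alpha> \<noteq> 1"
    then have "\<alpha> = - 1" using ad(1) by linarith
    then have "a' * (3 * \<beta>) = - (b + b')" using e(2) d1 by simp
    moreover from this have "\<beta> = 0" using b aa by (intro small) simp
    ultimately show False using b by simp
  qed
  have "a' * (3 * \<beta>) = b - b'" using e(2) d1 \<alpha> by simp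
  moreover from this have "\<beta> = 0" using b aa by (intro small) (simp add: abs_le_iff)
  ultimately show ?thesis using e d1 \<alpha> aa by simp
qed

text \<open>With \<open>a = 0\<close> the shear acts on the third coefficient through
  \<open>2 b' \<beta>\<close>. The ranges of \<open>c\<close> and \<open>c'\<close> make
  \<open>c - c'\<close> and \<open>c + c'\<close> smaller than \<open>2 b'\<close> in absolute
  value, so \<open>\<beta> = 0\<close>, and positivity fixes the signs.\<close>

lemma equiv_eq_zero:
  fixes b c d b' c' d' :: int
  assumes eq: "form_equiv (0, b, c, d) (0, b', c', d')"
    and Q: "(b' * c')\<^sup>2 \<le> b'\<^sup>2 * (c'\<^sup>2 - 3 * b' * d')" and PR: "2 * b\<^sup>2 < c'\<^sup>2 - 3 * b' * d'"
    and b: "1 \<le> c" "c < b" "1 \<le> c'" "c' < b'"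
  shows "(0::int, b, c, d) = (0, b', c', d')"
proof -
  obtain \<alpha> \<beta> \<delta> where ad: "\<bar>\<alpha>\<bar> = 1" "\<bar>\<delta>\<bar> = 1" and e:
    "0 = \<delta> * 0" "b = \<alpha> * (3 * 0 * \<beta> * \<delta> + b')"
    "c = \<delta> * (3 * 0 * \<beta>\<^sup>2) + \<delta> * (2 * b' * \<beta> * \<delta>) + \<delta> * c'"
    "\<alpha> * \<delta> * d = 0 * \<beta> ^ 3 + b' * \<beta>\<^sup>2 * \<delta> + c' * \<beta> + d' * \<delta>"
  proof -
    have "(b' * c' - 9 * 0 * d')\<^sup>2 \<le> (b'\<^sup>2 - 3 * 0 * c') * (c'\<^sup>2 - 3 * b' * d')" using Q by simp
    moreover have "0 \<le> b'\<^sup>2 - 3 * 0 * c'" "0 \<le> b\<^sup>2 - 3 * 0 * c" by simp_all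
    moreover have "2 * (b\<^sup>2 - 3 * 0 * c) < c'\<^sup>2 - 3 * b' * d'" using PR by simp
    ultimately show thesis by (rule equiv_upper_triangular[OF eq]) (rule that; assumption)
  qed
  have \<alpha>: "\<alpha> = 1"
  proof (rule ccontr)
    assume "\<alpha> \<noteq> 1"
    then have "\<alpha> = - 1" using ad(1) by linarith
    then show False using e(2) b by simp
  qed
  have bb: "b = b'" using e(2) \<alpha> by simp
  have small: "\<beta> = 0" if "\<bar>b' * (2 * \<beta>)\<bar> < 2 * b'" for \<beta>
  proof (rule ccontr)
    assume "\<beta> \<noteq> 0"
    then have "b' * 2 \<le> b' * \<bar>2 * \<beta>\<bar>" using b by (intro mult_left_mono) auto
    then show False using that b by (simp add: abs_mult)
  qed
  have dd: "\<delta> * \<delta> = 1" using abs_mult_self_eq[of \<delta>] ad(2) by simp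
  have c: "c = b' * (2 * \<beta>) + \<delta> * c'"
  proof -
    have "\<delta> * (2 * b' * \<beta> * \<delta>) = (\<delta> * \<delta>) * (b' * (2 * \<beta>))" by (simp only: mult_ac)
    then show ?thesis using e(3) dd by simp
  qed
  have d1: "\<delta> = 1"
  proof (rule ccontr)
    assume "\<delta> \<noteq> 1"
    then have "\<delta> = - 1" using ad(2) by linarith
    then have "b' * (2 * \<beta>) = c + c'" using c by simp
    moreover from this have "\<beta> = 0" using b bb by (intro small) simp
    ultimately show False using b by simp
  qed
  have "b' * (2 * \<beta>) = c - c'" using c d1 by simp
  moreover from this have "\<beta> = 0" using b bb by (intro small) (simp add: abs_less_iff)
  ultimately show ?thesis using e d1 \<alpha> bb by simp
qed

section \<open>Rings near a given point\<close>

text \<open>If \<open>|z| > 2 s\<close>, the lower terms amount to at most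
  \<open>1/2 + 1/4 + 1/8\<close> of \<open>|z|^3\<close>.\<close>

lemma cubic_root_bound:
  fixes z :: complex
  assumes eq: "z ^ 3 + \<beta> * z\<^sup>2 + \<kappa> * z + \<theta> = 0" and s: "s \<ge> 0"
    and b: "cmod \<beta> \<le> s" "cmod \<kappa> \<le> s\<^sup>2" "cmod \<theta> \<le> s ^ 3"
  shows "cmod z \<le> 2 * s"
proof (rule ccontr)
  assume "\<not> cmod z \<le> 2 * s"
  then have r: "2 * s < cmod z" by simp
  define r where "r = cmod z"
  have r0: "r > 0" "s < r / 2" unfolding r_def using r s by linarith+
  have "z ^ 3 = - (\<beta> * z\<^sup>2 + \<kappa> * z + \<theta>)" unfolding eq_neg_iff_add_eq_0 using eq by (simp add: add.assoc)
  then have "r ^ 3 = cmod (\<beta> * z\<^sup>2 + \<kappa> * z + \<theta>)" unfolding r_def norm_power[symmetric] by (metis norm_minus_cancel)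
  also have "\<dots> \<le> cmod \<beta> * r\<^sup>2 + cmod \<kappa> * r + cmod \<theta>"
    unfolding r_def by (intro order_trans[OF norm_triangle_ineq] add_mono) (simp_all add: norm_mult norm_power)
  also have "\<dots> \<le> s * r\<^sup>2 + s\<^sup>2 * r + s ^ 3" using r0 b by (intro add_mono mult_right_mono) auto
  also have "\<dots> \<le> (r / 2) * r\<^sup>2 + (r / 2)\<^sup>2 * r + (r / 2) ^ 3"
    using r0 s by (intro add_mono mult_right_mono power_mono) auto
  also have "\<dots> = r ^ 3 * (7 / 8)" by (simp add: power2_eq_square power3_eq_cube field_simps)
  finally show False using r0 by simp
qed

lemma flen_le:
  assumes d: "disc f \<noteq> 0" and r: "r \<ge> 0" and b: "\<And>u. u \<in> pts f \<Longrightarrow> cmod (ev u x) \<le> r"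
  shows "flen f x \<le> r"
proof -
  obtain u v t where p: "pts f = {u, v, t}" "u \<noteq> v" "u \<noteq> t" "v \<noteq> t"
    by (rule form_points[OF d]) (rule that; assumption)
  then have c: "card (pts f) = 3" by simp
  have "(\<Sum>u\<in>pts f. (cmod (ev u x))\<^sup>2) \<le> real (card (pts f)) * r\<^sup>2"
    by (rule sum_bounded_above) (intro power_mono b norm_ge_zero)
  then have "1 / 3 * (\<Sum>u\<in>pts f. (cmod (ev u x))\<^sup>2) \<le> r\<^sup>2" unfolding c by simp
  then show ?thesis unfolding flen_def using r by (intro real_le_lsqrt) auto
qed

text \<open>\<open>\<omega>\<close> is a root of \<open>z^3 + b z^2 + a c z + a^2 d\<close>, so
  these coefficients bound its conjugates. This estimates minima straight from the coefficients of a
  form that is given explicitly, without reducing it.\<close>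

lemma succ_min_1_le:
  assumes R: "cring R" and h: "h \<in> ring_iso (form_ring (a, b, c, d)) R" and D: "disc (a, b, c, d) \<noteq> 0"
    and s: "1 \<le> s" "\<bar>real_of_int b\<bar> \<le> s" "\<bar>real_of_int (a * c)\<bar> \<le> s\<^sup>2" "\<bar>real_of_int (a\<^sup>2 * d)\<bar> \<le> s ^ 3"
  shows "succ_min 3 R 1 \<le> 2 * s" "flen (a, b, c, d) (0, 1, 0) \<le> 2 * s"
proof -
  have s0: "0 \<le> s" using s(1) by linarith
  show fl: "flen (a, b, c, d) (0, 1, 0) \<le> 2 * s"
  proof (rule flen_le[OF D])
    fix u assume u: "u \<in> pts (a, b, c, d)"
    obtain z w where zw: "u = (z, w)" by (cases u)
    have "cmod z \<le> 2 * s"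
      by (rule cubic_root_bound[OF pts_cubic(1)[OF u[unfolded zw]]]) (use s s0 in \<open>simp_all only: norm_of_int\<close>)
    then show "cmod (ev u (0, 1, 0)) \<le> 2 * s" by (simp add: zw)
  qed (use s in simp)
  then show "succ_min 3 R 1 \<le> 2 * s" using succ_min_le_flen(1)[OF R h D, of 0] s(1) by linarith
qed

lemma succ_min_2_le:
  assumes R: "cring R" and h: "h \<in> ring_iso (form_ring (a, b, c, d)) R" and D: "disc (a, b, c, d) \<noteq> 0"
    and s: "1 \<le> s" "\<bar>real_of_int b\<bar> \<le> s" "\<bar>real_of_int (a * c)\<bar> \<le> s\<^sup>2" "\<bar>real_of_int (a\<^sup>2 * d)\<bar> \<le> s ^ 3"
    and u: "s \<le> u" "\<bar>real_of_int c\<bar> \<le> u" "\<bar>real_of_int (b * d)\<bar> \<le> u\<^sup>2" "\<bar>real_of_int (a * d\<^sup>2)\<bar> \<le> u ^ 3"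
  shows "succ_min 3 R 2 \<le> 2 * u"
proof -
  have u0: "0 \<le> u" using s(1) u(1) by linarith
  have "flen (a, b, c, d) (0, 0, 1) \<le> 2 * u"
  proof (rule flen_le[OF D])
    fix v assume v: "v \<in> pts (a, b, c, d)"
    obtain z w where zw: "v = (z, w)" by (cases v)
    have "cmod w \<le> 2 * u"
    proof (rule cubic_root_bound)
      show "w ^ 3 + (- of_int c) * w\<^sup>2 + of_int (b * d) * w + (- of_int (a * d\<^sup>2)) = 0"
        using pts_cubic(2)[OF v[unfolded zw]] by simp
    qed (use u u0 in \<open>simp_all only: norm_minus_cancel norm_of_int\<close>)
    then show "cmod (ev v (0, 0, 1)) \<le> 2 * u" by (simp add: zw)
  qed (use s(1) u(1) in simp)
  then show ?thesis using succ_min_le_flen(2)[OF R h D, of 0 0] succ_min_1_le(2)[OF R h D s] s(1) u(1) by linarith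
qed

text \<open>\<open>log D\<close> divides by \<open>ln D\<close>, the window by \<open>ln X\<close>;
  \<open>ln D \<ge> ln X / 2\<close> accounts for the 2 in the condition on
  \<open>\<epsilon>\<close>.\<close>

lemma abs_log_le:
  assumes "l > 0" "l \<le> W * D powr p" "D powr p \<le> W * l" "ln X / 2 \<le> ln D" "ln X > 0" "W \<ge> 1" "D > 0"
    and \<epsilon>: "2 * ln W \<le> \<epsilon>"
  shows "\<bar>log D l - p\<bar> \<le> \<epsilon> / ln X"
proof -
  have D: "ln D > 0" using assms(4,5) by linarith
  have "ln l \<le> ln (W * D powr p)" using assms by simp
  moreover have "ln (D powr p) \<le> ln (W * l)" using assms by (intro ln_mono) auto
  ultimately have "\<bar>ln l - p * ln D\<bar> \<le> ln W" using assms by (simp add: ln_mult ln_powr abs_le_iff)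
  moreover have "log D l - p = (ln l - p * ln D) / ln D" using D by (simp add: log_def field_simps)
  ultimately have "\<bar>log D l - p\<bar> \<le> ln W / ln D" using D by (simp add: abs_divide divide_right_mono)
  also have "\<dots> \<le> ln W / (ln X / 2)" using assms D by (intro divide_left_mono) auto
  also have "\<dots> = 2 * ln W / ln X" by simp
  also have "\<dots> \<le> \<epsilon> / ln X" using \<epsilon> assms(5) by (intro divide_right_mono) auto
  finally show ?thesis .
qed

lemma abs_log_leD:
  assumes "\<bar>log D l - p\<bar> \<le> \<epsilon> / ln X" "1 < D" "D \<le> X" "l > 0" "\<epsilon> \<ge> 0"
  shows "D powr p / exp \<epsilon> \<le> l" "l \<le> exp \<epsilon> * D powr p"
proof -
  have D: "ln D > 0" "ln D \<le> ln X" using assms by simp_all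
  have "\<bar>log D l - p\<bar> * ln D \<le> \<epsilon> / ln X * ln D" using assms(1) D by (intro mult_right_mono) auto
  also have "\<dots> \<le> \<epsilon>"
  proof -
    have "\<epsilon> * ln D \<le> \<epsilon> * ln X" using D assms(5) by (intro mult_left_mono)
    then show ?thesis using D by (simp add: field_simps)
  qed
  also have "\<bar>log D l - p\<bar> * ln D = \<bar>ln l - p * ln D\<bar>"
  proof -
    have "ln l - p * ln D = (log D l - p) * ln D" using D by (simp add: log_def field_simps)
    then show ?thesis using D by (simp add: abs_mult)
  qed
  finally have l: "ln l \<le> \<epsilon> + p * ln D" "p * ln D - \<epsilon> \<le> ln l" by linarith+
  have "exp (ln l) \<le> exp (\<epsilon> + p * ln D)" using l(1) by simp
  then show "l \<le> exp \<epsilon> * D powr p" using assms by (simp add: exp_add powr_def)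
  have "exp (p * ln D - \<epsilon>) \<le> exp (ln l)" using l(2) by simp
  then show "D powr p / exp \<epsilon> \<le> l" using assms by (simp add: exp_diff powr_def)
qed

text \<open>The last claim is one half of Minkowski's second theorem, obtained from a reduced
  equivalent form; 25 is the square of the 5 in \<open>succ_min_bounds\<close>.\<close>

lemma succ_min_pos:
  assumes R: "cring R" and h: "h \<in> ring_iso (form_ring f) R" and d: "disc f \<noteq> 0"
  shows "succ_min 3 R 1 > 0" "succ_min 3 R 2 > 0"
    "sqrt \<bar>of_int (disc f)\<bar> \<le> 25 * (succ_min 3 R 1 * succ_min 3 R 2)"
proof -
  obtain g where g: "form_equiv g f" "reduced g" using reduced_exists[OF d] by blast
  obtain k where k: "k \<in> ring_iso (form_ring g) (form_ring f)"
    using g(1) unfolding form_equiv_def is_ring_iso_def by blast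
  have hk: "h \<circ> k \<in> ring_iso (form_ring g) R" by (rule ring_iso_set_trans[OF k h])
  note b = succ_min_bounds[OF R hk g(2)]
  have s: "1 \<le> sqrt (qP g)" "1 \<le> sqrt (qR g)" using reduced_ge_1[OF g(2)] by simp_all
  show 1: "succ_min 3 R 1 > 0" "succ_min 3 R 2 > 0" using b(2,4) s by linarith+
  have "sqrt \<bar>of_int (disc f)\<bar> \<le> sqrt (qP g * qR g)"
    using reduced_gram(1)[OF g(2)] form_equiv_disc[OF g(1)] by simp
  also have "\<dots> = sqrt (qP g) * sqrt (qR g)" by (rule real_sqrt_mult)
  also have "\<dots> \<le> (5 * succ_min 3 R 1) * (5 * succ_min 3 R 2)" using b s 1 by (intro mult_mono) auto
  finally show "sqrt \<bar>of_int (disc f)\<bar> \<le> 25 * (succ_min 3 R 1 * succ_min 3 R 2)" by simp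
qed

text \<open>Upper bounds of the right order for both minima suffice: their product is at least
  \<open>sqrt D / 25\<close> and \<open>p1 + p2 = 1 / 2\<close>, so the upper bound for one is a
  lower bound for the other. The factor \<open>50 K^2\<close> is \<open>25\<close> times the
  \<open>2 K^2\<close> of the upper bounds.\<close>

lemma near_minimaI:
  fixes R :: "nat ring"
  assumes R: "rank_ring 3 R" and h: "h \<in> ring_iso (form_ring (a, b, c, d)) R"
  defines "D \<equiv> \<bar>real_of_int (disc (a, b, c, d))\<bar>"
  assumes K: "K \<ge> 1" "K\<^sup>2 \<le> X" "X > 1" and D: "X / K \<le> D" "D \<le> X"
    and s: "1 \<le> s" "\<bar>real_of_int b\<bar> \<le> s" "\<bar>real_of_int (a * c)\<bar> \<le> s\<^sup>2" "\<bar>real_of_int (a\<^sup>2 * d)\<bar> \<le> s ^ 3"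
    and u: "s \<le> u" "\<bar>real_of_int c\<bar> \<le> u" "\<bar>real_of_int (b * d)\<bar> \<le> u\<^sup>2" "\<bar>real_of_int (a * d\<^sup>2)\<bar> \<le> u ^ 3"
    and p: "s \<le> K * X powr p1" "u \<le> K * X powr p2" "p1 + p2 = 1 / 2" "p1 \<ge> 0" "p2 \<ge> 0"
    and \<epsilon>: "2 * ln (50 * K\<^sup>2) \<le> \<epsilon>"
  shows "near_minima (p1, p2) \<epsilon> X R"
proof -
  have cr: "cring R" using R by (simp add: rank_ring_def)
  have "0 < X / K" using K by simp
  then have D0: "D > 0" using D(1) by linarith
  then have dz: "disc (a, b, c, d) \<noteq> 0" unfolding D_def by (metis abs_zero less_irrefl of_int_0)
  have aD: "abs_disc 3 R = D" unfolding abs_disc_def ring_disc_form[OF cr h] D_def by simp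
  define l1 l2 where "l1 = succ_min 3 R 1" and "l2 = succ_min 3 R 2"
  have pos: "l1 > 0" "l2 > 0" "sqrt D \<le> 25 * (l1 * l2)"
    using succ_min_pos[OF cr h dz] by (simp_all add: l1_def l2_def D_def)
  have le: "l1 \<le> 2 * s" "l2 \<le> 2 * u"
    unfolding l1_def l2_def by (rule succ_min_1_le[OF cr h dz s] succ_min_2_le[OF cr h dz s u])+
  have XD: "K * X powr q \<le> K\<^sup>2 * D powr q" if "0 \<le> q" "q \<le> 1" for q
  proof -
    have "X \<le> K * D" using D(1) K by (simp add: field_simps)
    then have "X powr q \<le> (K * D) powr q" using K that by (intro powr_mono2) auto
    also have "\<dots> = K powr q * D powr q" using K D0 by (simp add: powr_mult)
    also have "\<dots> \<le> K powr 1 * D powr q" using K that by (intro mult_right_mono powr_mono) auto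
    finally have "K * X powr q \<le> K * (K * D powr q)" using K by (intro mult_left_mono) auto
    then show ?thesis by (simp add: power2_eq_square mult.assoc)
  qed
  have up: "l1 \<le> 2 * K\<^sup>2 * D powr p1" "l2 \<le> 2 * K\<^sup>2 * D powr p2"
    using le p(1,2) XD[of p1] XD[of p2] p(3-5) by linarith+
  have sq: "sqrt D = D powr p1 * D powr p2" using D0 by (simp add: powr_half_sqrt[symmetric] powr_add[symmetric] p(3))
  have low1: "D powr p1 \<le> 50 * K\<^sup>2 * l1"
  proof -
    have "D powr p1 * D powr p2 \<le> 25 * (l1 * l2)" using pos(3) sq by simp
    also have "\<dots> \<le> 25 * (l1 * (2 * K\<^sup>2 * D powr p2))" using up pos by (intro mult_left_mono) auto
    finally have "D powr p1 * D powr p2 \<le> (50 * K\<^sup>2 * l1) * D powr p2" by (simp add: mult_ac)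
    then show ?thesis using D0 by simp
  qed
  have low2: "D powr p2 \<le> 50 * K\<^sup>2 * l2"
  proof -
    have "D powr p1 * D powr p2 \<le> 25 * (l1 * l2)" using pos(3) sq by simp
    also have "\<dots> \<le> 25 * ((2 * K\<^sup>2 * D powr p1) * l2)" using up pos by (intro mult_left_mono mult_right_mono) auto
    finally have "D powr p1 * D powr p2 \<le> D powr p1 * (50 * K\<^sup>2 * l2)" by (simp add: mult_ac)
    then show ?thesis using D0 by simp
  qed
  have K2: "1 \<le> K\<^sup>2" using K by simp
  have up': "l1 \<le> 50 * K\<^sup>2 * D powr p1" "l2 \<le> 50 * K\<^sup>2 * D powr p2"
  proof -
    have "2 * K\<^sup>2 * D powr q \<le> 50 * K\<^sup>2 * D powr q" for q by (intro mult_right_mono) auto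
    from this[of p1] this[of p2] up show "l1 \<le> 50 * K\<^sup>2 * D powr p1" "l2 \<le> 50 * K\<^sup>2 * D powr p2" by linarith+
  qed
  have lnD: "ln X / 2 \<le> ln D"
  proof -
    have "ln (K\<^sup>2) \<le> ln X" using K by (intro ln_mono) auto
    then have "2 * ln K \<le> ln X" using K by (simp add: ln_realpow)
    moreover have "ln (X / K) \<le> ln D" using D(1) K by (intro ln_mono) auto
    then have "ln X - ln K \<le> ln D" using K by (simp add: ln_div)
    ultimately show ?thesis by linarith
  qed
  have lnX: "ln X > 0" using K by simp
  have W: "50 * K\<^sup>2 \<ge> 1" using K2 by linarith
  have "\<bar>log D l1 - p1\<bar> \<le> \<epsilon> / ln X" by (rule abs_log_le[OF pos(1) up'(1) low1 lnD lnX W D0 \<epsilon>])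
  moreover have "\<bar>log D l2 - p2\<bar> \<le> \<epsilon> / ln X" by (rule abs_log_le[OF pos(2) up'(2) low2 lnD lnX W D0 \<epsilon>])
  ultimately show ?thesis unfolding near_minima_def aD l1_def[symmetric] l2_def[symmetric] by simp
qed

section \<open>The counted rings in terms of forms\<close>

definition near_forms :: "real \<times> real \<Rightarrow> real \<Rightarrow> real \<Rightarrow> form set" where
  "near_forms p \<epsilon> X = {f. \<exists>R\<in>{R. nondegenerate 3 R \<and> abs_disc 3 R \<le> X \<and> near_minima p \<epsilon> X R}. form_ring f \<simeq> R}"

definition max_near_forms :: "real \<times> real \<Rightarrow> real \<Rightarrow> real \<Rightarrow> form set" where
  "max_near_forms p \<epsilon> X = {f. \<exists>R\<in>{R. nondegenerate 3 R \<and> maximal_ring 3 R \<and> abs_disc 3 R \<le> X \<and> near_minima p \<epsilon> X R}. form_ring f \<simeq> R}"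

lemma cubic_classes_eq: "cubic_classes p \<epsilon> X = form_class ` near_forms p \<epsilon> X"
  unfolding cubic_classes_def near_forms_def by (rule quotient_rank_ring_iso) (auto simp: nondegenerate_def)

lemma max_cubic_classes_eq: "max_cubic_classes p \<epsilon> X = form_class ` max_near_forms p \<epsilon> X"
  unfolding max_cubic_classes_def max_near_forms_def by (rule quotient_rank_ring_iso) (auto simp: nondegenerate_def)

lemma max_near_forms_subset: "max_near_forms p \<epsilon> X \<subseteq> near_forms p \<epsilon> X"
  unfolding near_forms_def max_near_forms_def by blast

lemma near_formsE:
  assumes "f \<in> near_forms p \<epsilon> X"
  obtains R :: "nat ring" and h where "rank_ring 3 R" "h \<in> ring_iso (form_ring f) R" "near_minima p \<epsilon> X R"
    "abs_disc 3 R = \<bar>of_int (disc f)\<bar>" "disc f \<noteq> 0" "\<bar>of_int (disc f)\<bar> \<le> X"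
proof -
  obtain R :: "nat ring" and h where R: "nondegenerate 3 R" "abs_disc 3 R \<le> X" "near_minima p \<epsilon> X R"
    and h: "h \<in> ring_iso (form_ring f) R"
    using assms unfolding near_forms_def is_ring_iso_def by blast
  have r: "rank_ring 3 R" using R by (simp add: nondegenerate_def)
  then have "ring_disc 3 R = disc f" using ring_disc_form[OF _ h] by (simp add: rank_ring_def)
  then show thesis using R r h by (intro that[of R h]) (simp_all add: abs_disc_def nondegenerate_def)
qed

lemma max_near_formsE:
  assumes "f \<in> max_near_forms p \<epsilon> X"
  obtains R :: "nat ring" and h where "rank_ring 3 R" "h \<in> ring_iso (form_ring f) R" "maximal_ring 3 R"
  using assms unfolding max_near_forms_def is_ring_iso_def nondegenerate_def by blast

text \<open>Membership asks for some copy of the ring on the natural numbers; \<open>n\<close>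
  provides the estimate for every copy, so any one can be chosen.\<close>

lemma near_formsI:
  assumes d: "disc f \<noteq> 0" "\<bar>of_int (disc f)\<bar> \<le> X"
    and n: "\<And>(R :: nat ring) h. rank_ring 3 R \<Longrightarrow> h \<in> ring_iso (form_ring f) R \<Longrightarrow> near_minima p \<epsilon> X R"
  shows "f \<in> near_forms p \<epsilon> X"
    and "(\<And>q. prime q \<Longrightarrow> \<not> nonmax_at q f) \<Longrightarrow> f \<in> max_near_forms p \<epsilon> X"
proof -
  obtain R :: "nat ring" where R: "rank_ring 3 R" "form_ring f \<simeq> R"
    using rank_ring_nat_copy[OF rank_ring_form_ring] by blast
  then obtain h where h: "h \<in> ring_iso (form_ring f) R" unfolding is_ring_iso_def by blast
  have "ring_disc 3 R = disc f" using ring_disc_form[OF _ h] R by (simp add: rank_ring_def)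
  then have *: "nondegenerate 3 R" "abs_disc 3 R \<le> X" "near_minima p \<epsilon> X R"
    using d R n[OF R(1) h] by (simp_all add: nondegenerate_def abs_disc_def)
  then show "f \<in> near_forms p \<epsilon> X" unfolding near_forms_def using R by blast
  assume "\<And>q. prime q \<Longrightarrow> \<not> nonmax_at q f"
  then have "maximal_ring 3 R" using not_maximal_imp_nonmax_at[OF R(1) h] by blast
  then show "f \<in> max_near_forms p \<epsilon> X" unfolding max_near_forms_def using * R by blast
qed

lemma near_forms_equiv:
  assumes "form_equiv g f"
  shows "f \<in> near_forms p \<epsilon> X \<Longrightarrow> g \<in> near_forms p \<epsilon> X" "f \<in> max_near_forms p \<epsilon> X \<Longrightarrow> g \<in> max_near_forms p \<epsilon> X"
proof -
  have "form_ring g \<simeq> R" if "form_ring f \<simeq> R" for R :: "nat ring"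
    using assms that unfolding form_equiv_def by (rule ring_iso_trans)
  then show "f \<in> near_forms p \<epsilon> X \<Longrightarrow> g \<in> near_forms p \<epsilon> X" "f \<in> max_near_forms p \<epsilon> X \<Longrightarrow> g \<in> max_near_forms p \<epsilon> X"
    unfolding near_forms_def max_near_forms_def by blast+
qed

lemma near_forms_reduced:
  assumes f: "f \<in> near_forms p \<epsilon> X"
  obtains g where "reduced g" "form_equiv g f" "form_class f = form_class g"
proof -
  have "disc f \<noteq> 0" using f by (rule near_formsE)
  then obtain g where g: "form_equiv g f" "reduced g" using reduced_exists by blast
  then show thesis using form_class_eq_iff form_equiv_sym that by blast
qed

lemma near_reduced:
  assumes g: "reduced g" "g \<in> near_forms (p1, p2) \<epsilon> X" and \<epsilon>: "\<epsilon> \<ge> 0"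
  defines "D \<equiv> \<bar>real_of_int (disc g)\<bar>" and "c \<equiv> 5 * exp \<epsilon>"
  shows "D powr p1 / c \<le> sqrt (qP g)" "sqrt (qP g) \<le> c * D powr p1"
    "D powr p2 / c \<le> sqrt (qR g)" "sqrt (qR g) \<le> c * D powr p2" "1 \<le> D" "D \<le> X"
proof -
  obtain R :: "nat ring" and h where R: "rank_ring 3 R" "h \<in> ring_iso (form_ring g) R" "near_minima (p1, p2) \<epsilon> X R"
    "abs_disc 3 R = \<bar>of_int (disc g)\<bar>" "disc g \<noteq> 0" "\<bar>of_int (disc g)\<bar> \<le> X"
    by (rule near_formsE[OF g(2)]) (rule that; assumption)
  note R = R[folded D_def]
  show D: "1 \<le> D" unfolding D_def by (rule abs_disc_ge_1[OF R(5)])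
  show "D \<le> X" by fact
  have cr: "cring R" using R(1) by (simp add: rank_ring_def)
  note b = succ_min_bounds[OF cr R(2) g(1)]
  note pos = succ_min_pos[OF cr R(2,5)]
  note ge = reduced_ge_1[OF g(1)]
  have e1: "exp \<epsilon> \<ge> 1" using \<epsilon> by simp
  have "D powr p1 / c \<le> sqrt (qP g) \<and> sqrt (qP g) \<le> c * D powr p1 \<and> D powr p2 / c \<le> sqrt (qR g) \<and> sqrt (qR g) \<le> c * D powr p2"
  \<comment> \<open>With base 1 the logarithm is 0 and the window carries no information about the
    minima; the Gram bound gives \<open>qP g \<le> 4\<close> and \<open>qR g \<le> 4\<close>
    instead.\<close>
  proof (cases "D = 1")
    case True
    have "qP g * qR g \<le> 4" using reduced_gram(2)[OF g(1)] True unfolding D_def by simp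
    moreover have "qP g * 1 \<le> qP g * qR g" "1 * qR g \<le> qP g * qR g" using ge by (intro mult_mono; simp)+
    ultimately have "sqrt (qP g) \<le> sqrt 4" "sqrt (qR g) \<le> sqrt 4" unfolding real_sqrt_le_iff by linarith+
    moreover have "1 \<le> sqrt (qP g)" "1 \<le> sqrt (qR g)" using ge by simp_all
    moreover have c5: "5 \<le> c" unfolding c_def using e1 by simp
    moreover have "1 / c \<le> 1" using c5 by (simp add: divide_le_eq_1)
    moreover have "sqrt 4 = (2 :: real)" by simp
    ultimately have "1 / c \<le> sqrt (qP g)" "sqrt (qP g) \<le> c" "1 / c \<le> sqrt (qR g)" "sqrt (qR g) \<le> c" by linarith+
    then show ?thesis unfolding True by simp
  next
    case False
    then have D1: "1 < D" using D by simp
    have n: "\<bar>log D (succ_min 3 R 1) - p1\<bar> \<le> \<epsilon> / ln X" "\<bar>log D (succ_min 3 R 2) - p2\<bar> \<le> \<epsilon> / ln X"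
      using R(3) unfolding near_minima_def R(4) by simp_all
    note n1 = abs_log_leD[OF n(1) D1 R(6) pos(1) \<epsilon>] and n2 = abs_log_leD[OF n(2) D1 R(6) pos(2) \<epsilon>]
    have half: "D powr q / c \<le> x" if "D powr q / exp \<epsilon> \<le> 2 * x" "x \<ge> 0" for q x
    proof -
      have "v / 5 \<le> y" if "v \<le> 2 * y" "y \<ge> 0" for v y :: real using that by linarith
      from this[OF that] have "D powr q / exp \<epsilon> / 5 \<le> x" .
      then show ?thesis by (simp add: c_def mult.commute)
    qed
    show ?thesis
    proof (intro conjI)
      show "D powr p1 / c \<le> sqrt (qP g)" "D powr p2 / c \<le> sqrt (qR g)"
        using n1(1) n2(1) b(1,3) ge by (intro half; simp)+
      show "sqrt (qP g) \<le> c * D powr p1" "sqrt (qR g) \<le> c * D powr p2"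
        using n1(2) n2(2) b(2,4) unfolding c_def by linarith+
    qed
  qed
  then show "D powr p1 / c \<le> sqrt (qP g)" "sqrt (qP g) \<le> c * D powr p1"
    "D powr p2 / c \<le> sqrt (qR g)" "sqrt (qR g) \<le> c * D powr p2" by blast+
qed

section \<open>Growth exponents and upper bounds\<close>

lemma powr_bound:
  fixes D K e :: real
  assumes "D powr e \<le> K" "e > 0" "D \<ge> 0" shows "D \<le> K powr (1 / e)"
proof -
  have "(D powr e) powr (1 / e) \<le> K powr (1 / e)" using assms by (intro powr_mono2) auto
  then show ?thesis using assms by (simp add: powr_powr)
qed

lemma growth_upI:
  assumes "\<And>X. X \<ge> 1 \<Longrightarrow> real (card (F X)) \<le> C * (1 + log 2 X) * X powr L" and C: "C > 0" and L: "L \<ge> 0" and \<eta>: "\<eta> > 0"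
  shows "\<forall>\<^sub>F X in at_top. real (card (F X)) + 1 \<le> X powr (L + \<eta>)"
proof -
  have "\<forall>\<^sub>F X::real in at_top. C * (1 + log 2 X) + 1 \<le> X powr \<eta>" using C \<eta> by real_asymp
  then show ?thesis using eventually_ge_at_top[of 1]
  proof eventually_elim
    case (elim X)
    have XL: "1 \<le> X powr L" using elim(2) L by (simp add: ge_one_powr_ge_zero)
    have "real (card (F X)) + 1 \<le> C * (1 + log 2 X) * X powr L + X powr L" using assms(1)[OF elim(2)] XL by linarith
    also have "\<dots> = (C * (1 + log 2 X) + 1) * X powr L" by (simp add: algebra_simps)
    also have "\<dots> \<le> X powr \<eta> * X powr L" using elim(1) by (intro mult_right_mono) auto
    finally show ?case by (simp add: powr_add mult.commute)
  qed
qed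

lemma growth_lowI:
  assumes "\<forall>\<^sub>F X in at_top. c * X powr L \<le> real (card (F X))" and c: "c > 0" and \<eta>: "\<eta> > 0"
  shows "\<forall>\<^sub>F X in at_top. X powr (L - \<eta>) \<le> real (card (F X)) + 1"
proof -
  have "\<forall>\<^sub>F X::real in at_top. 1 / c \<le> X powr \<eta>" using c \<eta> by real_asymp
  then show ?thesis using assms(1) eventually_gt_at_top[of 0]
  proof eventually_elim
    case (elim X)
    have "1 \<le> c * X powr \<eta>" using elim(1) c by (simp add: field_simps)
    then have "X powr (L - \<eta>) \<le> X powr (L - \<eta>) * (c * X powr \<eta>)"
      using mult_left_mono[of 1 "c * X powr \<eta>" "X powr (L - \<eta>)"] by simp
    also have "\<dots> = c * (X powr (L - \<eta>) * X powr \<eta>)" by simp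
    also have "\<dots> = c * X powr L" by (simp add: powr_add[symmetric])
    finally show ?case using elim(2) by linarith
  qed
qed

text \<open>The summand 1 under the logarithm keeps the lower bound true even when there are no
  classes at all.\<close>

lemma growth_exponent_bounded:
  assumes "\<And>X. X > 1 \<Longrightarrow> F X \<subseteq> disc_classes Y"
  shows "growth_exponent F = Some 0"
proof (rule growth_exponentI)
  fix \<eta> :: real assume \<eta>: "\<eta> > 0"
  have "\<forall>\<^sub>F X::real in at_top. real (card (disc_classes Y)) + 1 \<le> X powr \<eta>" using \<eta> by real_asymp
  then show "\<forall>\<^sub>F X in at_top. real (card (F X)) + 1 \<le> X powr (0 + \<eta>)" using eventually_gt_at_top[of 1]
  proof eventually_elim
    case (elim X)
    have "card (F X) \<le> card (disc_classes Y)" by (intro card_mono finite_disc_classes assms elim)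
    then show ?case using elim(1) by simp
  qed
  show "\<forall>\<^sub>F X in at_top. X powr (0 - \<eta>) \<le> real (card (F X)) + 1" using eventually_gt_at_top[of 1]
  proof eventually_elim
    case (elim X)
    have "X powr (0 - \<eta>) \<le> X powr 0" using elim \<eta> by (intro powr_mono) auto
    then show ?case using elim by simp
  qed
qed

lemma near_classes_bounded:
  assumes "\<And>g. reduced g \<Longrightarrow> g \<in> near_forms p \<epsilon> X \<Longrightarrow> \<bar>real_of_int (disc g)\<bar> \<le> Y"
  shows "form_class ` near_forms p \<epsilon> X \<subseteq> disc_classes Y"
proof (intro image_subsetI)
  fix f assume f: "f \<in> near_forms p \<epsilon> X"
  obtain g where g: "reduced g" "form_equiv g f" "form_class f = form_class g" by (rule near_forms_reduced[OF f])
  have "\<bar>real_of_int (disc g)\<bar> \<le> Y" using assms[OF g(1) near_forms_equiv(1)[OF g(2) f]] .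
  then show "form_class f \<in> disc_classes Y" unfolding disc_classes_def g(3) using g(1) by (auto simp: reduced_def)
qed

text \<open>For a reduced form \<open>qP qR\<close> is of the order of the discriminant,
  \<open>qP \<ge> 1\<close> and \<open>qP \<le> qR\<close>. Off the segment one of these becomes an
  inequality between powers of \<open>D\<close> that fails for large \<open>D\<close>; given
  \<open>p1 + p2 = 1 / 2\<close>, the end \<open>p1 \<le> 1 / 4\<close> means
  \<open>p1 \<le> p2\<close>.\<close>

lemma near_disc_bounded:
  assumes off: "\<not> (p1 + p2 = 1 / 2 \<and> 0 \<le> p1 \<and> p1 \<le> 1 / 4)" and \<epsilon>: "\<epsilon> \<ge> 0"
  shows "\<exists>Y. \<forall>X g. reduced g \<longrightarrow> g \<in> near_forms (p1, p2) \<epsilon> X \<longrightarrow> \<bar>real_of_int (disc g)\<bar> \<le> Y"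
proof -
  define c where "c = 5 * exp \<epsilon>"
  have c: "c > 0" by (simp add: c_def)
  obtain e K where e: "e > 0"
    and K: "\<And>X g. reduced g \<Longrightarrow> g \<in> near_forms (p1, p2) \<epsilon> X \<Longrightarrow> \<bar>real_of_int (disc g)\<bar> powr e \<le> K"
  proof -
    have gram: "\<bar>real_of_int (disc g)\<bar> powr (p1 + p2) \<le> 2 * c\<^sup>2 * \<bar>real_of_int (disc g)\<bar> powr (1 / 2)"
      "\<bar>real_of_int (disc g)\<bar> powr (1 / 2) \<le> c\<^sup>2 * \<bar>real_of_int (disc g)\<bar> powr (p1 + p2)"
      if g: "reduced g" "g \<in> near_forms (p1, p2) \<epsilon> X" for g X
    proof -
      define D where "D = \<bar>real_of_int (disc g)\<bar>"
      note n = near_reduced[OF g \<epsilon>, folded D_def c_def]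
      have D: "sqrt D = D powr (1 / 2)" using n(5) by (simp add: powr_half_sqrt)
      have "D powr p1 / c * (D powr p2 / c) \<le> sqrt (qP g) * sqrt (qR g)"
        using n c reduced_ge_1[OF g(1)] by (intro mult_mono) auto
      also have "\<dots> = sqrt (qP g * qR g)" by (simp add: real_sqrt_mult)
      also have "\<dots> \<le> sqrt (4 * D)" using reduced_gram(2)[OF g(1)] by (simp add: D_def)
      also have "\<dots> = 2 * D powr (1 / 2)" using D by (simp add: real_sqrt_mult)
      also have "D powr p1 / c * (D powr p2 / c) = D powr (p1 + p2) / c\<^sup>2" by (simp add: powr_add power2_eq_square)
      finally have "D powr (p1 + p2) \<le> 2 * D powr (1 / 2) * c\<^sup>2" using c by (simp only: pos_divide_le_eq zero_less_power)
      then show "D powr (p1 + p2) \<le> 2 * c\<^sup>2 * D powr (1 / 2)" by (simp only: mult_ac)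
      have "D powr (1 / 2) \<le> sqrt (3 * D)" unfolding D[symmetric] using n(5) by simp
      also have "\<dots> \<le> sqrt (qP g * qR g)" using reduced_gram(1)[OF g(1)] by (simp add: D_def)
      also have "\<dots> = sqrt (qP g) * sqrt (qR g)" by (simp add: real_sqrt_mult)
      also have "\<dots> \<le> (c * D powr p1) * (c * D powr p2)" using n c reduced_ge_1[OF g(1)] by (intro mult_mono) auto
      finally show "D powr (1 / 2) \<le> c\<^sup>2 * D powr (p1 + p2)" by (simp add: powr_add power2_eq_square mult_ac)
    qed
    have quot: "x powr (a - b) \<le> K" if "x powr a \<le> K * x powr b" "x \<ge> 1" for x a b K :: real
      using that by (simp add: powr_diff divide_le_eq)
    have D1: "1 \<le> \<bar>real_of_int (disc g)\<bar>" if "reduced g" for g using that by (intro abs_disc_ge_1) (simp add: reduced_def)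
    consider "p1 + p2 > 1 / 2" | "p1 + p2 < 1 / 2" | "p1 < 0" | "p1 > p2" using off by linarith
    then show thesis
    proof cases
      case 1
      show thesis
      proof (rule that[of "p1 + p2 - 1 / 2" "2 * c\<^sup>2"])
        fix X g assume g: "reduced g" "g \<in> near_forms (p1, p2) \<epsilon> X"
        show "\<bar>real_of_int (disc g)\<bar> powr (p1 + p2 - 1 / 2) \<le> 2 * c\<^sup>2" by (rule quot[OF gram(1)[OF g] D1[OF g(1)]])
      qed (use 1 in simp)
    next
      case 2
      show thesis
      proof (rule that[of "1 / 2 - (p1 + p2)" "c\<^sup>2"])
        fix X g assume g: "reduced g" "g \<in> near_forms (p1, p2) \<epsilon> X"
        show "\<bar>real_of_int (disc g)\<bar> powr (1 / 2 - (p1 + p2)) \<le> c\<^sup>2" by (rule quot[OF gram(2)[OF g] D1[OF g(1)]])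
      qed (use 2 in simp)
    next
      case 3
      show thesis
      proof (rule that[of "0 - p1" c])
        fix X g assume g: "reduced g" "g \<in> near_forms (p1, p2) \<epsilon> X"
        have "1 \<le> sqrt (qP g)" using reduced_ge_1[OF g(1)] by simp
        with near_reduced(2)[OF g \<epsilon>] have "1 \<le> c * \<bar>real_of_int (disc g)\<bar> powr p1" unfolding c_def by linarith
        then show "\<bar>real_of_int (disc g)\<bar> powr (0 - p1) \<le> c" using D1[OF g(1)] by (intro quot) auto
      qed (use 3 in simp)
    next
      case 4
      show thesis
      proof (rule that[of "p1 - p2" "c\<^sup>2"])
        fix X g assume g: "reduced g" "g \<in> near_forms (p1, p2) \<epsilon> X"
        have "sqrt (qP g) \<le> sqrt (qR g)" using g(1) by (simp add: reduced_def)
        then have "\<bar>real_of_int (disc g)\<bar> powr p1 / c \<le> c * \<bar>real_of_int (disc g)\<bar> powr p2"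
          using near_reduced(1,4)[OF g \<epsilon>] unfolding c_def by linarith
        then have "\<bar>real_of_int (disc g)\<bar> powr p1 \<le> c\<^sup>2 * \<bar>real_of_int (disc g)\<bar> powr p2"
          using c by (simp add: pos_divide_le_eq power2_eq_square mult_ac)
        then show "\<bar>real_of_int (disc g)\<bar> powr (p1 - p2) \<le> c\<^sup>2" using D1[OF g(1)] by (intro quot)
      qed (use 4 in simp)
    qed
  qed
  show ?thesis by (rule exI[of _ "K powr (1 / e)"]) (use powr_bound[OF K e] in auto)
qed

lemma near_classes_segment:
  assumes p: "p1 + p2 = 1 / 2" and \<epsilon>: "\<epsilon> \<ge> 0"
  shows "form_class ` near_forms (p1, p2) \<epsilon> X \<subseteq> form_class ` segment_forms p1 (5 * exp \<epsilon>) X"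
proof (intro image_subsetI)
  fix f assume f: "f \<in> near_forms (p1, p2) \<epsilon> X"
  obtain g where g: "reduced g" "form_equiv g f" "form_class f = form_class g" by (rule near_forms_reduced[OF f])
  note n = near_reduced[OF g(1) near_forms_equiv(1)[OF g(2) f] \<epsilon>]
  have "g \<in> segment_forms p1 (5 * exp \<epsilon>) X" unfolding segment_forms_def using g(1) n by blast
  then show "form_class f \<in> form_class ` segment_forms p1 (5 * exp \<epsilon>) X" unfolding g(3) by (rule imageI)
qed

lemma finite_segment_classes: "finite (form_class ` segment_forms p c X)"
proof (rule finite_subset[OF _ finite_disc_classes])
  show "form_class ` segment_forms p c X \<subseteq> disc_classes X"
    unfolding segment_forms_def disc_classes_def reduced_def by (intro image_mono) auto
qed

lemma near_classes_up:
  assumes p: "p1 + p2 = 1 / 2" "0 \<le> p1" "p1 \<le> 1 / 4" and \<epsilon>: "\<epsilon> \<ge> 0" and \<eta>: "\<eta> > 0"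
    and S: "\<And>X. S X \<subseteq> form_class ` near_forms (p1, p2) \<epsilon> X"
  shows "\<forall>\<^sub>F X in at_top. real (card (S X)) + 1 \<le> X powr (max (1 - p1) (1 / 2 + 2 * p1) + \<eta>)"
proof -
  have "5 * exp \<epsilon> \<ge> 1" using \<epsilon> one_le_exp_iff[of \<epsilon>] by linarith
  then obtain C where C: "C > 0" "\<And>X. X \<ge> 1 \<Longrightarrow> real (card (form_class ` segment_forms p1 (5 * exp \<epsilon>) X)) \<le>
      C * (1 + log 2 X) * X powr (max (1 - p1) (1 / 2 + 2 * p1))"
    using card_segment_forms[of p1 "5 * exp \<epsilon>"] p by auto
  show ?thesis
  proof (rule growth_upI[OF _ C(1) _ \<eta>])
    fix X :: real assume X: "X \<ge> 1"
    have "card (S X) \<le> card (form_class ` segment_forms p1 (5 * exp \<epsilon>) X)"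
      using S[of X] near_classes_segment[OF p(1) \<epsilon>, of X] by (intro card_mono finite_segment_classes) blast
    then show "real (card (S X)) \<le> C * (1 + log 2 X) * X powr (max (1 - p1) (1 / 2 + 2 * p1))"
      using C(2)[OF X] by linarith
  qed (use p in linarith)
qed

text \<open>If \<open>a = 0\<close> then the ring has index \<open>\<bar>b\<bar>\<close> in the ring of the form \<open>(0, 1, c, b d)\<close>.\<close>

lemma maximal_zero_coeff:
  fixes R :: "nat ring"
  assumes R: "rank_ring 3 R" "h \<in> ring_iso (form_ring (0, b, c, d)) R" "maximal_ring 3 R" and b: "b \<noteq> 0"
  shows "\<bar>b\<bar> = 1"
proof -
  define \<phi> :: "vec3 \<Rightarrow> vec3" where "\<phi> = (\<lambda>(x, y, z). (x, b * y, z))"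
  let ?g = "(0, 1, c, b * d) :: form"
  obtain S :: "nat ring" where S: "rank_ring 3 S" "form_ring ?g \<simeq> S"
    using rank_ring_nat_copy[OF rank_ring_form_ring] by blast
  then obtain k where k: "k \<in> ring_iso (form_ring ?g) S" unfolding is_ring_iso_def by blast
  have cr: "ring R" using R(1) by (simp add: rank_ring_def cring.axioms(1))
  have "\<phi> \<in> Ring.ring_hom (form_ring (0, b, c, d)) (form_ring ?g)"
  proof (rule ring_hom_memI)
    fix x y :: vec3
    obtain x0 x1 x2 y0 y1 y2 where xy: "x = (x0, x1, x2)" "y = (y0, y1, y2)" by (metis prod_cases3)
    show "\<phi> (x \<otimes>\<^bsub>form_ring (0, b, c, d)\<^esub> y) = \<phi> x \<otimes>\<^bsub>form_ring ?g\<^esub> \<phi> y"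
      unfolding xy by (simp add: \<phi>_def algebra_simps)
    show "\<phi> (x \<oplus>\<^bsub>form_ring (0, b, c, d)\<^esub> y) = \<phi> x \<oplus>\<^bsub>form_ring ?g\<^esub> \<phi> y"
      unfolding xy by (simp add: \<phi>_def algebra_simps)
  qed (simp_all add: \<phi>_def)
  moreover have hi: "inv_into (carrier (form_ring (0, b, c, d))) h \<in> ring_iso R (form_ring (0, b, c, d))"
    by (rule ring_iso_set_sym[OF cring.axioms(1)[OF cring_form_ring] R(2)])
  ultimately have "k \<circ> (\<phi> \<circ> inv_into (carrier (form_ring (0, b, c, d))) h) \<in> Ring.ring_hom R S" (is "?m \<in> _")
    using k unfolding ring_iso_def by (intro ring_hom_trans) auto
  moreover have "inj_on ?m (carrier R)"
  proof (intro comp_inj_on)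
    show "inj_on (inv_into (carrier (form_ring (0, b, c, d))) h) (carrier R)" using hi by (simp add: ring_iso_def bij_betw_def)
    show "inj_on \<phi> A" for A using b by (auto simp: \<phi>_def inj_on_def)
    show "inj_on k A" for A using ring_iso_form_ringE(1)[OF k] by (auto simp: bij_betw_def intro: inj_on_subset)
  qed
  ultimately have "?m ` carrier R = carrier S" using R(3) S(1) unfolding maximal_ring_def by blast
  \<comment> \<open>The element \<open>\<omega>\<close> of the larger ring lies in the image only if
    \<open>b x1 = 1\<close> for some \<open>x1\<close>.\<close>
  moreover have "k (0, 1, 0) \<in> carrier S" by (rule ring_iso_form_ringE(5)[OF k])
  ultimately have "k (0, 1, 0) \<in> ?m ` carrier R" by simp
  then obtain r where "k (0, 1, 0) = ?m r" by (rule imageE)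
  then have "k (0, 1, 0) = k (\<phi> (inv_into (carrier (form_ring (0, b, c, d))) h r))" by (simp only: o_apply)
  moreover have "inj k" using ring_iso_form_ringE(1)[OF k] by (simp add: bij_betw_def)
  ultimately have r: "(0, 1, 0) = \<phi> (inv_into (carrier (form_ring (0, b, c, d))) h r)" by (simp only: inj_eq)
  obtain x0 x1 x2 where "inv_into (carrier (form_ring (0, b, c, d))) h r = (x0, x1, x2)" by (metis prod_cases3)
  with r have "b * x1 = 1" by (simp add: \<phi>_def)
  then show ?thesis by (auto simp: zmult_eq_1_iff)
qed

text \<open>If \<open>a \<noteq> 0\<close>, then
  \<open>sqrt D \<le> |a| sqrt D \<le> sqrt (qP g) ^ 3\<close>, which is of order
  \<open>D powr (3 p1)\<close> with \<open>3 p1 < 1 / 2\<close>. If \<open>a = 0\<close>, then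
  \<open>|b| = 1\<close> and \<open>\<omega>\<close> is a root of \<open>z^3 + b z^2\<close>, so the
  first minimum is at most 2, whereas \<open>p1 > 0\<close> requires it to grow with
  \<open>D\<close>.\<close>

lemma max_near_disc_bounded:
  assumes p: "p1 + p2 = 1 / 2" "0 < p1" "p1 < 1 / 6" and \<epsilon>: "\<epsilon> \<ge> 0"
  shows "\<exists>Y. \<forall>X g. reduced g \<longrightarrow> g \<in> max_near_forms (p1, p2) \<epsilon> X \<longrightarrow> \<bar>real_of_int (disc g)\<bar> \<le> Y"
proof -
  define c where "c = 5 * exp \<epsilon>"
  have c: "c > 0" by (simp add: c_def)
  define Y where "Y = max ((c ^ 3) powr (1 / (1 / 2 - 3 * p1))) ((10 * c) powr (1 / p1))"
  have "\<bar>real_of_int (disc g)\<bar> \<le> Y" if g: "reduced g" "g \<in> max_near_forms (p1, p2) \<epsilon> X" for X g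
  proof -
    define D where "D = \<bar>real_of_int (disc g)\<bar>"
    obtain a b c' d where abcd: "g = (a, b, c', d)" by (metis prod_cases4)
    have gn: "g \<in> near_forms (p1, p2) \<epsilon> X" using g(2) max_near_forms_subset by blast
    note n = near_reduced[OF g(1) gn \<epsilon>, folded D_def c_def]
    have dz: "disc (a, b, c', d) \<noteq> 0" using g(1) by (simp add: reduced_def abcd del: disc.simps)
    note ge = reduced_ge_1[OF g(1)]
    show ?thesis
    proof (cases "a = 0")
      case False
      have "\<bar>of_int a\<bar> * sqrt D \<le> sqrt (qP g) ^ 3"
        using coeff_bound(1)[OF dz, of "sqrt (qP g)" "sqrt (qR g)"] ge unfolding D_def abcd by simp
      moreover have "1 * sqrt D \<le> \<bar>real_of_int a\<bar> * sqrt D" using False n(5) by (intro mult_right_mono) auto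
      ultimately have "sqrt D \<le> sqrt (qP g) ^ 3" by linarith
      also have "\<dots> \<le> (c * D powr p1) ^ 3" using n ge by (intro power_mono) auto
      also have "\<dots> = c ^ 3 * D powr (3 * p1)" using n(5) by (simp add: power_mult_distrib powr_power mult.commute)
      finally have "D powr (1 / 2) \<le> c ^ 3 * D powr (3 * p1)" using n(5) by (simp add: powr_half_sqrt)
      then have "D powr (1 / 2 - 3 * p1) \<le> c ^ 3" using n(5) by (simp add: powr_diff divide_le_eq)
      then have "D \<le> (c ^ 3) powr (1 / (1 / 2 - 3 * p1))" using p n(5) by (intro powr_bound) auto
      then show ?thesis unfolding Y_def D_def by linarith
    next
      case True
      obtain R :: "nat ring" and h where R: "rank_ring 3 R" "h \<in> ring_iso (form_ring g) R" "maximal_ring 3 R"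
        by (rule max_near_formsE[OF g(2)]) (rule that; assumption)
      have cr: "cring R" using R(1) by (simp add: rank_ring_def)
      have "b \<noteq> 0" using dz True by auto
      then have b: "\<bar>b\<bar> = 1" using maximal_zero_coeff[of R h b c' d] R abcd True by simp
      then have "\<bar>real_of_int b\<bar> \<le> 1" by linarith
      then have "succ_min 3 R 1 \<le> 2 * 1"
        using succ_min_1_le(1)[OF cr R(2)[unfolded abcd] dz, of 1] True by simp
      then have "D powr p1 / c \<le> 10" using succ_min_bounds(2)[OF cr R(2) g(1)] n(1) by linarith
      then have "D powr p1 \<le> 10 * c" using c by (simp add: field_simps)
      then have "D \<le> (10 * c) powr (1 / p1)" using p n(5) by (intro powr_bound) auto
      then show ?thesis unfolding Y_def D_def by linarith
    qed
  qed
  then show ?thesis by blast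
qed

lemma max_near_classes_bounded:
  assumes "\<And>g. reduced g \<Longrightarrow> g \<in> max_near_forms p \<epsilon> X \<Longrightarrow> \<bar>real_of_int (disc g)\<bar> \<le> Y"
  shows "form_class ` max_near_forms p \<epsilon> X \<subseteq> disc_classes Y"
proof (intro image_subsetI)
  fix f assume f: "f \<in> max_near_forms p \<epsilon> X"
  then have "f \<in> near_forms p \<epsilon> X" using max_near_forms_subset by blast
  then obtain g where g: "reduced g" "form_equiv g f" "form_class f = form_class g" by (rule near_forms_reduced)
  have "\<bar>real_of_int (disc g)\<bar> \<le> Y" using assms[OF g(1) near_forms_equiv(2)[OF g(2) f]] .
  then show "form_class f \<in> disc_classes Y" unfolding disc_classes_def g(3) using g(1) by (auto simp: reduced_def)
qed

section \<open>Families of forms\<close>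

lemma near_classes_subset: "form_class ` near_forms p \<epsilon> X \<subseteq> disc_classes X"
  by (rule near_classes_bounded) (erule near_formsE)

lemma card_le_near_classes:
  assumes "inj_on form_class F"
  shows "F \<subseteq> near_forms p \<epsilon> X \<Longrightarrow> real (card F) \<le> real (card (cubic_classes p \<epsilon> X))"
    and "F \<subseteq> max_near_forms p \<epsilon> X \<Longrightarrow> real (card F) \<le> real (card (max_cubic_classes p \<epsilon> X))"
proof -
  have fin: "finite (form_class ` near_forms p \<epsilon> X)" by (rule finite_subset[OF near_classes_subset finite_disc_classes])
  have c: "card F = card (form_class ` F)" using assms by (simp add: card_image)
  show "real (card F) \<le> real (card (cubic_classes p \<epsilon> X))" if "F \<subseteq> near_forms p \<epsilon> X"
    unfolding cubic_classes_eq c by (intro of_nat_mono card_mono fin image_mono that)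
  have "finite (form_class ` max_near_forms p \<epsilon> X)"
    by (rule finite_subset[OF image_mono[OF max_near_forms_subset] fin])
  then show "real (card F) \<le> real (card (max_cubic_classes p \<epsilon> X))" if "F \<subseteq> max_near_forms p \<epsilon> X"
    unfolding max_cubic_classes_eq c by (intro of_nat_mono card_mono image_mono that)
qed

text \<open>Large enough for \<open>400 N\<close>, with \<open>N\<close> the sieve modulus, which
  enters the bounds for the minima, and for \<open>fam_const\<close>, the loss in the discriminant.
  The threshold of the theorem is derived from it.\<close>

definition scale_const :: real where "scale_const = (400 * of_int sieve_modulus) ^ 5"

lemma scale_const_ge: "scale_const \<ge> 100000"
proof -
  have "(1::real) \<le> of_int sieve_modulus" using sieve_modulus_pos by simp
  then have "(400::real) ^ 5 \<le> (400 * of_int sieve_modulus) ^ 5" by (intro power_mono) auto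
  then show ?thesis unfolding scale_const_def by (rule order_trans[rotated]) simp
qed

text \<open>Forms \<open>(0, b, c, - e)\<close> with \<open>b\<close> of order
  \<open>Y powr p1\<close>, \<open>c\<close> up to that order and \<open>e\<close> of order
  \<open>Y powr (1 - 3 p1)\<close>: the discriminant \<open>b^2 c^2 + 4 b^3 e\<close> is of order
  \<open>Y\<close>, and the exponents add up to \<open>2 p1 + (1 - 3 p1) = 1 - p1\<close>. Keeping
  \<open>c\<close> below \<open>b\<close> excludes translations.\<close>

lemma zero_family:
  assumes p: "p1 + p2 = 1 / 2" "0 \<le> p1" "p1 < 1 / 6" and \<epsilon>: "2 * ln (50 * scale_const\<^sup>2) \<le> \<epsilon>"
    and X: "scale_const\<^sup>2 \<le> X"
  shows "(X / 3888) powr (1 - p1) \<le> real (card (cubic_classes (p1, p2) \<epsilon> X))"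
proof -
  \<comment> \<open>3888 leaves room for the largest discriminant, which is at most
    \<open>66 * 54 * Y\<close>.\<close>
  define Y \<beta> \<delta> \<mu> where "Y = X / 3888" and "\<beta> = Y powr p1" and "\<delta> = Y powr (1 - 3 * p1)" and "\<mu> = Y powr p2"
  \<comment> \<open>The additional 1 leaves at least \<open>\<beta>\<close> values for
    \<open>c\<close> in \<open>{1..<B}\<close>.\<close>
  define B D where "B = \<lceil>\<beta>\<rceil> + 1" and "D = \<lceil>\<delta>\<rceil>"
  have K: "scale_const \<ge> 100000" by (rule scale_const_ge)
  then have "(100000)\<^sup>2 \<le> scale_const\<^sup>2" by (intro power_mono) auto
  then have X0: "10000000000 \<le> X" using X by simp
  then have Y: "512 \<le> Y" "1 \<le> Y" "Y > 0" "X = 3888 * Y" by (simp_all add: Y_def)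
  have \<beta>1: "\<beta> \<ge> 1" and \<delta>1: "\<delta> \<ge> 1" unfolding \<beta>_def \<delta>_def using Y p by (auto intro!: ge_one_powr_ge_zero)
  have \<beta>\<mu>: "\<beta> \<le> \<mu>" unfolding \<beta>_def \<mu>_def using Y p by (intro powr_mono) auto
  have prod: "\<beta> ^ 3 * \<delta> = Y" "\<beta> * \<delta> = \<mu>\<^sup>2" "\<beta> * \<beta> * \<delta> = Y powr (1 - p1)"
  proof -
    have "\<beta> ^ 3 * \<delta> = Y powr (3 * p1) * \<delta>" using Y by (simp add: \<beta>_def powr_power mult.commute)
    also have "\<dots> = Y powr (3 * p1 + (1 - 3 * p1))" unfolding \<delta>_def powr_add ..
    finally show "\<beta> ^ 3 * \<delta> = Y" using Y by simp
    have "\<beta> * \<delta> = Y powr (p1 + (1 - 3 * p1))" unfolding \<beta>_def \<delta>_def powr_add ..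
    also have "p1 + (1 - 3 * p1) = p2 + p2" using p(1) by simp
    finally show "\<beta> * \<delta> = \<mu>\<^sup>2" unfolding \<mu>_def powr_add power2_eq_square .
    have "\<beta> * \<beta> * \<delta> = Y powr (p1 + p1 + (1 - 3 * p1))" unfolding \<beta>_def \<delta>_def powr_add ..
    then show "\<beta> * \<beta> * \<delta> = Y powr (1 - p1)" by (simp add: algebra_simps)
  qed
  \<comment> \<open>Makes the Hessian unbalanced. For \<open>p1 < 1 / 6\<close> the exponent
    \<open>1 - 4 p1\<close> exceeds \<open>1 / 3\<close>, and \<open>512 = 8^3\<close>.\<close>
  have \<beta>\<delta>: "8 * \<beta> \<le> \<delta>"
  proof -
    have "512 powr (1 / 3) = (8 powr 3) powr (1 / 3 :: real)" by simp
    also have "\<dots> = 8" by (simp only: powr_powr) simp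
    finally have "8 \<le> Y powr (1 / 3)" using Y powr_mono2[of "1 / 3" 512 Y] by simp
    also have "\<dots> \<le> Y powr (1 - 4 * p1)" using Y p by (intro powr_mono) auto
    finally have "8 * \<beta> \<le> Y powr (1 - 4 * p1) * \<beta>" using \<beta>1 by (intro mult_right_mono) auto
    also have "\<dots> = \<delta>" unfolding \<beta>_def \<delta>_def powr_add[symmetric] by (simp add: algebra_simps)
    finally show ?thesis .
  qed
  have B: "\<beta> + 1 \<le> of_int B" "of_int B \<le> 3 * \<beta>" and D: "\<delta> \<le> of_int D" "of_int D \<le> 2 * \<delta>"
    using \<beta>1 \<delta>1 le_of_int_ceiling[of \<beta>] le_of_int_ceiling[of \<delta>] of_int_ceiling_le_add_one[of \<beta>] of_int_ceiling_le_add_one[of \<delta>]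
    unfolding B_def D_def of_int_add of_int_1 by linarith+
  have BD: "8 * B \<le> 3 * D"
  proof -
    have "real_of_int (8 * B) \<le> real_of_int (3 * D)" using B D \<beta>\<delta> by simp
    then show ?thesis by (simp only: of_int_le_iff)
  qed
  have "real_of_int 1 < real_of_int B" "real_of_int 0 < real_of_int D" using B D \<beta>1 \<delta>1 by simp_all
  then have B1: "B > 1" "D > 0" by (simp_all only: of_int_less_iff)
  define I where "I = {B..<2 * B} \<times> {1..<B} \<times> {D..<2 * D}"
  define \<phi> :: "int \<times> int \<times> int \<Rightarrow> form" where "\<phi> = (\<lambda>(b, c, e). (0, b, c, - e))"
  have eq: "x = y" if xy: "x \<in> I" "y \<in> I" "form_class (\<phi> x) = form_class (\<phi> y)" for x y
  proof -
    obtain b c e b' c' e' where e: "x = (b, c, e)" "y = (b', c', e')" by (metis prod_cases3)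
    have r: "B \<le> b" "b < 2 * B" "1 \<le> c" "c < B" "D \<le> e" "B \<le> b'" "1 \<le> c'" "c' < B" "D \<le> e'"
      using xy by (auto simp: e I_def)
    have be: "B * D \<le> b' * e'" using r B1 by (intro mult_mono) auto
    have "form_equiv (0, b, c, - e) (0, b', c', - e')" using xy(3) by (simp add: form_class_eq_iff \<phi>_def e)
    moreover have "(b' * c')\<^sup>2 \<le> b'\<^sup>2 * (c'\<^sup>2 - 3 * b' * (- e'))"
    proof -
      have "0 \<le> b' * e'" using r B1 by (intro mult_nonneg_nonneg) auto
      then have "c'\<^sup>2 \<le> c'\<^sup>2 - 3 * b' * (- e')" by (simp add: mult.assoc)
      then have "b'\<^sup>2 * c'\<^sup>2 \<le> b'\<^sup>2 * (c'\<^sup>2 - 3 * b' * (- e'))" by (intro mult_left_mono) auto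
      then show ?thesis by (simp add: power_mult_distrib)
    qed
    moreover have "2 * b\<^sup>2 < c'\<^sup>2 - 3 * b' * (- e')"
    proof -
      have "b\<^sup>2 < (2 * B)\<^sup>2" using r B1 by (intro power_strict_mono) auto
      then have "2 * b\<^sup>2 < (8 * B) * B" by (simp add: power2_eq_square)
      also have "\<dots> \<le> (3 * D) * B" using BD B1 by (intro mult_right_mono) auto
      also have "\<dots> \<le> 3 * (b' * e')" using be by (simp add: mult_ac)
      also have "\<dots> \<le> c'\<^sup>2 - 3 * b' * (- e')" by (simp add: mult.assoc)
      finally show ?thesis .
    qed
    ultimately have "(0::int, b, c, - e) = (0, b', c', - e')" by (rule equiv_eq_zero) (use r in auto)
    then show ?thesis by (simp add: e)
  qed
  have inj: "inj_on form_class (\<phi> ` I)" by (intro inj_onI) (use eq in blast)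
  have "inj_on \<phi> I" by (auto simp: \<phi>_def inj_on_def)
  then have "card (\<phi> ` I) = card I" by (rule card_image)
  also have "\<dots> = nat B * (nat (B - 1) * nat D)" by (simp add: I_def card_cartesian_product)
  finally have "real (card (\<phi> ` I)) = of_int B * (of_int (B - 1) * of_int D)" using B1 by simp
  moreover have "\<beta> * (\<beta> * \<delta>) \<le> of_int B * (of_int (B - 1) * of_int D)" using B D \<beta>1 \<delta>1 by (intro mult_mono) auto
  moreover have "real (card (\<phi> ` I)) \<le> real (card (cubic_classes (p1, p2) \<epsilon> X))"
  proof (rule card_le_near_classes(1)[OF inj], rule subsetI)
    fix f assume "f \<in> \<phi> ` I"
    then obtain b c e where f: "f = (0, b, c, - e)" and r: "B \<le> b" "b < 2 * B" "1 \<le> c" "c < B" "D \<le> e" "e < 2 * D"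
      by (auto simp: \<phi>_def I_def)
    define b' c' e' B' D' where rdef: "b' = real_of_int b" "c' = real_of_int c" "e' = real_of_int e" "B' = real_of_int B" "D' = real_of_int D"
    have r': "B' \<le> b'" "b' \<le> 2 * B'" "1 \<le> c'" "c' \<le> B'" "D' \<le> e'" "e' \<le> 2 * D'" "1 < B'" "0 < D'" "8 * B' \<le> 3 * D'"
      using r B1 BD unfolding rdef by linarith+
    have B': "\<beta> \<le> B'" "B' \<le> 3 * \<beta>" "\<delta> \<le> D'" "D' \<le> 2 * \<delta>" using B D unfolding rdef by linarith+
    have dd: "real_of_int (disc f) = b'\<^sup>2 * c'\<^sup>2 + 4 * (b' ^ 3 * e')" unfolding f rdef by simp
    have low: "Y \<le> real_of_int (disc f)"
    proof -
      have "Y \<le> B' ^ 3 * D'" unfolding prod(1)[symmetric] using B' \<beta>1 \<delta>1 by (intro mult_mono power_mono) auto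
      also have "\<dots> \<le> b' ^ 3 * e'" using r' by (intro mult_mono power_mono) auto
      finally have "Y \<le> b' ^ 3 * e'" .
      moreover have "0 \<le> b'\<^sup>2 * c'\<^sup>2" by simp
      ultimately show ?thesis unfolding dd using Y(3) by linarith
    qed
    have up: "real_of_int (disc f) \<le> X"
    proof -
      have "b'\<^sup>2 * c'\<^sup>2 \<le> (2 * B')\<^sup>2 * B'\<^sup>2" using r' by (intro mult_mono power_mono) auto
      also have "\<dots> = B' ^ 3 * (4 * B')" by (simp add: power2_eq_square power3_eq_cube)
      also have "\<dots> \<le> B' ^ 3 * (2 * D')" using r' by (intro mult_left_mono) auto
      finally have 1: "b'\<^sup>2 * c'\<^sup>2 \<le> 2 * (B' ^ 3 * D')" by simp
      have "b' ^ 3 * e' \<le> (2 * B') ^ 3 * (2 * D')" using r' by (intro mult_mono power_mono) auto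
      then have 2: "b' ^ 3 * e' \<le> 16 * (B' ^ 3 * D')" by (simp add: power3_eq_cube)
      have "B' ^ 3 * D' \<le> (3 * \<beta>) ^ 3 * (2 * \<delta>)" using B' \<beta>1 \<delta>1 r' by (intro mult_mono power_mono) auto
      also have "\<dots> = 54 * (\<beta> ^ 3 * \<delta>)" by (simp add: power3_eq_cube)
      finally have "B' ^ 3 * D' \<le> 54 * Y" unfolding prod .
      then show ?thesis using 1 2 Y(3) unfolding dd Y(4) by linarith
    qed
    have dz: "disc f \<noteq> 0" using low Y by auto
    show "f \<in> near_forms (p1, p2) \<epsilon> X"
    proof (rule near_formsI(1)[OF dz])
      have "0 \<le> real_of_int (disc f)" using low Y by linarith
      then have ab: "\<bar>real_of_int (disc f)\<bar> = real_of_int (disc f)" by simp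
      show dX: "\<bar>real_of_int (disc f)\<bar> \<le> X" unfolding ab by (rule up)
      have XK: "X / scale_const \<le> \<bar>real_of_int (disc f)\<bar>"
      proof -
        have "X / scale_const \<le> X / 3888" using K X0 by (intro divide_left_mono) auto
        then show ?thesis unfolding ab using low unfolding Y_def by linarith
      qed
      have YX: "Y powr q \<le> X powr q" if "q \<ge> 0" for q using Y that by (intro powr_mono2) auto
      have cx: "6 * Y powr q \<le> scale_const * X powr q" if "q \<ge> 0" for q
        using YX[OF that] K by (intro mult_mono) auto
      fix R :: "nat ring" and h assume R: "rank_ring 3 R" "h \<in> ring_iso (form_ring f) R"
      have be: "b' * e' \<le> 36 * \<mu>\<^sup>2"
      proof -
        have "b' * e' \<le> (2 * B') * (2 * D')" using r' by (intro mult_mono) auto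
        also have "\<dots> \<le> (2 * (3 * \<beta>)) * (2 * (2 * \<delta>))" using B' r' \<beta>1 \<delta>1 by (intro mult_mono) auto
        also have "\<dots> = 24 * \<mu>\<^sup>2" unfolding prod(2)[symmetric] by simp
        finally show ?thesis using zero_le_power2[of \<mu>] by linarith
      qed
      show "near_minima (p1, p2) \<epsilon> X R"
      proof (rule near_minimaI[OF R(1) R(2)[unfolded f], of scale_const X "6 * \<beta>" "6 * \<mu>"])
        show "X / scale_const \<le> \<bar>real_of_int (disc (0, b, c, - e))\<bar>" "\<bar>real_of_int (disc (0, b, c, - e))\<bar> \<le> X"
          using XK dX unfolding f .
        show "\<bar>real_of_int b\<bar> \<le> 6 * \<beta>" using r' B' \<beta>1 unfolding rdef by linarith
        show "\<bar>real_of_int c\<bar> \<le> 6 * \<mu>" using r' B' \<beta>1 \<beta>\<mu> unfolding rdef by linarith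
        show "\<bar>real_of_int (b * - e)\<bar> \<le> (6 * \<mu>)\<^sup>2"
        proof -
          have "\<bar>real_of_int (b * - e)\<bar> = b' * e'" using r' unfolding rdef by (simp add: abs_mult)
          then show ?thesis using be by (simp add: power_mult_distrib)
        qed
      qed (use K X0 X \<beta>1 \<beta>\<mu> p \<epsilon> cx[of p1] cx[of p2] in \<open>simp_all add: \<beta>_def \<mu>_def\<close>)
    qed
  qed
  ultimately show ?thesis using prod(3) unfolding Y_def by (simp add: mult.assoc)
qed

text \<open>\<open>1 + 4 n\<close> is odd, so a prime in question is at least 3, and the sum of
  \<open>1 / k^2\<close> over all \<open>k \<ge> 3\<close> is at most \<open>1 / 2\<close>. Half of
  the interval survives, up to an error of 1 for each modulus.\<close>

lemma card_square_free_shift: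
  fixes D :: int
  assumes D: "D \<ge> 0"
  shows "real_of_int D / 2 - real t \<le> real (card {n\<in>{D..<2 * D}. \<forall>p. prime p \<longrightarrow> p \<le> int t \<longrightarrow> \<not> p\<^sup>2 dvd 1 + 4 * n})"
proof -
  define T where "T k = (if odd k \<and> k > 0 then {n\<in>{D..<2 * D}. (int k)\<^sup>2 dvd 1 + 4 * n} else {})" for k :: nat
  define G where "G = {n\<in>{D..<2 * D}. \<forall>p. prime p \<longrightarrow> p \<le> int t \<longrightarrow> \<not> p\<^sup>2 dvd 1 + 4 * n}"
  define H where "H = {D..<2 * D} - G"
  have fin: "finite (T k)" for k unfolding T_def by (auto intro: finite_subset[of _ "{D..<2 * D}"])
  have cT: "real (card (T k)) \<le> of_int D * (1 / (real k)\<^sup>2) + 1" for k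
  proof (cases "odd k \<and> k > 0")
    case True
    have "real (card {n\<in>{D..<2 * D}. (int k)\<^sup>2 dvd 1 + 4 * n}) \<le> real_of_int D / real_of_int ((int k)\<^sup>2) + 1"
    proof (rule card_residue_class[of _ D])
      fix x y assume "x \<in> {n\<in>{D..<2 * D}. (int k)\<^sup>2 dvd 1 + 4 * n}" "y \<in> {n\<in>{D..<2 * D}. (int k)\<^sup>2 dvd 1 + 4 * n}"
      then have "(int k)\<^sup>2 dvd (1 + 4 * x) - (1 + 4 * y)" by (intro dvd_diff[of "(int k)\<^sup>2" "1 + 4 * x" "1 + 4 * y"]) blast+
      then have "(int k)\<^sup>2 dvd 4 * (x - y)" by (simp add: algebra_simps)
      moreover have "coprime ((int k)\<^sup>2) (2 ^ 2)" using True by (simp only: coprime_power_left_iff coprime_power_right_iff) simp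
      then have "coprime ((int k)\<^sup>2) (4::int)" by simp
      from coprime_dvd_mult_right_iff[OF this, of "x - y"] calculation show "(int k)\<^sup>2 dvd x - y" by blast
    qed (use True D in auto)
    then show ?thesis using True by (simp add: T_def)
  qed (use D in \<open>auto simp: T_def\<close>)
  have sub: "H \<subseteq> (\<Union>k\<in>{Suc 2..t}. T k)"
  proof
    fix n assume n: "n \<in> H"
    then obtain p where p: "prime p" "p \<le> int t" "p\<^sup>2 dvd 1 + 4 * n" and nD: "n \<in> {D..<2 * D}" unfolding H_def G_def by blast
    have op: "odd p"
    proof
      assume "even p"
      then have "2 dvd 1 + 4 * n" using p(3) by (metis dvd_mult_left dvd_trans power2_eq_square)
      then show False by presburger
    qed
    have "p > 1" using p(1) by (rule prime_gt_1_int)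
    then have "p > 2" using op by (cases "p = 2") auto
    then have "nat p \<in> {Suc 2..t}" "n \<in> T (nat p)" using p nD op by (auto simp: T_def even_nat_iff)
    then show "n \<in> (\<Union>k\<in>{Suc 2..t}. T k)" by blast
  qed
  have "real (card H) \<le> (\<Sum>k\<in>{Suc 2..t}. of_int D * (1 / (real k)\<^sup>2) + 1)"
    by (rule card_UN_le_sum[OF _ sub fin cT]) simp
  also have "\<dots> = of_int D * (\<Sum>k=Suc 2..t. 1 / (real k)\<^sup>2) + real (card {Suc 2..t})"
    unfolding sum.distrib sum_distrib_left by simp
  also have "\<dots> \<le> of_int D * (1 / real 2) + real t"
    using D by (intro add_mono mult_left_mono sum_inverse_squares) auto
  finally have h: "real (card H) \<le> of_int D / 2 + real t" by simp
  have Gs: "G \<subseteq> {D..<2 * D}" by (auto simp: G_def)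
  then have fG: "finite G" by (rule finite_subset) simp
  have "card H = card {D..<2 * D} - card G" unfolding H_def by (rule card_Diff_subset[OF fG Gs])
  moreover have "card G \<le> card {D..<2 * D}" by (rule card_mono[OF _ Gs]) simp
  ultimately have "card {D..<2 * D} = card G + card H" by linarith
  moreover have "card {D..<2 * D} = nat D" by simp
  ultimately have "real_of_int D = real (card G) + real (card H)" using D by linarith
  then show ?thesis unfolding G_def[symmetric] using h by linarith
qed

lemma nat_ceiling_bounds:
  fixes x :: real
  assumes "0 < x"
  shows "x \<le> real (nat \<lceil>x\<rceil>)" "real (nat \<lceil>x\<rceil>) \<le> x + 1" "nat \<lceil>x\<rceil> \<ge> 1"
proof -
  have pos: "0 < \<lceil>x\<rceil>" using assms by simp
  then have e: "real (nat \<lceil>x\<rceil>) = of_int \<lceil>x\<rceil>" by simp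
  show "x \<le> real (nat \<lceil>x\<rceil>)" "real (nat \<lceil>x\<rceil>) \<le> x + 1"
    unfolding e by (rule le_of_int_ceiling of_int_ceiling_le_add_one)+
  show "nat \<lceil>x\<rceil> \<ge> 1" using assms by (simp add: Suc_le_eq)
qed

text \<open>\<open>(0, 1, 1, - n)\<close> belongs to the product of the integers with the quadratic
  order of discriminant \<open>1 + 4 n\<close>. Different \<open>n\<close> give different
  discriminants, and a discriminant without square factors makes the ring maximal by
  \<open>nonmax_at_disc\<close>.\<close>

lemma unit_family:
  assumes \<epsilon>: "2 * ln (50 * scale_const\<^sup>2) \<le> \<epsilon>" and X: "scale_const\<^sup>2 \<le> X"
  shows "X / 64 \<le> real (card (max_cubic_classes (0, 1 / 2) \<epsilon> X))"
proof -
  have K: "scale_const \<ge> 100000" by (rule scale_const_ge)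
  then have "(100000)\<^sup>2 \<le> scale_const\<^sup>2" by (intro power_mono) auto
  then have X0: "10000000000 \<le> X" using X by simp
  define D where "D = \<lfloor>X / 16\<rfloor>"
  have "real_of_int D \<le> X / 16" "X / 16 < real_of_int D + 1" unfolding D_def by linarith+
  then have D: "16 * real_of_int D \<le> X" "X \<le> 32 * real_of_int D" "D \<ge> 0" using X0 by (simp, simp, simp add: D_def)
  \<comment> \<open>A prime whose square divides \<open>1 + 4 n \<le> X\<close> is at most
    \<open>sqrt X\<close>, so the sieve up to \<open>t\<close> is complete.\<close>
  define t where "t = nat \<lceil>sqrt X\<rceil>"
  define G where "G = {n\<in>{D..<2 * D}. \<forall>p. prime p \<longrightarrow> p \<le> int t \<longrightarrow> \<not> p\<^sup>2 dvd 1 + 4 * n}"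
  have sX: "sqrt X \<ge> 100000" using X0 by (intro real_le_rsqrt) simp
  have t: "real t \<le> sqrt X + 1" "sqrt X \<le> real t"
  proof -
    have "0 < sqrt X" by (rule less_le_trans[OF _ sX]) simp
    then show "real t \<le> sqrt X + 1" "sqrt X \<le> real t" unfolding t_def by (rule nat_ceiling_bounds)+
  qed
  have "sqrt X * 100000 \<le> sqrt X * sqrt X" using sX X0 by (intro mult_left_mono) auto
  then have "sqrt X * 100000 \<le> X" using X0 by simp
  then have "X / 64 \<le> real_of_int D / 2 - real t" using t D X0 sX \<open>X / 16 < real_of_int D + 1\<close> by simp
  also have "\<dots> \<le> real (card G)" unfolding G_def by (rule card_square_free_shift[OF D(3)])
  finally have cG: "X / 64 \<le> real (card G)" .
  define \<phi> :: "int \<Rightarrow> form" where "\<phi> n = (0, 1, 1, - n)" for n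
  have dn: "disc (\<phi> n) = 1 + 4 * n" for n by (simp add: \<phi>_def)
  have eq: "n = n'" if "form_class (\<phi> n) = form_class (\<phi> n')" for n n'
    using form_equiv_disc[of "\<phi> n" "\<phi> n'"] that by (simp add: form_class_eq_iff dn)
  have inj: "inj_on form_class (\<phi> ` G)" by (intro inj_onI) (use eq in blast)
  have "inj_on \<phi> G" by (auto simp: \<phi>_def inj_on_def)
  then have "real (card G) = real (card (\<phi> ` G))" by (simp add: card_image)
  also have "\<dots> \<le> real (card (max_cubic_classes (0, 1 / 2) \<epsilon> X))"
  proof (rule card_le_near_classes(2)[OF inj], rule subsetI)
    fix f assume "f \<in> \<phi> ` G"
    then obtain n where n: "n \<in> G" and f: "f = \<phi> n" by blast
    have nD: "D \<le> n" "n < 2 * D" using n by (auto simp: G_def)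
    have rn: "real_of_int D \<le> real_of_int n" "real_of_int n \<le> 2 * real_of_int D" using nD by linarith+
    have rd: "\<bar>real_of_int (disc f)\<bar> = 1 + 4 * real_of_int n" unfolding f dn using D nD by simp
    show "f \<in> max_near_forms (0, 1 / 2) \<epsilon> X"
    proof (rule near_formsI(2))
      show "disc f \<noteq> 0" unfolding f dn by presburger
      show dX: "\<bar>real_of_int (disc f)\<bar> \<le> X" unfolding rd using rn D X0 by simp
      show "\<not> nonmax_at p f" if p: "prime p" for p
      proof
        assume "nonmax_at p f"
        then have dv: "p\<^sup>2 dvd 1 + 4 * n" using nonmax_at_disc[of p f] by (simp only: f dn)
        have "1 + 4 * n > 0" using D nD by simp
        with dv have "p\<^sup>2 \<le> 1 + 4 * n" by (intro zdvd_imp_le)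
        then have "real_of_int (p\<^sup>2) \<le> real_of_int (1 + 4 * n)" by (simp only: of_int_le_iff)
        then have "(real_of_int p)\<^sup>2 \<le> X" using dX unfolding rd by simp
        then have "real_of_int p \<le> sqrt X" by (rule real_le_rsqrt)
        then have "real_of_int p \<le> real_of_int (int t)" using t by simp
        then have "p \<le> int t" by (simp only: of_int_le_iff)
        then show False using n p dv by (simp add: G_def)
      qed
      fix R :: "nat ring" and h assume R: "rank_ring 3 R" "h \<in> ring_iso (form_ring f) R"
      have XK: "X / scale_const \<le> \<bar>real_of_int (disc f)\<bar>"
      proof -
        have "X / scale_const \<le> X / 32" using K X0 by (intro divide_left_mono) auto
        also have "\<dots> \<le> 1 + 4 * real_of_int n" using D rn X0 by linarith
        finally show ?thesis unfolding rd .
      qed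
      have sq: "X powr (1 / 2) = sqrt X" using X0 by (simp add: powr_half_sqrt)
      show "near_minima (0, 1 / 2) \<epsilon> X R"
      proof (rule near_minimaI[OF R(1) R(2)[unfolded f \<phi>_def], of scale_const X 1 "sqrt X"])
        show "X / scale_const \<le> \<bar>real_of_int (disc (0, 1, 1, - n))\<bar>" "\<bar>real_of_int (disc (0, 1, 1, - n))\<bar> \<le> X"
          using XK dX unfolding f \<phi>_def .
        show "\<bar>real_of_int (1 * - n)\<bar> \<le> (sqrt X)\<^sup>2" using rn D X0 by simp
        have "1 * sqrt X \<le> scale_const * sqrt X" using K X0 by (intro mult_right_mono) auto
        then show "sqrt X \<le> scale_const * X powr (1 / 2)" unfolding sq by simp
      qed (use K X0 X sX \<epsilon> in simp_all)
    qed
  qed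
  finally show ?thesis using cG by linarith
qed

text \<open>With \<open>g = - c\<close> the discriminant is \<open>4 a g ^ 3\<close> and four
  further terms. The relations between \<open>m\<close>, \<open>n\<close> and \<open>q\<close> bound
  each of these by a multiple of \<open>a g ^ 3\<close> in which one or more factors
  \<open>g\<close> are replaced by \<open>N n\<close>, and \<open>N n \<le> g / 99\<close> makes
  that a small part. The last two estimates make the Hessian unbalanced, as
  \<open>2 * 2404 < 9000\<close>.\<close>

lemma fam_real_estimates:
  fixes a b g d m n q N :: real
  assumes 1: "1 \<le> N" "1 \<le> m" "1 \<le> n" "1 \<le> q"
    and a: "N * m \<le> a" "a \<le> 2 * (N * m)" and b: "1 \<le> b" "b \<le> N * m"
    and g: "99 * (N * n) \<le> g" "g \<le> 200 * (N * n)" and d: "0 \<le> d" "d \<le> N * q"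
    and mq: "m * q\<^sup>2 \<le> 8 * n ^ 3" "m * q \<le> 4 * n\<^sup>2" "m\<^sup>2 * q \<le> 8 * n ^ 3" "m \<le> 2 * n"
  shows "3 * (a * g ^ 3) \<le> b\<^sup>2 * g\<^sup>2 + 4 * (a * g ^ 3) - 4 * (b ^ 3 * d) - 27 * (a\<^sup>2 * d\<^sup>2) - 18 * (a * b * g * d)"
    and "b\<^sup>2 * g\<^sup>2 + 4 * (a * g ^ 3) - 4 * (b ^ 3 * d) - 27 * (a\<^sup>2 * d\<^sup>2) - 18 * (a * b * g * d) \<le> 5 * (a * g ^ 3)"
    and "(b * g + 9 * (a * d))\<^sup>2 \<le> (b\<^sup>2 + 3 * (a * g)) * (g\<^sup>2 - 3 * (b * d))"
    and "b\<^sup>2 + 3 * (a * g) \<le> 2404 * (N * n)\<^sup>2" "9000 * (N * n)\<^sup>2 \<le> g\<^sup>2 - 3 * (b * d)"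
proof -
  define x G where "x = N * n" and "G = a * g ^ 3"
  have Nm: "1 \<le> N * m" using mult_mono[of 1 N 1 m] 1 by simp
  have x1: "1 \<le> x" unfolding x_def using mult_mono[of 1 N 1 n] 1 by simp
  have pos: "0 < a" "0 < b" "0 < g" "0 \<le> x" "0 \<le> N * q" "0 \<le> N * m" using a b g Nm x1 1 unfolding x_def by auto
  have xg: "x \<le> g / 99" "g \<le> 200 * x" using g unfolding x_def by linarith+
  have G: "0 \<le> G" unfolding G_def using pos by simp
  have ba: "b \<le> a" using a b by linarith
  have Nm2: "N * m \<le> 2 * x" unfolding x_def using mult_left_mono[OF mq(4), of N] 1 by (simp add: mult.left_commute)
  have h1: "b\<^sup>2 * g\<^sup>2 \<le> (2 / 99) * G"
  proof -
    have "b * b \<le> a * (2 * (g / 99))" using ba b Nm2 xg pos by (intro mult_mono) auto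
    then have "b * b * g\<^sup>2 \<le> a * (2 * (g / 99)) * g\<^sup>2" by (rule mult_right_mono) simp
    then show ?thesis unfolding G_def by (simp add: power2_eq_square power3_eq_cube mult_ac)
  qed
  have x3: "x ^ 3 \<le> g ^ 3 / 970299"
  proof -
    have "x ^ 3 \<le> (g / 99) ^ 3" using xg pos by (intro power_mono) auto
    then show ?thesis by (simp add: power_divide)
  qed
  have x2: "x\<^sup>2 \<le> g\<^sup>2 / 9801"
  proof -
    have "x\<^sup>2 \<le> (g / 99)\<^sup>2" using xg pos by (intro power_mono) auto
    then show ?thesis by (simp add: power_divide)
  qed
  have h2: "b ^ 3 * d \<le> (8 / 970299) * G"
  proof -
    have "b ^ 3 * d = b * (b * b * d)" by (simp add: power3_eq_cube)
    also have "\<dots> \<le> a * ((N * m) * (N * m) * (N * q))" using ba b d pos by (intro mult_mono) auto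
    also have "\<dots> = a * (N ^ 3 * (m\<^sup>2 * q))" by (simp add: power2_eq_square power3_eq_cube mult_ac)
    also have "\<dots> \<le> a * (N ^ 3 * (8 * n ^ 3))" using mq pos 1 by (intro mult_left_mono) auto
    also have "\<dots> = a * (8 * x ^ 3)" by (simp add: x_def power_mult_distrib)
    also have "\<dots> \<le> a * (8 * (g ^ 3 / 970299))" using x3 pos by (intro mult_left_mono) auto
    finally show ?thesis by (simp add: G_def mult_ac)
  qed
  have h3: "a\<^sup>2 * d\<^sup>2 \<le> (16 / 970299) * G"
  proof -
    have "a\<^sup>2 * d\<^sup>2 = a * (a * (d * d))" by (simp add: power2_eq_square mult_ac)
    also have "\<dots> \<le> a * ((2 * (N * m)) * ((N * q) * (N * q)))" using a d pos by (intro mult_left_mono mult_mono) auto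
    also have "\<dots> = a * (2 * N ^ 3 * (m * q\<^sup>2))" by (simp add: power2_eq_square power3_eq_cube mult_ac)
    also have "\<dots> \<le> a * (2 * N ^ 3 * (8 * n ^ 3))" using mq pos 1 by (intro mult_left_mono) auto
    also have "\<dots> = a * (16 * x ^ 3)" by (simp add: x_def power_mult_distrib)
    also have "\<dots> \<le> a * (16 * (g ^ 3 / 970299))" using x3 pos by (intro mult_left_mono) auto
    finally show ?thesis by (simp add: G_def mult_ac)
  qed
  have bd: "b * d \<le> 4 * x\<^sup>2"
  proof -
    have "b * d \<le> (N * m) * (N * q)" using b d pos by (intro mult_mono) auto
    also have "\<dots> = N\<^sup>2 * (m * q)" by (simp add: power2_eq_square mult_ac)
    also have "\<dots> \<le> N\<^sup>2 * (4 * n\<^sup>2)" using mq by (intro mult_left_mono) auto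
    finally show ?thesis by (simp add: x_def power_mult_distrib)
  qed
  have h4: "a * b * g * d \<le> (4 / 9801) * G"
  proof -
    have "a * b * g * d = a * g * (b * d)" by simp
    also have "\<dots> \<le> a * g * (4 * (g\<^sup>2 / 9801))" using bd x2 pos by (intro mult_left_mono) auto
    finally show ?thesis by (simp add: G_def power2_eq_square power3_eq_cube mult_ac)
  qed
  have nn: "0 \<le> b\<^sup>2 * g\<^sup>2" "0 \<le> b ^ 3 * d" "0 \<le> a\<^sup>2 * d\<^sup>2" "0 \<le> a * b * g * d" using pos d by simp_all
  show "3 * (a * g ^ 3) \<le> b\<^sup>2 * g\<^sup>2 + 4 * (a * g ^ 3) - 4 * (b ^ 3 * d) - 27 * (a\<^sup>2 * d\<^sup>2) - 18 * (a * b * g * d)"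
    unfolding G_def[symmetric] using h2 h3 h4 nn G by linarith
  show "b\<^sup>2 * g\<^sup>2 + 4 * (a * g ^ 3) - 4 * (b ^ 3 * d) - 27 * (a\<^sup>2 * d\<^sup>2) - 18 * (a * b * g * d) \<le> 5 * (a * g ^ 3)"
    unfolding G_def[symmetric] using h1 nn G by linarith
  have R: "99 / 100 * g\<^sup>2 \<le> g\<^sup>2 - 3 * (b * d)" using bd x2 zero_le_power2[of g] by linarith
  show "(b * g + 9 * (a * d))\<^sup>2 \<le> (b\<^sup>2 + 3 * (a * g)) * (g\<^sup>2 - 3 * (b * d))"
  proof -
    have "(b * g + 9 * (a * d))\<^sup>2 \<le> 2 * (b\<^sup>2 * g\<^sup>2) + 162 * (a\<^sup>2 * d\<^sup>2)"
      using zero_le_power2[of "b * g - 9 * (a * d)"] by (simp add: power2_sum power2_diff power_mult_distrib)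
    also have "\<dots> \<le> 3 * (99 / 100) * G" using h1 h3 G by linarith
    also have "\<dots> = (3 * (a * g)) * (99 / 100 * g\<^sup>2)" by (simp add: G_def power2_eq_square power3_eq_cube)
    also have "\<dots> \<le> (b\<^sup>2 + 3 * (a * g)) * (g\<^sup>2 - 3 * (b * d))" using R pos by (intro mult_mono) auto
    finally show ?thesis .
  qed
  have "9801 * x\<^sup>2 \<le> g\<^sup>2" using x2 by linarith
  then show "9000 * (N * n)\<^sup>2 \<le> g\<^sup>2 - 3 * (b * d)" using R zero_le_power2[of x] unfolding x_def[symmetric] by linarith
  have "b\<^sup>2 \<le> (2 * x)\<^sup>2" using b Nm2 pos by (intro power_mono) auto
  moreover have "a * g \<le> (2 * (2 * x)) * (200 * x)" using a Nm2 xg pos by (intro mult_mono) auto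
  ultimately show "b\<^sup>2 + 3 * (a * g) \<le> 2404 * (N * n)\<^sup>2" unfolding x_def[symmetric] by (simp add: power2_eq_square)
qed

context
  fixes m n q :: int
  assumes mnq: "1 \<le> m" "1 \<le> n" "1 \<le> q"
    and mq: "m * q\<^sup>2 \<le> 8 * n ^ 3" "m * q \<le> 4 * n\<^sup>2" "m\<^sup>2 * q \<le> 8 * n ^ 3" "m \<le> 2 * n"
begin

lemma fam_coeffs:
  assumes x: "x \<in> fam_index m n q" and f: "fam_form sieve_modulus x = (a, b, c, d)"
  defines "N \<equiv> real_of_int sieve_modulus"
  shows "N * of_int m \<le> of_int a" "of_int a \<le> 2 * (N * of_int m)" "1 \<le> b" "of_int b \<le> N * of_int m" "b \<le> a"
    "99 * (N * of_int n) \<le> - of_int c" "- of_int c \<le> 200 * (N * of_int n)" "0 \<le> d" "of_int d \<le> N * of_int q" "0 < a"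
proof -
  obtain a0 b0 c0 d0 where x0: "x = (a0, b0, c0, d0)" by (metis prod_cases4)
  have r: "m \<le> a0" "a0 < 2 * m" "0 \<le> b0" "b0 < m" "100 * n \<le> c0" "c0 < 200 * n" "0 \<le> d0" "d0 < q"
    using x by (auto simp: x0 fam_index_def)
  have e: "a = sieve_modulus * a0" "b = 1 + sieve_modulus * b0" "c = 1 - sieve_modulus * c0" "d = sieve_modulus * d0"
    using f by (auto simp: x0)
  have M: "1 \<le> sieve_modulus" using sieve_modulus_pos by simp
  have 1: "sieve_modulus * m \<le> a" "a \<le> sieve_modulus * (2 * m)" "d \<le> sieve_modulus * q" "sieve_modulus * (100 * n) \<le> 1 - c" "1 - c \<le> sieve_modulus * (200 * n)"
    unfolding e using r M by (auto intro: mult_left_mono)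
  have "sieve_modulus * b0 \<le> sieve_modulus * (m - 1)" using r M by (intro mult_left_mono) auto
  then have 2: "b \<le> sieve_modulus * m" using M unfolding e by (simp add: right_diff_distrib)
  have Mn: "1 \<le> sieve_modulus * n" using mult_mono[of 1 sieve_modulus 1 n] M mnq by simp
  have Mm: "1 \<le> sieve_modulus * m" using mult_mono[of 1 sieve_modulus 1 m] M mnq by simp
  show "1 \<le> b" "0 \<le> d" unfolding e using r M by auto
  show "b \<le> a" using 1 2 by linarith
  show "0 < a" using 1 Mm by linarith
  have i: "99 * (sieve_modulus * n) \<le> - c" "- c \<le> 200 * (sieve_modulus * n)" "a \<le> 2 * (sieve_modulus * m)"
    using 1 Mn by (simp_all add: mult.left_commute)
  have c: "of_int u \<le> (of_int v :: real)" if "u \<le> v" for u v using that by simp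
  show "N * of_int m \<le> of_int a" "of_int a \<le> 2 * (N * of_int m)" "of_int b \<le> N * of_int m"
    "99 * (N * of_int n) \<le> - of_int c" "- of_int c \<le> 200 * (N * of_int n)" "of_int d \<le> N * of_int q"
    using c[OF 1(1)] c[OF i(3)] c[OF 2] c[OF i(1)] c[OF i(2)] c[OF 1(3)] unfolding N_def by simp_all
qed

lemma fam_int_estimates:
  assumes x: "x \<in> fam_index m n q" and f: "fam_form sieve_modulus x = (a, b, c, d)"
  defines "N \<equiv> real_of_int sieve_modulus"
  shows "3 * (of_int a * (- of_int c) ^ 3) \<le> real_of_int (disc (a, b, c, d))"
    "real_of_int (disc (a, b, c, d)) \<le> 5 * (of_int a * (- of_int c) ^ 3)"
    "(b * c - 9 * a * d)\<^sup>2 \<le> (b\<^sup>2 - 3 * a * c) * (c\<^sup>2 - 3 * b * d)"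
    "real_of_int (b\<^sup>2 - 3 * a * c) \<le> 2404 * (N * of_int n)\<^sup>2" "9000 * (N * of_int n)\<^sup>2 \<le> real_of_int (c\<^sup>2 - 3 * b * d)"
    "0 \<le> b\<^sup>2 - 3 * a * c"
proof -
  note co = fam_coeffs[OF x f, folded N_def]
  have N1: "1 \<le> N" unfolding N_def using sieve_modulus_pos by simp
  have r1: "1 \<le> real_of_int m" "1 \<le> real_of_int n" "1 \<le> real_of_int q" "1 \<le> real_of_int b" "0 \<le> real_of_int d" using mnq co by simp_all
  have c: "of_int u \<le> (of_int v :: real)" if "u \<le> v" for u v using that by simp
  have r2: "real_of_int m * (of_int q)\<^sup>2 \<le> 8 * of_int n ^ 3" "real_of_int m * of_int q \<le> 4 * (of_int n)\<^sup>2"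
    "(real_of_int m)\<^sup>2 * of_int q \<le> 8 * of_int n ^ 3" "real_of_int m \<le> 2 * of_int n"
    using c[OF mq(1)] c[OF mq(2)] c[OF mq(3)] c[OF mq(4)] by simp_all
  define g where "g = - real_of_int c"
  note co = co[folded g_def]
  note E = fam_real_estimates[OF N1 r1(1-3) co(1,2) r1(4) co(4) co(6,7) r1(5) co(9) r2]
  have cg: "real_of_int c = - g" by (simp add: g_def)
  have D: "real_of_int (disc (a, b, c, d)) = (of_int b)\<^sup>2 * g\<^sup>2 + 4 * (of_int a * g ^ 3) - 4 * (of_int b ^ 3 * of_int d)
      - 27 * ((of_int a)\<^sup>2 * (of_int d)\<^sup>2) - 18 * (of_int a * of_int b * g * of_int d)"
    by (simp add: cg)
  show "3 * (of_int a * (- of_int c) ^ 3) \<le> real_of_int (disc (a, b, c, d))"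
    "real_of_int (disc (a, b, c, d)) \<le> 5 * (of_int a * (- of_int c) ^ 3)"
    unfolding D g_def[symmetric] using E(1,2) .
  have P: "real_of_int (b\<^sup>2 - 3 * a * c) = (of_int b)\<^sup>2 + 3 * (of_int a * g)" by (simp add: cg)
  have R: "real_of_int (c\<^sup>2 - 3 * b * d) = g\<^sup>2 - 3 * (of_int b * of_int d)" by (simp add: cg)
  show "real_of_int (b\<^sup>2 - 3 * a * c) \<le> 2404 * (N * of_int n)\<^sup>2" "9000 * (N * of_int n)\<^sup>2 \<le> real_of_int (c\<^sup>2 - 3 * b * d)"
    unfolding P R using E(4,5) .
  have "real_of_int ((b * c - 9 * a * d)\<^sup>2) = (of_int b * g + 9 * (of_int a * of_int d))\<^sup>2"
  proof -
    have "real_of_int (b * c - 9 * a * d) = - (of_int b * g + 9 * (of_int a * of_int d))" by (simp add: cg)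
    then show ?thesis by (simp only: of_int_power power2_minus)
  qed
  then have "real_of_int ((b * c - 9 * a * d)\<^sup>2) \<le> real_of_int ((b\<^sup>2 - 3 * a * c) * (c\<^sup>2 - 3 * b * d))"
    unfolding of_int_mult[of "b\<^sup>2 - 3 * a * c"] P R using E(3) by simp
  then show "(b * c - 9 * a * d)\<^sup>2 \<le> (b\<^sup>2 - 3 * a * c) * (c\<^sup>2 - 3 * b * d)" by (simp only: of_int_le_iff)
  have "0 \<le> N * of_int n" using N1 r1 by simp
  then have "0 \<le> g" using co(6) by linarith
  then have "real_of_int 0 \<le> real_of_int (b\<^sup>2 - 3 * a * c)" unfolding P using co(10) by simp
  then show "0 \<le> b\<^sup>2 - 3 * a * c" by (simp only: of_int_le_iff)
qed

lemma fam_inject: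
  assumes x: "x \<in> fam_index m n q" and y: "y \<in> fam_index m n q"
    and eq: "form_class (fam_form sieve_modulus x) = form_class (fam_form sieve_modulus y)"
  shows "x = y"
proof -
  obtain a b c d where f: "fam_form sieve_modulus x = (a, b, c, d)" by (metis prod_cases4)
  obtain a' b' c' d' where f': "fam_form sieve_modulus y = (a', b', c', d')" by (metis prod_cases4)
  have "form_equiv (a, b, c, d) (a', b', c', d')" using eq unfolding f f' form_class_eq_iff .
  moreover note fam_int_estimates(3)[OF y f'] fam_int_estimates(6)[OF y f'] fam_int_estimates(6)[OF x f]
  moreover have "2 * (b\<^sup>2 - 3 * a * c) < c'\<^sup>2 - 3 * b' * d'"
  proof -
    define w where "w = (real_of_int sieve_modulus * of_int n)\<^sup>2"
    have "w > 0" using sieve_modulus_pos mnq by (simp add: w_def)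
    have "real_of_int (2 * (b\<^sup>2 - 3 * a * c)) = 2 * real_of_int (b\<^sup>2 - 3 * a * c)" by (simp only: of_int_mult of_int_numeral)
    also have "\<dots> \<le> 2 * (2404 * w)" using fam_int_estimates(4)[OF x f] unfolding w_def by (intro mult_left_mono) auto
    also have "\<dots> < 9000 * w" using \<open>w > 0\<close> by simp
    also have "\<dots> \<le> real_of_int (c'\<^sup>2 - 3 * b' * d')" using fam_int_estimates(5)[OF y f'] unfolding w_def .
    finally show ?thesis by (simp only: of_int_less_iff)
  qed
  ultimately have "(a, b, c, d) = (a', b', c', d')"
    by (rule equiv_eq_nonzero) (use fam_coeffs[OF x f] fam_coeffs[OF y f'] in auto)
  then have "fam_form sieve_modulus x = fam_form sieve_modulus y" unfolding f f' .
  then show ?thesis using sieve_modulus_pos by (cases x; cases y) auto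
qed

definition good_index :: "nat \<Rightarrow> (int \<times> int \<times> int \<times> int) set" where
  "good_index t = fam_index m n q - content_bad m n q - square_bad t m n q -
     {x\<in>fam_index m n q. \<exists>p. prime p \<and> p > int t \<and> overform_at p (fam_form sieve_modulus x)}"

text \<open>Primes up to 48 are excluded by the congruence for the discriminant. A larger prime is
  excluded by the content if it divides the first two coefficients, which covers forms divisible by
  \<open>p\<close>; otherwise by the square in the discriminant up to \<open>t\<close> and by the
  overform beyond \<open>t\<close>.\<close>

lemma good_index_maximal:
  assumes x: "x \<in> good_index t" and p: "prime p"
  shows "\<not> nonmax_at p (fam_form sieve_modulus x)"
proof
  assume nm: "nonmax_at p (fam_form sieve_modulus x)"
  have xi: "x \<in> fam_index m n q" using x by (simp add: good_index_def)
  obtain a b c d where x0: "x = (a, b, c, d)" by (metis prod_cases4)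
  have dv: "p\<^sup>2 dvd disc (fam_form sieve_modulus x)" by (rule nonmax_at_disc[OF nm])
  obtain k where k: "disc (fam_form sieve_modulus x) = 1 + sieve_modulus * k" using fam_form_disc_mod by blast
  have p48: "p > 48"
  proof (rule ccontr)
    assume "\<not> p > 48"
    then have "p dvd sieve_modulus * k" using prime_dvd_sieve_modulus[OF p] by simp
    moreover have "p dvd 1 + sieve_modulus * k" using dv unfolding k by (metis dvd_mult_left power2_eq_square)
    ultimately have "p dvd 1" by (simp add: dvd_add_left_iff)
    then show False using p by (simp add: prime_int_iff)
  qed
  have nd: "\<not> p dvd sieve_modulus" using prime_dvd_sieve_modulus[OF p] p48 by simp
  have cb: "\<not> (p dvd a \<and> p dvd 1 + sieve_modulus * b)"
    using x xi p p48 unfolding good_index_def content_bad_def x0 by blast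
  have "overform_at p (fam_form sieve_modulus x)"
  proof -
    have False if "fam_form sieve_modulus x = scale_form p g" for g
    proof -
      obtain a' b' c' d' where g: "g = (a', b', c', d')" by (metis prod_cases4)
      have "sieve_modulus * a = p * a'" "1 + sieve_modulus * b = p * b'" using that unfolding x0 g by simp_all
      then have "p dvd sieve_modulus * a" "p dvd 1 + sieve_modulus * b" by simp_all
      then show False using cb nd p by (simp add: prime_dvd_mult_iff)
    qed
    then show ?thesis using nm unfolding nonmax_at_def overform_at_def by blast
  qed
  then have "\<not> p > int t" using x xi p unfolding good_index_def by blast
  then have "x \<in> square_bad t m n q" unfolding square_bad_def using xi p p48 cb dv x0 by auto
  then show False using x by (simp add: good_index_def)
qed

text \<open>\<open>T\<close> is the size of the family. The losses are \<open>9/48\<close> for the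
  content, \<open>3/48 + 1/8\<close> for the squares up to \<open>t\<close>, where \<open>t1\<close>
  bounds the error terms by the \<open>1/8\<close>, and \<open>1/8\<close> beyond \<open>t\<close>
  by \<open>t2\<close>: one half in all.\<close>

lemma card_good_index:
  assumes C: "\<forall>Y\<ge>0. real (card (disc_classes Y)) \<le> C * Y powr (9 / 8)" "C > 0"
    and disc: "\<And>x. x \<in> fam_index m n q \<Longrightarrow> disc (fam_form sieve_modulus x) \<noteq> 0 \<and> \<bar>real_of_int (disc (fam_form sieve_modulus x))\<bar> \<le> X"
    and X: "X \<ge> 1" and t: "t \<ge> 1" "X \<le> real t ^ 6"
    and T: "T = (of_int m)\<^sup>2 * (100 * of_int n) * of_int q"
    and t1: "8 * (real t * (300 * of_int n + of_int q + 1)) \<le> 100 * of_int n * of_int q"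
    and t2: "4 * C * X powr (9 / 8) * real t powr (- 5 / 4) \<le> T / 8"
  shows "T / 2 \<le> real (card (good_index t))"
proof -
  let ?O = "{x\<in>fam_index m n q. \<exists>p. prime p \<and> p > int t \<and> overform_at p (fam_form sieve_modulus x)}"
  let ?F = "fam_form sieve_modulus ` fam_index m n q"
  note fin = finite_fam_index[of m n q]
  have "inj_on (fam_form sieve_modulus) (fam_index m n q)" by (intro inj_onI fam_inject) auto
  then have "inj_on (fam_form sieve_modulus) ?O" by (rule inj_on_subset) auto
  then have "card ?O \<le> card {f\<in>?F. \<exists>p. prime p \<and> p > int t \<and> overform_at p f}"
    by (rule card_inj_on_le) (use fin in auto)
  moreover have "real (card {f\<in>?F. \<exists>p. prime p \<and> p > int t \<and> overform_at p f}) \<le> 4 * C * X powr (9 / 8) * real t powr (- 5 / 4)"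
  proof (rule card_overform_large[OF C _ _ _ X t])
    show "finite ?F" using fin by simp
    show "inj_on form_class ?F" by (intro inj_onI) (use fam_inject in blast)
    fix f assume "f \<in> ?F"
    then show "disc f \<noteq> 0 \<and> \<bar>real_of_int (disc f)\<bar> \<le> X" using disc by blast
  qed
  ultimately have O: "real (card ?O) \<le> T / 8" using t2 by linarith
  have cb: "real (card (content_bad m n q)) \<le> T * (9 / 48)" unfolding T using mnq by (intro card_content_bad) auto
  have sb: "real (card (square_bad t m n q)) \<le> T * (9 / 48)"
  proof -
    have "real (card (square_bad t m n q)) \<le> (of_int m)\<^sup>2 * (100 * of_int n * of_int q * (3 / 48) + real t * (300 * of_int n + of_int q + 1))"
      by (rule card_square_bad[OF mnq])
    also have "\<dots> \<le> (of_int m)\<^sup>2 * (100 * of_int n * of_int q * (3 / 48) + 100 * of_int n * of_int q / 8)"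
      using t1 by (intro mult_left_mono add_left_mono) auto
    also have "\<dots> = T * (9 / 48)" unfolding T by (simp add: field_simps)
    finally show ?thesis .
  qed
  have "card (fam_index m n q) = nat m * (nat m * (nat (100 * n) * nat q))" by (simp add: fam_index_def card_cartesian_product)
  then have cF: "real (card (fam_index m n q)) = T" unfolding T using mnq by (simp add: power2_eq_square)
  have "card (fam_index m n q) \<le> card (good_index t) + card (content_bad m n q) + card (square_bad t m n q) + card ?O"
  proof -
    have fs: "finite (content_bad m n q)" "finite (square_bad t m n q)" "finite ?O"
      using fin by (auto intro: finite_subset[of _ "fam_index m n q"] simp: content_bad_def square_bad_def)
    have "fam_index m n q \<subseteq> good_index t \<union> content_bad m n q \<union> square_bad t m n q \<union> ?O" unfolding good_index_def by blast
    moreover have "finite (good_index t)" unfolding good_index_def using fin by simp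
    ultimately have "card (fam_index m n q) \<le> card (good_index t \<union> content_bad m n q \<union> square_bad t m n q \<union> ?O)"
      using fs by (intro card_mono) auto
    also have "\<dots> \<le> card (good_index t) + card (content_bad m n q) + card (square_bad t m n q) + card ?O"
      by (intro order_trans[OF card_Un_le] add_right_mono) (rule order_refl)
    finally show ?thesis .
  qed
  then have "T \<le> real (card (good_index t)) + real (card (content_bad m n q)) + real (card (square_bad t m n q)) + real (card ?O)"
    unfolding cF[symmetric] by simp
  then show ?thesis using O cb sb by linarith
qed

end

section \<open>The densities\<close>

text \<open>The number is \<open>5 * 4 * 400 ^ 3\<close>: the discriminant is at most
  \<open>5 a (- c) ^ 3\<close>, with \<open>a\<close> up to \<open>4 N \<alpha>\<close> and
  \<open>- c\<close> up to \<open>400 N \<kappa>\<close>.\<close>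

definition fam_const :: real where "fam_const = 1280000000 * of_int sieve_modulus ^ 4"

lemma fam_const_bounds: "1 \<le> fam_const" "fam_const \<le> scale_const"
proof -
  have N: "(1::real) \<le> of_int sieve_modulus" using sieve_modulus_pos by simp
  then have N4: "(1::real) \<le> of_int sieve_modulus ^ 4" by (rule one_le_power)
  then show "1 \<le> fam_const" unfolding fam_const_def by linarith
  have "real_of_int sieve_modulus ^ 4 \<le> of_int sieve_modulus ^ 5" using N by (intro power_increasing) auto
  then have "1280000000 * real_of_int sieve_modulus ^ 4 \<le> 400 ^ 5 * of_int sieve_modulus ^ 5" by (intro mult_mono) auto
  then show "fam_const \<le> scale_const" unfolding fam_const_def scale_const_def power_mult_distrib .
qed

text \<open>\<open>\<alpha>\<close>, \<open>\<kappa>\<close> and \<open>\<delta>\<close> are the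
  orders of the sides of the coefficient box for \<open>a\<close>, \<open>c\<close> and
  \<open>d\<close>. The side for \<open>b\<close> has order \<open>\<mu>\<close>, but
  \<open>b\<close> runs only up to the order of \<open>a\<close>, which excludes translations. The
  family thus has about \<open>\<alpha>^2 \<kappa> \<delta>\<close> members, of order
  \<open>Y powr (1 / 2 + 2 p1)\<close>; \<open>\<alpha> \<ge> 1\<close> is where
  \<open>p1 \<ge> 1 / 6\<close> comes from.\<close>

lemma segment_family_at:
  assumes p: "p1 + p2 = 1 / 2" "1 / 6 \<le> p1" "p1 \<le> 1 / 4" and \<epsilon>: "2 * ln (50 * scale_const\<^sup>2) \<le> \<epsilon>"
    and C: "\<forall>Y\<ge>0. real (card (disc_classes Y)) \<le> C * Y powr (9 / 8)" "C > 0"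
    and X: "scale_const\<^sup>2 \<le> X"
    and as: "100 * (X powr (6 / 25) + 1) \<le> (X / fam_const) powr (1 / 4)"
      "4 * C * X powr (33 / 40) \<le> 12 * (X / fam_const) powr (5 / 6)"
  shows "50 * (X / fam_const) powr (1 / 2 + 2 * p1) \<le> real (card (max_cubic_classes (p1, p2) \<epsilon> X))"
proof -
  have p2: "p2 = 1 / 2 - p1" using p(1) by simp
  define N where "N = real_of_int sieve_modulus"
  have N: "1 \<le> N" unfolding N_def using sieve_modulus_pos by simp
  have K: "scale_const \<ge> 100000" by (rule scale_const_ge)
  have KX: "scale_const \<le> X"
  proof -
    have "scale_const * 1 \<le> scale_const * scale_const" using K by (intro mult_left_mono) auto
    then show ?thesis using X by (simp add: power2_eq_square)
  qed
  have X1: "X > 1" using K KX by simp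
  define Y \<alpha> \<kappa> \<delta> \<mu> where "Y = X / fam_const" and "\<alpha> = Y powr (3 * p1 - 1 / 2)" and "\<kappa> = Y powr (1 / 2 - p1)"
    and "\<delta> = Y powr (1 - 3 * p1)" and "\<mu> = Y powr p1"
  have Y: "1 \<le> Y" "Y \<le> X" "X / scale_const \<le> Y" "X = fam_const * Y"
  proof -
    have "fam_const \<le> X" using fam_const_bounds KX by linarith
    then show "1 \<le> Y" unfolding Y_def using fam_const_bounds by simp
    have "X * 1 \<le> X * fam_const" using fam_const_bounds X1 by (intro mult_left_mono) auto
    then show "Y \<le> X" unfolding Y_def using fam_const_bounds by (simp add: divide_le_eq)
    show "X / scale_const \<le> Y" unfolding Y_def using fam_const_bounds X1 by (intro divide_left_mono) auto
    show "X = fam_const * Y" unfolding Y_def using fam_const_bounds by simp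
  qed
  have ge1: "1 \<le> \<alpha>" "1 \<le> \<kappa>" "1 \<le> \<delta>" "1 \<le> \<mu>"
    unfolding \<alpha>_def \<kappa>_def \<delta>_def \<mu>_def using Y p by (auto intro!: ge_one_powr_ge_zero)
  have le: "\<alpha> \<le> \<kappa>" "\<alpha> \<le> \<mu>" "\<mu> \<le> \<kappa>" "Y powr (1 / 4) \<le> \<kappa>" "Y powr (1 / 4) \<le> \<delta>"
    unfolding \<alpha>_def \<kappa>_def \<delta>_def \<mu>_def using Y p by (auto intro!: powr_mono)
  note defs = \<alpha>_def \<kappa>_def \<delta>_def \<mu>_def power2_eq_square power3_eq_cube powr_add[symmetric]
  have prod: "\<alpha> * \<kappa> ^ 3 = Y" "\<alpha> * \<kappa> = \<mu>\<^sup>2" "\<alpha>\<^sup>2 * \<delta> = \<mu> ^ 3" "\<alpha> * \<delta>\<^sup>2 = \<kappa> ^ 3" "\<alpha>\<^sup>2 * \<kappa> * \<delta> = Y powr (1 / 2 + 2 * p1)"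
  proof -
    have "\<alpha> * \<kappa> ^ 3 = Y powr 1" unfolding defs by (rule arg_cong[where f = "\<lambda>e. Y powr e"]) (simp add: algebra_simps)
    then show "\<alpha> * \<kappa> ^ 3 = Y" using Y by simp
  qed (unfold defs, (rule arg_cong[where f = "\<lambda>e. Y powr e"], simp add: algebra_simps)+)
  have ad: "\<alpha> * \<delta> \<le> \<kappa>\<^sup>2" unfolding defs using Y p by (intro powr_mono) auto
  have \<mu>\<kappa>: "\<mu> ^ 3 \<le> \<kappa> ^ 3" using le ge1 by (intro power_mono) auto
  define m n q where "m = \<lceil>\<alpha>\<rceil>" and "n = \<lceil>\<kappa>\<rceil>" and "q = \<lceil>\<delta>\<rceil>"
  have c: "z \<le> of_int \<lceil>z\<rceil>" "of_int \<lceil>z\<rceil> \<le> 2 * z" "1 \<le> \<lceil>z\<rceil>" if "1 \<le> z" for z :: real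
    using le_of_int_ceiling[of z] of_int_ceiling_le_add_one[of z] that by linarith+
  have mnq: "1 \<le> m" "1 \<le> n" "1 \<le> q" unfolding m_def n_def q_def using c(3) ge1 by simp_all
  have b: "\<alpha> \<le> of_int m" "of_int m \<le> 2 * \<alpha>" "\<kappa> \<le> of_int n" "of_int n \<le> 2 * \<kappa>" "\<delta> \<le> of_int q" "of_int q \<le> 2 * \<delta>"
    unfolding m_def n_def q_def using c(1,2) ge1 by simp_all
  have \<kappa>n: "\<kappa>\<^sup>2 \<le> (of_int n)\<^sup>2" "\<kappa> ^ 3 \<le> of_int n ^ 3" using b ge1 by (auto intro!: power_mono)
  have toint: "u \<le> v" if "real_of_int u \<le> real_of_int v" for u v using that by simp
  have mq1: "m * q\<^sup>2 \<le> 8 * n ^ 3"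
  proof (rule toint)
    have "real_of_int m * (of_int q)\<^sup>2 \<le> (2 * \<alpha>) * (2 * \<delta>)\<^sup>2" using b ge1 by (intro mult_mono power_mono) auto
    also have "\<dots> = 8 * \<kappa> ^ 3" unfolding prod(4)[symmetric] by (simp add: power_mult_distrib)
    finally show "real_of_int (m * q\<^sup>2) \<le> real_of_int (8 * n ^ 3)" using \<kappa>n by simp
  qed
  have mq2: "m * q \<le> 4 * n\<^sup>2"
  proof (rule toint)
    have "real_of_int m * of_int q \<le> (2 * \<alpha>) * (2 * \<delta>)" using b ge1 by (intro mult_mono) auto
    also have "\<dots> = 4 * (\<alpha> * \<delta>)" by simp
    finally show "real_of_int (m * q) \<le> real_of_int (4 * n\<^sup>2)" using \<kappa>n ad by simp
  qed
  have mq3: "m\<^sup>2 * q \<le> 8 * n ^ 3"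
  proof (rule toint)
    have "(real_of_int m)\<^sup>2 * of_int q \<le> (2 * \<alpha>)\<^sup>2 * (2 * \<delta>)" using b ge1 by (intro mult_mono power_mono) auto
    also have "\<dots> = 8 * \<mu> ^ 3" unfolding prod(3)[symmetric] by (simp add: power_mult_distrib)
    finally show "real_of_int (m\<^sup>2 * q) \<le> real_of_int (8 * n ^ 3)" using \<kappa>n \<mu>\<kappa> by simp
  qed
  have mq4: "m \<le> 2 * n"
  proof (rule toint)
    show "real_of_int m \<le> real_of_int (2 * n)" using b le by simp
  qed
  note mq = mq1 mq2 mq3 mq4
  have bounds: "fam_form sieve_modulus x = (a, b, c, d) \<Longrightarrow> x \<in> fam_index m n q \<Longrightarrow>
      \<bar>real_of_int b\<bar> \<le> 2 * (N * \<alpha>) \<and> \<bar>real_of_int a\<bar> \<le> 4 * (N * \<alpha>) \<and> \<bar>real_of_int c\<bar> \<le> 400 * (N * \<kappa>) \<and> \<bar>real_of_int d\<bar> \<le> 2 * (N * \<delta>)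
      \<and> Y \<le> real_of_int (disc (a, b, c, d)) \<and> real_of_int (disc (a, b, c, d)) \<le> X" for x a b c d
  proof -
    assume f: "fam_form sieve_modulus x = (a, b, c, d)" and x: "x \<in> fam_index m n q"
    note co = fam_coeffs[OF mnq mq x f, folded N_def]
    note es = fam_int_estimates[OF mnq mq x f]
    have sc: "N * u \<le> N * v" if "u \<le> v" for u v using that N by (intro mult_left_mono) auto
    have lin: "N * (2 * u) = 2 * (N * u)" for u by simp
    have 1: "N * \<alpha> \<le> N * of_int m" "N * of_int m \<le> 2 * (N * \<alpha>)" "N * \<kappa> \<le> N * of_int n" "N * of_int n \<le> 2 * (N * \<kappa>)" "N * of_int q \<le> 2 * (N * \<delta>)"
      using sc[OF b(1)] sc[OF b(2)] sc[OF b(3)] sc[OF b(4)] sc[OF b(6)] unfolding lin by simp_all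
    have pos: "0 \<le> N * \<alpha>" "0 \<le> N * \<kappa>" using N ge1 by auto
    have b0: "1 \<le> real_of_int b" "0 \<le> real_of_int d" "0 < real_of_int a" using co by simp_all
    have bb: "\<bar>real_of_int b\<bar> \<le> 2 * (N * \<alpha>)" "\<bar>real_of_int a\<bar> \<le> 4 * (N * \<alpha>)" "\<bar>real_of_int d\<bar> \<le> 2 * (N * \<delta>)"
      using co 1 b0 by linarith+
    have cc: "99 * (N * \<kappa>) \<le> - real_of_int c" "- real_of_int c \<le> 400 * (N * \<kappa>)" using co 1 by linarith+
    then have cb: "\<bar>real_of_int c\<bar> \<le> 400 * (N * \<kappa>)" using pos by linarith
    have "real_of_int a * (- of_int c) ^ 3 \<le> (4 * (N * \<alpha>)) * (400 * (N * \<kappa>)) ^ 3"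
      using bb b0 cc pos by (intro mult_mono power_mono) auto
    also have "\<dots> = 256000000 * N ^ 4 * (\<alpha> * \<kappa> ^ 3)" by (simp add: power_mult_distrib power3_eq_cube power4_eq_xxxx)
    finally have "real_of_int a * (- of_int c) ^ 3 \<le> 256000000 * N ^ 4 * Y" unfolding prod .
    moreover have "X = 5 * (256000000 * N ^ 4 * Y)" unfolding Y(4) fam_const_def N_def by simp
    ultimately have up: "real_of_int (disc (a, b, c, d)) \<le> X" using es(2) by linarith
    have "1 * Y \<le> N ^ 4 * Y" using N Y one_le_power[OF N, of 4] by (intro mult_right_mono) auto
    also have "\<dots> = (N * \<alpha>) * (N * \<kappa>) ^ 3" unfolding prod(1)[symmetric] by (simp add: power_mult_distrib power3_eq_cube power4_eq_xxxx)
    also have "\<dots> \<le> real_of_int a * (- of_int c) ^ 3"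
      using co(1) cc 1(1) pos b0 by (intro mult_mono power_mono) auto
    finally have "Y \<le> real_of_int (disc (a, b, c, d))" using es(1) Y(1) by linarith
    then show ?thesis using bb cb up by blast
  qed
  have member: "fam_form sieve_modulus x \<in> max_near_forms (p1, p2) \<epsilon> X" if x: "x \<in> good_index m n q t" for x t
  proof -
    obtain a b' c' d where f: "fam_form sieve_modulus x = (a, b', c', d)" by (metis prod_cases4)
    have xi: "x \<in> fam_index m n q" using x mnq mq by (simp add: good_index_def)
    have B: "\<bar>real_of_int b'\<bar> \<le> 2 * (N * \<alpha>)" "\<bar>real_of_int a\<bar> \<le> 4 * (N * \<alpha>)" "\<bar>real_of_int c'\<bar> \<le> 400 * (N * \<kappa>)"
      "\<bar>real_of_int d\<bar> \<le> 2 * (N * \<delta>)" "Y \<le> real_of_int (disc (a, b', c', d))" "real_of_int (disc (a, b', c', d)) \<le> X"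
      using bounds[OF f xi] by blast+
    have "0 < real_of_int (disc (a, b', c', d))" using B(5) Y(1) by linarith
    then have dp: "0 < disc (a, b', c', d)" by (simp only: of_int_0_less_iff)
    then have ab: "\<bar>real_of_int (disc (a, b', c', d))\<bar> = real_of_int (disc (a, b', c', d))" by (simp del: disc.simps)
    show ?thesis unfolding f
    proof (rule near_formsI(2))
      show "disc (a, b', c', d) \<noteq> 0" using dp by linarith
      show "\<bar>real_of_int (disc (a, b', c', d))\<bar> \<le> X" unfolding ab by (rule B(6))
      show "\<not> nonmax_at r (a, b', c', d)" if "prime r" for r
        using good_index_maximal[OF mnq mq x that] unfolding f .
      fix R :: "nat ring" and h assume R: "rank_ring 3 R" "h \<in> ring_iso (form_ring (a, b', c', d)) R"
      have pos: "0 \<le> N * \<alpha>" "0 \<le> N * \<kappa>" "0 \<le> N * \<delta>" "0 \<le> N" using N ge1 by auto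
      show "near_minima (p1, p2) \<epsilon> X R"
      proof (rule near_minimaI[OF R, of scale_const X "40 * (N * \<mu>)" "400 * (N * \<kappa>)"])
        show "1 \<le> scale_const" using K by simp
        show "X / scale_const \<le> \<bar>real_of_int (disc (a, b', c', d))\<bar>" unfolding ab using B(5) Y(3) by linarith
        show "\<bar>real_of_int (disc (a, b', c', d))\<bar> \<le> X" unfolding ab by (rule B(6))
        have N\<mu>: "1 \<le> N * \<mu>" using mult_mono[of 1 N 1 \<mu>] N ge1 by simp
        then show "1 \<le> 40 * (N * \<mu>)" by linarith
        have "N * \<alpha> \<le> N * \<mu>" "N * \<mu> \<le> N * \<kappa>" using le N by (auto intro: mult_left_mono)
        then show "\<bar>real_of_int b'\<bar> \<le> 40 * (N * \<mu>)" "40 * (N * \<mu>) \<le> 400 * (N * \<kappa>)" using B(1) pos N\<mu> by linarith+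
        show "\<bar>real_of_int (a * c')\<bar> \<le> (40 * (N * \<mu>))\<^sup>2"
        proof -
          have "\<bar>real_of_int (a * c')\<bar> \<le> (4 * (N * \<alpha>)) * (400 * (N * \<kappa>))"
            unfolding of_int_mult abs_mult using B pos by (intro mult_mono) auto
          also have "\<dots> = 1600 * N\<^sup>2 * (\<alpha> * \<kappa>)" by (simp add: power2_eq_square)
          also have "\<dots> = (40 * (N * \<mu>))\<^sup>2" unfolding prod by (simp add: power_mult_distrib)
          finally show ?thesis .
        qed
        show "\<bar>real_of_int (a\<^sup>2 * d)\<bar> \<le> (40 * (N * \<mu>)) ^ 3"
        proof -
          have "\<bar>real_of_int (a\<^sup>2 * d)\<bar> \<le> (4 * (N * \<alpha>))\<^sup>2 * (2 * (N * \<delta>))"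
            unfolding of_int_mult of_int_power abs_mult power_abs using B pos by (intro mult_mono power_mono) auto
          also have "\<dots> = 32 * (N ^ 3 * (\<alpha>\<^sup>2 * \<delta>))" by (simp add: power2_eq_square power3_eq_cube)
          also have "\<dots> \<le> 64000 * (N ^ 3 * (\<alpha>\<^sup>2 * \<delta>))" using N ge1 by (intro mult_right_mono) auto
          also have "\<dots> = (40 * (N * \<mu>)) ^ 3" unfolding prod by (simp add: power_mult_distrib)
          finally show ?thesis .
        qed
        show "\<bar>real_of_int c'\<bar> \<le> 400 * (N * \<kappa>)" by (rule B(3))
        show "\<bar>real_of_int (b' * d)\<bar> \<le> (400 * (N * \<kappa>))\<^sup>2"
        proof -
          have "\<bar>real_of_int (b' * d)\<bar> \<le> (2 * (N * \<alpha>)) * (2 * (N * \<delta>))"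
            unfolding of_int_mult abs_mult using B pos by (intro mult_mono) auto
          also have "\<dots> = 4 * (N\<^sup>2 * (\<alpha> * \<delta>))" by (simp add: power2_eq_square)
          also have "\<dots> \<le> 160000 * (N\<^sup>2 * \<kappa>\<^sup>2)" using N ge1 ad by (intro mult_mono) auto
          also have "\<dots> = (400 * (N * \<kappa>))\<^sup>2" by (simp add: power_mult_distrib)
          finally show ?thesis .
        qed
        show "\<bar>real_of_int (a * d\<^sup>2)\<bar> \<le> (400 * (N * \<kappa>)) ^ 3"
        proof -
          have "\<bar>real_of_int (a * d\<^sup>2)\<bar> \<le> (4 * (N * \<alpha>)) * (2 * (N * \<delta>))\<^sup>2"
            unfolding of_int_mult of_int_power abs_mult power_abs using B pos by (intro mult_mono power_mono) auto
          also have "\<dots> = 16 * (N ^ 3 * (\<alpha> * \<delta>\<^sup>2))" by (simp add: power2_eq_square power3_eq_cube)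
          also have "\<dots> \<le> 64000000 * (N ^ 3 * (\<alpha> * \<delta>\<^sup>2))" using N ge1 by (intro mult_right_mono) auto
          also have "\<dots> = (400 * (N * \<kappa>)) ^ 3" unfolding prod by (simp add: power_mult_distrib)
          finally show ?thesis .
        qed
        have YX: "400 * N * Y powr e \<le> scale_const * X powr e" if "0 \<le> e" for e
        proof -
          have "(400 * N) ^ 1 \<le> (400 * N) ^ 5" using N by (intro power_increasing) auto
          then have "400 * N \<le> scale_const" unfolding scale_const_def N_def by simp
          moreover have "Y powr e \<le> X powr e" using Y that by (intro powr_mono2) auto
          ultimately show ?thesis using K by (intro mult_mono) auto
        qed
        show "40 * (N * \<mu>) \<le> scale_const * X powr p1"
          using YX[of p1] p N\<mu> unfolding \<mu>_def by simp
        show "400 * (N * \<kappa>) \<le> scale_const * X powr p2"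
          using YX[of p2] p unfolding \<kappa>_def p2 by simp
      qed (use X X1 p \<epsilon> in auto)
    qed
  qed
  \<comment> \<open>\<open>6/25 < 1/4\<close> keeps \<open>t\<close> small against the sides of
    \<open>c\<close> and \<open>d\<close>, and \<open>9/8 - 5/4 * 6/25 = 33/40 < 5/6\<close> makes
    the tail negligible; moreover \<open>6 * 6/25 \<ge> 1\<close> gives
    \<open>X \<le> t ^ 6\<close>.\<close>
  define t where "t = nat \<lceil>X powr (6 / 25)\<rceil>"
  have Xp: "1 \<le> X powr (6 / 25)" using X1 by (intro ge_one_powr_ge_zero) auto
  have t: "X powr (6 / 25) \<le> real t" "real t \<le> X powr (6 / 25) + 1" "t \<ge> 1"
  proof -
    have "0 < X powr (6 / 25)" using Xp by linarith
    then show "X powr (6 / 25) \<le> real t" "real t \<le> X powr (6 / 25) + 1" "t \<ge> 1"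
      unfolding t_def by (rule nat_ceiling_bounds)+
  qed
  define T where "T = (real_of_int m)\<^sup>2 * (100 * of_int n) * of_int q"
  have T100: "100 * Y powr (1 / 2 + 2 * p1) \<le> T"
  proof -
    have "\<alpha>\<^sup>2 * \<kappa> * \<delta> \<le> (of_int m)\<^sup>2 * of_int n * of_int q" using b ge1 by (intro mult_mono power_mono) auto
    then show ?thesis unfolding prod T_def by simp
  qed
  have "T / 2 \<le> real (card (good_index m n q t))"
  proof (rule card_good_index[OF mnq mq C _ _ t(3) _ T_def])
    fix x assume x: "x \<in> fam_index m n q"
    obtain a b' c' d where f: "fam_form sieve_modulus x = (a, b', c', d)" by (metis prod_cases4)
    have B: "Y \<le> real_of_int (disc (a, b', c', d))" "real_of_int (disc (a, b', c', d)) \<le> X" using bounds[OF f x] by blast+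
    have "0 < real_of_int (disc (a, b', c', d))" using B(1) Y(1) by linarith
    then have dp: "0 < disc (a, b', c', d)" by (simp only: of_int_0_less_iff)
    then have "\<bar>real_of_int (disc (a, b', c', d))\<bar> = real_of_int (disc (a, b', c', d))" by (simp del: disc.simps)
    then show "disc (fam_form sieve_modulus x) \<noteq> 0 \<and> \<bar>real_of_int (disc (fam_form sieve_modulus x))\<bar> \<le> X"
      unfolding f using dp B(2) by linarith
  next
    show "1 \<le> X" using X1 by simp
    have "X powr 1 \<le> X powr (6 * (6 / 25))" using X1 by (intro powr_mono) auto
    also have "\<dots> = (X powr (6 / 25)) powr 6" unfolding powr_powr by (simp add: mult.commute)
    also have "\<dots> = (X powr (6 / 25)) ^ 6" using Xp X1 powr_realpow[of "X powr (6 / 25)" 6] by simp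
    also have "\<dots> \<le> real t ^ 6" using t(1) by (intro power_mono) auto
    finally show "X \<le> real t ^ 6" using X1 by simp
    define w where "w = Y powr (1 / 4)"
    have "100 * real t \<le> 100 * (X powr (6 / 25) + 1)" using t(2) by (intro mult_left_mono) auto
    also have "\<dots> \<le> w" using as(1) unfolding w_def Y_def .
    finally have w1: "100 * real t \<le> w" .
    have w2: "w \<le> of_int n" unfolding w_def by (rule order_trans[OF le(4) b(3)])
    have w3: "w \<le> of_int q" unfolding w_def by (rule order_trans[OF le(5) b(5)])
    have nn: "0 \<le> w" "1 \<le> real_of_int n" "1 \<le> real_of_int q" using mnq by (simp_all add: w_def)
    define S z where "S = real t * (300 * of_int n + of_int q + 1)" and "z = real_of_int n * of_int q"
    have "(100 * real t) * (300 * of_int n + of_int q + 1) \<le> w * (301 * of_int n + of_int q)"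
      using w1 nn by (intro mult_mono) auto
    also have "\<dots> = 301 * (w * of_int n) + w * of_int q" by (simp add: algebra_simps)
    also have "\<dots> \<le> 301 * (of_int q * of_int n) + of_int n * of_int q"
      using w2 w3 nn by (intro add_mono mult_left_mono mult_right_mono) auto
    also have "\<dots> = 302 * z" by (simp add: z_def)
    finally have "100 * S \<le> 302 * z" by (simp only: S_def mult.assoc)
    moreover have "0 \<le> z" using nn by (simp add: z_def)
    ultimately have "8 * S \<le> 100 * z" by linarith
    then show "8 * (real t * (300 * of_int n + of_int q + 1)) \<le> 100 * of_int n * of_int q"
      unfolding S_def z_def by (simp only: mult.assoc)
    have "4 * C * X powr (9 / 8) * real t powr (- 5 / 4) \<le> 4 * C * X powr (9 / 8) * (X powr (6 / 25)) powr (- 5 / 4)"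
      using C t Xp X1 by (intro mult_left_mono powr_mono2') auto
    also have "\<dots> = 4 * C * X powr (33 / 40)"
      unfolding powr_powr mult.assoc powr_add[symmetric] by simp
    \<comment> \<open>The 12 is below \<open>100 / 8\<close>, and \<open>5 / 6\<close> is the value
      of \<open>1 / 2 + 2 p1\<close> at \<open>p1 = 1 / 6\<close>.\<close>
    also have "\<dots> \<le> 12 * Y powr (5 / 6)" using as(2) unfolding Y_def .
    also have "\<dots> \<le> 12 * Y powr (1 / 2 + 2 * p1)" using Y p by (intro mult_left_mono powr_mono) auto
    also have "\<dots> \<le> T / 8"
    proof -
      have "0 \<le> Y powr (1 / 2 + 2 * p1)" by simp
      then show ?thesis using T100 by linarith
    qed
    finally show "4 * C * X powr (9 / 8) * real t powr (- 5 / 4) \<le> T / 8" .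
  qed
  moreover have "real (card (good_index m n q t)) \<le> real (card (max_cubic_classes (p1, p2) \<epsilon> X))"
  proof -
    have gs: "good_index m n q t \<subseteq> fam_index m n q" using mnq mq by (auto simp: good_index_def)
    have inj: "inj_on form_class (fam_form sieve_modulus ` good_index m n q t)"
      by (intro inj_onI) (use fam_inject[OF mnq mq] gs in blast)
    have "inj_on (fam_form sieve_modulus) (good_index m n q t)"
    proof (rule inj_onI)
      fix x y assume "x \<in> good_index m n q t" "y \<in> good_index m n q t" "fam_form sieve_modulus x = fam_form sieve_modulus y"
      then show "x = y" using gs by (intro fam_inject[OF mnq mq]) auto
    qed
    then have "real (card (good_index m n q t)) = real (card (fam_form sieve_modulus ` good_index m n q t))" by (simp add: card_image)
    also have "\<dots> \<le> real (card (max_cubic_classes (p1, p2) \<epsilon> X))"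
      by (rule card_le_near_classes(2)[OF inj]) (use member in blast)
    finally show ?thesis .
  qed
  ultimately show ?thesis using T100 unfolding Y_def by linarith
qed

lemma family_asymptotics:
  assumes "K > 0" "C > 0"
  shows "\<forall>\<^sub>F X::real in at_top. 100 * (X powr (6 / 25) + 1) \<le> (X / K) powr (1 / 4)"
    and "\<forall>\<^sub>F X::real in at_top. 4 * C * X powr (33 / 40) \<le> 12 * (X / K) powr (5 / 6)"
  using assms by real_asymp+

lemma segment_family:
  assumes p: "p1 + p2 = 1 / 2" "1 / 6 \<le> p1" "p1 \<le> 1 / 4" and \<epsilon>: "2 * ln (50 * scale_const\<^sup>2) \<le> \<epsilon>"
  shows "\<exists>c>0. \<forall>\<^sub>F X in at_top. c * X powr (1 / 2 + 2 * p1) \<le> real (card (max_cubic_classes (p1, p2) \<epsilon> X))"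
proof -
  obtain C where C: "C > 0" "\<forall>Y\<ge>0. real (card (disc_classes Y)) \<le> C * Y powr (9 / 8)" using card_disc_classes by blast
  have K: "fam_const > 0" using fam_const_bounds by linarith
  have "\<forall>\<^sub>F X in at_top. 50 / fam_const powr (1 / 2 + 2 * p1) * X powr (1 / 2 + 2 * p1) \<le> real (card (max_cubic_classes (p1, p2) \<epsilon> X))"
    using family_asymptotics[OF K C(1)] eventually_ge_at_top[of "scale_const\<^sup>2"] eventually_gt_at_top[of 0]
  proof eventually_elim
    case (elim X)
    have "50 / fam_const powr (1 / 2 + 2 * p1) * X powr (1 / 2 + 2 * p1) = 50 * (X / fam_const) powr (1 / 2 + 2 * p1)"
      using elim(4) K by (simp add: powr_divide)
    also have "\<dots> \<le> real (card (max_cubic_classes (p1, p2) \<epsilon> X))"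
      by (rule segment_family_at[OF p \<epsilon> C(2,1) elim(3,1,2)])
    finally show ?case .
  qed
  then show ?thesis using K by (intro exI[of _ "50 / fam_const powr (1 / 2 + 2 * p1)"]) auto
qed

lemma max_le_cubic_classes: "real (card (max_cubic_classes p \<epsilon> X)) \<le> real (card (cubic_classes p \<epsilon> X))"
  unfolding cubic_classes_eq max_cubic_classes_eq
  by (intro of_nat_mono card_mono image_mono max_near_forms_subset finite_subset[OF near_classes_subset finite_disc_classes])

section \<open>Assembly of the two densities\<close>

lemma mem_segment:
  fixes p1 p2 :: real
  shows "(p1, p2) \<in> closed_segment (0, 1 / 2) (1 / 4, 1 / 4) \<longleftrightarrow> p1 + p2 = 1 / 2 \<and> 0 \<le> p1 \<and> p1 \<le> 1 / 4"
    and "(p1, p2) \<in> closed_segment (1 / 6, 1 / 3) (1 / 4, 1 / 4) \<longleftrightarrow> p1 + p2 = 1 / 2 \<and> 1 / 6 \<le> p1 \<and> p1 \<le> 1 / 4"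
proof -
  show "(p1, p2) \<in> closed_segment (0, 1 / 2) (1 / 4, 1 / 4) \<longleftrightarrow> p1 + p2 = 1 / 2 \<and> 0 \<le> p1 \<and> p1 \<le> 1 / 4"
  proof
    assume "p1 + p2 = 1 / 2 \<and> 0 \<le> p1 \<and> p1 \<le> 1 / 4"
    then show "(p1, p2) \<in> closed_segment (0, 1 / 2) (1 / 4, 1 / 4)"
      unfolding in_segment by (intro exI[of _ "4 * p1"]) (auto simp: field_simps)
  qed (auto simp: in_segment field_simps)
  show "(p1, p2) \<in> closed_segment (1 / 6, 1 / 3) (1 / 4, 1 / 4) \<longleftrightarrow> p1 + p2 = 1 / 2 \<and> 1 / 6 \<le> p1 \<and> p1 \<le> 1 / 4"
  proof
    assume "p1 + p2 = 1 / 2 \<and> 1 / 6 \<le> p1 \<and> p1 \<le> 1 / 4"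
    then show "(p1, p2) \<in> closed_segment (1 / 6, 1 / 3) (1 / 4, 1 / 4)"
      \<comment> \<open>The witness solves \<open>(1 - u) / 6 + u / 4 = p1\<close> for
        \<open>u\<close>.\<close>
      unfolding in_segment by (intro exI[of _ "12 * p1 - 2"]) (auto simp: field_simps)
  qed (auto simp: in_segment field_simps)
qed

text \<open>Below \<open>1 / 6\<close> the upper bound is attained by the forms with
  \<open>a = 0\<close>; from \<open>1 / 6\<close> on it is already attained by maximal rings, so
  their family serves here too.\<close>

lemma cubic_density_segment:
  assumes p: "p1 + p2 = 1 / 2" "0 \<le> p1" "p1 \<le> 1 / 4" and \<epsilon>: "2 * ln (50 * scale_const\<^sup>2) \<le> \<epsilon>" "0 \<le> \<epsilon>"
  shows "cubic_density \<epsilon> (p1, p2) = Some (max (1 - p1) (1 / 2 + 2 * p1))"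
  unfolding cubic_density_def
proof (rule growth_exponentI)
  let ?L = "max (1 - p1) (1 / 2 + 2 * p1)"
  fix \<eta> :: real assume \<eta>: "\<eta> > 0"
  show "\<forall>\<^sub>F X in at_top. real (card (cubic_classes (p1, p2) \<epsilon> X)) + 1 \<le> X powr (?L + \<eta>)"
    by (rule near_classes_up[OF p \<epsilon>(2) \<eta>]) (simp add: cubic_classes_eq)
  have "\<exists>c>0. \<forall>\<^sub>F X in at_top. c * X powr ?L \<le> real (card (cubic_classes (p1, p2) \<epsilon> X))"
  proof (cases "p1 < 1 / 6")
    case True
    then have L: "?L = 1 - p1" by linarith
    have "\<forall>\<^sub>F X in at_top. 1 / 3888 powr (1 - p1) * X powr (1 - p1) \<le> real (card (cubic_classes (p1, p2) \<epsilon> X))"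
      using eventually_ge_at_top[of "scale_const\<^sup>2"] eventually_gt_at_top[of 0]
    proof eventually_elim
      case (elim X)
      have "1 / 3888 powr (1 - p1) * X powr (1 - p1) = (X / 3888) powr (1 - p1)" using elim(2) by (simp add: powr_divide)
      also have "\<dots> \<le> real (card (cubic_classes (p1, p2) \<epsilon> X))" by (rule zero_family[OF p(1,2) True \<epsilon>(1) elim(1)])
      finally show ?case .
    qed
    then show ?thesis unfolding L by (intro exI[of _ "1 / 3888 powr (1 - p1)"]) auto
  next
    case False
    then have L: "?L = 1 / 2 + 2 * p1" "1 / 6 \<le> p1" by linarith+
    obtain c where c: "c > 0" "\<forall>\<^sub>F X in at_top. c * X powr (1 / 2 + 2 * p1) \<le> real (card (max_cubic_classes (p1, p2) \<epsilon> X))"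
      using segment_family[OF p(1) L(2) p(3) \<epsilon>(1)] by blast
    have "\<forall>\<^sub>F X in at_top. c * X powr (1 / 2 + 2 * p1) \<le> real (card (cubic_classes (p1, p2) \<epsilon> X))"
      by (rule eventually_mono[OF c(2)]) (rule order_trans[OF _ max_le_cubic_classes])
    then show ?thesis unfolding L(1) using c(1) by blast
  qed
  then show "\<forall>\<^sub>F X in at_top. X powr (?L - \<eta>) \<le> real (card (cubic_classes (p1, p2) \<epsilon> X)) + 1"
    using growth_lowI \<eta> by blast
qed

text \<open>The point \<open>p1 = 0\<close> escapes the argument for \<open>0 < p1 < 1 / 6\<close>,
  because there the first minimum is supposed to be bounded; \<open>unit_family\<close> attains the
  upper bound.\<close>

lemma max_cubic_density_segment:
  assumes p: "p1 + p2 = 1 / 2" "1 / 6 \<le> p1 \<or> p1 = 0" "p1 \<le> 1 / 4" and \<epsilon>: "2 * ln (50 * scale_const\<^sup>2) \<le> \<epsilon>" "0 \<le> \<epsilon>"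
  shows "max_cubic_density \<epsilon> (p1, p2) = Some (max (1 - p1) (1 / 2 + 2 * p1))"
  unfolding max_cubic_density_def
proof (rule growth_exponentI)
  let ?L = "max (1 - p1) (1 / 2 + 2 * p1)"
  fix \<eta> :: real assume \<eta>: "\<eta> > 0"
  have p0: "0 \<le> p1" using p(2) by linarith
  show "\<forall>\<^sub>F X in at_top. real (card (max_cubic_classes (p1, p2) \<epsilon> X)) + 1 \<le> X powr (?L + \<eta>)"
    by (rule near_classes_up[OF p(1) p0 p(3) \<epsilon>(2) \<eta>])
      (unfold max_cubic_classes_eq, rule image_mono[OF max_near_forms_subset])
  have "\<exists>c>0. \<forall>\<^sub>F X in at_top. c * X powr ?L \<le> real (card (max_cubic_classes (p1, p2) \<epsilon> X))"
  proof (cases "p1 = 0")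
    case True
    have L: "?L = 1" "p2 = 1 / 2" using True p(1) by simp_all
    have "\<forall>\<^sub>F X in at_top. 1 / 64 * X powr 1 \<le> real (card (max_cubic_classes (p1, p2) \<epsilon> X))"
      using eventually_ge_at_top[of "scale_const\<^sup>2"] eventually_gt_at_top[of 0]
    proof eventually_elim
      case (elim X)
      then show ?case using unit_family[OF \<epsilon>(1) elim(1)] unfolding True L(2) by simp
    qed
    then show ?thesis unfolding L(1) by (intro exI[of _ "1 / 64"]) auto
  next
    case False
    then have L: "?L = 1 / 2 + 2 * p1" "1 / 6 \<le> p1" using p(2) by linarith+
    show ?thesis unfolding L(1) by (rule segment_family[OF p(1) L(2) p(3) \<epsilon>(1)])
  qed
  then show "\<forall>\<^sub>F X in at_top. X powr (?L - \<eta>) \<le> real (card (max_cubic_classes (p1, p2) \<epsilon> X)) + 1"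
    using growth_lowI \<eta> by blast
qed

lemma density_off_segment:
  assumes off: "\<not> (p1 + p2 = 1 / 2 \<and> 0 \<le> p1 \<and> p1 \<le> 1 / 4)" and \<epsilon>: "\<epsilon> \<ge> 0"
  shows "cubic_density \<epsilon> (p1, p2) = Some 0" "max_cubic_density \<epsilon> (p1, p2) = Some 0"
proof -
  obtain Y where Y: "\<forall>X g. reduced g \<longrightarrow> g \<in> near_forms (p1, p2) \<epsilon> X \<longrightarrow> \<bar>real_of_int (disc g)\<bar> \<le> Y"
    using near_disc_bounded[OF off \<epsilon>] by blast
  then have c: "form_class ` near_forms (p1, p2) \<epsilon> X \<subseteq> disc_classes Y" for X
    by (intro near_classes_bounded) blast
  show "cubic_density \<epsilon> (p1, p2) = Some 0" unfolding cubic_density_def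
    by (rule growth_exponent_bounded[of _ Y]) (simp add: cubic_classes_eq c)
  show "max_cubic_density \<epsilon> (p1, p2) = Some 0" unfolding max_cubic_density_def
    by (rule growth_exponent_bounded[of _ Y])
      (unfold max_cubic_classes_eq, rule order_trans[OF image_mono[OF max_near_forms_subset] c])
qed

lemma max_density_gap:
  assumes p: "p1 + p2 = 1 / 2" "0 < p1" "p1 < 1 / 6" and \<epsilon>: "\<epsilon> \<ge> 0"
  shows "max_cubic_density \<epsilon> (p1, p2) = Some 0"
proof -
  obtain Y where Y: "\<forall>X g. reduced g \<longrightarrow> g \<in> max_near_forms (p1, p2) \<epsilon> X \<longrightarrow> \<bar>real_of_int (disc g)\<bar> \<le> Y"
    using max_near_disc_bounded[OF p \<epsilon>] by blast
  then have c: "form_class ` max_near_forms (p1, p2) \<epsilon> X \<subseteq> disc_classes Y" for X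
    by (intro max_near_classes_bounded) blast
  show ?thesis unfolding max_cubic_density_def
    by (rule growth_exponent_bounded[of _ Y]) (simp add: max_cubic_classes_eq c)
qed

theorem theorem1p8:
  shows "\<exists>M::real. M > 0 \<and> (\<forall>\<epsilon>::real. \<epsilon> > M \<longrightarrow> (\<forall>p1 p2 :: real.
     cubic_density \<epsilon> (p1, p2) =
       Some (if (p1, p2) \<in> closed_segment (0, 1/2) (1/4, 1/4)
             then 1 - (p2 - p1) + max 0 (1/2 - 3 * p1)
             else 0) \<and>
     max_cubic_density \<epsilon> (p1, p2) =
       Some (if (p1, p2) \<in> closed_segment (1/6, 1/3) (1/4, 1/4)
             then 1 - (p2 - p1)
             else if (p1, p2) = (0, 1/2) then 1
             else 0)))"
proof (intro exI[of _ "max 1 (2 * ln (50 * scale_const\<^sup>2))"] conjI allI impI)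
  show "0 < max 1 (2 * ln (50 * scale_const\<^sup>2))" by linarith
  fix \<epsilon> p1 p2 :: real
  assume "max 1 (2 * ln (50 * scale_const\<^sup>2)) < \<epsilon>"
  then have \<epsilon>: "2 * ln (50 * scale_const\<^sup>2) \<le> \<epsilon>" "0 \<le> \<epsilon>" by linarith+
  show "cubic_density \<epsilon> (p1, p2) =
       Some (if (p1, p2) \<in> closed_segment (0, 1/2) (1/4, 1/4)
             then 1 - (p2 - p1) + max 0 (1/2 - 3 * p1)
             else 0)"
  proof (cases "p1 + p2 = 1 / 2 \<and> 0 \<le> p1 \<and> p1 \<le> 1 / 4")
    case True
    \<comment> \<open>On the segment \<open>1 - (p2 - p1) = 1 / 2 + 2 p1\<close>, and adding
      \<open>1 / 2 - 3 p1\<close> gives \<open>1 - p1\<close>.\<close>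
    have "max (1 - p1) (1 / 2 + 2 * p1) = 1 - (p2 - p1) + max 0 (1 / 2 - 3 * p1)" using True by linarith
    then show ?thesis unfolding mem_segment using True cubic_density_segment[OF _ _ _ \<epsilon>, of p1 p2] by simp
  next
    case False
    show ?thesis unfolding mem_segment if_not_P[OF False] by (rule density_off_segment(1)[OF False \<epsilon>(2)])
  qed
  show "max_cubic_density \<epsilon> (p1, p2) =
       Some (if (p1, p2) \<in> closed_segment (1/6, 1/3) (1/4, 1/4)
             then 1 - (p2 - p1)
             else if (p1, p2) = (0, 1/2) then 1
             else 0)"
  proof -
    consider (seg) "p1 + p2 = 1 / 2" "1 / 6 \<le> p1" "p1 \<le> 1 / 4" | (pt) "p1 = 0" "p2 = 1 / 2"
      | (gap) "p1 + p2 = 1 / 2" "0 < p1" "p1 < 1 / 6" | (off) "\<not> (p1 + p2 = 1 / 2 \<and> 0 \<le> p1 \<and> p1 \<le> 1 / 4)"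
      by linarith
    then show ?thesis
    proof cases
      case seg
      have "max (1 - p1) (1 / 2 + 2 * p1) = 1 - (p2 - p1)" using seg by linarith
      then show ?thesis unfolding mem_segment using seg max_cubic_density_segment[OF seg(1) _ seg(3) \<epsilon>] by simp
    next
      case pt
      then show ?thesis unfolding mem_segment using max_cubic_density_segment[OF _ _ _ \<epsilon>, of p1 p2] by simp
    next
      case gap
      then show ?thesis unfolding mem_segment using max_density_gap[OF gap \<epsilon>(2)] by simp
    next
      case off
      then have "\<not> (p1 + p2 = 1 / 2 \<and> 1 / 6 \<le> p1 \<and> p1 \<le> 1 / 4)" "(p1, p2) \<noteq> (0, 1 / 2)" by auto
      then show ?thesis unfolding mem_segment using density_off_segment(2)[OF off \<epsilon>(2)] by simp
    qed
  qed
qed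

end
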